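(* Let $k$ be a field, $S=k[x_1,x_2,x_3,x_4]$, and let $I\subset(x_1,x_2,x_3,x_4)^2$ be a monomial ideal. Then $I$ is Golod if and only if the following four inclusions hold, together with all the inclusions obtained from them by permuting the indices $1,2,3,4$: \[ [I:x_1][I:(x_2,x_3,x_4)]\subset I, \] \[ [I:(x_1,x_2)][I:(x_3,x_4)]\subset I, \] \[ [I:x_1][I:(x_2,x_3)]\subset I+x_4[I:(x_1,x_2,x_3)], \] \[ [I:x_1][I:x_2]\subset I+(x_3,x_4)[I:(x_1,x_2)]+\Big((x_3x_4)[I:x_1x_2]\cap\big((x_3[I:x_1]\cap x_4[I:x_2])+(x_3[I:x_2]\cap x_4[I:x_1])\big)\Big). \]
   Context: For a homogeneous ideal $I\subset S=k[x_1,\dots,x_n]$ and $R=S/I$, the ring $R$ (or the ideal $I$) is called Golod if the coefficientwise equality of power series \[ \sum_{j\ge0}\dim_k\operatorname{Tor}^R_j(k,k)\,t^j=\frac{(1+t)^n}{1-\sum_{j\ge1}\dim_k\operatorname{Tor}^S_j(R,k)\,t^{j+1}} \] holds. Colon ideals are in $S$, $[\,\cdot\,][\,\cdot\,]$ denotes the product of ideals, and $I:(x_a,x_b,\dots)$ is the colon by the ideal generated by those variables. *)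

theory Defs
  imports
    "HOL-Library.Poly_Mapping"
    "HOL-Library.Numeral_Type"
    "HOL-Computational_Algebra.Formal_Power_Series"
    "HOL-Combinatorics.Permutations"
    "HOL-Algebra.Ideal_Product"
    "HOL-Algebra.QuotRing"
    "HOL-Algebra.Algebraic_Closure_Type"
    "Jordan_Normal_Form.Missing_VectorSpace"
begin

section \<open>Modules\<close>

text \<open>The ring multiplication and unit that are part of the record type of modules play no role
  below; they are left unspecified where there is no natural candidate.\<close>

definition regular_module :: "('a, 'm) ring_scheme \<Rightarrow> ('a, 'a) module" where
  "regular_module R =
     \<lparr>carrier = carrier R, monoid.mult = monoid.mult R, one = one R, zero = zero R, add = add R,
      module.smult = monoid.mult R\<rparr>"

definition direct_power :: "('a, 'b, 'm) module_scheme \<Rightarrow> nat \<Rightarrow> ('a, nat \<Rightarrow> 'b) module" where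
  "direct_power M b =
     \<lparr>carrier = {..<b} \<rightarrow>\<^sub>E carrier M, monoid.mult = undefined, one = undefined,
      zero = (\<lambda>i\<in>{..<b}. \<zero>\<^bsub>M\<^esub>),
      add = (\<lambda>u v. \<lambda>i\<in>{..<b}. u i \<oplus>\<^bsub>M\<^esub> v i),
      module.smult = (\<lambda>r v. \<lambda>i\<in>{..<b}. r \<odot>\<^bsub>M\<^esub> v i)\<rparr>"

definition quotient_module :: "('a, 'b, 'm) module_scheme \<Rightarrow> 'b set \<Rightarrow> ('a, 'b set) module" where
  "quotient_module M B =
     \<lparr>carrier = a_rcosets\<^bsub>M\<^esub> B, monoid.mult = undefined, one = undefined,
      zero = B, add = set_add M,
      module.smult = (\<lambda>r c. \<Union>x\<in>c. B +>\<^bsub>M\<^esub> (r \<odot>\<^bsub>M\<^esub> x))\<rparr>"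

definition restrict_scalars ::
  "('c \<Rightarrow> 'a) \<Rightarrow> ('a, 'b, 'm) module_scheme \<Rightarrow> ('c, 'b) module" where
  "restrict_scalars \<phi> M =
     \<lparr>carrier = carrier M, monoid.mult = monoid.mult M, one = one M, zero = zero M, add = add M,
      module.smult = (\<lambda>c v. \<phi> c \<odot>\<^bsub>M\<^esub> v)\<rparr>"

text \<open>An \<open>R\<close>-module annihilated by an ideal \<open>I\<close>, regarded as a module over \<open>R Quot I\<close>: a coset acts
  through any of its representatives, all of which act in the same way.\<close>

definition module_over_quotient :: "('a, 'b, 'm) module_scheme \<Rightarrow> ('a set, 'b) module" where
  "module_over_quotient M =
     \<lparr>carrier = carrier M, monoid.mult = monoid.mult M, one = one M, zero = zero M, add = add M,
      module.smult = (\<lambda>c v. the_elem ((\<lambda>r. r \<odot>\<^bsub>M\<^esub> v) ` c))\<rparr>"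


section \<open>Tor\<close>

definition matrix_map ::
  "('a, 'b, 'm) module_scheme \<Rightarrow> (nat \<Rightarrow> nat \<Rightarrow> 'a) \<Rightarrow> nat \<Rightarrow> nat \<Rightarrow> (nat \<Rightarrow> 'b) \<Rightarrow> (nat \<Rightarrow> 'b)" where
  "matrix_map M A p q v = (\<lambda>i\<in>{..<p}. \<Oplus>\<^bsub>M\<^esub>j\<in>{..<q}. A i j \<odot>\<^bsub>M\<^esub> v j)"

text \<open>A resolution \<open>\<dots> \<rightarrow> R\<^sup>b\<^sup>(\<^sup>2\<^sup>) \<rightarrow> R\<^sup>b\<^sup>(\<^sup>1\<^sup>) \<rightarrow> R\<^sup>b\<^sup>(\<^sup>0\<^sup>) \<rightarrow> M \<rightarrow> 0\<close> by free modules of finite rank, where \<open>A n\<close> is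
  the matrix of the differential from degree \<open>n + 1\<close> to degree \<open>n\<close>. Such resolutions exist for
  finitely generated modules over Noetherian rings, the only case needed here.\<close>

definition free_resolution ::
  "('a, 'r) ring_scheme \<Rightarrow> ('a, 'b, 'm) module_scheme \<Rightarrow>
     (nat \<Rightarrow> nat) \<Rightarrow> (nat \<Rightarrow> nat \<Rightarrow> nat \<Rightarrow> 'a) \<Rightarrow> bool" where
  "free_resolution R M b A \<longleftrightarrow>
     (let F = (\<lambda>n. direct_power (regular_module R) (b n));
          d = (\<lambda>n. matrix_map (regular_module R) (A n) (b n) (b (Suc n)))
      in (\<forall>n. \<forall>i<b n. \<forall>j<b (Suc n). A n i j \<in> carrier R) \<and>
         (\<exists>\<epsilon>\<in>module_hom R (F 0) M.
            \<epsilon> ` carrier (F 0) = carrier M \<and>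
            a_kernel (F 0) M \<epsilon> = d 0 ` carrier (F 1)) \<and>
         (\<forall>n. a_kernel (F (Suc n)) (F n) (d n) = d (Suc n) ` carrier (F (Suc (Suc n)))))"

text \<open>Homology of the complex \<open>F \<otimes> N\<close>, where \<open>F\<close> is the complex of free modules of ranks \<open>b\<close> with
  matrices \<open>A\<close>. Here \<open>R\<^sup>b \<otimes> N\<close> is identified with \<open>N\<^sup>b\<close>, under which the differential \<open>A \<otimes> N\<close> becomes
  the action of the matrix \<open>A\<close> on \<open>N\<^sup>b\<close>.\<close>

definition tensor_cycles ::
  "('a, 'b, 'm) module_scheme \<Rightarrow> (nat \<Rightarrow> nat) \<Rightarrow> (nat \<Rightarrow> nat \<Rightarrow> nat \<Rightarrow> 'a) \<Rightarrow> nat \<Rightarrow> (nat \<Rightarrow> 'b) set" where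
  "tensor_cycles N b A n =
     (case n of
        0 \<Rightarrow> carrier (direct_power N (b 0))
      | Suc m \<Rightarrow> a_kernel (direct_power N (b (Suc m))) (direct_power N (b m))
                   (matrix_map N (A m) (b m) (b (Suc m))))"

definition tensor_boundaries ::
  "('a, 'b, 'm) module_scheme \<Rightarrow> (nat \<Rightarrow> nat) \<Rightarrow> (nat \<Rightarrow> nat \<Rightarrow> nat \<Rightarrow> 'a) \<Rightarrow> nat \<Rightarrow> (nat \<Rightarrow> 'b) set" where
  "tensor_boundaries N b A n =
     matrix_map N (A n) (b n) (b (Suc n)) ` carrier (direct_power N (b (Suc n)))"

definition tensor_homology ::
  "('a, 'b, 'm) module_scheme \<Rightarrow> (nat \<Rightarrow> nat) \<Rightarrow> (nat \<Rightarrow> nat \<Rightarrow> nat \<Rightarrow> 'a) \<Rightarrow> nat \<Rightarrow>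
     ('a, (nat \<Rightarrow> 'b) set) module" where
  "tensor_homology N b A n =
     quotient_module ((direct_power N (b n))\<lparr>carrier := tensor_cycles N b A n\<rparr>)
       (tensor_boundaries N b A n)"

definition Tor ::
  "('a, 'r) ring_scheme \<Rightarrow> ('a, 'b, 'm) module_scheme \<Rightarrow> ('a, 'c, 'l) module_scheme \<Rightarrow> nat \<Rightarrow>
     ('a, (nat \<Rightarrow> 'c) set) module" where
  "Tor R M N n =
     (let (b, A) = (SOME (b, A). free_resolution R M b A) in tensor_homology N b A n)"


section \<open>Polynomial rings and ideals\<close>

text \<open>Polynomials with variables indexed by \<open>'n\<close> are finitely supported functions on the monoid of
  exponent vectors \<open>'n \<Rightarrow>\<^sub>0 nat\<close>, multiplied by convolution.
  With \<open>'n = 4\<close> the indices \<open>1, 2, 3, 4\<close> are the four distinct elements of the numeral type (where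
  arithmetic is modulo 4, so \<open>4 = 0\<close>).\<close>

type_synonym ('n, 'k) mpoly = "('n \<Rightarrow>\<^sub>0 nat) \<Rightarrow>\<^sub>0 'k"

definition mpoly_ring :: "('n::finite, 'k::field) mpoly ring" where
  "mpoly_ring = ring_of_type_algebra"

definition monomial :: "('n \<Rightarrow>\<^sub>0 nat) \<Rightarrow> ('n, 'k::field) mpoly" where
  "monomial m = Poly_Mapping.single m 1"

definition mvar :: "'n \<Rightarrow> ('n, 'k::field) mpoly" where
  "mvar i = monomial (Poly_Mapping.single i 1)"

definition mconst :: "'k \<Rightarrow> ('n, 'k::field) mpoly" where
  "mconst c = Poly_Mapping.single 0 c"

definition ideal_of :: "('n::finite, 'k::field) mpoly set \<Rightarrow> ('n, 'k) mpoly set" where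
  "ideal_of G = genideal mpoly_ring G"

definition monomial_ideal :: "('n::finite, 'k::field) mpoly set \<Rightarrow> bool" where
  "monomial_ideal I \<longleftrightarrow> (\<exists>E. I = ideal_of (monomial ` E))"

definition colon_ideal :: "('a, 'r) ring_scheme \<Rightarrow> 'a set \<Rightarrow> 'a set \<Rightarrow> 'a set" where
  "colon_ideal R I J = {f \<in> carrier R. \<forall>g\<in>J. f \<otimes>\<^bsub>R\<^esub> g \<in> I}"


section \<open>Golod ideals\<close>

text \<open>The coefficient field \<open>k = S / (x\<^sub>1, \<dots>, x\<^sub>n)\<close> as an \<open>S\<close>-module: a polynomial acts through its
  constant term.\<close>

definition residue_module :: "(('n::finite, 'k::field) mpoly, 'k) module" where
  "residue_module =
     \<lparr>carrier = UNIV, monoid.mult = (*), one = 1, zero = 0, add = (+),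
      module.smult = (\<lambda>f c. Poly_Mapping.lookup f 0 * c)\<rparr>"

definition k_dim :: "('k::field, 'b, 'm) module_scheme \<Rightarrow> nat" where
  "k_dim V = vectorspace.dim (ring_of_type_algebra :: 'k ring) V"

text \<open>\<open>dim\<^sub>k Tor\<^sup>R\<^sub>j(k, k)\<close> for \<open>R = S / I\<close>, with \<open>k\<close> embedded in \<open>R\<close> by the classes of the constants.\<close>

definition residue_betti :: "('n::finite, 'k::field) mpoly set \<Rightarrow> nat \<Rightarrow> nat" where
  "residue_betti I j =
     k_dim (restrict_scalars (\<lambda>c. I +>\<^bsub>mpoly_ring\<^esub> mconst c)
       (Tor (mpoly_ring Quot I)
          (module_over_quotient residue_module) (module_over_quotient residue_module) j))"

text \<open>\<open>dim\<^sub>k Tor\<^sup>S\<^sub>j(S / I, k)\<close>\<close>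

definition quotient_betti :: "('n::finite, 'k::field) mpoly set \<Rightarrow> nat \<Rightarrow> nat" where
  "quotient_betti I j =
     k_dim (restrict_scalars mconst
       (Tor mpoly_ring (quotient_module (regular_module mpoly_ring) I) residue_module j))"

definition golod :: "('n::finite, 'k::field) mpoly set \<Rightarrow> bool" where
  "golod I \<longleftrightarrow>
     (Abs_fps (\<lambda>j. of_nat (residue_betti I j)) :: rat fps) =
       (1 + fps_X) ^ CARD('n) /
       (1 - fps_X * Abs_fps (\<lambda>j. if j = 0 then 0 else of_nat (quotient_betti I j)))"

end

theory Submission
  imports Defs "HOL-Library.Function_Algebras"
begin

text \<open>Over a monomial ideal everything is multigraded, so Golodness can be read off the Koszul complex.
  If products of positive degree Koszul homology classes vanish, bounding chains of the products of
  basis cycles define Golod's complex on words in these cycles, provided the triple products of the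
  chains cancel; for four variables only three classes of degree one can interfere, and for monomial
  cycles the cancellation is a sign identity. The complex then resolves the residue field minimally
  and gives the Golod series. Conversely, Golod's complex exists up to the degree of a first nonzero
  product, which yields a cycle there with a unit coefficient, hence too small a Betti number.
  Finally, since Koszul homology in degrees one and two is spanned by single monomials, the vanishing of
  all products is the combinatorial content of the four inclusions. Betti numbers are computed from any
  free resolution by comparing it with the Koszul complex or with Golod's complex through a double complex.\<close>

section \<open>Subquotients of vector spaces\<close>

text \<open>Vanishing products alone do not in general make a ring Golod: the higher Massey
  operations must vanish too. A chain bounding the product of classes of degrees p and q has degree
  p + q + 1, so a triple product has degree at least four, with equality only for three classes of
  degree one. In degree four there is no higher chain left to bound it, so the triple sum has to lie
  in the ideal itself; the bounding chains must be chosen coherently, which is the purpose of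
  \<open>bounds\<close>, and then all operations on more than two letters can be taken to be zero.
  The form of the inclusions reflects the boundaries available in each degree: none in degree four
  (the first two), multiples of the boundary of the top exterior element in degree three (the
  third), and in degree two flows on the complete graph with four vertices, where an edge is closed
  up by a triangle or by a four-cycle (the fourth). Golod's complex is treated up to a degree N
  because in the converse direction it exists only that far; in the last degree, Tor is therefore
  taken modulo all cycles and not only modulo known boundaries.\<close>

text \<open>The quotient \<open>V / U\<close> has dimension \<open>n\<close>, stated through representatives so that no quotient space is formed.\<close>

definition qdim :: "('k::field \<Rightarrow> 'v::ab_group_add \<Rightarrow> 'v) \<Rightarrow> 'v set \<Rightarrow> 'v set \<Rightarrow> nat \<Rightarrow> bool" where
  "qdim sc U V n \<longleftrightarrow> (\<exists>f. (\<forall>i<n. f i \<in> V) \<and> (\<forall>v\<in>V. \<exists>c. v - (\<Sum>i<n. sc (c i) (f i)) \<in> U) \<and>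
     (\<forall>c. (\<Sum>i<n. sc (c i) (f i)) \<in> U \<longrightarrow> (\<forall>i<n. c i = 0)))"

text \<open>Iterated, this puts the scalars of \<open>k\<close> on families of families, such as the
  entries of a double complex with polynomial values.\<close>

definition lsc :: "('k \<Rightarrow> 'v \<Rightarrow> 'v) \<Rightarrow> 'k \<Rightarrow> ('i \<Rightarrow> 'v) \<Rightarrow> 'i \<Rightarrow> 'v" where
  "lsc sc c v = (\<lambda>i. sc c (v i))"

lemma vector_space_lsc: "vector_space sc \<Longrightarrow> vector_space (lsc sc)"
  unfolding vector_space_def lsc_def by (auto simp: fun_eq_iff)

lemma vector_space_mult: "vector_space ((*) :: 'k::field \<Rightarrow> 'k \<Rightarrow> 'k)"
  by unfold_locales (auto simp: algebra_simps)

lemma sum_fun_apply: "(\<Sum>i\<in>A. f i) x = (\<Sum>i\<in>A. f i x)"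
  for f :: "'i \<Rightarrow> 'x \<Rightarrow> 'v::comm_monoid_add"
  by (induction A rule: infinite_finite_induct) auto

lemma (in vector_space) subspace_sum_scale:
  assumes "subspace U" "\<And>i. i \<in> A \<Longrightarrow> f i \<in> U"
  shows "(\<Sum>i\<in>A. scale (c i) (f i)) \<in> U"
  using assms by (auto intro!: subspace_sum subspace_scale)

text \<open>The hypotheses make \<open>f\<close> induce a bijection from \<open>V / U\<close> to
  \<open>V' / U'\<close>. A basis is pushed forward by \<open>f\<close>; in the other direction each
  basis vector gets a preimage modulo \<open>U'\<close>, which exists by \<open>surj\<close>. The
  comparisons of homology groups below are instances; the spaces themselves are usually infinite
  dimensional.\<close>

lemma qdim_iso:
  fixes sc :: "'k::field \<Rightarrow> 'v::ab_group_add \<Rightarrow> 'v" and sc' :: "'k \<Rightarrow> 'w::ab_group_add \<Rightarrow> 'w"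
  assumes vs: "vector_space sc" "vector_space sc'"
    and lin: "\<And>x y. f (x + y) = f x + f y" "\<And>c x. f (sc c x) = sc' c (f x)"
    and sub: "module.subspace sc U" "module.subspace sc V" 
             "module.subspace sc' U'" "module.subspace sc' V'" "U' \<subseteq> V'"
    and into: "\<And>x. x \<in> V \<Longrightarrow> f x \<in> V'"
    and inj: "\<And>x. x \<in> V \<Longrightarrow> f x \<in> U' \<longleftrightarrow> x \<in> U"
    and surj: "\<And>y. y \<in> V' \<Longrightarrow> \<exists>x\<in>V. y - f x \<in> U'"
  shows "qdim sc U V n \<longleftrightarrow> qdim sc' U' V' n"
proof -
  interpret s: vector_space sc by fact
  interpret s': vector_space sc' by fact
  have f0: "f 0 = 0" using lin(1)[of 0 0] by simp
  have fdiff: "f (x - y) = f x - f y" for x y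
    using lin(1)[of "x - y" y] by (simp add: algebra_simps)
  have fsum: "f (\<Sum>i<n. sc (c i) (b i)) = (\<Sum>i<n. sc' (c i) (f (b i)))" for c b
    by (induction n) (auto simp: f0 lin)
  have trans: "a - c \<in> U'" if "a - b \<in> U'" "b - c \<in> U'" for a b c
    using s'.subspace_add[OF sub(3) that] by simp
  show ?thesis
  proof
    assume "qdim sc U V n"
    then obtain b where b: "\<forall>i<n. b i \<in> V" "\<forall>v\<in>V. \<exists>c. v - (\<Sum>i<n. sc (c i) (b i)) \<in> U"
      "\<forall>c. (\<Sum>i<n. sc (c i) (b i)) \<in> U \<longrightarrow> (\<forall>i<n. c i = 0)" unfolding qdim_def by blast
    have bV: "(\<Sum>i<n. sc (c i) (b i)) \<in> V" for c
      using b(1) sub(2) by (auto intro!: s.subspace_sum_scale)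
    show "qdim sc' U' V' n" unfolding qdim_def
    proof (intro exI[of _ "\<lambda>i. f (b i)"] conjI ballI allI impI)
      fix v assume "v \<in> V'"
      then obtain x where x: "x \<in> V" "v - f x \<in> U'" using surj by blast
      then obtain c where c: "x - (\<Sum>i<n. sc (c i) (b i)) \<in> U" using b(2) by blast
      have "f (x - (\<Sum>i<n. sc (c i) (b i))) \<in> U'"
        using inj c s.subspace_diff[OF sub(2) x(1) bV] by blast
      then show "\<exists>c. v - (\<Sum>i<n. sc' (c i) (f (b i))) \<in> U'"
        using trans x(2) unfolding fdiff fsum by blast
    next
      fix c i assume "(\<Sum>i<n. sc' (c i) (f (b i))) \<in> U'" "i < n"
      then show "c i = 0" using b(3) inj[OF bV] unfolding fsum[symmetric] by blast
    qed (use b(1) into in auto)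
  next
    assume "qdim sc' U' V' n"
    then obtain b' where b': "\<forall>i<n. b' i \<in> V'" "\<forall>v\<in>V'. \<exists>c. v - (\<Sum>i<n. sc' (c i) (b' i)) \<in> U'"
      "\<forall>c. (\<Sum>i<n. sc' (c i) (b' i)) \<in> U' \<longrightarrow> (\<forall>i<n. c i = 0)" unfolding qdim_def by blast
    have "\<forall>i. \<exists>x. i < n \<longrightarrow> x \<in> V \<and> b' i - f x \<in> U'" using surj b'(1) by blast
    then obtain b where b: "\<And>i. i < n \<Longrightarrow> b i \<in> V" "\<And>i. i < n \<Longrightarrow> b' i - f (b i) \<in> U'" by metis
    have bV: "(\<Sum>i<n. sc (c i) (b i)) \<in> V" for c
      using b(1) sub(2) by (auto intro!: s.subspace_sum_scale)
    \<comment> \<open>\<open>b'\<close> and the images of \<open>b\<close> agree only modulo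
      \<open>U'\<close>; this carries the congruence over to linear combinations.\<close>
    have key: "(\<Sum>i<n. sc' (c i) (b' i)) - f (\<Sum>i<n. sc (c i) (b i)) \<in> U'" for c
      unfolding fsum sum_subtractf[symmetric] s'.scale_right_diff_distrib[symmetric]
      using b(2) sub(3) by (auto intro!: s'.subspace_sum_scale)
    show "qdim sc U V n" unfolding qdim_def
    proof (intro exI[of _ b] conjI ballI allI impI)
      fix v assume v: "v \<in> V"
      then obtain c where "f v - (\<Sum>i<n. sc' (c i) (b' i)) \<in> U'" using b'(2) into by blast
      then have "f (v - (\<Sum>i<n. sc (c i) (b i))) \<in> U'" using key trans fdiff by metis
      then show "\<exists>c. v - (\<Sum>i<n. sc (c i) (b i)) \<in> U" 
        using inj s.subspace_diff[OF sub(2) v bV] by blast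
    next
      fix c i assume "(\<Sum>i<n. sc (c i) (b i)) \<in> U" "i < n"
      then have "f (\<Sum>i<n. sc (c i) (b i)) \<in> U'" using inj bV by blast
      then have "(\<Sum>i<n. sc' (c i) (b' i)) \<in> U'" using s'.subspace_add[OF sub(3) key] by (metis diff_add_cancel)
      then show "c i = 0" using b'(3) \<open>i < n\<close> by blast
    qed (use b(1) in auto)
  qed
qed

text \<open>Padding with zeros makes the vectors of all lengths subspaces of one vector space, so
  that matrices of varying sizes need no separate types.\<close>

definition coords :: "nat \<Rightarrow> (nat \<Rightarrow> 'k::zero) set" where
  "coords n = {c. \<forall>i\<ge>n. c i = 0}"

abbreviation fsc :: "'k::field \<Rightarrow> ('i \<Rightarrow> 'k) \<Rightarrow> 'i \<Rightarrow> 'k" where "fsc \<equiv> lsc (*)"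

interpretation fsc: vector_space "fsc :: 'k::field \<Rightarrow> ('i \<Rightarrow> 'k) \<Rightarrow> 'i \<Rightarrow> 'k"
  by (rule vector_space_lsc) (rule vector_space_mult)

definition unitv :: "nat \<Rightarrow> nat \<Rightarrow> 'k::zero_neq_one" where "unitv i = (\<lambda>j. if j = i then 1 else 0)"

lemma subspace_coords: "fsc.subspace (coords n)"
  by (auto simp: fsc.subspace_def coords_def lsc_def)

lemma sum_unitv: "(\<Sum>i<n. fsc (c i) (unitv i)) = (\<lambda>j. if j < n then c j else 0)"
  for c :: "nat \<Rightarrow> 'k::field"
  by (rule ext) (auto simp: sum_fun_apply lsc_def unitv_def if_distrib[of "(*) _"] cong: if_cong)

lemma coords_span: "coords n \<subseteq> fsc.span (unitv ` {..<n} :: (nat \<Rightarrow> 'k::field) set)"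
proof
  fix v :: "nat \<Rightarrow> 'k" assume "v \<in> coords n"
  then have "v = (\<Sum>i<n. fsc (v i) (unitv i))" by (auto simp: sum_unitv coords_def fun_eq_iff)
  then show "v \<in> fsc.span (unitv ` {..<n})"
    by (metis (no_types, lifting) fsc.span_base fsc.span_scale fsc.span_sum imageI)
qed

lemma coords_independent_bound:
  assumes "fsc.independent (B :: (nat \<Rightarrow> 'k::field) set)" "B \<subseteq> coords n"
  shows "finite B \<and> card B \<le> n"
proof -
  have "finite B \<and> card B \<le> card (unitv ` {..<n} :: (nat \<Rightarrow> 'k) set)"
    using fsc.independent_span_bound assms coords_span by (meson finite_imageI finite_lessThan subset_trans)
  then show ?thesis using card_image_le[of "{..<n}" "unitv :: nat \<Rightarrow> nat \<Rightarrow> 'k"] by simp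
qed

text \<open>A basis \<open>B\<close> of \<open>U\<close> is extended to a basis \<open>C\<close> of
  \<open>V\<close>; the vectors in \<open>C - B\<close> represent a basis of the quotient, and they
  are finite in number because \<open>V\<close> lies in \<open>coords g\<close>.\<close>

lemma qdim_coords_ex:
  fixes U V :: "(nat \<Rightarrow> 'k::field) set"
  assumes "fsc.subspace U" "fsc.subspace V" "U \<subseteq> V" "V \<subseteq> coords g"
  shows "\<exists>n. qdim fsc U V n"
proof -
  obtain B where B: "B \<subseteq> U" "fsc.independent B" "U \<subseteq> fsc.span B"
    using fsc.maximal_independent_subset by blast
  obtain C where C: "B \<subseteq> C" "C \<subseteq> V" "fsc.independent C" "V \<subseteq> fsc.span C"
    using fsc.maximal_independent_subset_extend[of B V] B assms(3) by blast
  have fin: "finite C" using coords_independent_bound C assms(4) by blast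
  have spB: "fsc.span B = U" using B assms(1) by (metis fsc.span_minimal subset_antisym)
  obtain f where f: "bij_betw f {..<card (C - B)} (C - B)"
    using ex_bij_betw_nat_finite[of "C - B"] fin by (auto simp: atLeast0LessThan)
  have re: "(\<Sum>i<card (C - B). fsc (c i) (f i)) = (\<Sum>x\<in>C - B. fsc (c (inv_into {..<card (C - B)} f x)) x)" for c
    unfolding sum.reindex_bij_betw[OF f, symmetric]
    by (rule sum.cong) (auto simp: bij_betw_inv_into_left[OF f])
  have "qdim fsc U V (card (C - B))" unfolding qdim_def
  proof (intro exI[of _ f] conjI allI impI ballI)
    fix i assume "i < card (C - B)" then show "f i \<in> V" using f C by (auto dest: bij_betwE)
  next
    fix v assume "v \<in> V"
    then obtain u where u: "v = (\<Sum>x\<in>C. fsc (u x) x)" using C(4) fin fsc.span_finite[OF fin] by auto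
    have "(\<Sum>x\<in>B. fsc (u x) x) \<in> U" using assms(1) B(1) by (intro fsc.subspace_sum_scale) auto
    moreover have "v = (\<Sum>x\<in>C-B. fsc (u x) x) + (\<Sum>x\<in>B. fsc (u x) x)"
      unfolding u using C(1) fin by (simp add: sum.subset_diff)
    moreover have "(\<Sum>x\<in>C-B. fsc (u x) x) = (\<Sum>i<card (C - B). fsc (u (f i)) (f i))"
      by (rule sum.reindex_bij_betw[OF f, symmetric])
    ultimately show "\<exists>c. v - (\<Sum>i<card (C - B). fsc (c i) (f i)) \<in> U" 
      by (intro exI[of _ "\<lambda>i. u (f i)"]) simp
  next
    fix c i assume a: "(\<Sum>i<card (C - B). fsc (c i) (f i)) \<in> U" and i: "i < card (C - B)"
    have finB: "finite B" using fin C(1) finite_subset by blast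
    obtain u where u: "(\<Sum>i<card (C - B). fsc (c i) (f i)) = (\<Sum>x\<in>B. fsc (u x) x)" 
      using a spB fsc.span_finite[OF finB] by auto
    \<comment> \<open>The coefficients on all of \<open>C\<close> of the relation saying that the
      combination of \<open>C - B\<close> equals the combination \<open>u\<close> of
      \<open>B\<close>; independence of \<open>C\<close> kills them.\<close>
    define w where "w x = (if x \<in> B then - u x else c (inv_into {..<card (C - B)} f x))" for x
    have "(\<Sum>x\<in>C. fsc (w x) x) = (\<Sum>x\<in>C-B. fsc (w x) x) + (\<Sum>x\<in>B. fsc (w x) x)"
      using C(1) fin by (simp add: sum.subset_diff)
    also have "(\<Sum>x\<in>C-B. fsc (w x) x) = (\<Sum>i<card (C - B). fsc (c i) (f i))"
      unfolding re by (rule sum.cong) (auto simp: w_def)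
    also have "(\<Sum>x\<in>B. fsc (w x) x) = - (\<Sum>x\<in>B. fsc (u x) x)"
      unfolding sum_negf[symmetric] by (rule sum.cong) (auto simp: w_def)
    finally have "(\<Sum>x\<in>C. fsc (w x) x) = 0" by (simp only: u right_minus)
    then have "w (f i) = 0" using fsc.independentD[OF C(3) fin] f i by (auto dest: bij_betwE)
    moreover have "f i \<notin> B" using f i by (auto dest: bij_betwE)
    ultimately show "c i = 0" using i by (simp add: w_def bij_betw_inv_into_left[OF f])
  qed
  then show ?thesis by blast
qed

text \<open>Steinitz exchange modulo \<open>U\<close>: writing each \<open>h i\<close> in terms of
  the \<open>n\<close> representatives gives a coefficient row \<open>K i\<close> in
  \<open>coords n\<close>, and a relation between the rows would be a relation between the
  \<open>h i\<close> modulo \<open>U\<close>.\<close>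

lemma qdim_independent_le:
  fixes sc :: "'k::field \<Rightarrow> 'v::ab_group_add \<Rightarrow> 'v"
  assumes vs: "vector_space sc" and U: "module.subspace sc U" and q: "qdim sc U V n"
    and h: "\<And>i. i < m \<Longrightarrow> h i \<in> V" "\<And>c. (\<Sum>i<m. sc (c i) (h i)) \<in> U \<Longrightarrow> \<forall>i<m. c i = 0"
  shows "m \<le> n"
proof -
  interpret s: vector_space sc by fact
  obtain b where b: "\<forall>v\<in>V. \<exists>c. v - (\<Sum>i<n. sc (c i) (b i)) \<in> U" using q unfolding qdim_def by blast
  have "\<forall>i. \<exists>c. i < m \<longrightarrow> h i - (\<Sum>j<n. sc (c j) (b j)) \<in> U" using b h(1) by blast
  then obtain K0 where K0: "\<And>i. i < m \<Longrightarrow> h i - (\<Sum>j<n. sc (K0 i j) (b j)) \<in> U" by metis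
  define K where "K i j = (if j < n then K0 i j else 0)" for i j
  have K: "h i - (\<Sum>j<n. sc (K i j) (b j)) \<in> U" if "i < m" for i
    using K0[OF that] by (simp add: K_def cong: sum.cong_simp)
  have ind: "\<forall>i<m. c i = 0" if c: "(\<Sum>i<m. fsc (c i) (K i)) = 0" for c
  proof (rule h(2))
    have "(\<Sum>i<m. sc (c i) (\<Sum>j<n. sc (K i j) (b j))) = (\<Sum>j<n. sc ((\<Sum>i<m. fsc (c i) (K i)) j) (b j))"
      by (simp add: s.scale_sum_right sum_fun_apply s.scale_sum_left lsc_def)
         (rule sum.swap)
    then have "(\<Sum>i<m. sc (c i) (h i)) = (\<Sum>i<m. sc (c i) (h i - (\<Sum>j<n. sc (K i j) (b j))))"
      by (simp add: c s.scale_right_diff_distrib sum_subtractf)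
    also have "\<dots> \<in> U" using K U by (auto intro!: s.subspace_sum_scale)
    finally show "(\<Sum>i<m. sc (c i) (h i)) \<in> U" .
  qed
  have inj: "inj_on K {..<m}"
  proof (rule inj_onI, rule ccontr)
    fix i j assume ij: "i \<in> {..<m}" "j \<in> {..<m}" "K i = K j" "i \<noteq> j"
    \<comment> \<open>Two equal rows would give the relation \<open>K i - K j = 0\<close>, against
      \<open>ind\<close>.\<close>
    define c where "c = (\<lambda>l. if l = i then 1 else if l = j then -1 else (0::'k))"
    have "(\<Sum>l<m. fsc (c l) (K l)) = (\<Sum>l\<in>{i,j}. fsc (c l) (K l))"
      by (rule sum.mono_neutral_right) (use ij in \<open>auto simp: c_def\<close>)
    also have "\<dots> = 0" using ij by (simp add: c_def)
    finally show False using ind[of c] ij by (auto simp: c_def)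
  qed
  have "fsc.independent (K ` {..<m})"
  proof
    assume "fsc.dependent (K ` {..<m})"
    then obtain u where u: "\<exists>v\<in>K ` {..<m}. u v \<noteq> 0" "(\<Sum>v\<in>K ` {..<m}. fsc (u v) v) = 0"
      using fsc.dependent_finite[of "K ` {..<m}"] by auto
    then show False using ind[of "\<lambda>i. u (K i)"] by (auto simp: sum.reindex[OF inj])
  qed
  moreover have "K ` {..<m} \<subseteq> coords n" by (auto simp: K_def coords_def)
  ultimately have "card (K ` {..<m}) \<le> n" using coords_independent_bound by blast
  then show ?thesis by (simp add: card_image inj)
qed

lemma qdim_unique:
  assumes "vector_space sc" "module.subspace sc U" "qdim sc U V n" "qdim sc U V m"
  shows "n = m"
proof -
  have "m \<le> n" if q: "qdim sc U V m" "qdim sc U V n" for m n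
  proof -
    obtain f where f: "\<forall>i<m. f i \<in> V" "\<forall>c. (\<Sum>i<m. sc (c i) (f i)) \<in> U \<longrightarrow> (\<forall>i<m. c i = 0)"
      using q(1) unfolding qdim_def by blast
    then show ?thesis using qdim_independent_le[OF assms(1,2) q(2), of m f] by blast
  qed
  then show ?thesis using assms by (metis order_antisym)
qed

text \<open>A basis modulo \<open>U\<close>, enlarged by \<open>w\<close>, stays independent modulo
  \<open>U'\<close>: a relation has zero coefficients at the basis already modulo \<open>U\<close>,
  and then at \<open>w\<close> because \<open>w\<close> is not in \<open>U'\<close>. This is the
  source of the strict inequality between Betti numbers in the converse direction.\<close>

lemma qdim_strict:
  fixes sc :: "'k::field \<Rightarrow> 'v::ab_group_add \<Rightarrow> 'v"
  assumes vs: "vector_space sc" and U: "module.subspace sc U" "module.subspace sc U'" "U' \<subseteq> U" 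
    and q: "qdim sc U V n" "qdim sc U' V r" and w: "w \<in> U" "w \<in> V" "w \<notin> U'"
  shows "n < r"
proof -
  interpret s: vector_space sc by fact
  obtain f where f: "\<forall>i<n. f i \<in> V" "\<forall>c. (\<Sum>i<n. sc (c i) (f i)) \<in> U \<longrightarrow> (\<forall>i<n. c i = 0)"
    using q(1) unfolding qdim_def by blast
  define h where "h = f(n := w)"
  have sm: "(\<Sum>i<Suc n. sc (c i) (h i)) = (\<Sum>i<n. sc (c i) (f i)) + sc (c n) w" for c
    by (simp add: h_def)
  have "Suc n \<le> r"
  proof (rule qdim_independent_le[OF vs U(2) q(2), of "Suc n" h])
    show "h i \<in> V" if "i < Suc n" for i using f(1) w that by (auto simp: h_def less_Suc_eq)
  next
    fix c assume a: "(\<Sum>i<Suc n. sc (c i) (h i)) \<in> U'"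
    then have "(\<Sum>i<n. sc (c i) (f i)) + sc (c n) w \<in> U" using U(3) sm by auto
    then have "(\<Sum>i<n. sc (c i) (f i)) \<in> U" 
      using s.subspace_diff[OF U(1) _ s.subspace_scale[OF U(1) w(1), of "c n"]] by fastforce
    then have c0: "\<forall>i<n. c i = 0" using f(2) by blast
    then have "sc (c n) w \<in> U'" using a unfolding sm by simp
    then have "c n = 0" using s.subspace_scale[OF U(2), of "sc (c n) w" "inverse (c n)"] w(3) 
      by (cases "c n = 0") auto
    then show "\<forall>i<Suc n. c i = 0" using c0 by (auto simp: less_Suc_eq)
  qed
  then show ?thesis by simp
qed

text \<open>A longest family from \<open>S\<close> that is independent modulo \<open>U\<close> must
  span, since any further element of \<open>S\<close> would lengthen it otherwise. This provides a
  basis of the homology in degree one that consists of single monomials.\<close>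

lemma qdim_basis_from_spanning:
  fixes sc :: "'k::field \<Rightarrow> 'v::ab_group_add \<Rightarrow> 'v"
  assumes vs: "vector_space sc" and U: "module.subspace sc U" 
    and q: "qdim sc U V n" and S: "S \<subseteq> V" 
    and sp: "\<And>v. v \<in> V \<Longrightarrow> \<exists>w\<in>Modules.module.span sc S. v - w \<in> U"
  shows "\<exists>f. (\<forall>i<n. f i \<in> S) \<and> (\<forall>v\<in>V. \<exists>c. v - (\<Sum>i<n. sc (c i) (f i)) \<in> U) \<and>
     (\<forall>c. (\<Sum>i<n. sc (c i) (f i)) \<in> U \<longrightarrow> (\<forall>i<n. c i = 0))"
proof -
  interpret s: vector_space sc by fact
  define P where "P m \<longleftrightarrow> (\<exists>f. (\<forall>i<m. f i \<in> S) \<and> (\<forall>c. (\<Sum>i<m. sc (c i) (f i)) \<in> U \<longrightarrow> (\<forall>i<m. c i = 0)))" for m :: nat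
  have "P 0" by (simp add: P_def)
  moreover have "m \<le> n" if "P m" for m
    using that S qdim_independent_le[OF vs U q, of m] unfolding P_def by blast
  ultimately have "\<exists>m. P m \<and> (\<forall>m'. P m' \<longrightarrow> m' \<le> m)"
    by (intro Nat.ex_has_greatest_nat[of P 0 n]) blast+
  then obtain m where m: "P m" "\<And>m'. P m' \<Longrightarrow> m' \<le> m" by blast
  then obtain f where f: "\<forall>i<m. f i \<in> S" "\<forall>c. (\<Sum>i<m. sc (c i) (f i)) \<in> U \<longrightarrow> (\<forall>i<m. c i = 0)"
    unfolding P_def by blast
  define W where "W = {v. \<exists>c. v - (\<Sum>i<m. sc (c i) (f i)) \<in> U}"
  have subW: "s.subspace W" unfolding s.subspace_def
  proof (intro conjI ballI allI)
    show "0 \<in> W" unfolding W_def using s.subspace_0[OF U] by (auto intro!: exI[of _ "\<lambda>_. 0"])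
  next
    fix x y assume "x \<in> W" "y \<in> W"
    then obtain c d where "x - (\<Sum>i<m. sc (c i) (f i)) \<in> U" "y - (\<Sum>i<m. sc (d i) (f i)) \<in> U"
      unfolding W_def by blast
    from s.subspace_add[OF U this] show "x + y \<in> W" unfolding W_def
      by (auto intro!: exI[of _ "\<lambda>i. c i + d i"] simp: s.scale_left_distrib sum.distrib algebra_simps)
  next
    fix a x assume "x \<in> W"
    then obtain c where "x - (\<Sum>i<m. sc (c i) (f i)) \<in> U" unfolding W_def by blast
    from s.subspace_scale[OF U this, of a] show "sc a x \<in> W" unfolding W_def
      by (auto intro!: exI[of _ "\<lambda>i. a * c i"] simp: s.scale_right_diff_distrib s.scale_sum_right)
  qed
  have SW: "x \<in> W" if x: "x \<in> S" for x
  proof -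
    have "\<not> P (Suc m)" using m(2)[of "Suc m"] by auto
    moreover have "\<forall>i<Suc m. (f(m := x)) i \<in> S" using f(1) x by (auto simp: less_Suc_eq)
    ultimately obtain c where c: "(\<Sum>i<Suc m. sc (c i) ((f(m := x)) i)) \<in> U" "\<not> (\<forall>i<Suc m. c i = 0)"
      unfolding P_def by blast
    have c': "(\<Sum>i<m. sc (c i) (f i)) + sc (c m) x \<in> U" using c(1) by simp
    have "c m \<noteq> 0"
    proof
      assume "c m = 0"
      then show False using c' c(2) f(2) by (auto simp: less_Suc_eq)
    qed
    then have "sc (inverse (c m)) ((\<Sum>i<m. sc (c i) (f i)) + sc (c m) x) 
        = x - (\<Sum>i<m. sc (- (inverse (c m) * c i)) (f i))"
      by (simp add: s.scale_right_distrib s.scale_sum_right sum_negf)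
    then have "x - (\<Sum>i<m. sc (- (inverse (c m) * c i)) (f i)) \<in> U"
      using s.subspace_scale[OF U c', of "inverse (c m)"] by simp
    then show ?thesis unfolding W_def by (intro CollectI exI[of _ "\<lambda>i. - (inverse (c m) * c i)"])
  qed
  have WV: "\<exists>c. v - (\<Sum>i<m. sc (c i) (f i)) \<in> U" if v: "v \<in> V" for v
  proof -
    obtain w where w: "w \<in> s.span S" "v - w \<in> U" using sp[OF v] by blast
    have "w \<in> W" using w(1) SW subW s.span_minimal[of S W] by blast
    then obtain c where "w - (\<Sum>i<m. sc (c i) (f i)) \<in> U" unfolding W_def by blast
    from s.subspace_add[OF U w(2) this] show ?thesis by auto
  qed
  then have "qdim sc U V m" unfolding qdim_def using f S by blast
  then have "m = n" using qdim_unique vs U q by blast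
  then show ?thesis using f WV by blast
qed

section \<open>Tor from matrices\<close>

text \<open>Viewing a ring as a module over itself turns ideals into \<open>subspace\<close> and
  generated ideals into \<open>span\<close>. The simp rules removed below merely restate
  associativity and commutativity of the product in this reading.\<close>

interpretation idl: Modules.module "(*) :: 'a::comm_ring_1 \<Rightarrow> 'a \<Rightarrow> 'a"
  by unfold_locales (auto simp: algebra_simps)

declare idl.scale_scale [simp del] idl.scale_left_commute [simp del]

abbreviation is_ideal :: "'a::comm_ring_1 set \<Rightarrow> bool" where "is_ideal \<equiv> idl.subspace"

definition mv :: "(nat \<Rightarrow> nat \<Rightarrow> 'a::comm_ring_1) \<Rightarrow> nat \<Rightarrow> nat \<Rightarrow> (nat \<Rightarrow> 'a) \<Rightarrow> nat \<Rightarrow> 'a" where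
  "mv a p q v = (\<lambda>i. if i < p then \<Sum>j<q. a i j * v j else 0)"

lemma mv_coords: "mv a p q v \<in> coords p" by (auto simp: mv_def coords_def)

abbreviation cst :: "(('n \<Rightarrow>\<^sub>0 nat) \<Rightarrow>\<^sub>0 'k::zero) \<Rightarrow> 'k" where "cst p \<equiv> Poly_Mapping.lookup p 0"

text \<open>The vector space axioms of \<open>V\<close> are carried over along the linear bijection
  \<open>F\<close>, and the images of the unit vectors form the basis that is counted.\<close>

lemma k_dim_eqI:
  fixes V :: "('k::field, 'b, 'm) module_scheme" and F :: "(nat \<Rightarrow> 'k) \<Rightarrow> 'b"
  assumes car: "carrier V = F ` coords n"
    and zero: "\<zero>\<^bsub>V\<^esub> = F 0"
    and add: "\<And>x y. x \<in> coords n \<Longrightarrow> y \<in> coords n \<Longrightarrow> F x \<oplus>\<^bsub>V\<^esub> F y = F (x + y)"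
    and smult: "\<And>c x. x \<in> coords n \<Longrightarrow> c \<odot>\<^bsub>V\<^esub> F x = F (fsc c x)"
    and inj: "inj_on F (coords n)"
  shows "k_dim V = n"
proof -
  let ?K = "ring_of_type_algebra :: 'k ring"
  have K: "carrier ?K = UNIV" "monoid.mult ?K = (*)" "add ?K = (+)" "\<one>\<^bsub>?K\<^esub> = 1" "\<zero>\<^bsub>?K\<^esub> = 0"
    by (auto simp: ring_of_type_algebra_def)
  note subs = fsc.subspace_add[OF subspace_coords] fsc.subspace_scale[OF subspace_coords] 
    fsc.subspace_neg[OF subspace_coords] fsc.subspace_0[OF subspace_coords]
  interpret V: vectorspace ?K V
  proof (rule vs_criteria)
    show "\<forall>v\<in>carrier V. \<exists>w\<in>carrier V. v \<oplus>\<^bsub>V\<^esub> w = \<zero>\<^bsub>V\<^esub>"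
    proof
      fix v assume "v \<in> carrier V"
      then obtain x where "x \<in> coords n" "v = F x" using car by auto
      then show "\<exists>w\<in>carrier V. v \<oplus>\<^bsub>V\<^esub> w = \<zero>\<^bsub>V\<^esub>" 
        by (intro bexI[of _ "F (- x)"]) (auto simp: add subs zero car)
    qed
  qed (auto simp: K car add smult zero ac_simps subs
         fsc.scale_left_distrib fsc.scale_right_distrib intro!: field_class.field_from_type_algebra imageI)
  have fs: "(\<Oplus>\<^bsub>V\<^esub> i\<in>A. F (f i)) = F (\<Sum>i\<in>A. f i)" if "finite A" "\<And>i. i \<in> A \<Longrightarrow> f i \<in> coords n" for A :: "nat set" and f
    using that
  proof (induction A rule: finite_induct)
    case empty then show ?case by (simp add: zero zero_fun_def)
  next
    case (insert i A)
    have "(\<Sum>i\<in>A. f i) \<in> coords n" using insert by (intro fsc.subspace_sum[OF subspace_coords]) auto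
    then show ?case using insert
      by (subst V.M.finsum_insert) (auto simp: car add)
  qed
  have un: "unitv i \<in> coords n" if "i < n" for i using that by (auto simp: unitv_def coords_def)
  define B where "B = (\<lambda>i. F (unitv i)) ` {..<n}"
  have injB: "inj_on (\<lambda>i. F (unitv i)) {..<n}"
  proof (rule inj_onI)
    fix i j assume ij: "i \<in> {..<n}" "j \<in> {..<n}" "F (unitv i) = F (unitv j)"
    then have "(unitv i :: nat \<Rightarrow> 'k) = unitv j" using inj un by (auto dest: inj_onD)
    then show "i = j" unfolding unitv_def by (metis zero_neq_one)
  qed
  have lc: "V.lincomb a B = F (\<lambda>j. if j < n then a (F (unitv j)) else 0)" for a
  proof -
    have "V.lincomb a B = (\<Oplus>\<^bsub>V\<^esub> i\<in>{..<n}. a (F (unitv i)) \<odot>\<^bsub>V\<^esub> F (unitv i))"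
      unfolding V.lincomb_def B_def
      by (rule V.M.finsum_reindex) (use injB in \<open>auto simp: smult un car subs\<close>)
    also have "\<dots> = (\<Oplus>\<^bsub>V\<^esub> i\<in>{..<n}. F (fsc (a (F (unitv i))) (unitv i)))"
      by (rule V.M.finsum_cong') (auto simp: smult un car subs)
    also have "\<dots> = F (\<Sum>i<n. fsc (a (F (unitv i))) (unitv i))"
      by (rule fs) (auto simp: un subs)
    finally show ?thesis by (simp add: sum_unitv)
  qed
  have finB: "finite B" and BV: "B \<subseteq> carrier V" unfolding B_def by (auto simp: car un)
  have "V.basis B" unfolding V.basis_def
  proof (intro conjI BV)
    show "V.lin_indpt B"
    proof (rule V.finite_lin_indpt2[OF finB BV])
      fix a assume "V.lincomb a B = \<zero>\<^bsub>V\<^esub>"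
      then have "(\<lambda>j. if j < n then a (F (unitv j)) else 0) = 0"
        unfolding lc zero by (intro inj_onD[OF inj]) (auto simp: coords_def)
      then have "a (F (unitv j)) = 0" if "j < n" for j using that by (auto dest: fun_cong[of _ _ j])
      then show "\<forall>v\<in>B. a v = \<zero>\<^bsub>?K\<^esub>" by (auto simp: B_def K)
    qed
    show "V.span B = carrier V"
    proof
      show "V.span B \<subseteq> carrier V" unfolding V.span_def using BV by (auto intro!: V.lincomb_closed)
      show "carrier V \<subseteq> V.span B"
      proof
        fix v assume "v \<in> carrier V"
        then obtain x where x: "x \<in> coords n" "v = F x" using car by auto
        let ?a = "\<lambda>v. x (inv_into {..<n} (\<lambda>i. F (unitv i)) v)"
        have "V.lincomb ?a B = v" unfolding lc x(2)
          using x(1) by (intro arg_cong[of _ _ F]) (auto simp: coords_def fun_eq_iff inv_into_f_f[OF injB, simplified])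
        then show "v \<in> V.span B" unfolding V.span_def using finB K(1) by blast
      qed
    qed
  qed
  then have "V.dim = card B" using V.dim_basis finB by blast
  also have "\<dots> = n" unfolding B_def using injB by (simp add: card_image)
  finally show ?thesis unfolding k_dim_def .
qed

section \<open>Rings and modules described by representatives\<close>

lemma subset_eqI_iff: "A \<subseteq> C \<Longrightarrow> B \<subseteq> C \<Longrightarrow> A = B \<longleftrightarrow> (\<forall>u\<in>C. u \<in> A \<longleftrightarrow> u \<in> B)"
  by blast

text \<open>Matrices over a polynomial ring \<open>P\<close> that give, modulo \<open>I\<close>, a free resolution over \<open>P / I\<close> of \<open>P / J\<close>, where
  \<open>q\<close> describes the augmentation \<open>v \<mapsto> \<Sum> v l * q l\<close>.\<close>

definition resolves :: "'a::comm_ring_1 set \<Rightarrow> 'a set \<Rightarrow> (nat \<Rightarrow> nat) \<Rightarrow> (nat \<Rightarrow> nat \<Rightarrow> nat \<Rightarrow> 'a) \<Rightarrow> (nat \<Rightarrow> 'a) \<Rightarrow> bool" where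
  "resolves I J b a q \<longleftrightarrow>
     (\<exists>t\<in>coords (b 0). (\<Sum>l<b 0. t l * q l) - 1 \<in> J) \<and>
     (\<forall>v\<in>coords (b 0). (\<Sum>l<b 0. v l * q l) \<in> J \<longleftrightarrow>
        (\<exists>w\<in>coords (b 1). \<forall>i. v i - mv (a 0) (b 0) (b 1) w i \<in> I)) \<and>
     (\<forall>n. \<forall>v\<in>coords (b (Suc n)). (\<forall>i. mv (a n) (b n) (b (Suc n)) v i \<in> I) \<longleftrightarrow>
        (\<exists>w\<in>coords (b (Suc (Suc n))). \<forall>i. v i - mv (a (Suc n)) (b (Suc n)) (b (Suc (Suc n))) w i \<in> I))"

text \<open>\<open>\<pi>\<close> is an additive and multiplicative surjection with kernel
  \<open>I\<close>. There are two instances, the polynomial ring itself with \<open>I = {0}\<close>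
  and its quotient by an ideal with the coset map; Tor over both is thereby reduced to matrices of
  polynomials.\<close>

locale presented =
  fixes R :: "('r, 'rm) ring_scheme" and \<pi> :: "'a::comm_ring_1 \<Rightarrow> 'r" and I :: "'a set"
  assumes R: "cring R" and carR: "carrier R = range \<pi>"
    and pi_add: "\<pi> (x + y) = \<pi> x \<oplus>\<^bsub>R\<^esub> \<pi> y" and pi_mult: "\<pi> (x * y) = \<pi> x \<otimes>\<^bsub>R\<^esub> \<pi> y"
    and pi_eq: "\<pi> x = \<pi> y \<longleftrightarrow> x - y \<in> I" and ideal_I: "is_ideal I"
begin

sublocale R: cring R by (rule R)

lemma pi_closed[simp]: "\<pi> x \<in> carrier R" by (simp add: carR)

lemma pi_0: "\<pi> 0 = \<zero>\<^bsub>R\<^esub>"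
  using pi_add[of 0 0] pi_closed[of 0] by simp

abbreviation F where "F n \<equiv> direct_power (regular_module R) n"

definition P_vec :: "nat \<Rightarrow> (nat \<Rightarrow> 'a) \<Rightarrow> nat \<Rightarrow> 'r" where "P_vec n v = (\<lambda>i\<in>{..<n}. \<pi> (v i))"

lemma F_simps: "carrier (F n) = {..<n} \<rightarrow>\<^sub>E carrier R" "\<zero>\<^bsub>F n\<^esub> = P_vec n 0"
  by (auto simp: direct_power_def regular_module_def P_vec_def pi_0)

lemma P_vec_mem: "P_vec n v \<in> carrier (F n)" by (auto simp: F_simps P_vec_def)

lemma P_vec_add: "P_vec n v \<oplus>\<^bsub>F n\<^esub> P_vec n w = P_vec n (v + w)"
  by (auto simp: direct_power_def regular_module_def P_vec_def pi_add intro!: restrict_ext)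

lemma P_vec_smult: "\<pi> r \<odot>\<^bsub>F n\<^esub> P_vec n w = P_vec n (\<lambda>i. r * w i)"
  by (auto simp: direct_power_def regular_module_def P_vec_def pi_mult intro!: restrict_ext)

lemma P_vec_surj: assumes "u \<in> carrier (F n)" shows "\<exists>v\<in>coords n. u = P_vec n v"
proof -
  have "i < n \<Longrightarrow> u i \<in> range \<pi>" for i using assms carR by (simp add: F_simps PiE_def Pi_def)
  then have "\<forall>i. \<exists>x. i < n \<longrightarrow> u i = \<pi> x" by blast
  then obtain f where f: "\<And>i. i < n \<Longrightarrow> u i = \<pi> (f i)" by metis
  show ?thesis
    by (intro bexI[of _ "\<lambda>i. if i < n then f i else 0"]) 
       (use assms f in \<open>auto simp: F_simps P_vec_def coords_def PiE_def extensional_def fun_eq_iff restrict_def\<close>)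
qed

lemma carF: "carrier (F n) = P_vec n ` coords n"
  using P_vec_surj[of _ n] P_vec_mem[of n] by (auto simp: image_iff)

lemma P_vec_eq: assumes "v \<in> coords n" "w \<in> coords n" shows "P_vec n v = P_vec n w \<longleftrightarrow> (\<forall>i. v i - w i \<in> I)"
proof -
  have "P_vec n v = P_vec n w \<longleftrightarrow> (\<forall>i<n. v i - w i \<in> I)"
    by (auto simp: P_vec_def fun_eq_iff restrict_def pi_eq[symmetric])
  also have "\<dots> \<longleftrightarrow> (\<forall>i. v i - w i \<in> I)"
    using assms idl.subspace_0[OF ideal_I] by (auto simp: coords_def) (metis diff_self not_le)
  finally show ?thesis .
qed

lemma finsum_pi: "(\<Oplus>\<^bsub>R\<^esub>j\<in>{..<q::nat}. \<pi> (f j)) = \<pi> (\<Sum>j<q. f j)"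
  by (induction q) (auto simp: pi_0 lessThan_Suc pi_add R.add.m_comm)

lemma finsum_regular: "finsum (regular_module R) f A = finsum R f A"
  by (simp add: finsum_def finprod_def regular_module_def)

lemma matrix_map_P_vec:
  assumes "\<And>i j. i < p \<Longrightarrow> j < q \<Longrightarrow> A i j = \<pi> (a i j)"
  shows "matrix_map (regular_module R) A p q (P_vec q v) = P_vec p (mv a p q v)"
proof -
  have "(\<Oplus>\<^bsub>R\<^esub>j\<in>{..<q}. A i j \<otimes>\<^bsub>R\<^esub> P_vec q v j) = \<pi> (\<Sum>j<q. a i j * v j)" if "i < p" for i
  proof -
    have "(\<Oplus>\<^bsub>R\<^esub>j\<in>{..<q}. A i j \<otimes>\<^bsub>R\<^esub> P_vec q v j) = (\<Oplus>\<^bsub>R\<^esub>j\<in>{..<q}. \<pi> (a i j * v j))"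
      by (rule R.finsum_cong') (auto simp: assms that P_vec_def pi_mult)
    then show ?thesis by (simp add: finsum_pi)
  qed
  then show ?thesis unfolding matrix_map_def finsum_regular P_vec_def[of p] mv_def
    by (auto simp: regular_module_def intro!: restrict_ext)
qed

lemma kernel_eq_image_iff:
  assumes A: "\<And>i j. i < p \<Longrightarrow> j < q \<Longrightarrow> A i j = \<pi> (a i j)" and A': "\<And>i j. i < q \<Longrightarrow> j < r \<Longrightarrow> A' i j = \<pi> (a' i j)"
  shows "a_kernel (F q) (F p) (matrix_map (regular_module R) A p q) = matrix_map (regular_module R) A' q r ` carrier (F r) \<longleftrightarrow>
    (\<forall>v\<in>coords q. (\<forall>i. mv a p q v i \<in> I) \<longleftrightarrow> (\<exists>w\<in>coords r. \<forall>i. v i - mv a' q r w i \<in> I))" (is "?K = ?M \<longleftrightarrow> _")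
proof -
  have K: "P_vec q v \<in> ?K \<longleftrightarrow> (\<forall>i. mv a p q v i \<in> I)" for v
    using P_vec_eq[of "mv a p q v" p 0, OF mv_coords]
    by (simp add: a_kernel_def kernel_def P_vec_mem matrix_map_P_vec[where a=a, OF A] F_simps(2) coords_def)
  have M: "P_vec q v \<in> ?M \<longleftrightarrow> (\<exists>w\<in>coords r. \<forall>i. v i - mv a' q r w i \<in> I)" if "v \<in> coords q" for v
    using P_vec_eq[OF that mv_coords] by (auto simp: carF matrix_map_P_vec[where a=a', OF A'] image_iff)
  have "?K \<subseteq> carrier (F q)" by (auto simp: a_kernel_def kernel_def)
  moreover have "?M \<subseteq> carrier (F q)" by (auto simp: carF[of r] matrix_map_P_vec[where a=a', OF A'] P_vec_mem)
  ultimately have "?K = ?M \<longleftrightarrow> (\<forall>u\<in>carrier (F q). u \<in> ?K \<longleftrightarrow> u \<in> ?M)" by (rule subset_eqI_iff)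
  then have "?K = ?M \<longleftrightarrow> (\<forall>v\<in>coords q. P_vec q v \<in> ?K \<longleftrightarrow> P_vec q v \<in> ?M)"
    by (simp only: carF[of q] ball_simps)
  then show ?thesis by (simp add: K M)
qed

end

text \<open>The modules resolved here are cyclic: \<open>S / I\<close> over \<open>S\<close>, and
  \<open>k\<close> over \<open>S / I\<close>. Each is a quotient of the polynomials by
  \<open>J\<close>, and \<open>I \<subseteq> J\<close> makes the action of \<open>R\<close>
  consistent.\<close>

locale presented_module = presented R \<pi> I
  for R :: "('r, 'rm) ring_scheme" and \<pi> :: "'a::comm_ring_1 \<Rightarrow> 'r" and I :: "'a set" +
  fixes M :: "('r, 'b, 'm) module_scheme" and \<mu> :: "'a \<Rightarrow> 'b" and J :: "'a set"
  assumes carM: "carrier M = range \<mu>" and mu_add: "\<mu> (x + y) = \<mu> x \<oplus>\<^bsub>M\<^esub> \<mu> y"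
    and mu_smult: "\<mu> (r * x) = \<pi> r \<odot>\<^bsub>M\<^esub> \<mu> x" and mu_eq: "\<mu> x = \<mu> y \<longleftrightarrow> x - y \<in> J"
    and mu_0: "\<mu> 0 = \<zero>\<^bsub>M\<^esub>" and ideal_J: "is_ideal J" and IJ: "I \<subseteq> J"
begin

lemma kernel_eps_iff:
  assumes eps: "\<And>v. v \<in> coords p \<Longrightarrow> \<epsilon> (P_vec p v) = \<mu> (\<Sum>l<p. v l * q l)"
    and A: "\<And>i j. i < p \<Longrightarrow> j < r \<Longrightarrow> A i j = \<pi> (a i j)"
  shows "a_kernel (F p) M \<epsilon> = matrix_map (regular_module R) A p r ` carrier (F r) \<longleftrightarrow>
    (\<forall>v\<in>coords p. (\<Sum>l<p. v l * q l) \<in> J \<longleftrightarrow> (\<exists>w\<in>coords r. \<forall>i. v i - mv a p r w i \<in> I))" (is "?K = ?M \<longleftrightarrow> _")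
proof -
  have K: "P_vec p v \<in> ?K \<longleftrightarrow> (\<Sum>l<p. v l * q l) \<in> J" if "v \<in> coords p" for v
    using that by (auto simp: a_kernel_def kernel_def P_vec_mem eps mu_0[symmetric] mu_eq)
  have M: "P_vec p v \<in> ?M \<longleftrightarrow> (\<exists>w\<in>coords r. \<forall>i. v i - mv a p r w i \<in> I)" if "v \<in> coords p" for v
    using P_vec_eq[OF that mv_coords] by (auto simp: carF matrix_map_P_vec[where a=a, OF A] image_iff)
  have "?K \<subseteq> carrier (F p)" by (auto simp: a_kernel_def kernel_def)
  moreover have "?M \<subseteq> carrier (F p)" by (auto simp: carF[of r] matrix_map_P_vec[where a=a, OF A] P_vec_mem)
  ultimately have "?K = ?M \<longleftrightarrow> (\<forall>u\<in>carrier (F p). u \<in> ?K \<longleftrightarrow> u \<in> ?M)" by (rule subset_eqI_iff)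
  then have "?K = ?M \<longleftrightarrow> (\<forall>v\<in>coords p. P_vec p v \<in> ?K \<longleftrightarrow> P_vec p v \<in> ?M)"
    by (simp only: carF[of p] ball_simps)
  then show ?thesis by (simp add: K M)
qed

lemma hom_eps:
  assumes "\<epsilon> \<in> module_hom R (F p) M" and q: "\<And>l. l < p \<Longrightarrow> \<epsilon> (P_vec p (unitv l)) = \<mu> (q l)" and v: "v \<in> coords p"
  shows "\<epsilon> (P_vec p v) = \<mu> (\<Sum>l<p. v l * q l)"
proof -
  have add: "\<epsilon> (P_vec p (v + w)) = \<epsilon> (P_vec p v) \<oplus>\<^bsub>M\<^esub> \<epsilon> (P_vec p w)" for v w
    unfolding P_vec_add[symmetric] using assms(1) by (auto simp: module_hom_def P_vec_mem)
  have sm: "\<epsilon> (P_vec p (\<lambda>i. r * w i)) = \<pi> r \<odot>\<^bsub>M\<^esub> \<epsilon> (P_vec p w)" for r w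
    unfolding P_vec_smult[symmetric] using assms(1) by (auto simp: module_hom_def P_vec_mem)
  have mem: "\<epsilon> (P_vec p w) \<in> range \<mu>" for w using assms(1) P_vec_mem[of p w] by (auto simp: module_hom_def carM)
  have e0: "\<epsilon> (P_vec p 0) = \<mu> 0"
  proof -
    obtain x where "\<epsilon> (P_vec p 0) = \<mu> x" using mem[of 0] by blast
    then show ?thesis using sm[of 0 0] mu_smult[of 0 x] by (simp add: zero_fun_def)
  qed
  have "\<epsilon> (P_vec p (\<Sum>l<m. (\<lambda>i. v l * unitv l i))) = \<mu> (\<Sum>l<m. v l * q l)" if "m \<le> p" for m
    using that
  proof (induction m)
    case 0 then show ?case using e0 by (simp add: zero_fun_def)
  next
    case (Suc m) then show ?case by (simp only: sum.lessThan_Suc add sm q mu_add mu_smult Suc_le_eq less_imp_le)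
  qed
  moreover have "(\<Sum>l<p. (\<lambda>i. v l * unitv l i)) = v"
    using v by (auto simp: sum_fun_apply unitv_def coords_def fun_eq_iff if_distrib[of "(*) _"] cong: if_cong)
  ultimately show ?thesis by fastforce
qed

text \<open>The resolution inside \<open>Tor\<close> is arbitrary: its first rank \<open>b 0\<close>
  need not be 1, and the augmentation sends the unit vectors to elements with unknown
  representatives \<open>q l\<close>. This is why \<open>resolves\<close> carries
  \<open>q\<close>.\<close>

lemma resolves_of_free_resolution:
  assumes "free_resolution R M b A"
  shows "\<exists>a q. resolves I J b a q \<and> (\<forall>n. \<forall>i<b n. \<forall>j<b (Suc n). A n i j = \<pi> (a n i j))"
proof -
  have fr: "\<forall>n. \<forall>i<b n. \<forall>j<b (Suc n). A n i j \<in> carrier R" 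
    "\<exists>\<epsilon>\<in>module_hom R (F (b 0)) M. \<epsilon> ` carrier (F (b 0)) = carrier M \<and>
            a_kernel (F (b 0)) M \<epsilon> = matrix_map (regular_module R) (A 0) (b 0) (b 1) ` carrier (F (b 1))"
    "\<forall>n. a_kernel (F (b (Suc n))) (F (b n)) (matrix_map (regular_module R) (A n) (b n) (b (Suc n))) = 
       matrix_map (regular_module R) (A (Suc n)) (b (Suc n)) (b (Suc (Suc n))) ` carrier (F (b (Suc (Suc n))))"
    using assms unfolding free_resolution_def Let_def by auto
  have "\<forall>n i j. \<exists>x. i < b n \<longrightarrow> j < b (Suc n) \<longrightarrow> A n i j = \<pi> x" using fr(1) carR by blast
  then obtain a where a: "\<And>n i j. i < b n \<Longrightarrow> j < b (Suc n) \<Longrightarrow> A n i j = \<pi> (a n i j)" by metis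
  obtain \<epsilon> where eps: "\<epsilon> \<in> module_hom R (F (b 0)) M" "\<epsilon> ` carrier (F (b 0)) = carrier M"
    "a_kernel (F (b 0)) M \<epsilon> = matrix_map (regular_module R) (A 0) (b 0) (b 1) ` carrier (F (b 1))" using fr(2) by blast
  have "\<forall>l. \<exists>x. \<epsilon> (P_vec (b 0) (unitv l)) = \<mu> x" using eps(1) P_vec_mem by (fastforce simp: module_hom_def carM)
  then obtain q where q: "\<And>l. \<epsilon> (P_vec (b 0) (unitv l)) = \<mu> (q l)" by metis
  note e = hom_eps[OF eps(1) q]
  \<comment> \<open>A preimage \<open>t\<close> of the generator; multiplication by it will later be
    a section of the augmentation up to \<open>J\<close>.\<close>
  have "\<mu> 1 \<in> \<epsilon> ` carrier (F (b 0))" using eps(2) carM by blast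
  then obtain t where "t \<in> coords (b 0)" "\<mu> 1 = \<epsilon> (P_vec (b 0) t)" unfolding carF by blast
  then have "t \<in> coords (b 0)" "(\<Sum>l<b 0. t l * q l) - 1 \<in> J" using e mu_eq by metis+
  moreover have "\<forall>v\<in>coords (b 0). (\<Sum>l<b 0. v l * q l) \<in> J \<longleftrightarrow>
        (\<exists>w\<in>coords (b 1). \<forall>i. v i - mv (a 0) (b 0) (b 1) w i \<in> I)"
    using kernel_eps_iff[where \<epsilon>=\<epsilon> and q=q and a="a 0" and A="A 0" and p="b 0" and r="b 1", OF e] eps(3) a by simp
  moreover have "\<forall>v\<in>coords (b (Suc n)). (\<forall>i. mv (a n) (b n) (b (Suc n)) v i \<in> I) \<longleftrightarrow>
        (\<exists>w\<in>coords (b (Suc (Suc n))). \<forall>i. v i - mv (a (Suc n)) (b (Suc n)) (b (Suc (Suc n))) w i \<in> I)" for n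
    using fr(3) kernel_eq_image_iff[where a="a n" and a'="a (Suc n)" and A="A n" and A'="A (Suc n)" 
        and p="b n" and q="b (Suc n)" and r="b (Suc (Suc n))", OF a a] by blast
  ultimately have "resolves I J b a q" unfolding resolves_def by blast
  then show ?thesis
  proof (rule_tac exI, rule_tac exI, rule_tac conjI)
    show "\<forall>n. \<forall>i<b n. \<forall>j<b (Suc n). A n i j = \<pi> (a n i j)"
    proof (intro allI impI)
      fix n i j assume "i < b n" "j < b (Suc n)"
      then show "A n i j = \<pi> (a n i j)" by (rule a)
    qed
  qed
qed

text \<open>This direction serves to show that a free resolution exists at all, so that the choice
  made in \<open>Tor\<close> succeeds.\<close>

lemma free_resolution_of_resolves:
  assumes res: "resolves I J b a (\<lambda>_. 1)" and b0: "b 0 = 1"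
  shows "free_resolution R M b (\<lambda>n i j. \<pi> (a n i j))"
proof -
  \<comment> \<open>Any representative of the coordinate may be picked, since two of them differ by
    an element of \<open>I \<subseteq> J\<close>.\<close>
  define \<epsilon> where "\<epsilon> u = \<mu> (SOME x. u 0 = \<pi> x)" for u :: "nat \<Rightarrow> 'r"
  have e: "\<epsilon> (P_vec 1 v) = \<mu> (v 0)" for v
  proof -
    have "\<pi> (v 0) = \<pi> (SOME x. \<pi> (v 0) = \<pi> x)" by (rule someI) (rule refl)
    then have "v 0 - (SOME x. \<pi> (v 0) = \<pi> x) \<in> J" using IJ unfolding pi_eq by blast
    then have "\<mu> (v 0) = \<mu> (SOME x. \<pi> (v 0) = \<pi> x)" unfolding mu_eq .
    then show ?thesis by (simp add: \<epsilon>_def P_vec_def)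
  qed
  have hom: "\<epsilon> \<in> module_hom R (F 1) M" unfolding module_hom_def
    by (auto simp: carF e[unfolded One_nat_def] carM P_vec_add P_vec_smult mu_add mu_smult carR)
  have im: "\<epsilon> ` carrier (F 1) = carrier M"
  proof
    show "\<epsilon> ` carrier (F 1) \<subseteq> carrier M" unfolding carF carM using e by blast
    show "carrier M \<subseteq> \<epsilon> ` carrier (F 1)"
    proof
      fix y assume "y \<in> carrier M"
      then obtain x where x: "y = \<mu> x" using carM by blast
      have "(\<lambda>i. if i = 0 then x else 0) \<in> coords 1" by (simp add: coords_def)
      moreover have "y = \<epsilon> (P_vec 1 (\<lambda>i. if i = 0 then x else 0))" using x unfolding e by simp
      ultimately show "y \<in> \<epsilon> ` carrier (F 1)" unfolding carF by blast
    qed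
  qed
  have r0: "\<forall>v\<in>coords 1. (\<Sum>l<1. v l * 1) \<in> J \<longleftrightarrow> (\<exists>w\<in>coords (b 1). \<forall>i. v i - mv (a 0) 1 (b 1) w i \<in> I)"
    using res unfolding resolves_def b0 by blast
  have r1: "\<forall>v\<in>coords (b (Suc n)). (\<forall>i. mv (a n) (b n) (b (Suc n)) v i \<in> I) \<longleftrightarrow>
        (\<exists>w\<in>coords (b (Suc (Suc n))). \<forall>i. v i - mv (a (Suc n)) (b (Suc n)) (b (Suc (Suc n))) w i \<in> I)" for n
    using res unfolding resolves_def by blast
  have ke: "a_kernel (F 1) M \<epsilon> = matrix_map (regular_module R) (\<lambda>i j. \<pi> (a 0 i j)) 1 (b 1) ` carrier (F (b 1))"
    using kernel_eps_iff[where a="a 0" and q="\<lambda>_. 1" and p=1 and r="b 1" and \<epsilon>=\<epsilon> and A="\<lambda>i j. \<pi> (a 0 i j)"] r0 e by simp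
  show ?thesis unfolding free_resolution_def Let_def
  proof (intro conjI)
    show "\<exists>\<epsilon>\<in>module_hom R (F (b 0)) M. \<epsilon> ` carrier (F (b 0)) = carrier M \<and>
        a_kernel (F (b 0)) M \<epsilon> = matrix_map (regular_module R) (\<lambda>i j. \<pi> (a 0 i j)) (b 0) (b (Suc 0)) ` carrier (F (b 1))"
      unfolding b0 One_nat_def[symmetric] by (intro bexI[of _ \<epsilon>] conjI im ke hom)
    show "\<forall>n. a_kernel (F (b (Suc n))) (F (b n)) (matrix_map (regular_module R) (\<lambda>i j. \<pi> (a n i j)) (b n) (b (Suc n))) =
        matrix_map (regular_module R) (\<lambda>i j. \<pi> (a (Suc n) i j)) (b (Suc n)) (b (Suc (Suc n))) ` carrier (F (b (Suc (Suc n))))"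
    proof
      fix n
      show "a_kernel (F (b (Suc n))) (F (b n)) (matrix_map (regular_module R) (\<lambda>i j. \<pi> (a n i j)) (b n) (b (Suc n))) =
        matrix_map (regular_module R) (\<lambda>i j. \<pi> (a (Suc n) i j)) (b (Suc n)) (b (Suc (Suc n))) ` carrier (F (b (Suc (Suc n))))"
        by (rule kernel_eq_image_iff[where a="a n" and a'="a (Suc n)", THEN iffD2]) (rule refl r1)+
    qed
  qed auto
qed

end

section \<open>Homology of a resolution tensored with the residue field\<close>

definition bnd :: "(nat \<Rightarrow> nat) \<Rightarrow> (nat \<Rightarrow> nat \<Rightarrow> nat \<Rightarrow> 'k::comm_ring_1) \<Rightarrow> nat \<Rightarrow> (nat \<Rightarrow> 'k) set" where
  "bnd b a j = mv (a j) (b j) (b (Suc j)) ` coords (b (Suc j))"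

text \<open>The guard \<open>j = Suc m\<close> imposes nothing in degree 0, where there is no
  outgoing differential.\<close>

definition cyc :: "(nat \<Rightarrow> nat) \<Rightarrow> (nat \<Rightarrow> nat \<Rightarrow> nat \<Rightarrow> 'k::comm_ring_1) \<Rightarrow> nat \<Rightarrow> (nat \<Rightarrow> 'k) set" where
  "cyc b a j = {v \<in> coords (b j). \<forall>m. j = Suc m \<longrightarrow> mv (a m) (b m) (b j) v = 0}"

lemma mv_add: "mv a p q (v + w) = mv a p q v + mv a p q w"
  by (auto simp: mv_def fun_eq_iff distrib_left sum.distrib)

lemma mv_scale: "mv a p q (\<lambda>i. c * v i) = (\<lambda>i. c * mv a p q v i)"
proof
  fix i
  have "(\<Sum>j<q. a i j * (c * v j)) = c * (\<Sum>j<q. a i j * v j)" by (simp add: sum_distrib_left mult.left_commute)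
  then show "mv a p q (\<lambda>i. c * v i) i = c * mv a p q v i" by (simp add: mv_def)
qed

lemma mv_0: "mv a p q 0 = 0"
  by (auto simp: mv_def fun_eq_iff)

lemma coords_closed: "v \<in> coords n \<Longrightarrow> w \<in> coords n \<Longrightarrow> v + w \<in> coords n" "(0::nat \<Rightarrow> 'a) \<in> coords n"
  "v \<in> coords n \<Longrightarrow> (\<lambda>i. c * v i) \<in> coords n" for v :: "nat \<Rightarrow> 'a::comm_ring_1"
  by (auto simp: coords_def)

lemma subspace_bnd: "fsc.subspace (bnd b (a :: nat \<Rightarrow> nat \<Rightarrow> nat \<Rightarrow> 'k::field) j)"
  unfolding fsc.subspace_def bnd_def lsc_def
proof (intro conjI ballI allI)
  show "0 \<in> mv (a j) (b j) (b (Suc j)) ` coords (b (Suc j))"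
    by (rule image_eqI[of _ _ 0]) (auto simp: mv_0 coords_closed)
qed (auto simp: mv_add[symmetric] mv_scale[symmetric] coords_closed intro!: imageI)

lemma subspace_cyc: "fsc.subspace (cyc b (a :: nat \<Rightarrow> nat \<Rightarrow> nat \<Rightarrow> 'k::field) j)"
  unfolding fsc.subspace_def cyc_def lsc_def
  by (auto simp: mv_add mv_scale mv_0 coords_closed)

text \<open>The second argument of \<open>Tor\<close> is always the residue field. Polynomials act
  on it through their constant terms, so after tensoring only the constant terms of the matrices
  remain and homology is computed over \<open>k\<close>.\<close>

locale tensored = presented R \<pi> I
  for R :: "('r, 'rm) ring_scheme" and \<pi> :: "('n::finite, 'k::field) mpoly \<Rightarrow> 'r" and I +
  fixes N :: "('r, 'k, 'x) module_scheme"
  assumes carN: "carrier N = UNIV" and addN: "add N = (+)" and zeroN: "\<zero>\<^bsub>N\<^esub> = 0"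
    and smN: "\<And>p c. \<pi> p \<odot>\<^bsub>N\<^esub> c = cst p * c"
begin

abbreviation DN where "DN n \<equiv> direct_power N n"

definition rvec :: "nat \<Rightarrow> (nat \<Rightarrow> 'k) \<Rightarrow> nat \<Rightarrow> 'k" where "rvec n v = (\<lambda>i\<in>{..<n}. v i)"

lemma finsum_N: "(\<Oplus>\<^bsub>N\<^esub>j\<in>{..<q::nat}. f j) = (\<Sum>j<q. f j)"
proof -
  interpret N: abelian_monoid N
    by (rule abelian_monoidI) (auto simp: carN addN zeroN ac_simps)
  show ?thesis by (induction q) (auto simp: zeroN lessThan_Suc addN carN)
qed

lemma carDN: "carrier (DN n) = rvec n ` coords n"
proof -
  have "u \<in> rvec n ` coords n" if "u \<in> carrier (DN n)" for u
    by (rule image_eqI[of _ _ "\<lambda>i. if i < n then u i else 0"])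
       (use that in \<open>auto simp: direct_power_def rvec_def coords_def PiE_def extensional_def fun_eq_iff\<close>)
  moreover have "rvec n v \<in> carrier (DN n)" for v
    by (auto simp: direct_power_def rvec_def carN)
  ultimately show ?thesis by blast
qed

lemma rvec_inj: "v \<in> coords n \<Longrightarrow> w \<in> coords n \<Longrightarrow> rvec n v = rvec n w \<longleftrightarrow> v = w"
  by (auto simp: rvec_def fun_eq_iff restrict_def coords_def) (metis not_le)

lemma DN_simps: "rvec n v \<oplus>\<^bsub>DN n\<^esub> rvec n w = rvec n (v + w)" "\<zero>\<^bsub>DN n\<^esub> = rvec n 0"
  "\<pi> p \<odot>\<^bsub>DN n\<^esub> rvec n v = rvec n (\<lambda>i. cst p * v i)"
  by (auto simp: direct_power_def rvec_def addN zeroN smN intro!: restrict_ext)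

lemma matrix_map_rvec:
  assumes "\<And>i j. i < p \<Longrightarrow> j < q \<Longrightarrow> A i j = \<pi> (a i j)"
  shows "matrix_map N A p q (rvec q v) = rvec p (mv (\<lambda>i j. cst (a i j)) p q v)"
  unfolding matrix_map_def finsum_N rvec_def mv_def
  by (auto simp: assms smN intro!: restrict_ext sum.cong)

context
  fixes b :: "nat \<Rightarrow> nat" and A :: "nat \<Rightarrow> nat \<Rightarrow> nat \<Rightarrow> 'r" and a :: "nat \<Rightarrow> nat \<Rightarrow> nat \<Rightarrow> ('n, 'k) mpoly" and ca
  assumes A: "\<And>n i j. i < b n \<Longrightarrow> j < b (Suc n) \<Longrightarrow> A n i j = \<pi> (a n i j)"
    and ca: "ca = (\<lambda>n i j. cst (a n i j))"
begin

lemma tensor_boundaries_eq: "tensor_boundaries N b A j = rvec (b j) ` bnd b ca j"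
  unfolding tensor_boundaries_def carDN bnd_def image_image
  by (rule image_cong[OF refl]) (simp add: matrix_map_rvec[where a="a j"] A ca)

lemma tensor_cycles_eq: "tensor_cycles N b A j = rvec (b j) ` cyc b ca j"
proof (cases j)
  case 0 then show ?thesis by (simp add: tensor_cycles_def cyc_def carDN)
next
  case (Suc m)
  have "matrix_map N (A m) (b m) (b j) (rvec (b j) v) = rvec (b m) 0 \<longleftrightarrow> mv (ca m) (b m) (b j) v = 0" 
    if "v \<in> coords (b j)" for v
    using rvec_inj[OF mv_coords coords_closed(2)]
    by (simp add: matrix_map_rvec[where a="a m"] A ca Suc)
  then show ?thesis unfolding tensor_cycles_def Suc
    by (auto simp: Suc a_kernel_def kernel_def carDN cyc_def DN_simps image_iff)
qed

definition bcls where "bcls j v = rvec (b j) ` (\<lambda>h. h + v) ` bnd b ca j"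

lemma bnd_sub: "bnd b ca j \<subseteq> coords (b j)"
  by (auto simp: bnd_def mv_coords)

lemma cyc_sub: "cyc b ca j \<subseteq> coords (b j)"
  by (auto simp: cyc_def)

lemma bcls_eq: assumes "v \<in> coords (b j)" "w \<in> coords (b j)" shows "bcls j v = bcls j w \<longleftrightarrow> v - w \<in> bnd b ca j"
proof
  note sb = subspace_bnd[of b ca j]
  assume "bcls j v = bcls j w"
  moreover have "rvec (b j) v \<in> bcls j v" unfolding bcls_def
    by (intro imageI image_eqI[of _ _ 0]) (use fsc.subspace_0[OF sb] in \<open>auto simp: zero_fun_def\<close>)
  ultimately obtain h where h: "h \<in> bnd b ca j" "rvec (b j) v = rvec (b j) (h + w)" unfolding bcls_def by auto
  moreover have "h + w \<in> coords (b j)" using h(1) bnd_sub assms coords_closed(1) by blast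
  ultimately have "v = h + w" using rvec_inj assms by blast
  then show "v - w \<in> bnd b ca j" using h(1) by (simp add: algebra_simps)
next
  note sb = subspace_bnd[of b ca j]
  assume d: "v - w \<in> bnd b ca j"
  have "(\<lambda>h. h + v) ` bnd b ca j = (\<lambda>h. h + w) ` bnd b ca j" (is "?f ` ?B = ?g ` ?B")
  proof (intro equalityI subsetI)
    fix x assume "x \<in> ?f ` ?B"
    then obtain h where "h \<in> ?B" "x = h + v" by blast
    then show "x \<in> ?g ` ?B" using fsc.subspace_add[OF sb _ d, of h] 
      by (intro image_eqI[of _ _ "h + (v - w)"]) (auto simp: algebra_simps)
  next
    fix x assume "x \<in> ?g ` ?B"
    then obtain h where "h \<in> ?B" "x = h + w" by blast
    then show "x \<in> ?f ` ?B" using fsc.subspace_diff[OF sb _ d, of h] 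
      by (intro image_eqI[of _ _ "h - (v - w)"]) (auto simp: algebra_simps)
  qed
  then show "bcls j v = bcls j w" unfolding bcls_def by simp
qed

lemma tensor_homology_simps:
  shows "carrier (tensor_homology N b A j) = bcls j ` cyc b ca j"
    and "\<zero>\<^bsub>tensor_homology N b A j\<^esub> = bcls j 0"
    and "bcls j v \<oplus>\<^bsub>tensor_homology N b A j\<^esub> bcls j w = bcls j (v + w)"
    and "\<pi> p \<odot>\<^bsub>tensor_homology N b A j\<^esub> bcls j v = bcls j (\<lambda>i. cst p * v i)"
proof -
  note sb = subspace_bnd[of b ca j]
  let ?D = "(DN (b j))\<lparr>carrier := tensor_cycles N b A j\<rparr>"
  let ?E = "\<lambda>Z. (DN (b j))\<lparr>carrier := Z\<rparr>"
  have co: "rvec (b j) ` bnd b ca j +>\<^bsub>?E Z\<^esub> rvec (b j) v = bcls j v" for v Z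
    by (auto simp: a_r_coset_def' bcls_def DN_simps)
  show "carrier (tensor_homology N b A j) = bcls j ` cyc b ca j"
    unfolding tensor_homology_def quotient_module_def A_RCOSETS_def' tensor_boundaries_eq
    by (auto simp: tensor_cycles_eq co)
  show "\<zero>\<^bsub>tensor_homology N b A j\<^esub> = bcls j 0"
    unfolding tensor_homology_def quotient_module_def tensor_boundaries_eq bcls_def by simp
  show "bcls j v \<oplus>\<^bsub>tensor_homology N b A j\<^esub> bcls j w = bcls j (v + w)"
  proof -
    have 1: "(h1 + v) + (h2 + w) = (h1 + h2) + (v + w)" for h1 h2 by (simp add: algebra_simps)
    have "bcls j v <+>\<^bsub>?D\<^esub> bcls j w = (\<Union>h1\<in>bnd b ca j. \<Union>h2\<in>bnd b ca j. {rvec (b j) ((h1 + h2) + (v + w))})"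
      unfolding set_add_def' bcls_def by (simp add: DN_simps 1)
    also have "\<dots> = bcls j (v + w)"
    proof
      show "(\<Union>h1\<in>bnd b ca j. \<Union>h2\<in>bnd b ca j. {rvec (b j) ((h1 + h2) + (v + w))}) \<subseteq> bcls j (v + w)"
        unfolding bcls_def using fsc.subspace_add[OF sb] by blast
      show "bcls j (v + w) \<subseteq> (\<Union>h1\<in>bnd b ca j. \<Union>h2\<in>bnd b ca j. {rvec (b j) ((h1 + h2) + (v + w))})"
      proof
        fix x assume "x \<in> bcls j (v + w)"
        then obtain h where h: "h \<in> bnd b ca j" "x = rvec (b j) (h + (v + w))" unfolding bcls_def by blast
        then have "x = rvec (b j) ((h + 0) + (v + w))" by (simp only: add_0_right)
        then show "x \<in> (\<Union>h1\<in>bnd b ca j. \<Union>h2\<in>bnd b ca j. {rvec (b j) ((h1 + h2) + (v + w))})"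
          using h(1) fsc.subspace_0[OF sb] by blast
      qed
    qed
    finally show ?thesis unfolding tensor_homology_def quotient_module_def by simp
  qed
  show "\<pi> p \<odot>\<^bsub>tensor_homology N b A j\<^esub> bcls j v = bcls j (\<lambda>i. cst p * v i)"
  proof -
    have "bcls j (\<lambda>i. cst p * (h + v) i) = bcls j (\<lambda>i. cst p * v i)" if "h \<in> bnd b ca j" for h
    proof -
      have "(\<lambda>i. cst p * h i) \<in> bnd b ca j" using fsc.subspace_scale[OF sb that, of "cst p"] by (simp add: lsc_def)
      note m = this
      have "(\<lambda>k. k + (\<lambda>i. cst p * (h + v) i)) ` bnd b ca j = (\<lambda>k. k + (\<lambda>i. cst p * v i)) ` bnd b ca j" (is "?f ` ?B = ?g ` ?B")
      proof (intro equalityI subsetI)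
        fix x assume "x \<in> ?f ` ?B"
        then obtain k where "k \<in> ?B" "x = ?f k" by blast
        then show "x \<in> ?g ` ?B" using fsc.subspace_add[OF sb _ m, of k] 
          by (intro image_eqI[of _ _ "k + (\<lambda>i. cst p * h i)"]) (auto simp: algebra_simps fun_eq_iff)
      next
        fix x assume "x \<in> ?g ` ?B"
        then obtain k where "k \<in> ?B" "x = ?g k" by blast
        then show "x \<in> ?f ` ?B" using fsc.subspace_diff[OF sb _ m, of k] 
          by (intro image_eqI[of _ _ "k - (\<lambda>i. cst p * h i)"]) (auto simp: algebra_simps fun_eq_iff)
      qed
      then show ?thesis unfolding bcls_def by simp
    qed
    moreover have "\<pi> p \<odot>\<^bsub>tensor_homology N b A j\<^esub> bcls j v = (\<Union>h\<in>bnd b ca j. bcls j (\<lambda>i. cst p * (h + v) i))"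
      unfolding tensor_homology_def quotient_module_def tensor_boundaries_eq bcls_def[of j v]
      by (simp add: DN_simps co)
    moreover have "bnd b ca j \<noteq> {}" using fsc.subspace_0[OF sb] by auto
    ultimately show ?thesis by simp
  qed
qed

text \<open>Coordinates with respect to representatives \<open>f\<close> of a basis give the linear
  bijection that \<open>k_dim_eqI\<close> asks for.\<close>

lemma k_dim_tensor_homology:
  assumes q: "qdim fsc (bnd b ca j) (cyc b ca j) n"
  shows "k_dim (restrict_scalars (\<lambda>c. \<pi> (mconst c)) (tensor_homology N b A j)) = n"
proof -
  obtain f where f: "\<forall>i<n. f i \<in> cyc b ca j" "\<forall>v\<in>cyc b ca j. \<exists>c. v - (\<Sum>i<n. fsc (c i) (f i)) \<in> bnd b ca j"
     "\<forall>c. (\<Sum>i<n. fsc (c i) (f i)) \<in> bnd b ca j \<longrightarrow> (\<forall>i<n. c i = 0)" using q unfolding qdim_def by blast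
  let ?s = "\<lambda>c. \<Sum>i<n. fsc (c i) (f i)"
  have s_cyc: "?s c \<in> cyc b ca j" for c using f(1) subspace_cyc by (intro fsc.subspace_sum_scale) auto
  then have s_mem: "?s c \<in> coords (b j)" for c using cyc_sub by blast
  have mc: "cst (mconst c :: ('n, 'k) mpoly) = c" for c by (simp add: mconst_def)
  show ?thesis
  proof (rule k_dim_eqI[where F="\<lambda>c. bcls j (?s c)"])
    show "carrier (restrict_scalars (\<lambda>c. \<pi> (mconst c)) (tensor_homology N b A j)) = (\<lambda>c. bcls j (?s c)) ` coords n"
    proof -
      have "bcls j v \<in> (\<lambda>c. bcls j (?s c)) ` coords n" if v: "v \<in> cyc b ca j" for v
      proof -
        obtain c where c: "v - ?s c \<in> bnd b ca j" using f(2) v by blast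
        have "?s c = ?s (\<lambda>i. if i < n then c i else 0)" by (rule sum.cong) auto
        then have "bcls j v = bcls j (?s (\<lambda>i. if i < n then c i else 0))"
          using bcls_eq[OF _ s_mem, of v "\<lambda>i. if i < n then c i else 0"] c v cyc_sub by auto
        moreover have "(\<lambda>i. if i < n then c i else 0) \<in> coords n" by (simp add: coords_def)
        ultimately show ?thesis by (rule image_eqI)
      qed
      then show ?thesis using s_cyc by (auto simp: restrict_scalars_def tensor_homology_simps(1))
    qed
    show "inj_on (\<lambda>c. bcls j (?s c)) (coords n)"
    proof (rule inj_onI)
      fix c d assume cd: "c \<in> coords n" "d \<in> coords n" "bcls j (?s c) = bcls j (?s d)"
      then have "?s c - ?s d \<in> bnd b ca j" using bcls_eq s_mem by blast
      moreover have "?s c - ?s d = ?s (\<lambda>i. c i - d i)"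
        by (simp only: fsc.scale_left_diff_distrib sum_subtractf)
      ultimately have "\<forall>i<n. c i - d i = 0" using f(3) by metis
      then show "c = d" using cd by (auto simp: coords_def fun_eq_iff) (metis not_le eq_iff_diff_eq_0)
    qed
    have s0: "?s 0 = 0" by (rule sum.neutral) (auto simp: lsc_def fun_eq_iff)
    show "\<zero>\<^bsub>restrict_scalars (\<lambda>c. \<pi> (mconst c)) (tensor_homology N b A j)\<^esub> = bcls j (?s 0)"
      unfolding s0 by (simp add: restrict_scalars_def tensor_homology_simps)
  next
    fix c d
    have "?s c + ?s d = ?s (c + d)" by (simp add: sum.distrib[symmetric] fsc.scale_left_distrib)
    then show "bcls j (?s c) \<oplus>\<^bsub>restrict_scalars (\<lambda>c. \<pi> (mconst c)) (tensor_homology N b A j)\<^esub> bcls j (?s d) = bcls j (?s (c + d))"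
      using tensor_homology_simps(3)[where j=j and v="?s c" and w="?s d"] by (simp add: restrict_scalars_def)
  next
    fix r c
    have "(\<lambda>i. cst (mconst r :: ('n, 'k) mpoly) * ?s c i) = ?s (fsc r c)"
      unfolding mc by (simp add: fun_eq_iff sum_fun_apply lsc_def sum_distrib_left mult.assoc)
    then show "r \<odot>\<^bsub>restrict_scalars (\<lambda>c. \<pi> (mconst c)) (tensor_homology N b A j)\<^esub> bcls j (?s c) = bcls j (?s (fsc r c))"
      using tensor_homology_simps(4)[where p="mconst r" and j=j and v="?s c"] by (simp add: restrict_scalars_def)
  qed
qed

end

end

text \<open>The resolution picked by \<open>SOME\<close> is known only through the property that it
  resolves. Hence the conclusion offers some \<open>b\<close>, \<open>a\<close>, \<open>q\<close>,
  the same for all degrees \<open>j\<close>, and the dimension has to be found by comparison with a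
  known complex.\<close>

lemma k_dim_Tor:
  fixes \<pi> :: "('n::finite, 'k::field) mpoly \<Rightarrow> 'r"
  assumes "presented_module R \<pi> I M \<mu> J" "tensored R \<pi> I N"
    and ex: "\<exists>b a. resolves I J b a (\<lambda>_. 1) \<and> b 0 = 1"
  shows "\<exists>b a q. resolves I J b a q \<and> (\<forall>j n. qdim fsc (bnd b (\<lambda>n i j. cst (a n i j)) j) (cyc b (\<lambda>n i j. cst (a n i j)) j) n
     \<longrightarrow> k_dim (restrict_scalars (\<lambda>c. \<pi> (mconst c)) (Tor R M N j)) = n)"
proof -
  interpret presented_module R \<pi> I M \<mu> J by fact
  interpret tensored R \<pi> I N by fact
  obtain b0 a0 where ba0: "resolves I J b0 a0 (\<lambda>_. 1)" "b0 0 = 1" using ex by (elim exE conjE)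
  have "case_prod (free_resolution R M) (b0, \<lambda>n i j. \<pi> (a0 n i j))"
    unfolding prod.case by (rule free_resolution_of_resolves[OF ba0])
  then have so: "case_prod (free_resolution R M) (SOME x. case_prod (free_resolution R M) x)"
    by (rule someI[where P="case_prod (free_resolution R M)"])
  obtain b A where bA1: "(SOME x. case_prod (free_resolution R M) x) = (b, A)" by (rule prod.exhaust)
  then have bA: "(SOME (b, A). free_resolution R M b A) = (b, A)" "free_resolution R M b A"
    using so by simp_all
  from resolves_of_free_resolution[OF bA(2)] obtain a q where a: "resolves I J b a q" 
    "\<forall>n. \<forall>i<b n. \<forall>j<b (Suc n). A n i j = \<pi> (a n i j)" by (elim exE conjE)
  have "k_dim (restrict_scalars (\<lambda>c. \<pi> (mconst c)) (Tor R M N j)) = n"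
    if "qdim fsc (bnd b (\<lambda>n i j. cst (a n i j)) j) (cyc b (\<lambda>n i j. cst (a n i j)) j) n" for j n
    unfolding Tor_def bA(1) Let_def prod.case
    by (rule k_dim_tensor_homology[where a=a, OF _ refl that]) (use a(2) in simp)
  then show ?thesis using a(1) by (intro exI conjI allI impI)
qed

section \<open>Existence of resolutions\<close>

lemma nat_seq_min_tail: "\<exists>n\<ge>N. \<forall>m\<ge>n. s n \<le> s m" for s :: "nat \<Rightarrow> nat"
proof -
  obtain n where n: "n \<ge> N" "\<forall>m. m \<ge> N \<longrightarrow> s n \<le> s m"
    using ex_has_least_nat[of "\<lambda>n. n \<ge> N" N s] by auto
  then show ?thesis using le_trans by blast
qed

lemma nat_seq_incseq: "\<exists>r. strict_mono r \<and> incseq (s \<circ> r)" for s :: "nat \<Rightarrow> nat"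
proof -
  have "\<exists>f. \<forall>n. (\<forall>m\<ge>f n. s (f n) \<le> s m) \<and> f n < f (Suc n)"
  proof (rule dependent_nat_choice)
    show "\<exists>x. \<forall>m\<ge>x. s x \<le> s m" using nat_seq_min_tail[of 0 s] by blast
    fix x n show "\<exists>y. (\<forall>m\<ge>y. s y \<le> s m) \<and> x < y" using nat_seq_min_tail[of "Suc x" s] Suc_le_eq by blast
  qed
  then obtain f where "\<And>n. (\<forall>m\<ge>f n. s (f n) \<le> s m)" "\<And>n. f n < f (Suc n)" by blast
  note f = this
  have "s (f n) \<le> s (f (Suc n))" for n using f(1)[of n] f(2)[of n] less_imp_le by blast
  then show ?thesis using f(2) by (intro exI[of _ f]) (auto simp: strict_mono_Suc_iff intro!: incseq_SucI)
qed

lemma fun_seq_incseq: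
  fixes s :: "nat \<Rightarrow> 'x \<Rightarrow> nat"
  assumes "finite XX" shows "\<exists>r. strict_mono r \<and> (\<forall>x\<in>XX. incseq (\<lambda>i. s (r i) x))"
  using assms
proof (induction XX rule: finite_induct)
  case empty then show ?case by (intro exI[of _ id]) (auto simp: strict_mono_def)
next
  case (insert x XX)
  then obtain r where r: "strict_mono r" "\<forall>x\<in>XX. incseq (\<lambda>i. s (r i) x)" by blast
  obtain r' where r': "strict_mono r'" "incseq ((\<lambda>i. s (r i) x) \<circ> r')" using nat_seq_incseq by blast
  have "incseq (\<lambda>i. s (r (r' i)) y)" if "y \<in> XX" for y
    using r(2) r'(1) that by (auto simp: incseq_def strict_mono_less_eq)
  then show ?case using r r' by (intro exI[of _ "r \<circ> r'"]) (auto simp: comp_def strict_mono_def)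
qed

text \<open>The elements minimal for divisibility form an antichain \<open>L0\<close>. It cannot be
  infinite: along a suitable subsequence all of the finitely many coordinates are nondecreasing at
  once, which makes two members comparable.\<close>

lemma dickson:
  fixes L :: "('n::finite \<Rightarrow>\<^sub>0 nat) set"
  shows "\<exists>L0. finite L0 \<and> L0 \<subseteq> L \<and> (\<forall>m\<in>L. \<exists>m0\<in>L0. \<exists>d. m = m0 + d)"
proof -
  let ?le = "\<lambda>m m'. \<forall>i. Poly_Mapping.lookup m i \<le> Poly_Mapping.lookup m' i" 
  define L0 where "L0 = {m \<in> L. \<forall>m'\<in>L. ?le m' m \<longrightarrow> m' = m}"
  have "finite L0"
  proof (rule ccontr)
    assume "infinite L0"
    from infinite_countable_subset[OF this] 
    obtain s :: "nat \<Rightarrow> 'n \<Rightarrow>\<^sub>0 nat" where s: "inj s" "range s \<subseteq> L0" by (elim exE conjE)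
    obtain r where r: "strict_mono r" "\<forall>x. incseq (\<lambda>i. Poly_Mapping.lookup (s (r i)) x)"
      using fun_seq_incseq[of UNIV "\<lambda>i x. Poly_Mapping.lookup (s i) x", OF finite] by (elim exE conjE) simp
    have "?le (s (r 0)) (s (r 1))" using incseqD[OF r(2)[rule_format], of 0 1] by simp
    moreover have "s (r 0) \<in> L0" "s (r 1) \<in> L0" using s(2) by auto
    ultimately have "s (r 0) = s (r 1)" unfolding L0_def by simp
    then have "r 0 = r 1" using s(1) by (auto dest: injD)
    then show False using r(1) by (metis strict_mono_eq zero_neq_one)
  qed
  moreover have "\<exists>m0\<in>L0. ?le m0 m" if "m \<in> L" for m
    using that
  proof (induction "\<Sum>i\<in>UNIV. Poly_Mapping.lookup m i" arbitrary: m rule: less_induct)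
    case less
    show ?case
    proof (cases "m \<in> L0")
      case False
      then obtain m' where m': "m' \<in> L" "?le m' m" "m' \<noteq> m" using less.prems unfolding L0_def by blast
      obtain i where i: "Poly_Mapping.lookup m' i \<noteq> Poly_Mapping.lookup m i" using m'(3) by (meson poly_mapping_eqI)
      have "(\<Sum>i\<in>UNIV. Poly_Mapping.lookup m' i) < (\<Sum>i\<in>UNIV. Poly_Mapping.lookup m i)"
        by (rule sum_strict_mono_ex1) (use m'(2) le_neq_implies_less[OF m'(2)[rule_format] i] in auto)
      from less.hyps[OF this m'(1)] show ?thesis using m'(2) le_trans by blast
    qed blast
  qed
  moreover have "\<exists>d. m = m0 + d" if "?le m0 m" for m m0 :: "'n \<Rightarrow>\<^sub>0 nat"
    using that by (intro exI[of _ "m - m0"]) (auto intro!: poly_mapping_eqI simp: lookup_add lookup_minus)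
  ultimately have "\<forall>m\<in>L. \<exists>m0\<in>L0. \<exists>d. m = m0 + d" by blast
  moreover have "L0 \<subseteq> L" unfolding L0_def by blast
  ultimately show ?thesis using \<open>finite L0\<close> by blast
qed

text \<open>A lexicographic order on exponent vectors, read off along a list of all variables. As
  the two lists have equal length, \<open>lenlex\<close> compares them lexicographically, and its
  wellfoundedness is inherited.\<close>

definition mlt :: "('n::finite \<Rightarrow>\<^sub>0 nat) \<Rightarrow> ('n \<Rightarrow>\<^sub>0 nat) \<Rightarrow> bool" where
  "mlt m m' = (let xs = (SOME xs. set xs = UNIV) in 
     (map (Poly_Mapping.lookup m) xs, map (Poly_Mapping.lookup m') xs) \<in> lenlex less_than)"

lemma wfP_mlt: "wfP (mlt :: ('n::finite \<Rightarrow>\<^sub>0 nat) \<Rightarrow> _)"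
proof -
  have "{(m, m'). mlt m m'} = inv_image (lenlex less_than) (\<lambda>m::'n \<Rightarrow>\<^sub>0 nat. map (Poly_Mapping.lookup m) (SOME xs. set xs = UNIV))"
    by (auto simp: mlt_def Let_def inv_image_def)
  then show ?thesis unfolding wfp_def by (simp add: wf_lenlex)
qed

lemma mlt_total: "m = m' \<or> mlt m m' \<or> mlt m' m" for m :: "'n::finite \<Rightarrow>\<^sub>0 nat"
proof -
  obtain xs :: "'n list" where xs: "set xs = UNIV" using finite_list[OF finite] by blast
  define ys where "ys = (SOME xs. set xs = (UNIV :: 'n set))"
  have ys: "set ys = UNIV" unfolding ys_def by (rule someI) (rule xs)
  have "total (lenlex less_than)" by (intro total_lenlex) auto
  then have "map (Poly_Mapping.lookup m) ys = map (Poly_Mapping.lookup m') ys \<or> mlt m m' \<or> mlt m' m"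
    unfolding mlt_def ys_def Let_def total_on_def by blast
  moreover have "m = m'" if "map (Poly_Mapping.lookup m) ys = map (Poly_Mapping.lookup m') ys"
    using that ys by (intro poly_mapping_eqI) (auto simp: map_eq_conv)
  ultimately show ?thesis by blast
qed

lemma mlt_add: "mlt m m' \<Longrightarrow> mlt (m + d) (m' + d)"
proof -
  have "(map (Poly_Mapping.lookup m) xs, map (Poly_Mapping.lookup m') xs) \<in> lenlex less_than \<Longrightarrow>
     (map (Poly_Mapping.lookup (m + d)) xs, map (Poly_Mapping.lookup (m' + d)) xs) \<in> lenlex less_than" for xs
    by (induction xs) (auto simp: Cons_lenlex_iff lookup_add)
  then show "mlt m m' \<Longrightarrow> ?thesis" unfolding mlt_def Let_def by blast
qed

lemma mlt_trans: "mlt m m' \<Longrightarrow> mlt m' m'' \<Longrightarrow> mlt m m''"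
  unfolding mlt_def Let_def using lenlex_transI[of less_than] unfolding trans_def by auto

lemma finite_max_mlt: assumes "finite S" "S \<noteq> {}" shows "\<exists>m\<in>S. \<forall>m'\<in>S. m' = m \<or> mlt m' m"
  using assms
proof (induction S rule: finite_ne_induct)
  case (insert x F)
  then obtain m where m: "m \<in> F" "\<forall>m'\<in>F. m' = m \<or> mlt m' m" by blast
  show ?case
  proof (cases "mlt m x")
    case True
    then have "\<forall>m'\<in>insert x F. m' = x \<or> mlt m' x" using m(2) by (auto intro: mlt_trans)
    then show ?thesis by blast
  next
    case False
    then have "x = m \<or> mlt x m" using mlt_total by blast
    then show ?thesis using m by (intro bexI[of _ m]) auto
  qed
qed simp

lemma keys_times_single: "Poly_Mapping.keys (Poly_Mapping.single d c * p) \<subseteq> (\<lambda>m. d + m) ` Poly_Mapping.keys p"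
  for p :: "('n \<Rightarrow>\<^sub>0 nat) \<Rightarrow>\<^sub>0 'k::field"
  using keys_mult[of "Poly_Mapping.single d c" p] by (cases "c = 0") auto

lemma lookup_times_single: "Poly_Mapping.lookup (Poly_Mapping.single d c * p) (d + m) = c * Poly_Mapping.lookup p m"
  for p :: "('n \<Rightarrow>\<^sub>0 nat) \<Rightarrow>\<^sub>0 'k::field"
proof -
  have "Poly_Mapping.single d c * p = Poly_Mapping.single d c * p" ..
  have "prod_fun (Poly_Mapping.lookup (Poly_Mapping.single d c)) (Poly_Mapping.lookup p) (d + m) 
     = (\<Sum>l. Poly_Mapping.lookup (Poly_Mapping.single d c) l * (\<Sum>q. Poly_Mapping.lookup p q when d + m = l + q))"
    unfolding prod_fun_def ..
  also have "\<dots> = (\<Sum>l. (c * Poly_Mapping.lookup p m) when l = d)"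
    by (rule Sum_any.cong) (auto simp: lookup_single when_def)
  also have "\<dots> = c * Poly_Mapping.lookup p m" by simp
  finally show ?thesis by (simp add: times_poly_mapping.rep_eq)
qed

text \<open>Division by leading terms: members of \<open>U\<close> with the finitely many minimal
  leading exponents generate. The induction runs over an upper bound \<open>m\<close> for the
  exponents of \<open>f\<close>; whether or not \<open>m\<close> occurs in \<open>f\<close>, the
  step leads to an element all of whose exponents are below \<open>m\<close>.\<close>

lemma mpoly_ideal_fg:
  fixes U :: "('n::finite, 'k::field) mpoly set"
  assumes U: "is_ideal U"
  shows "\<exists>G. finite G \<and> G \<subseteq> U \<and> U = idl.span G"
proof -
  define ld where "ld f m \<longleftrightarrow> Poly_Mapping.lookup f m \<noteq> 0 \<and> (\<forall>m'\<in>Poly_Mapping.keys f. m' = m \<or> mlt m' m)" for f :: "('n, 'k) mpoly" and m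
  obtain L0 where L0: "finite L0" "L0 \<subseteq> {m. \<exists>f\<in>U. ld f m}" "\<forall>m\<in>{m. \<exists>f\<in>U. ld f m}. \<exists>m0\<in>L0. \<exists>d. m = m0 + d"
    using dickson[of "{m. \<exists>f\<in>U. ld f m}"] by blast
  have "\<forall>m\<in>L0. \<exists>f. f \<in> U \<and> ld f m" using L0(2) by blast
  then obtain g where g: "\<And>m. m \<in> L0 \<Longrightarrow> g m \<in> U" "\<And>m. m \<in> L0 \<Longrightarrow> ld (g m) m" by metis
  have "f \<in> idl.span (g ` L0)" if "f \<in> U" "\<forall>m'\<in>Poly_Mapping.keys f. m' = m \<or> mlt m' m" for f m
    using wfP_mlt that
  proof (induction m arbitrary: f rule: wfp_induct_rule)
    case (less m)
    have red: "h \<in> idl.span (g ` L0)" if h: "h \<in> U" "\<forall>m'\<in>Poly_Mapping.keys h. mlt m' m" for h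
    proof (cases "h = 0")
      case True then show ?thesis using idl.span_zero by simp
    next
      case False
      then obtain m' where "m' \<in> Poly_Mapping.keys h" "\<forall>m''\<in>Poly_Mapping.keys h. m'' = m' \<or> mlt m'' m'" 
        using finite_max_mlt[of "Poly_Mapping.keys h"] by auto
      then show ?thesis using less.IH[of m' h] h by blast
    qed
    show ?case
    proof (cases "m \<in> Poly_Mapping.keys f")
      case False
      then have "\<forall>m'\<in>Poly_Mapping.keys f. mlt m' m" using less.prems(2) by auto
      then show ?thesis using red[OF less.prems(1)] by blast
    next
      case True
      then have "ld f m" using less.prems(2) by (simp add: ld_def in_keys_iff)
      then obtain m0 d where m0: "m0 \<in> L0" "m = m0 + d" using L0(3) less.prems(1) by blast
      let ?c = "Poly_Mapping.lookup f m / Poly_Mapping.lookup (g m0) m0"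
      \<comment> \<open>The multiple of \<open>g m0\<close> with leading exponent \<open>m\<close>
        cancels the term of \<open>f\<close> at \<open>m\<close>; by \<open>mlt_add\<close> all its
        other exponents lie below \<open>m\<close>.\<close>
      let ?h = "f - Poly_Mapping.single d ?c * g m0"
      have ldg: "ld (g m0) m0" using g(2) m0(1) by blast
      have hU: "?h \<in> U" using g(1)[OF m0(1)] less.prems(1) idl.subspace_diff[OF U] idl.subspace_scale[OF U] by blast
      have hm: "Poly_Mapping.lookup ?h m = 0"
        using ldg lookup_times_single[of d ?c "g m0" m0] by (simp add: lookup_minus m0(2) ld_def add.commute)
      have "mlt m' m" if "m' \<in> Poly_Mapping.keys ?h" for m'
      proof -
        have ne: "m' \<noteq> m" using that hm by (auto simp: in_keys_iff)
        have "m' \<in> Poly_Mapping.keys f \<or> m' \<in> Poly_Mapping.keys (Poly_Mapping.single d ?c * g m0)"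
          using that by (auto simp: in_keys_iff lookup_minus)
        then show ?thesis
        proof
          assume "m' \<in> Poly_Mapping.keys f" then show ?thesis using ne less.prems(2) by blast
        next
          assume "m' \<in> Poly_Mapping.keys (Poly_Mapping.single d ?c * g m0)"
          then obtain m1 where m1: "m1 \<in> Poly_Mapping.keys (g m0)" "m' = d + m1" using keys_times_single by blast
          then have "m1 = m0 \<or> mlt m1 m0" using ldg by (auto simp: ld_def)
          then show ?thesis using ne m1 m0(2) mlt_add[of m1 m0 d] by (auto simp: add.commute)
        qed
      qed
      then have "?h \<in> idl.span (g ` L0)" using red hU by blast
      moreover have "Poly_Mapping.single d ?c * g m0 \<in> idl.span (g ` L0)"
        using m0(1) by (intro idl.span_scale idl.span_base) auto
      ultimately show ?thesis using idl.span_add by fastforce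
    qed
  qed
  then have "f \<in> idl.span (g ` L0)" if "f \<in> U" for f
    using that finite_max_mlt[of "Poly_Mapping.keys f"] idl.span_zero[of "g ` L0"] by (cases "f = 0") auto
  moreover have "idl.span (g ` L0) \<subseteq> U" using g(1) U by (intro idl.span_minimal) auto
  ultimately show ?thesis using g(1) L0(1) by (intro exI[of _ "g ` L0"]) auto
qed

lemma mpoly_ideal_fg_seq:
  fixes U :: "('n::finite, 'k::field) mpoly set"
  assumes U: "is_ideal U"
  shows "\<exists>q h. (\<forall>j<q. h j \<in> U) \<and> (\<forall>x\<in>U. \<exists>w. x = (\<Sum>j<q::nat. w j * h j))"
proof -
  obtain G where G: "finite G" "G \<subseteq> U" "U = idl.span G" using mpoly_ideal_fg[OF U] by blast
  obtain h where h: "bij_betw h {..<card G} G" using ex_bij_betw_nat_finite[OF G(1)] by (auto simp: atLeast0LessThan)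
  have "\<exists>w. x = (\<Sum>j<card G. w j * h j)" if x: "x \<in> U" for x
  proof -
    obtain u where "x = (\<Sum>v\<in>G. u v * v)" using G idl.span_finite[OF G(1)] x by auto
    also have "\<dots> = (\<Sum>j<card G. u (h j) * h j)" by (rule sum.reindex_bij_betw[OF h, symmetric])
    finally show ?thesis by (intro exI[of _ "\<lambda>j. u (h j)"])
  qed
  moreover have "\<forall>j<card G. h j \<in> U" using h G(2) by (auto dest: bij_betwE)
  ultimately show ?thesis by blast
qed

text \<open>Induction on the rank: the last coordinates of the members form an ideal whose
  generators are lifted to \<open>U\<close>. Subtracting a combination of the lifts makes the last
  coordinate zero, which leaves a submodule of smaller rank.\<close>

lemma mpoly_submodule_fg:
  fixes U :: "(nat \<Rightarrow> ('n::finite, 'k::field) mpoly) set"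
  assumes "0 \<in> U" "\<And>u v. u \<in> U \<Longrightarrow> v \<in> U \<Longrightarrow> u + v \<in> U" "\<And>c u. u \<in> U \<Longrightarrow> (\<lambda>i. c * u i) \<in> U" "U \<subseteq> coords N"
  shows "\<exists>q M. (\<forall>w\<in>coords q. mv M N q w \<in> U) \<and> (\<forall>u\<in>U. \<exists>w\<in>coords q. u = mv M N q w)"
proof -
  have "\<exists>q G. (\<forall>j<q. G j \<in> U) \<and> (\<forall>u\<in>U. \<exists>w. u = (\<lambda>i. \<Sum>j<q::nat. w j * G j i))"
    using assms
  proof (induction N arbitrary: U)
    case 0
    then have "u = 0" if "u \<in> U" for u using that by (auto simp: coords_def fun_eq_iff)
    then show ?case by (intro exI[of _ 0]) (auto simp: fun_eq_iff)
  next
    case (Suc N)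
    let ?A = "(\<lambda>u. u N) ` U"
    have "is_ideal ?A" unfolding idl.subspace_def
    proof (intro conjI ballI allI)
      show "0 \<in> ?A" using Suc.prems(1) by (force intro: image_eqI[of _ _ 0])
      fix x y assume "x \<in> ?A" "y \<in> ?A"
      then obtain u v where "u \<in> U" "v \<in> U" "x = u N" "y = v N" by blast
      then show "x + y \<in> ?A" by (intro image_eqI[of _ _ "u + v"] Suc.prems(2)) simp_all
    next
      fix c x assume "x \<in> ?A"
      then obtain u where "u \<in> U" "x = u N" by blast
      then show "c * x \<in> ?A" by (intro image_eqI[of _ _ "\<lambda>i. c * u i"] Suc.prems(3)) simp_all
    qed
    then obtain q1 h where h: "\<forall>j<q1. h j \<in> ?A" "\<forall>x\<in>?A. \<exists>w. x = (\<Sum>j<q1::nat. w j * h j)"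
      using mpoly_ideal_fg_seq by blast
    have "\<forall>j. \<exists>u. j < q1 \<longrightarrow> u \<in> U \<and> h j = u N" using h(1) by blast
    then obtain G1 where G1: "\<And>j. j < q1 \<Longrightarrow> G1 j \<in> U" "\<And>j. j < q1 \<Longrightarrow> h j = G1 j N" by metis
    have "\<exists>q G. (\<forall>j<q. G j \<in> U \<inter> coords N) \<and> (\<forall>u\<in>U \<inter> coords N. \<exists>w. u = (\<lambda>i. \<Sum>j<q::nat. w j * G j i))"
      using Suc.prems by (intro Suc.IH) (auto simp: coords_def)
    then obtain q2 G2 where G2: "\<forall>j<q2. G2 j \<in> U \<inter> coords N" "\<forall>u\<in>U \<inter> coords N. \<exists>w. u = (\<lambda>i. \<Sum>j<q2::nat. w j * G2 j i)"
      by blast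
    define G where "G j = (if j < q1 then G1 j else G2 (j - q1))" for j
    have lin: "(\<lambda>i. \<Sum>j<q1. w j * G1 j i) \<in> U" for w
    proof -
      have "(\<lambda>i. \<Sum>j<m. w j * G1 j i) \<in> U" if "m \<le> q1" for m
        using that
      proof (induction m)
        case 0 then show ?case using Suc.prems(1) by (simp add: zero_fun_def)
      next
        case (Suc m)
        then show ?case using Suc.prems G1(1)[of m] 
            \<open>\<And>u v. u \<in> U \<Longrightarrow> v \<in> U \<Longrightarrow> u + v \<in> U\<close>[of "\<lambda>i. \<Sum>j<m. w j * G1 j i" "\<lambda>i. w m * G1 m i"]
            \<open>\<And>c u. u \<in> U \<Longrightarrow> (\<lambda>i. c * u i) \<in> U\<close>[of "G1 m" "w m"] by (simp add: plus_fun_def)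
      qed
      then show ?thesis by blast
    qed
    have "\<exists>w. u = (\<lambda>i. \<Sum>j<q1 + q2. w j * G j i)" if u: "u \<in> U" for u
    proof -
      obtain w1 where w1: "u N = (\<Sum>j<q1. w1 j * h j)" using h(2) u by blast
      let ?u1 = "\<lambda>i. \<Sum>j<q1. w1 j * G1 j i"
      have "u + (\<lambda>i. (-1) * ?u1 i) \<in> U" using Suc.prems(2,3) u lin by blast
      moreover have "u + (\<lambda>i. (-1) * ?u1 i) \<in> coords N"
      proof -
        have "u \<in> coords (Suc N)" "?u1 \<in> coords (Suc N)" using u lin Suc.prems(4) by blast+
        moreover have "u N = ?u1 N" using w1 G1(2) by simp
        ultimately show ?thesis unfolding coords_def by (auto simp: Suc_le_eq) (metis le_neq_implies_less diff_self)
      qed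
      ultimately obtain w2 where w2: "u + (\<lambda>i. (-1) * ?u1 i) = (\<lambda>i. \<Sum>j<q2. w2 j * G2 j i)" using G2(2) by blast
      have "u i = (\<Sum>j<q1 + q2. (if j < q1 then w1 j else w2 (j - q1)) * G j i)" for i
      proof -
        have "(\<Sum>j<q1 + q2. (if j < q1 then w1 j else w2 (j - q1)) * G j i) = 
            (\<Sum>j<q1. (if j < q1 then w1 j else w2 (j - q1)) * G j i) + (\<Sum>j<q2. (if q1 + j < q1 then w1 (q1 + j) else w2 (q1 + j - q1)) * G (q1 + j) i)"
          by (induction q2) (auto simp: add.assoc)
        also have "\<dots> = ?u1 i + (\<Sum>j<q2. w2 j * G2 j i)" by (simp add: G_def)
        finally show ?thesis using fun_cong[OF w2, of i] by (simp add: diff_eq_eq add.commute)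
      qed
      then show ?thesis by (intro exI[of _ "\<lambda>j. if j < q1 then w1 j else w2 (j - q1)"] ext)
    qed
    moreover have "\<forall>j<q1 + q2. G j \<in> U" using G1 G2 by (auto simp: G_def)
    ultimately show ?case by blast
  qed
  then obtain q G where G: "\<forall>j<q. G j \<in> U" "\<forall>u\<in>U. \<exists>w. u = (\<lambda>i. \<Sum>j<q::nat. w j * G j i)" by blast
  have GN: "G j i = 0" if "j < q" "\<not> i < N" for i j using G(1) that assms(4) by (auto simp: coords_def subset_iff)
  have eq: "mv (\<lambda>i j. G j i) N q w = (\<lambda>i. \<Sum>j<q. w j * G j i)" for w
    by (auto simp: mv_def fun_eq_iff mult.commute GN)
  have lin: "(\<lambda>i. \<Sum>j<m. w j * G j i) \<in> U" if "m \<le> q" for w m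
    using that
  proof (induction m)
    case 0 then show ?case using assms(1) by (simp add: zero_fun_def)
  next
    case (Suc m)
    then show ?case using assms(2)[of "\<lambda>i. \<Sum>j<m. w j * G j i" "\<lambda>i. w m * G m i"] assms(3)[of "G m" "w m"] G(1) 
      by (simp add: plus_fun_def)
  qed
  show ?thesis
  proof (intro exI[of _ q] exI[of _ "\<lambda>i j. G j i"] conjI ballI)
    fix u assume "u \<in> U"
    then obtain w where w: "u = (\<lambda>i. \<Sum>j<q. w j * G j i)" using G(2) by blast
    then have "u = mv (\<lambda>i j. G j i) N q (\<lambda>j. if j < q then w j else 0)" unfolding eq by simp
    then show "\<exists>w\<in>coords q. u = mv (\<lambda>i j. G j i) N q w" 
      by (intro bexI[of _ "\<lambda>j. if j < q then w j else 0"]) (auto simp: coords_def)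
  qed (use lin in \<open>simp add: eq\<close>)
qed

text \<open>By \<open>IU\<close>, generating \<open>U\<close> by columns and generating it modulo
  \<open>I\<close> amount to the same thing, so one step of a resolution over the quotient ring is a
  matrix of polynomials.\<close>

lemma mpoly_presentation_step:
  fixes U :: "(nat \<Rightarrow> ('n::finite, 'k::field) mpoly) set"
  assumes I: "is_ideal I" and U: "\<And>u v. u \<in> U \<Longrightarrow> v \<in> U \<Longrightarrow> u + v \<in> U" "\<And>c u. u \<in> U \<Longrightarrow> (\<lambda>i. c * u i) \<in> U" "U \<subseteq> coords N"
    and IU: "\<And>v. v \<in> coords N \<Longrightarrow> \<forall>i. v i \<in> I \<Longrightarrow> v \<in> U"
  shows "\<exists>q M. \<forall>v\<in>coords N. v \<in> U \<longleftrightarrow> (\<exists>w\<in>coords q. \<forall>i. v i - mv M N q w i \<in> I)"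
proof -
  have U0: "0 \<in> U" using idl.subspace_0[OF I] by (intro IU) (auto simp: coords_def)
  obtain q M where M: "\<forall>w\<in>coords q. mv M N q w \<in> U" "\<forall>u\<in>U. \<exists>w\<in>coords q. u = mv M N q w"
    using mpoly_submodule_fg[OF U0 U] by blast
  have "v \<in> U \<longleftrightarrow> (\<exists>w\<in>coords q. \<forall>i. v i - mv M N q w i \<in> I)" if v: "v \<in> coords N" for v
  proof
    assume "v \<in> U"
    then obtain w where "w \<in> coords q" "v = mv M N q w" using M by blast
    then show "\<exists>w\<in>coords q. \<forall>i. v i - mv M N q w i \<in> I" using idl.subspace_0[OF I] by (intro bexI[of _ w]) auto
  next
    assume "\<exists>w\<in>coords q. \<forall>i. v i - mv M N q w i \<in> I"
    then obtain w where w: "w \<in> coords q" "\<forall>i. v i - mv M N q w i \<in> I" by blast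
    have "v - mv M N q w \<in> U" using w v by (intro IU) (auto simp: coords_def mv_def)
    then have "(v - mv M N q w) + mv M N q w \<in> U" using M(1) w(1) U(1) by blast
    then show "v \<in> U" by simp
  qed
  then show ?thesis by blast
qed

lemma resolves_exists:
  fixes I J :: "('n::finite, 'k::field) mpoly set"
  assumes I: "is_ideal I" and J: "is_ideal J" and IJ: "I \<subseteq> J"
  shows "\<exists>b a. resolves I J b a (\<lambda>_. 1) \<and> b 0 = 1"
proof -
  \<comment> \<open>The state of the construction is a matrix with its numbers of rows and columns.
    \<open>?Q\<close> makes the columns of each matrix the rows of the next one and demands
    exactness between the two.\<close>
  let ?P = "\<lambda>(n::nat) (p::nat, q::nat, M). n = 0 \<longrightarrow> p = 1 \<and> (\<forall>v\<in>coords 1. v 0 \<in> J \<longleftrightarrow> (\<exists>w\<in>coords q. \<forall>i. v i - mv M p q w i \<in> I))"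
  let ?Q = "\<lambda>(n::nat) (p::nat, q::nat, M) (p'::nat, q'::nat, M'). p' = q \<and> 
     (\<forall>v\<in>coords q. (\<forall>i. mv M p q v i \<in> I) \<longleftrightarrow> (\<exists>w\<in>coords q'. \<forall>i. v i - mv M' q q' w i \<in> I))"
  have "\<exists>f. \<forall>n. ?P n (f n) \<and> ?Q n (f n) (f (Suc n))"
  proof (rule dependent_nat_choice)
    have "\<exists>q M. \<forall>v\<in>coords 1. v \<in> {v\<in>coords 1. v 0 \<in> J} \<longleftrightarrow> (\<exists>w\<in>coords q. \<forall>i. v i - mv M 1 q w i \<in> I)"
      by (rule mpoly_presentation_step[OF I]) 
         (use IJ in \<open>auto simp: coords_def idl.subspace_add[OF J] idl.subspace_scale[OF J]\<close>)
    then show "\<exists>x. ?P 0 x" by auto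
  next
    fix x n assume "?P n x"
    obtain p q M where x: "x = (p, q, M)" by (cases x) auto
    have "\<exists>q' M'. \<forall>v\<in>coords q. v \<in> {v\<in>coords q. \<forall>i. mv M p q v i \<in> I} \<longleftrightarrow> (\<exists>w\<in>coords q'. \<forall>i. v i - mv M' q q' w i \<in> I)"
    proof (rule mpoly_presentation_step[OF I])
      fix v assume v: "v \<in> coords q" "\<forall>i. v i \<in> I"
      have "mv M p q v i \<in> I" for i unfolding mv_def
        using v(2) idl.subspace_0[OF I] by (auto intro!: idl.subspace_sum[OF I] idl.subspace_scale[OF I])
      then show "v \<in> {v\<in>coords q. \<forall>i. mv M p q v i \<in> I}" using v by simp
    qed (auto simp: coords_closed mv_add mv_scale idl.subspace_add[OF I] idl.subspace_scale[OF I])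
    then show "\<exists>y. ?P (Suc n) y \<and> ?Q n x y" unfolding x by auto
  qed
  then obtain f where f0: "\<forall>n. ?P n (f n) \<and> ?Q n (f n) (f (Suc n))" by (elim exE)
  have f: "?P n (f n)" "?Q n (f n) (f (Suc n))" for n
    using spec[OF f0, of n] by (rule conjunct1, rule conjunct2)
  define b where "b n = fst (f n)" for n
  define a where "a n = snd (snd (f n))" for n
  have fn: "f n = (b n, b (Suc n), a n)" for n
    using f(2)[of n] unfolding a_def b_def by (auto split: prod.splits)
  have "b 0 = 1" using f(1)[of 0] unfolding fn by simp
  moreover have "(\<exists>t\<in>coords 1. t 0 - 1 \<in> J)" using idl.subspace_0[OF J] 
    by (intro bexI[of _ "\<lambda>i. if i = 0 then 1 else 0"]) (auto simp: coords_def)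
  ultimately have "resolves I J b a (\<lambda>_. 1)" unfolding resolves_def using f(1)[of 0] f(2) unfolding fn by auto
  then show ?thesis using \<open>b 0 = 1\<close> by blast
qed

section \<open>Balancing Tor\<close>

text \<open>All identities hold modulo \<open>N\<close>, so that complexes over a quotient ring are represented by liftings.
  Exactness in the first direction is only available below degree \<open>m\<close>.\<close>

locale double_complex = vector_space sc
  for sc :: "'k::field \<Rightarrow> 'v::ab_group_add \<Rightarrow> 'v" +
  fixes C :: "nat \<Rightarrow> nat \<Rightarrow> 'v set" and N :: "'v set" and D :: "'v \<Rightarrow> 'v" and E :: "nat \<Rightarrow> 'v \<Rightarrow> 'v" and m :: nat
  assumes C_sub: "subspace (C i j)" and N_sub: "subspace N"
    and D_add: "D (x + y) = D x + D y" and D_scale: "D (sc c x) = sc c (D x)"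
    and E_add: "E j (x + y) = E j x + E j y" and E_scale: "E j (sc c x) = sc c (E j x)"
    and D_C: "x \<in> C (Suc i) j \<Longrightarrow> D x \<in> C i j" and E_C: "x \<in> C i (Suc j) \<Longrightarrow> E j x \<in> C i j"
    and D_N: "x \<in> N \<Longrightarrow> D x \<in> N" and E_N: "x \<in> N \<Longrightarrow> E j x \<in> N"
    and DE: "D (E j x) = E j (D x)"
    and DD: "Suc i < m \<Longrightarrow> x \<in> C (Suc (Suc i)) j \<Longrightarrow> D (D x) \<in> N"
    and EE: "x \<in> C i (Suc (Suc j)) \<Longrightarrow> E j (E (Suc j) x) \<in> N"
    and D_exact: "Suc i < m \<Longrightarrow> x \<in> C (Suc i) j \<Longrightarrow> D x \<in> N \<Longrightarrow> \<exists>y\<in>C (Suc (Suc i)) j. x - D y \<in> N"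
    and E_exact: "x \<in> C i (Suc j) \<Longrightarrow> E j x \<in> N \<Longrightarrow> \<exists>y\<in>C i (Suc (Suc j)). x - E (Suc j) y \<in> N"
begin

lemma D_diff: "D (x - y) = D x - D y"
  using D_add[of "x - y" y] by (simp add: algebra_simps)

lemma E_diff: "E j (x - y) = E j x - E j y"
  using E_add[of j "x - y" y] by (simp add: algebra_simps)

lemma D_0: "D 0 = 0" using D_add[of 0 0] by simp
lemma E_0: "E j 0 = 0" using E_add[of j 0 0] by simp

lemmas N_add = subspace_add[OF N_sub]
  and N_diff = subspace_diff[OF N_sub]
  and N_0 = subspace_0[OF N_sub]
  and N_scale = subspace_scale[OF N_sub]
lemmas C_add = subspace_add[OF C_sub]
  and C_diff = subspace_diff[OF C_sub]
  and C_0 = subspace_0[OF C_sub]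
  and C_scale = subspace_scale[OF C_sub]

lemma N_cong: "x - y \<in> N \<Longrightarrow> x \<in> N \<longleftrightarrow> y \<in> N"
  using N_add[of "x - y" y] N_diff[of x "x - y"] by auto

text \<open>The steps of the zigzag: the quotients \<open>V i j / U i j\<close> with \<open>i + j + 1 = m\<close> are all isomorphic to each other
  (through \<open>VE / UE\<close>), and to the homology of the two edges, \<open>V0 / U0\<close> and \<open>VF / UF\<close>.\<close>

definition V where "V i j = {z \<in> C i j. (\<exists>y\<in>C (Suc i) j. z - D y \<in> N) \<and> (\<exists>y\<in>C i (Suc j). z - E j y \<in> N)}"
definition U where "U i j = {z \<in> C i j. \<exists>y\<in>C (Suc i) (Suc j). z - D (E j y) \<in> N}"
definition VE where "VE i j = {z \<in> C (Suc i) (Suc j). D (E j z) \<in> N}"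
definition UE where "UE i j = {z \<in> C (Suc i) (Suc j). \<exists>y\<in>C (Suc i) (Suc j). D y \<in> N \<and> E j (z - y) \<in> N}"
definition V0 where "V0 j = {z \<in> C 0 (Suc j). \<exists>y\<in>C 1 j. E j z - D y \<in> N}"
definition U0 where "U0 j = {z \<in> C 0 (Suc j). \<exists>y\<in>C 0 (Suc (Suc j)). \<exists>w\<in>C 1 (Suc j). z - (E (Suc j) y + D w) \<in> N}"
definition VF where "VF i = {z \<in> C (Suc i) 0. \<exists>y\<in>C i 1. D z - E 0 y \<in> N}"
definition UF where "UF i = {z \<in> C (Suc i) 0. \<exists>y\<in>C (Suc i) 1. D (z - E 0 y) \<in> N}"

text \<open>The sets of the zigzag are mostly projections of spaces of pairs \<open>(z, y)\<close>
  that a linear map sends into \<open>N\<close>; this covers them in one go.\<close>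

lemma linear_subspace:
  assumes C: "subspace S" "subspace T" 
    and L: "\<And>x y u v. L (x + y) (u + v) = L x u + L y v" "\<And>c x u. L (sc c x) (sc c u) = sc c (L x u)"
  shows "subspace {z \<in> S. \<exists>y\<in>T. L z y \<in> N}"
proof -
  have L0: "L 0 0 = 0" using L(1)[of 0 0 0 0] by simp
  show ?thesis unfolding subspace_def
  proof (intro conjI ballI allI; (elim CollectE conjE bexE)?)
    show "0 \<in> {z \<in> S. \<exists>y\<in>T. L z y \<in> N}" using subspace_0[OF C(1)] subspace_0[OF C(2)] L0 N_0 by (auto intro!: bexI[of _ 0])
  next
    fix x y u v assume "x \<in> S" "y \<in> S" "u \<in> T" "v \<in> T" "L x u \<in> N" "L y v \<in> N"
    then show "x + y \<in> {z \<in> S. \<exists>y\<in>T. L z y \<in> N}"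
      using C by (auto simp: L intro!: subspace_add N_add bexI[of _ "u + v"])
  next
    fix c x u assume "x \<in> S" "u \<in> T" "L x u \<in> N"
    then show "sc c x \<in> {z \<in> S. \<exists>y\<in>T. L z y \<in> N}"
      using C by (auto simp: L intro!: subspace_scale N_scale bexI[of _ "sc c u"])
  qed
qed

lemma subspaces:
  "subspace (V i j)" "subspace (U i j)" "subspace (VE i j)" "subspace (UE i j)"
  "subspace (V0 j)" "subspace (U0 j)" "subspace (VF i)" "subspace (UF i)"
proof -
  note [simp] = D_add E_add D_scale E_scale D_diff E_diff D_0 E_0
    and [intro!] = C_add C_scale C_0 N_0
  have "V i j = {z \<in> C i j. \<exists>y\<in>C (Suc i) j. z - D y \<in> N} \<inter> {z \<in> C i j. \<exists>y\<in>C i (Suc j). z - E j y \<in> N}"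
    unfolding V_def by blast
  moreover have "subspace {z \<in> C i j. \<exists>y\<in>C (Suc i) j. z - D y \<in> N}" "subspace {z \<in> C i j. \<exists>y\<in>C i (Suc j). z - E j y \<in> N}"
    by (rule linear_subspace[OF C_sub C_sub]; simp add: algebra_simps)+
  ultimately show "subspace (V i j)" using subspace_inter by simp
  show "subspace (U i j)" unfolding U_def
    by (rule linear_subspace[OF C_sub C_sub]; simp add: algebra_simps)
  have "VE i j = {z \<in> C (Suc i) (Suc j). \<exists>y\<in>C (Suc i) (Suc j). D (E j z) \<in> N}" unfolding VE_def by auto
  also have "subspace \<dots>" by (rule linear_subspace[OF C_sub C_sub]; simp add: algebra_simps)
  finally show "subspace (VE i j)" .
  have "subspace {y \<in> C (Suc i) (Suc j). \<exists>u\<in>C (Suc i) (Suc j). D y \<in> N}"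
    by (rule linear_subspace[OF C_sub C_sub]; simp add: algebra_simps)
  then have "subspace {z \<in> C (Suc i) (Suc j). \<exists>y\<in>{y \<in> C (Suc i) (Suc j). \<exists>u\<in>C (Suc i) (Suc j). D y \<in> N}. E j (z - y) \<in> N}"
    by (rule linear_subspace[OF C_sub]; simp add: algebra_simps)
  also have "{z \<in> C (Suc i) (Suc j). \<exists>y\<in>{y \<in> C (Suc i) (Suc j). \<exists>u\<in>C (Suc i) (Suc j). D y \<in> N}. E j (z - y) \<in> N} = UE i j"
    unfolding UE_def by blast
  finally show "subspace (UE i j)" .
  show "subspace (V0 j)" unfolding V0_def
    by (rule linear_subspace[OF C_sub C_sub]; simp add: algebra_simps)
  show "subspace (VF i)" unfolding VF_def
    by (rule linear_subspace[OF C_sub C_sub]; simp add: algebra_simps)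
  show "subspace (UF i)" unfolding UF_def
    by (rule linear_subspace[OF C_sub C_sub]; simp add: algebra_simps)
  show "subspace (U0 j)" unfolding subspace_def U0_def
  proof (intro conjI ballI allI; (elim CollectE conjE bexE)?)
    show "0 \<in> {z \<in> C 0 (Suc j). \<exists>y\<in>C 0 (Suc (Suc j)). \<exists>w\<in>C 1 (Suc j). z - (E (Suc j) y + D w) \<in> N}"
      by (auto intro!: bexI[of _ 0])
  next
    fix x y u u' v v' assume a: "x \<in> C 0 (Suc j)" "y \<in> C 0 (Suc j)" "u \<in> C 0 (Suc (Suc j))" "v \<in> C 0 (Suc (Suc j))" "u' \<in> C 1 (Suc j)" "v' \<in> C 1 (Suc j)"
       "x - (E (Suc j) u + D u') \<in> N" "y - (E (Suc j) v + D v') \<in> N"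
    have eq: "x + y - (E (Suc j) (u + v) + D (u' + v')) = (x - (E (Suc j) u + D u')) + (y - (E (Suc j) v + D v'))"
      by (simp add: algebra_simps)
    have "x + y - (E (Suc j) (u + v) + D (u' + v')) \<in> N" unfolding eq by (rule N_add[OF a(7,8)])
    then show "x + y \<in> {z \<in> C 0 (Suc j). \<exists>y\<in>C 0 (Suc (Suc j)). \<exists>w\<in>C 1 (Suc j). z - (E (Suc j) y + D w) \<in> N}"
      using a C_add by blast
  next
    fix c x u u' assume a: "x \<in> C 0 (Suc j)" "u \<in> C 0 (Suc (Suc j))" "u' \<in> C 1 (Suc j)" "x - (E (Suc j) u + D u') \<in> N"
    have "sc c x - (E (Suc j) (sc c u) + D (sc c u')) = sc c (x - (E (Suc j) u + D u'))" 
      by (simp add: scale_right_diff_distrib scale_right_distrib)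
    then have "sc c x - (E (Suc j) (sc c u) + D (sc c u')) \<in> N" using a N_scale by simp
    then show "sc c x \<in> {z \<in> C 0 (Suc j). \<exists>y\<in>C 0 (Suc (Suc j)). \<exists>w\<in>C 1 (Suc j). z - (E (Suc j) y + D w) \<in> N}"
      using a C_scale by blast
  qed
qed

lemma U_V: "i + j + 1 = m \<Longrightarrow> U i j \<subseteq> V i j"
proof
  fix z assume "z \<in> U i j"
  then obtain y where y: "y \<in> C (Suc i) (Suc j)" "z - D (E j y) \<in> N" and z: "z \<in> C i j" by (auto simp: U_def)
  then have "z - E j (D y) \<in> N" by (simp add: DE)
  then show "z \<in> V i j" unfolding V_def using y(2) z D_C[OF y(1)] E_C[OF y(1)] by blast
qed

lemma vs: "vector_space sc" by unfold_locales

text \<open>\<open>VE / UE\<close> is the kernel of the composite of \<open>D\<close> and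
  \<open>E\<close> modulo the sum of the two kernels. \<open>D\<close> maps it onto the elements
  that are boundaries in both directions, modulo the double boundaries; exactness for
  \<open>E\<close> turns the vanishing of \<open>E j (D z)\<close> into a boundary.\<close>

lemma qdim_E_D:
  assumes ij: "i + Suc j + 1 = m"
  shows "qdim sc (UE i j) (VE i j) n \<longleftrightarrow> qdim sc (U i (Suc j)) (V i (Suc j)) n"
proof (rule qdim_iso[OF vs vs, where f=D])
  show "U i (Suc j) \<subseteq> V i (Suc j)" using U_V ij by simp
  fix z assume z: "z \<in> VE i j"
  then have zC: "z \<in> C (Suc i) (Suc j)" and zN: "E j (D z) \<in> N" by (auto simp: VE_def DE)
  from E_exact[OF D_C[OF zC] zN] show "D z \<in> V i (Suc j)" using zC D_C[OF zC] N_0 by (auto simp: V_def intro!: bexI[of _ z])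
  show "D z \<in> U i (Suc j) \<longleftrightarrow> z \<in> UE i j"
  proof
    assume "D z \<in> U i (Suc j)"
    then obtain y where y: "y \<in> C (Suc i) (Suc (Suc j))" "D z - D (E (Suc j) y) \<in> N" by (auto simp: U_def)
    then show "z \<in> UE i j" unfolding UE_def using zC E_C[OF y(1)] EE[OF y(1)]
      by (auto intro!: bexI[of _ "z - E (Suc j) y"] C_diff simp: D_diff)
  next
    assume "z \<in> UE i j"
    then obtain y where y: "y \<in> C (Suc i) (Suc j)" "D y \<in> N" "E j (z - y) \<in> N" by (auto simp: UE_def)
    obtain w where w: "w \<in> C (Suc i) (Suc (Suc j))" "(z - y) - E (Suc j) w \<in> N" 
      using E_exact[OF C_diff[OF zC y(1)] y(3)] by blast
    have "D z - D (E (Suc j) w) = D ((z - y) - E (Suc j) w) + D y" by (simp add: D_diff)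
    then have "D z - D (E (Suc j) w) \<in> N" using D_N[OF w(2)] y(2) N_add by simp
    then show "D z \<in> U i (Suc j)" unfolding U_def using w(1) D_C[OF zC] by blast
  qed
next
  fix z assume "z \<in> V i (Suc j)"
  then obtain y w where y: "y \<in> C (Suc i) (Suc j)" "z - D y \<in> N" and w: "w \<in> C i (Suc (Suc j))" "z - E (Suc j) w \<in> N"
    and z: "z \<in> C i (Suc j)"
    by (auto simp: V_def)
  have "E j z \<in> N" using E_N[OF w(2), of j] EE[OF w(1)] N_cong by (simp add: E_diff)
  then have "D (E j y) \<in> N" using E_N[OF y(2), of j] N_cong by (simp add: E_diff DE)
  then have "y \<in> VE i j" using y(1) by (simp add: VE_def)
  moreover have "z - D y \<in> U i (Suc j)" unfolding U_def using y z D_C C_diff C_0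
    by (auto intro!: bexI[of _ 0] simp: D_0 E_0)
  ultimately show "\<exists>x\<in>VE i j. z - D x \<in> U i (Suc j)" by blast
qed (use subspaces D_add D_scale in auto)

text \<open>The same correspondence with \<open>D\<close> and \<open>E\<close> exchanged. It relies
  on exactness for \<open>D\<close> in degree \<open>Suc i\<close>, which is below \<open>m\<close>
  because the zigzag stays on the antidiagonal \<open>i + Suc j + 1 = m\<close>.\<close>

lemma qdim_E_E:
  assumes ij: "i + Suc j + 1 = m"
  shows "qdim sc (UE i j) (VE i j) n \<longleftrightarrow> qdim sc (U (Suc i) j) (V (Suc i) j) n"
proof (rule qdim_iso[OF vs vs, where f="E j"])
  have im: "Suc i < m" using ij by simp
  show "U (Suc i) j \<subseteq> V (Suc i) j" using U_V ij by simp
  fix z assume z: "z \<in> VE i j"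
  then have zC: "z \<in> C (Suc i) (Suc j)" and zN: "D (E j z) \<in> N" by (auto simp: VE_def)
  from D_exact[OF im E_C[OF zC] zN] show "E j z \<in> V (Suc i) j" using zC E_C[OF zC] N_0 by (auto simp: V_def intro!: bexI[of _ z])
  show "E j z \<in> U (Suc i) j \<longleftrightarrow> z \<in> UE i j"
  proof
    assume "E j z \<in> U (Suc i) j"
    then obtain y where y: "y \<in> C (Suc (Suc i)) (Suc j)" "E j z - D (E j y) \<in> N" by (auto simp: U_def)
    then have "E j (z - D y) \<in> N" by (simp add: E_diff DE)
    then show "z \<in> UE i j" unfolding UE_def using zC D_C[OF y(1)] DD[OF im y(1)] by blast
  next
    assume "z \<in> UE i j"
    then obtain y where y: "y \<in> C (Suc i) (Suc j)" "D y \<in> N" "E j (z - y) \<in> N" by (auto simp: UE_def)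
    obtain w where w: "w \<in> C (Suc (Suc i)) (Suc j)" "y - D w \<in> N" using D_exact[OF im y(1,2)] by blast
    have "E j z - D (E j w) = E j (z - y) + E j (y - D w)" by (simp add: E_diff DE)
    then have "E j z - D (E j w) \<in> N" using E_N[OF w(2)] y(3) N_add by simp
    then show "E j z \<in> U (Suc i) j" unfolding U_def using w(1) E_C[OF zC] by blast
  qed
next
  have im: "Suc i < m" using ij by simp
  fix z assume "z \<in> V (Suc i) j"
  then obtain y w where y: "y \<in> C (Suc (Suc i)) j" "z - D y \<in> N" and w: "w \<in> C (Suc i) (Suc j)" "z - E j w \<in> N"
    and z: "z \<in> C (Suc i) j"
    by (auto simp: V_def)
  have "D z \<in> N" using D_N[OF y(2)] DD[OF im y(1)] N_cong by (simp add: D_diff)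
  then have "D (E j w) \<in> N" using D_N[OF w(2)] N_cong by (simp add: D_diff)
  then have "w \<in> VE i j" using w(1) by (simp add: VE_def)
  moreover have "z - E j w \<in> U (Suc i) j" unfolding U_def using w z E_C C_diff C_0
    by (auto intro!: bexI[of _ 0] simp: D_0 E_0)
  ultimately show "\<exists>x\<in>VE i j. z - E j x \<in> U (Suc i) j" by blast
qed (use subspaces E_add E_scale in auto)

lemma qdim_zigzag: "i + j + 1 = m \<Longrightarrow> qdim sc (U 0 (i + j)) (V 0 (i + j)) n \<longleftrightarrow> qdim sc (U i j) (V i j) n"
proof (induction i arbitrary: j)
  case (Suc i)
  then have "qdim sc (U 0 (i + Suc j)) (V 0 (i + Suc j)) n \<longleftrightarrow> qdim sc (U i (Suc j)) (V i (Suc j)) n" by (intro Suc.IH) simp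
  also have "\<dots> \<longleftrightarrow> qdim sc (U (Suc i) j) (V (Suc i) j) n" using qdim_E_D qdim_E_E Suc.prems by (metis add_Suc add_Suc_right)
  finally show ?case by simp
qed simp

text \<open>On the edge \<open>i = 0\<close> the cokernel of \<open>D\<close> takes over:
  \<open>V0 / U0\<close> is the homology in degree \<open>Suc j\<close> of the complex that
  \<open>E\<close> induces on this cokernel.\<close>

lemma qdim_start:
  assumes j: "j + 1 = m"
  shows "qdim sc (U0 j) (V0 j) n \<longleftrightarrow> qdim sc (U 0 j) (V 0 j) n"
proof (rule qdim_iso[OF vs vs, where f="E j"])
  show "U 0 j \<subseteq> V 0 j" using U_V j by simp
  fix z assume z: "z \<in> V0 j"
  then obtain y where zC: "z \<in> C 0 (Suc j)" and y: "y \<in> C 1 j" "E j z - D y \<in> N" by (auto simp: V0_def)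
  show "E j z \<in> V 0 j" using zC y E_C[OF zC] N_0 unfolding V_def by (intro CollectI conjI bexI[of _ z] bexI[of _ y]) auto
  show "E j z \<in> U 0 j \<longleftrightarrow> z \<in> U0 j"
  proof
    assume "E j z \<in> U 0 j"
    then obtain y where y: "y \<in> C 1 (Suc j)" "E j z - D (E j y) \<in> N" by (auto simp: U_def)
    then have "E j (z - D y) \<in> N" by (simp add: E_diff DE)
    moreover have "z - D y \<in> C 0 (Suc j)" using zC y(1) D_C C_diff by simp
    ultimately obtain w where "w \<in> C 0 (Suc (Suc j))" "z - D y - E (Suc j) w \<in> N" using E_exact by blast
    then have "w \<in> C 0 (Suc (Suc j))" "z - (E (Suc j) w + D y) \<in> N" by (simp_all add: algebra_simps)
    then show "z \<in> U0 j" unfolding U0_def using zC y by blast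
  next
    assume "z \<in> U0 j"
    then obtain y w where y: "y \<in> C 0 (Suc (Suc j))" "w \<in> C 1 (Suc j)" "z - (E (Suc j) y + D w) \<in> N" by (auto simp: U0_def)
    have "E j z - D (E j w) = E j (z - (E (Suc j) y + D w)) + E j (E (Suc j) y)" by (simp add: E_diff E_add DE)
    then have "E j z - D (E j w) \<in> N" using E_N[OF y(3)] EE[OF y(1)] N_add by simp
    then show "E j z \<in> U 0 j" unfolding U_def using E_C[OF zC] y by auto
  qed
next
  fix z assume "z \<in> V 0 j"
  then obtain y w where y: "y \<in> C 1 j" "z - D y \<in> N" and w: "w \<in> C 0 (Suc j)" "z - E j w \<in> N"
    and z: "z \<in> C 0 j"
    by (auto simp: V_def)
  have "E j w - D y = (z - D y) - (z - E j w)" by simp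
  then have "w \<in> V0 j" unfolding V0_def using w(1) y(1) N_diff[OF y(2) w(2)] by auto
  moreover have "z - E j w \<in> U 0 j" unfolding U_def using w z E_C C_diff C_0
    by (auto intro!: bexI[of _ 0] simp: D_0 E_0)
  ultimately show "\<exists>x\<in>V0 j. z - E j x \<in> U 0 j" by blast
qed (use subspaces E_add E_scale in auto)

text \<open>On the edge \<open>j = 0\<close> the elements of \<open>UF\<close> become
  \<open>D\<close>-cycles after subtracting an \<open>E\<close>-boundary. They are not asked to be
  \<open>D\<close>-boundaries, as exactness for \<open>D\<close> stops below degree
  \<open>m = Suc i\<close>.\<close>

lemma qdim_end:
  assumes i: "i + 1 = m"
  shows "qdim sc (UF i) (VF i) n \<longleftrightarrow> qdim sc (U i 0) (V i 0) n"
proof (rule qdim_iso[OF vs vs, where f=D])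
  show "U i 0 \<subseteq> V i 0" using U_V i by simp
  fix z assume z: "z \<in> VF i"
  then obtain y where zC: "z \<in> C (Suc i) 0" and y: "y \<in> C i 1" "D z - E 0 y \<in> N" by (auto simp: VF_def)
  show "D z \<in> V i 0" using zC y D_C[OF zC] N_0 unfolding V_def by (intro CollectI conjI bexI[of _ z] bexI[of _ y]) auto
  show "D z \<in> U i 0 \<longleftrightarrow> z \<in> UF i" unfolding U_def UF_def using zC D_C[OF zC] by (auto simp: D_diff)
next
  fix z assume "z \<in> V i 0"
  then obtain y w where y: "y \<in> C (Suc i) 0" "z - D y \<in> N" and w: "w \<in> C i 1" "z - E 0 w \<in> N"
    and z: "z \<in> C i 0"
    by (auto simp: V_def)
  have "D y - E 0 w = (z - E 0 w) - (z - D y)" by simp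
  then have "y \<in> VF i" unfolding VF_def using w(1) y(1) N_diff[OF w(2) y(2)] by auto
  moreover have "z - D y \<in> U i 0" unfolding U_def using y z D_C C_diff C_0
    by (auto intro!: bexI[of _ 0] simp: D_0 E_0)
  ultimately show "\<exists>x\<in>VF i. z - D x \<in> U i 0" by blast
qed (use subspaces D_add D_scale in auto)

lemma qdim_balance: "m = Suc i \<Longrightarrow> qdim sc (U0 i) (V0 i) n \<longleftrightarrow> qdim sc (UF i) (VF i) n"
  using qdim_start[of i] qdim_zigzag[of i 0] qdim_end[of i] by simp

end

section \<open>Constants and constant terms of polynomials\<close>

definition msc :: "'k \<Rightarrow> ('n::finite, 'k::field) mpoly \<Rightarrow> ('n, 'k) mpoly" where
  "msc c p = mconst c * p"

lemma mconst_simps: "mconst (c + d) = (mconst c + mconst d :: ('n::finite, 'k::field) mpoly)"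
  "mconst (c * d) = (mconst c * mconst d :: ('n::finite, 'k::field) mpoly)" "mconst 1 = (1 :: ('n::finite, 'k::field) mpoly)"
  "mconst 0 = (0 :: ('n::finite, 'k::field) mpoly)" "cst (mconst c :: ('n::finite, 'k::field) mpoly) = c"
  by (simp_all add: mconst_def single_add mult_single)

lemma vector_space_msc: "vector_space (msc :: 'k \<Rightarrow> ('n::finite, 'k::field) mpoly \<Rightarrow> _)"
  by unfold_locales (auto simp: msc_def mconst_simps algebra_simps)

lemma cst_add: "cst (p + q) = cst p + cst q"
  by (simp add: lookup_add)

lemma cst_diff: "cst (p - q) = cst p - cst q" for p :: "('n::finite, 'k::field) mpoly"
  by (simp add: lookup_minus)

text \<open>The zero exponent decomposes only as \<open>0 + 0\<close>, so no other pair of terms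
  contributes.\<close>

lemma cst_mult: "cst (p * q) = cst p * cst q" for p :: "('n::finite, 'k::field) mpoly"
proof -
  have z: "l = 0 \<and> r = 0" if "(0 :: 'n \<Rightarrow>\<^sub>0 nat) = l + r" for l r
  proof -
    have "Poly_Mapping.lookup l i = 0 \<and> Poly_Mapping.lookup r i = 0" for i
      using arg_cong[OF that, of "\<lambda>m. Poly_Mapping.lookup m i"] by (simp add: lookup_add)
    then show ?thesis by (auto intro!: poly_mapping_eqI)
  qed
  have "prod_fun (Poly_Mapping.lookup p) (Poly_Mapping.lookup q) 0 
     = (\<Sum>l. Poly_Mapping.lookup p l * (\<Sum>r. Poly_Mapping.lookup q r when 0 = l + r))"
    unfolding prod_fun_def ..
  also have "\<dots> = (\<Sum>l :: 'n \<Rightarrow>\<^sub>0 nat. cst p * cst q when l = 0)"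
  proof (rule Sum_any.cong)
    fix l :: "'n \<Rightarrow>\<^sub>0 nat"
    have "(\<Sum>r. Poly_Mapping.lookup q r when 0 = l + r) = (\<Sum>r :: 'n \<Rightarrow>\<^sub>0 nat. (cst q when l = 0) when r = 0)"
    proof (rule Sum_any.cong)
      fix r show "(Poly_Mapping.lookup q r when 0 = l + r) = ((cst q when l = 0) when r = 0)"
        using z[of l r] by (cases "0 = l + r") (auto simp: when_def)
    qed
    then show "Poly_Mapping.lookup p l * (\<Sum>r. Poly_Mapping.lookup q r when 0 = l + r) = (cst p * cst q when l = 0)"
      by (auto simp: when_def)
  qed
  also have "\<dots> = cst p * cst q" by simp
  finally show ?thesis by (simp add: times_poly_mapping.rep_eq)
qed

lemma cst_sum: "cst (\<Sum>i\<in>S. f i) = (\<Sum>i\<in>S. cst (f i))" for f :: "'i \<Rightarrow> ('n::finite, 'k::field) mpoly"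
  by (induction S rule: infinite_finite_induct) (auto simp: cst_add)

lemma cst_mv: "cst (mv a p q v l) = mv (\<lambda>i j. cst (a i j)) p q (\<lambda>i. cst (v i)) l"
  for a :: "nat \<Rightarrow> nat \<Rightarrow> ('n::finite, 'k::field) mpoly"
  by (simp add: mv_def cst_sum cst_mult)

text \<open>The free module on the basis \<open>A i\<close>, placed inside the functions on the
  generators of all degrees so that one function \<open>d\<close> can be the differential in every
  degree.\<close>

definition XM :: "(nat \<Rightarrow> 'a set) \<Rightarrow> nat \<Rightarrow> ('a \<Rightarrow> 'p::zero) set" where
  "XM A i = {x. \<forall>e. e \<notin> A i \<longrightarrow> x e = 0}"

text \<open>Two resolutions are compared: the unknown one of the quotient by \<open>J\<close>, given
  by \<open>g\<close>, \<open>a\<close>, \<open>q\<close>, and an explicit complex \<open>d\<close>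
  on the bases \<open>A i\<close> which resolves the residue field up to degree \<open>m\<close>. By
  \<open>d_0\<close>, its boundaries in degree 0 are modulo \<open>I\<close> the polynomials without
  constant term.\<close>

locale tor_data =
  fixes I J :: "('n::finite, 'k::field) mpoly set" and g :: "nat \<Rightarrow> nat" and a q
    and A :: "nat \<Rightarrow> 'a set" and d :: "('a \<Rightarrow> ('n, 'k) mpoly) \<Rightarrow> 'a \<Rightarrow> ('n, 'k) mpoly" and m :: nat and a0 :: 'a
  assumes ideal_I: "is_ideal I" and ideal_J: "is_ideal J" and IJ: "I \<subseteq> J"
    and res: "resolves I J g a q"
    and d_add: "d (\<lambda>e. x e + y e) = (\<lambda>e. d x e + d y e)" and d_smult: "d (\<lambda>e. p * x e) = (\<lambda>e. p * d x e)"
    and d_XM: "x \<in> XM A (Suc i) \<Longrightarrow> d x \<in> XM A i"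
    and d_I: "(\<And>e. x e \<in> I) \<Longrightarrow> d x e \<in> I"
    and d_d: "Suc i < m \<Longrightarrow> x \<in> XM A (Suc (Suc i)) \<Longrightarrow> d (d x) e \<in> I"
    and d_exact: "Suc i < m \<Longrightarrow> x \<in> XM A (Suc i) \<Longrightarrow> (\<And>e. d x e \<in> I) \<Longrightarrow> \<exists>y\<in>XM A (Suc (Suc i)). \<forall>e. x e - d y e \<in> I"
    and A0: "A 0 = {a0}" and d_0: "cst p = 0 \<longleftrightarrow> (\<exists>y\<in>XM A 1. p - d y a0 \<in> I)"
begin

lemmas I_0 = idl.subspace_0[OF ideal_I]
  and I_add = idl.subspace_add[OF ideal_I]
  and I_mult = idl.subspace_scale[OF ideal_I]
  and I_sum = idl.subspace_sum[OF ideal_I]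
lemmas J_0 = idl.subspace_0[OF ideal_J]
  and J_add = idl.subspace_add[OF ideal_J]
  and J_mult = idl.subspace_scale[OF ideal_J]
  and J_diff = idl.subspace_diff[OF ideal_J]

definition C where "C i j = {z :: nat \<Rightarrow> 'a \<Rightarrow> ('n, 'k) mpoly. (\<forall>l\<ge>g j. \<forall>e. z l e = 0) \<and> (\<forall>l. z l \<in> XM A i)}"
definition N where "N = {z :: nat \<Rightarrow> 'a \<Rightarrow> ('n, 'k) mpoly. \<forall>l e. z l e \<in> I}"
definition D where "D z = (\<lambda>l. d (z l))" for z :: "nat \<Rightarrow> 'a \<Rightarrow> ('n, 'k) mpoly"
definition E where "E j z = (\<lambda>l e. mv (a j) (g j) (g (Suc j)) (\<lambda>l'. z l' e) l)" for z :: "nat \<Rightarrow> 'a \<Rightarrow> ('n, 'k) mpoly"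

abbreviation "sc \<equiv> lsc (lsc (msc :: 'k \<Rightarrow> ('n, 'k) mpoly \<Rightarrow> _)) :: 'k \<Rightarrow> (nat \<Rightarrow> 'a \<Rightarrow> ('n, 'k) mpoly) \<Rightarrow> _"

lemma d_zero: "d (\<lambda>e. 0) = (\<lambda>e. 0)" using d_smult[of 0 "\<lambda>e. 0"] by simp

lemma d_sum: "d (\<lambda>e. \<Sum>l<k::nat. r l * z l e) = (\<lambda>e. \<Sum>l<k. r l * d (z l) e)"
  by (induction k) (auto simp: d_zero d_add d_smult)

lemma D_E: "D (E j x) = E j (D x)"
  unfolding D_def E_def mv_def by (auto simp: d_sum d_zero fun_eq_iff)

lemma mv_mem_I: "(\<And>l. v l \<in> I) \<Longrightarrow> mv b p k v l \<in> I"
  by (auto simp: mv_def intro!: I_sum I_mult I_0)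

lemma res_J: "v \<in> coords (g 0) \<Longrightarrow> (\<Sum>l<g 0. v l * q l) \<in> J \<longleftrightarrow> (\<exists>w\<in>coords (g 1). \<forall>i. v i - mv (a 0) (g 0) (g 1) w i \<in> I)"
  and res_exact: "v \<in> coords (g (Suc j)) \<Longrightarrow> (\<forall>i. mv (a j) (g j) (g (Suc j)) v i \<in> I) \<longleftrightarrow>
        (\<exists>w\<in>coords (g (Suc (Suc j))). \<forall>i. v i - mv (a (Suc j)) (g (Suc j)) (g (Suc (Suc j))) w i \<in> I)"
  and res_t: "\<exists>t\<in>coords (g 0). (\<Sum>l<g 0. t l * q l) - 1 \<in> J"
  using res unfolding resolves_def by blast+

text \<open>\<open>E\<close> acts on each coordinate \<open>e\<close> separately, so its equations
  are solved for one \<open>e\<close> at a time.\<close>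

lemma choose_columns:
  assumes "\<And>e. e \<in> S \<Longrightarrow> \<exists>w\<in>coords p. P e w"
  shows "\<exists>y :: nat \<Rightarrow> 'a \<Rightarrow> ('n, 'k) mpoly. (\<forall>l\<ge>p. \<forall>e. y l e = 0) \<and> (\<forall>l. \<forall>e. e \<notin> S \<longrightarrow> y l e = 0) \<and> (\<forall>e\<in>S. P e (\<lambda>l. y l e))"
proof -
  have "\<forall>e. \<exists>w. e \<in> S \<longrightarrow> w \<in> coords p \<and> P e w" using assms by blast
  then obtain w where w: "\<And>e. e \<in> S \<Longrightarrow> w e \<in> coords p" "\<And>e. e \<in> S \<Longrightarrow> P e (w e)" by metis
  have "(\<lambda>l. if e \<in> S then w e l else 0) = w e" if "e \<in> S" for e using that by simp
  then show ?thesis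
    by (intro exI[of _ "\<lambda>l e. if e \<in> S then w e l else 0"]) (use w in \<open>auto simp: coords_def\<close>)
qed

lemma E_exact_raw:
  assumes x: "x \<in> C i (Suc j)" and N: "E j x \<in> N"
  shows "\<exists>y\<in>C i (Suc (Suc j)). x - E (Suc j) y \<in> N"
proof -
  have "\<exists>w\<in>coords (g (Suc (Suc j))). \<forall>l. x l e - mv (a (Suc j)) (g (Suc j)) (g (Suc (Suc j))) w l \<in> I" for e
  proof -
    have "(\<lambda>l. x l e) \<in> coords (g (Suc j))" using x by (auto simp: C_def coords_def)
    moreover have "\<forall>i. mv (a j) (g j) (g (Suc j)) (\<lambda>l. x l e) i \<in> I" using N by (auto simp: N_def E_def)
    ultimately show ?thesis using res_exact by blast
  qed
  then obtain y where y: "\<forall>l\<ge>g (Suc (Suc j)). \<forall>e. y l e = 0" "\<forall>l. \<forall>e. e \<notin> A i \<longrightarrow> y l e = 0"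
    "\<forall>e\<in>A i. \<forall>l. x l e - mv (a (Suc j)) (g (Suc j)) (g (Suc (Suc j))) (\<lambda>l. y l e) l \<in> I"
    using choose_columns[of "A i" "g (Suc (Suc j))" "\<lambda>e w. \<forall>l. x l e - mv (a (Suc j)) (g (Suc j)) (g (Suc (Suc j))) w l \<in> I"] by blast
  have "x l e - mv (a (Suc j)) (g (Suc j)) (g (Suc (Suc j))) (\<lambda>l. y l e) l \<in> I" for l e
  proof (cases "e \<in> A i")
    case False
    then have "y l e = 0" "x l e = 0" for l using x y(2) by (auto simp: C_def XM_def)
    then show ?thesis using I_0 by (simp add: mv_def)
  qed (use y in auto)
  then show ?thesis using y by (intro bexI[of _ y]) (auto simp: N_def E_def C_def XM_def)
qed

sublocale dc: double_complex sc C N D E m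
proof -
  interpret v: vector_space sc by (intro vector_space_lsc vector_space_msc)
  show "double_complex sc C N D E m"
  proof unfold_locales
    show "v.subspace (C i j)" for i j
      by (auto simp: v.subspace_def C_def XM_def lsc_def msc_def)
    show "v.subspace N"
      by (auto simp: v.subspace_def N_def lsc_def msc_def I_0 I_add I_mult)
    show "D (x + y) = D x + D y" for x y
      using d_add by (auto simp: D_def fun_eq_iff plus_fun_def)
    show "D (sc c x) = sc c (D x)" for c x
      using d_smult by (auto simp: D_def fun_eq_iff lsc_def msc_def)
    show "E j (x + y) = E j x + E j y" for j x y
      by (auto simp: E_def fun_eq_iff mv_def distrib_left sum.distrib)
    show "E j (sc c x) = sc c (E j x)" for j c x
    proof (intro ext)
      fix l e
      have "(\<Sum>l'<k. b l' * (mconst c * x l' e)) = mconst c * (\<Sum>l'<k. b l' * x l' e)" for b k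
        by (simp add: sum_distrib_left mult.left_commute)
      then show "E j (sc c x) l e = sc c (E j x) l e" by (simp add: E_def lsc_def msc_def mv_def)
    qed
    show "D x \<in> C i j" if "x \<in> C (Suc i) j" for x i j
    proof -
      have "D x l e = 0" if "l \<ge> g j" for l e
      proof -
        have "x l = (\<lambda>e. 0)" using \<open>x \<in> C (Suc i) j\<close> that by (auto simp: C_def fun_eq_iff)
        then show ?thesis by (simp add: D_def d_zero)
      qed
      then show ?thesis using that d_XM by (auto simp: C_def D_def)
    qed
    show "E j x \<in> C i j" if "x \<in> C i (Suc j)" for x i j
      using that by (auto simp: C_def E_def mv_def XM_def)
    show "D x \<in> N" if "x \<in> N" for x using that d_I by (auto simp: N_def D_def)
    show "E j x \<in> N" if "x \<in> N" for x j using that by (auto simp: N_def E_def intro!: mv_mem_I)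
    show "D (E j x) = E j (D x)" for j x by (rule D_E)
    show "D (D x) \<in> N" if "Suc i < m" "x \<in> C (Suc (Suc i)) j" for x i j
      using that d_d by (auto simp: N_def D_def C_def)
    show "E j (E (Suc j) x) \<in> N" if "x \<in> C i (Suc (Suc j))" for x i j
    proof -
      have "mv (a j) (g j) (g (Suc j)) (mv (a (Suc j)) (g (Suc j)) (g (Suc (Suc j))) (\<lambda>l. x l e)) l \<in> I" for l e
      proof -
        have w: "(\<lambda>l. x l e) \<in> coords (g (Suc (Suc j)))" using that by (auto simp: C_def coords_def)
        let ?v = "mv (a (Suc j)) (g (Suc j)) (g (Suc (Suc j))) (\<lambda>l. x l e)"
        have "\<forall>i. ?v i - ?v i \<in> I" using I_0 by simp
        then have "\<exists>w\<in>coords (g (Suc (Suc j))). \<forall>i. ?v i - mv (a (Suc j)) (g (Suc j)) (g (Suc (Suc j))) w i \<in> I" using w by blast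
        then show ?thesis using res_exact[OF mv_coords, of j "a (Suc j)"] by blast
      qed
      then show ?thesis by (auto simp: N_def E_def)
    qed
    show "\<exists>y\<in>C (Suc (Suc i)) j. x - D y \<in> N" if "Suc i < m" "x \<in> C (Suc i) j" "D x \<in> N" for x i j
    proof -
      have "\<forall>l. \<exists>y. y \<in> XM A (Suc (Suc i)) \<and> (\<forall>e. x l e - d y e \<in> I)"
        using d_exact[OF that(1)] that(2,3) by (auto simp: C_def N_def D_def Bex_def)
      then obtain y where y: "\<And>l. y l \<in> XM A (Suc (Suc i))" "\<And>l e. x l e - d (y l) e \<in> I" by metis
      have z: "x l = (\<lambda>e. 0)" if "l \<ge> g j" for l using \<open>x \<in> C (Suc i) j\<close> that by (auto simp: C_def fun_eq_iff)
      show ?thesis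
      proof (rule bexI[of _ "\<lambda>l. if l < g j then y l else (\<lambda>e. 0)"])
        show "x - D (\<lambda>l. if l < g j then y l else (\<lambda>e. 0)) \<in> N"
          using y(2) z I_0 by (auto simp: N_def D_def d_zero)
      qed (use y(1) in \<open>auto simp: C_def XM_def\<close>)
    qed
    show "\<exists>y\<in>C i (Suc (Suc j)). x - E (Suc j) y \<in> N" if "x \<in> C i (Suc j)" "E j x \<in> N" for x i j
      using E_exact_raw that .
  qed
qed

abbreviation "ca \<equiv> \<lambda>n i j. cst (a n i j)"

lemma I_cst: "p \<in> I \<Longrightarrow> cst p = 0"
  using d_0[of p] by (auto simp: XM_def d_zero intro!: bexI[of _ "\<lambda>e. 0"])

lemma d_cst: "y \<in> XM A 1 \<Longrightarrow> cst (d y a0) = 0"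
  using d_0[of "d y a0"] I_0 by (metis diff_self)

text \<open>\<open>d_0\<close> is applied in each coordinate: on the edge \<open>i = 0\<close>, an
  element is determined modulo the boundaries of \<open>D\<close> by its constant terms.\<close>

lemma cst_C0: assumes "z \<in> C 0 j" "\<And>l. cst (z l a0) = 0" shows "\<exists>w\<in>C 1 j. z - D w \<in> N"
proof -
  have "\<forall>l. \<exists>y. y \<in> XM A 1 \<and> z l a0 - d y a0 \<in> I" using d_0 assms(2) by (auto simp: Bex_def)
  then obtain y where y: "\<And>l. y l \<in> XM A 1" "\<And>l. z l a0 - d (y l) a0 \<in> I" by metis
  let ?w = "\<lambda>l. if l < g j then y l else (\<lambda>e. 0)"
  have w: "?w \<in> C 1 j" using y(1) by (auto simp: C_def XM_def)
  have "z l e - D ?w l e \<in> I" for l e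
  proof (cases "e = a0 \<and> l < g j")
    case True then show ?thesis using y(2) by (simp add: D_def)
  next
    case False
    have "z l e = 0" "D ?w l e = 0" using False assms(1) dc.D_C[of ?w 0 j] w by (auto simp: C_def XM_def A0)
    then show ?thesis using I_0 by simp
  qed
  then show ?thesis using w by (intro bexI[of _ ?w]) (auto simp: N_def)
qed

text \<open>Taking constant terms at \<open>a0\<close> identifies the edge \<open>i = 0\<close>
  modulo \<open>D\<close> with the unknown resolution tensored with \<open>k\<close>; constant
  polynomials lift vectors back.\<close>

lemma qdim_cst: 
  "qdim sc (dc.U0 j) (dc.V0 j) n \<longleftrightarrow> qdim fsc (bnd g ca (Suc j)) (cyc g ca (Suc j)) n"
proof (rule qdim_iso[OF dc.vs, where f="\<lambda>z l. cst (z l a0)"])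
  let ?f = "\<lambda>(z :: nat \<Rightarrow> 'a \<Rightarrow> ('n, 'k) mpoly) l. cst (z l a0)"
  show "vector_space (fsc :: 'k \<Rightarrow> (nat \<Rightarrow> 'k) \<Rightarrow> _)" by unfold_locales
  show "?f (x + y) = ?f x + ?f y" for x y by (auto simp: cst_add fun_eq_iff)
  show "?f (sc c x) = fsc c (?f x)" for c x by (auto simp: lsc_def msc_def cst_mult mconst_simps fun_eq_iff)
  have coordsf: "?f z \<in> coords (g j)" if "z \<in> C i j" for z i j using that by (auto simp: C_def coords_def)
  have fE: "?f (E j z) = mv (ca j) (g j) (g (Suc j)) (?f z)" for j z by (auto simp: E_def cst_mv)
  have fD: "?f (D w) = 0" if "w \<in> C 1 j" for w j using that by (auto simp: D_def C_def d_cst fun_eq_iff)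
  have fN: "?f z = 0" if "z \<in> N" for z using that I_cst by (auto simp: N_def fun_eq_iff)
  have fdiff: "?f (x - y) = ?f x - ?f y" for x y by (auto simp: cst_diff fun_eq_iff)
  have fadd: "?f (x + y) = ?f x + ?f y" for x y by (auto simp: cst_add fun_eq_iff)
  have lift: "\<exists>y\<in>C 0 j. ?f y = w" if "w \<in> coords (g j)" for w j
    using that by (intro bexI[of _ "\<lambda>l e. if e = a0 then mconst (w l) else 0"])
      (auto simp: C_def XM_def A0 coords_def mconst_simps)
  show "bnd g ca (Suc j) \<subseteq> cyc g ca (Suc j)"
  proof
    fix v assume "v \<in> bnd g ca (Suc j)"
    then obtain w where w: "w \<in> coords (g (Suc (Suc j)))" "v = mv (ca (Suc j)) (g (Suc j)) (g (Suc (Suc j))) w" by (auto simp: bnd_def)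
    then obtain y where y: "y \<in> C 0 (Suc (Suc j))" "?f y = w" using lift by blast
    have "mv (ca j) (g j) (g (Suc j)) v = 0" using fN[OF dc.EE[OF y(1)]] by (simp add: w(2) fE y(2))
    then show "v \<in> cyc g ca (Suc j)" using w mv_coords by (auto simp: cyc_def)
  qed
  fix z assume "z \<in> dc.V0 j"
  then obtain y where z: "z \<in> C 0 (Suc j)" and y: "y \<in> C 1 j" "E j z - D y \<in> N" by (auto simp: dc.V0_def)
  have "mv (ca j) (g j) (g (Suc j)) (?f z) = 0" using fN[OF y(2)] fD[OF y(1)] unfolding fdiff fE by simp
  then show "?f z \<in> cyc g ca (Suc j)" using coordsf[OF z] by (auto simp: cyc_def)
  show "?f z \<in> bnd g ca (Suc j) \<longleftrightarrow> z \<in> dc.U0 j"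
  proof
    assume "?f z \<in> bnd g ca (Suc j)"
    then obtain w where w: "w \<in> coords (g (Suc (Suc j)))" "?f z = mv (ca (Suc j)) (g (Suc j)) (g (Suc (Suc j))) w" by (auto simp: bnd_def)
    then obtain y where y: "y \<in> C 0 (Suc (Suc j))" "?f y = w" using lift by blast
    have "?f (z - E (Suc j) y) = 0" unfolding fdiff fE y(2) w(2) by simp
    then have "\<And>l. cst ((z - E (Suc j) y) l a0) = 0" by (metis zero_fun_apply)
    moreover have "z - E (Suc j) y \<in> C 0 (Suc j)" using z y(1) dc.E_C dc.C_diff by blast
    ultimately obtain v where "v \<in> C 1 (Suc j)" "z - E (Suc j) y - D v \<in> N" using cst_C0 by blast
    then show "z \<in> dc.U0 j" unfolding dc.U0_def using z y(1) by (auto simp: diff_diff_eq)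
  next
    assume "z \<in> dc.U0 j"
    then obtain y v where y: "y \<in> C 0 (Suc (Suc j))" and v: "v \<in> C 1 (Suc j)" "z - (E (Suc j) y + D v) \<in> N" by (auto simp: dc.U0_def)
    have "?f z - (?f (E (Suc j) y) + ?f (D v)) = 0" using fN[OF v(2)] unfolding fdiff fadd .
    then have "?f z = mv (ca (Suc j)) (g (Suc j)) (g (Suc (Suc j))) (?f y)" unfolding fE fD[OF v(1)] by simp
    then show "?f z \<in> bnd g ca (Suc j)" using coordsf[OF y] by (auto simp: bnd_def)
  qed
next
  let ?f = "\<lambda>(z :: nat \<Rightarrow> 'a \<Rightarrow> ('n, 'k) mpoly) l. cst (z l a0)"
  fix c assume c: "c \<in> cyc g ca (Suc j)"
  let ?y = "\<lambda>l e. if e = a0 then mconst (c l) else (0 :: ('n, 'k) mpoly)"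
  have y: "?y \<in> C 0 (Suc j)" using c by (auto simp: C_def XM_def A0 cyc_def coords_def mconst_simps)
  have fy: "?f ?y = c" by (simp add: mconst_simps)
  have "?f (E j ?y) = 0" using c by (simp add: E_def cst_mv cyc_def mconst_simps zero_fun_def)
  from fun_cong[OF this] have "cst (E j ?y l a0) = 0" for l by simp
  from cst_C0[OF dc.E_C[OF y] this] have "?y \<in> dc.V0 j" using y by (auto simp: dc.V0_def)
  moreover have "c - ?f ?y \<in> bnd g ca (Suc j)" using fsc.subspace_0[OF subspace_bnd] unfolding fy by simp
  ultimately show "\<exists>x\<in>dc.V0 j. c - ?f x \<in> bnd g ca (Suc j)" by (intro bexI[of _ ?y])
qed (rule dc.subspaces subspace_bnd subspace_cyc)+

abbreviation "xsc \<equiv> lsc (msc :: 'k \<Rightarrow> ('n, 'k) mpoly \<Rightarrow> _) :: 'k \<Rightarrow> ('a \<Rightarrow> ('n, 'k) mpoly) \<Rightarrow> _"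

text \<open>\<open>VX / UX\<close> is the homology of the explicit complex modulo \<open>J\<close>,
  with cycles modulo \<open>I\<close> in place of boundaries. In any continuation to a resolution
  these cycles are the boundaries from the next degree, and in degree \<open>m\<close> no
  continuation is at hand.\<close>

definition UX where "UX i = {x \<in> XM A i. \<exists>y\<in>XM A i. (\<forall>e. d y e \<in> I) \<and> (\<forall>e. x e - y e \<in> J)}"
definition VX where "VX i = {x \<in> XM A i. \<forall>e. d x e \<in> J}"

text \<open>\<open>f\<close> applies the augmentation in each coordinate. Multiplication by
  \<open>t\<close> gives a map \<open>T\<close> in the other direction with \<open>f (T x)\<close>
  congruent to \<open>x\<close> modulo \<open>J\<close>, and what \<open>f\<close> sends into
  \<open>J\<close> comes from \<open>E 0\<close>, by exactness at the start of the
  resolution.\<close>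

lemma qdim_aug: assumes d_J: "\<And>x e. (\<And>e. x e \<in> J) \<Longrightarrow> d x e \<in> J"
  shows "qdim sc (dc.UF i) (dc.VF i) n \<longleftrightarrow> qdim xsc (UX (Suc i)) (VX (Suc i)) n"
proof -
  obtain t where t: "t \<in> coords (g 0)" "(\<Sum>l<g 0. t l * q l) - 1 \<in> J" using res_t by blast
  define f where "f z = (\<lambda>e. \<Sum>l<g 0. z l e * q l)" for z :: "nat \<Rightarrow> 'a \<Rightarrow> ('n, 'k) mpoly"
  define T where "T x = (\<lambda>l e. t l * x e)" for x :: "'a \<Rightarrow> ('n, 'k) mpoly"
  interpret x: vector_space xsc by (intro vector_space_lsc vector_space_msc)
  have d_diff: "d (\<lambda>e. x e - y e) = (\<lambda>e. d x e - d y e)" for x y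
    using d_add[of x "\<lambda>e. (-1) * y e"] d_smult[of "-1" y] by simp
  have fT: "f (T x) e - x e \<in> J" for x e
  proof -
    have "f (T x) e - x e = x e * ((\<Sum>l<g 0. t l * q l) - 1)" 
      by (simp add: f_def T_def sum_distrib_left right_diff_distrib mult_ac)
    then show ?thesis using J_mult t(2) by simp
  qed
  have TC: "T x \<in> C i 0" if "x \<in> XM A i" for x i using that t(1) by (auto simp: T_def C_def XM_def coords_def)
  have DT: "D (T x) = T (d x)" for x by (auto simp: D_def T_def d_smult)
  have fC: "f z \<in> XM A i" if "z \<in> C i j" for z i j using that by (auto simp: f_def C_def XM_def)
  have df: "d (f z) = f (D z)" for z 
    using d_sum[of q z "g 0"] by (simp add: f_def D_def mult.commute)
  have fN: "f z e \<in> I" if "z \<in> N" for z e using that by (auto simp: f_def N_def mult.commute[of _ "q _"] intro!: I_sum I_mult)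
  have TN: "T x \<in> N" if "\<And>e. x e \<in> I" for x using that I_mult by (auto simp: T_def N_def)
  have fdiff: "f (x - y) = (\<lambda>e. f x e - f y e)" for x y by (auto simp: f_def sum_subtractf left_diff_distrib)
  have fJ: "(\<forall>e. f z e \<in> J) \<longleftrightarrow> (\<exists>w\<in>C i 1. z - E 0 w \<in> N)" if z: "z \<in> C i 0" for z i
  proof
    assume a: "\<forall>e. f z e \<in> J"
    have "\<exists>w\<in>coords (g 1). \<forall>l. z l e - mv (a 0) (g 0) (g 1) w l \<in> I" for e
      using res_J[of "\<lambda>l. z l e"] a z by (auto simp: f_def C_def coords_def)
    then obtain y where y: "\<forall>l\<ge>g 1. \<forall>e. y l e = 0" "\<forall>l. \<forall>e. e \<notin> A i \<longrightarrow> y l e = 0"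
      "\<forall>e\<in>A i. \<forall>l. z l e - mv (a 0) (g 0) (g 1) (\<lambda>l. y l e) l \<in> I"
      using choose_columns[of "A i" "g 1" "\<lambda>e w. \<forall>l. z l e - mv (a 0) (g 0) (g 1) w l \<in> I"] by blast
    have "z l e - mv (a 0) (g 0) (g 1) (\<lambda>l. y l e) l \<in> I" for l e
    proof (cases "e \<in> A i")
      case False
      then have "y l e = 0" "z l e = 0" for l using z y(2) by (auto simp: C_def XM_def)
      then show ?thesis using I_0 by (simp add: mv_def)
    qed (use y in auto)
    then show "\<exists>w\<in>C i 1. z - E 0 w \<in> N" using y by (intro bexI[of _ y]) (auto simp: N_def E_def C_def XM_def)
  next
    assume "\<exists>w\<in>C i 1. z - E 0 w \<in> N"
    then obtain w where w: "w \<in> C i 1" "z - E 0 w \<in> N" by blast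
    show "\<forall>e. f z e \<in> J"
    proof
      fix e
      have "(\<lambda>l. z l e) \<in> coords (g 0)" "(\<lambda>l. w l e) \<in> coords (g 1)" using z w by (auto simp: C_def coords_def)
      moreover have "\<forall>l. z l e - mv (a 0) (g 0) (g 1) (\<lambda>l. w l e) l \<in> I" using w(2) by (auto simp: N_def E_def)
      ultimately show "f z e \<in> J" using res_J[of "\<lambda>l. z l e"] unfolding f_def by blast
    qed
  qed
  have subU: "x.subspace (UX (Suc i))" unfolding x.subspace_def
  proof (intro conjI ballI allI)
    show "0 \<in> UX (Suc i)" unfolding UX_def by (auto simp: XM_def d_zero I_0 J_0 intro!: bexI[of _ "\<lambda>e. 0"])
  next
    fix x y assume "x \<in> UX (Suc i)" "y \<in> UX (Suc i)"
    then obtain u v where u: "x \<in> XM A (Suc i)" "u \<in> XM A (Suc i)" "\<forall>e. d u e \<in> I" "\<forall>e. x e - u e \<in> J"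
      and v: "y \<in> XM A (Suc i)" "v \<in> XM A (Suc i)" "\<forall>e. d v e \<in> I" "\<forall>e. y e - v e \<in> J" by (auto simp: UX_def)
    have "x e + y e - (u e + v e) \<in> J" for e
      using J_add[of "x e - u e" "y e - v e"] u v by (simp add: algebra_simps)
    then have "\<forall>e. (x + y) e - (u e + v e) \<in> J" by simp
    moreover have "\<forall>e. d (\<lambda>e. u e + v e) e \<in> I" using u v by (simp add: d_add I_add)
    moreover have "x + y \<in> XM A (Suc i)" "(\<lambda>e. u e + v e) \<in> XM A (Suc i)" using u v by (simp_all add: XM_def)
    ultimately show "x + y \<in> UX (Suc i)" unfolding UX_def by blast
  next
    fix c x assume "x \<in> UX (Suc i)"
    then obtain u where u: "x \<in> XM A (Suc i)" "u \<in> XM A (Suc i)" "\<forall>e. d u e \<in> I" "\<forall>e. x e - u e \<in> J" by (auto simp: UX_def)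
    have "mconst c * x e - mconst c * u e \<in> J" for e
      using J_mult[of "x e - u e" "mconst c"] u by (simp add: right_diff_distrib)
    then have "\<forall>e. xsc c x e - mconst c * u e \<in> J" by (simp add: lsc_def msc_def)
    moreover have "\<forall>e. d (\<lambda>e. mconst c * u e) e \<in> I" using u by (simp add: d_smult I_mult)
    moreover have "xsc c x \<in> XM A (Suc i)" "(\<lambda>e. mconst c * u e) \<in> XM A (Suc i)" using u by (simp_all add: XM_def lsc_def msc_def)
    ultimately show "xsc c x \<in> UX (Suc i)" unfolding UX_def by blast
  qed
  have subV: "x.subspace (VX (Suc i))" unfolding x.subspace_def VX_def
    by (auto simp: XM_def d_zero J_0 lsc_def msc_def d_smult J_mult d_add J_add plus_fun_def zero_fun_def)
  have UV: "UX (Suc i) \<subseteq> VX (Suc i)"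
  proof
    fix x assume "x \<in> UX (Suc i)"
    then obtain u where u: "x \<in> XM A (Suc i)" "u \<in> XM A (Suc i)" "\<forall>e. d u e \<in> I" "\<forall>e. x e - u e \<in> J" by (auto simp: UX_def)
    have "d (\<lambda>e. x e - u e) e \<in> J" for e by (rule d_J) (use u in auto)
    then have "d x e - d u e \<in> J" for e unfolding d_diff .
    then have "(d x e - d u e) + d u e \<in> J" for e using u(3) IJ by (intro J_add) auto
    then show "x \<in> VX (Suc i)" using u(1) by (auto simp: VX_def)
  qed
  show ?thesis
  proof (rule qdim_iso[OF dc.vs, where f=f])
    show "vector_space xsc" by unfold_locales
    show "f (x + y) = f x + f y" for x y by (auto simp: f_def fun_eq_iff distrib_right sum.distrib)
    show "f (sc c x) = xsc c (f x)" for c x by (auto simp: f_def fun_eq_iff lsc_def msc_def sum_distrib_left mult.assoc)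
    fix z assume "z \<in> dc.VF i"
    then obtain y where z: "z \<in> C (Suc i) 0" and y: "y \<in> C i 1" "D z - E 0 y \<in> N" by (auto simp: dc.VF_def)
    have "\<forall>e. f (D z) e \<in> J" using fJ[OF dc.D_C[OF z]] y by blast
    then show "f z \<in> VX (Suc i)" using fC[OF z] by (simp add: VX_def df)
    show "f z \<in> UX (Suc i) \<longleftrightarrow> z \<in> dc.UF i"
    proof
      assume "f z \<in> UX (Suc i)"
      then obtain y where y: "y \<in> XM A (Suc i)" "\<forall>e. d y e \<in> I" "\<forall>e. f z e - y e \<in> J" by (auto simp: UX_def)
      have zT: "z - T y \<in> C (Suc i) 0" using z TC[OF y(1)] dc.C_diff by blast
      have "f (z - T y) e \<in> J" for e
        using J_diff[of "f z e - y e" "f (T y) e - y e"] y(3) fT[of y e] by (simp add: fdiff)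
      then obtain w where w: "w \<in> C (Suc i) 1" "z - T y - E 0 w \<in> N" using fJ[OF zT] by blast
      have "D (z - E 0 w) = D (z - T y - E 0 w) + T (d y)" by (simp add: dc.D_diff DT)
      also have "\<dots> \<in> N" by (intro dc.N_add dc.D_N w(2) TN) (use y(2) in blast)
      finally show "z \<in> dc.UF i" unfolding dc.UF_def using z w(1) by blast
    next
      assume "z \<in> dc.UF i"
      then obtain w where w: "w \<in> C (Suc i) 1" "D (z - E 0 w) \<in> N" by (auto simp: dc.UF_def)
      have zw: "z - E 0 w \<in> C (Suc i) 0" "E 0 w \<in> C (Suc i) 0" using z w(1) dc.E_C dc.C_diff by simp_all
      have "\<forall>e. d (f (z - E 0 w)) e \<in> I" unfolding df using fN[OF w(2)] by blast
      moreover have "f z e - f (z - E 0 w) e \<in> J" for e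
      proof -
        have "\<forall>e. f (E 0 w) e \<in> J" using fJ[OF zw(2)] w(1) dc.N_0 by (intro iffD2[OF fJ[OF zw(2)]] bexI[of _ w]) auto
        then show ?thesis by (simp add: fdiff)
      qed
      ultimately show "f z \<in> UX (Suc i)" unfolding UX_def using fC[OF z] fC[OF zw(1)] by blast
    qed
  next
    fix x assume "x \<in> VX (Suc i)"
    then have x: "x \<in> XM A (Suc i)" "\<forall>e. d x e \<in> J" by (auto simp: VX_def)
    have "f (T (d x)) e \<in> J" for e using J_add[OF fT[of "d x" e], of "d x e"] x(2) by simp
    then obtain w where "w \<in> C i 1" "D (T x) - E 0 w \<in> N" using fJ[OF dc.D_C[OF TC[OF x(1)]]] by (auto simp: DT)
    then have "T x \<in> dc.VF i" using TC[OF x(1)] by (auto simp: dc.VF_def)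
    moreover have "x - f (T x) \<in> UX (Suc i)"
    proof -
      have "x e - f (T x) e \<in> J" for e using idl.subspace_neg[OF ideal_J fT[of x e]] by simp
      then show ?thesis unfolding UX_def using x(1) fC[OF TC[OF x(1)]]
        by (auto simp: XM_def d_zero I_0 intro!: bexI[of _ "\<lambda>e. 0"])
    qed
    ultimately show "\<exists>z\<in>dc.VF i. x - f z \<in> UX (Suc i)" by blast
  qed (rule subU subV UV dc.subspaces)+
qed

theorem qdim_tor:
  assumes "m = Suc i" and "\<And>x e. (\<And>e. x e \<in> J) \<Longrightarrow> d x e \<in> J"
  shows "qdim fsc (bnd g ca m) (cyc g ca m) n \<longleftrightarrow> qdim xsc (UX m) (VX m) n"
  using qdim_cst[of i] qdim_aug[of i n] dc.qdim_balance[of i n] assms by simp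

end

section \<open>The Koszul complex\<close>

text \<open>A function \<open>x\<close> on sets of variables stands for \<open>\<Sum> x F e\<^sub>F\<close> in the Koszul complex, and \<open>e\<^sub>F e\<^sub>G = sg F G e\<^sub>F\<^sub>\<union>\<^sub>G\<close> for disjoint \<open>F\<close> and \<open>G\<close>.\<close>

definition sg :: "'n::linorder set \<Rightarrow> 'n set \<Rightarrow> 'a::comm_ring_1" where
  "sg F G = (-1) ^ card {(i, j). i \<in> F \<and> j \<in> G \<and> j < i}"

definition kd :: "('n::{finite,linorder} \<Rightarrow> 'a::comm_ring_1) \<Rightarrow> ('n set \<Rightarrow> 'a) \<Rightarrow> 'n set \<Rightarrow> 'a" where
  "kd t x F = (\<Sum>i\<in>-F. sg {i} F * t i * x (insert i F))"

definition km :: "('n::{finite,linorder} set \<Rightarrow> 'a::comm_ring_1) \<Rightarrow> ('n set \<Rightarrow> 'a) \<Rightarrow> 'n set \<Rightarrow> 'a" where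
  "km x y H = (\<Sum>F\<in>Pow H. sg F (H - F) * x F * y (H - F))"

text \<open>The involution by the parity of the homological degree, which carries the signs of the
  graded Leibniz rule.\<close>

definition kbar :: "('n set \<Rightarrow> 'a::comm_ring_1) \<Rightarrow> 'n set \<Rightarrow> 'a" where
  "kbar x F = (-1) ^ card F * x F"

lemma sg_Un_left: 
  fixes F G :: "'n::{finite,linorder} set"
  assumes "F \<inter> F' = {}" shows "sg (F \<union> F') G = (sg F G * sg F' G :: 'a::comm_ring_1)"
proof -
  have "{(i, j). i \<in> F \<union> F' \<and> j \<in> G \<and> j < i} = {(i, j). i \<in> F \<and> j \<in> G \<and> j < i} \<union> {(i, j). i \<in> F' \<and> j \<in> G \<and> j < i}" by auto
  moreover have "card \<dots> = card {(i, j). i \<in> F \<and> j \<in> G \<and> j < i} + card {(i, j). i \<in> F' \<and> j \<in> G \<and> j < i}"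
    by (rule card_Un_disjoint) (use assms in \<open>auto intro: finite_subset[OF subset_UNIV]\<close>)
  ultimately show ?thesis by (simp add: sg_def power_add)
qed

lemma sg_Un_right: 
  fixes F G :: "'n::{finite,linorder} set"
  assumes "G \<inter> G' = {}" shows "sg F (G \<union> G') = (sg F G * sg F G' :: 'a::comm_ring_1)"
proof -
  have "{(i, j). i \<in> F \<and> j \<in> G \<union> G' \<and> j < i} = {(i, j). i \<in> F \<and> j \<in> G \<and> j < i} \<union> {(i, j). i \<in> F \<and> j \<in> G' \<and> j < i}" by auto
  moreover have "card \<dots> = card {(i, j). i \<in> F \<and> j \<in> G \<and> j < i} + card {(i, j). i \<in> F \<and> j \<in> G' \<and> j < i}"
    by (rule card_Un_disjoint) (use assms in \<open>auto intro: finite_subset[OF subset_UNIV]\<close>)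
  ultimately show ?thesis by (simp add: sg_def power_add)
qed

lemma sg_insert_left: "i \<notin> F \<Longrightarrow> sg (insert i F) G = (sg {i} G * sg F G :: 'a::comm_ring_1)"
  for F G :: "'n::{finite,linorder} set"
  using sg_Un_left[of "{i}" F G] by simp

lemma sg_insert_right: "i \<notin> G \<Longrightarrow> sg F (insert i G) = (sg F {i} * sg F G :: 'a::comm_ring_1)"
  for F G :: "'n::{finite,linorder} set"
  using sg_Un_right[of "{i}" G F] by simp

lemma sg_split: "F \<subseteq> H \<Longrightarrow> sg G H = (sg G F * sg G (H - F) :: 'a::comm_ring_1)"
  for F G H :: "'n::{finite,linorder} set"
  using sg_Un_right[of F "H - F" G] by (simp add: Un_absorb1)

lemma sg_sq: "sg F G * sg F G = (1 :: 'a::comm_ring_1)"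
  by (simp add: sg_def power_add[symmetric] flip: mult_2)

lemma sg_sq': "sg F G * (sg F G * x) = (x :: 'a::comm_ring_1)"
  by (simp add: sg_sq mult.assoc[symmetric])

lemma sg_empty: "sg {} G = 1" "sg F {} = 1" by (simp_all add: sg_def)

lemma sg_singletons: "sg {i} {j} = (if j < i then -1 else 1)"
proof -
  have "{(a, b). a \<in> {i} \<and> b \<in> {j} \<and> b < a} = (if j < i then {(i, j)} else {})" by auto
  then show ?thesis by (simp add: sg_def)
qed

lemma sg_anti: "i \<noteq> j \<Longrightarrow> sg {i} {j} * sg {j} {i} = (-1 :: 'a::comm_ring_1)"
  by (auto simp: sg_singletons)

lemma sg_flip: "i \<notin> F \<Longrightarrow> sg {i} F * sg F {i} = ((-1) ^ card F :: 'a::comm_ring_1)"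
  for F :: "'n::{finite,linorder} set"
proof (induction F rule: finite_induct[OF finite])
  case (2 j F)
  then have j: "j \<notin> F" and ij: "i \<noteq> j" and ih: "sg {i} F * sg F {i} = ((-1) ^ card F :: 'a)" by auto
  have "sg {i} (insert j F) * sg (insert j F) {i} = (sg {i} {j} * sg {j} {i}) * (sg {i} F * sg F {i} :: 'a)"
    by (simp add: sg_insert_left[OF j] sg_insert_right[OF j] mult_ac)
  then show ?case unfolding ih sg_anti[OF ij] using j by simp
qed (simp add: sg_empty)

lemma sg_flip_gen: "F \<inter> G = {} \<Longrightarrow> sg F G * sg G F = ((-1) ^ (card F * card G) :: 'a::comm_ring_1)"
  for F :: "'n::{finite,linorder} set"
proof (induction F rule: finite_induct[OF finite])
  case (2 j F)
  then have j: "j \<notin> F" "j \<notin> G" and ih: "sg F G * sg G F = ((-1) ^ (card F * card G) :: 'a)" by auto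
  have "sg (insert j F) G * sg G (insert j F) = (sg {j} G * sg G {j}) * (sg F G * sg G F :: 'a)"
    by (simp add: sg_insert_left[OF j(1)] sg_insert_right[OF j(1)] mult_ac)
  then show ?case unfolding ih sg_flip[OF j(2)] using j by (simp add: power_add)
qed (simp add: sg_empty)

text \<open>The pairs with \<open>i < j\<close> cancel those with \<open>j < i\<close>. Splitting by
  the order avoids a division by two, so that characteristic two is covered.\<close>

lemma sum_antisym_zero:
  fixes f :: "'n::linorder \<Rightarrow> 'n \<Rightarrow> 'a::comm_ring_1"
  assumes "finite A" and "\<And>i j. i \<in> A \<Longrightarrow> j \<in> A \<Longrightarrow> i \<noteq> j \<Longrightarrow> f i j = - f j i"
  shows "(\<Sum>i\<in>A. \<Sum>j\<in>A - {i}. f i j) = 0"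
proof -
  have "(\<Sum>i\<in>A. \<Sum>j\<in>A - {i}. f i j) = (\<Sum>(i, j)\<in>(SIGMA i:A. A - {i}). f i j)"
    using assms(1) by (subst sum.Sigma) auto
  also have "(SIGMA i:A. A - {i}) = {(i, j) \<in> A \<times> A. i < j} \<union> {(i, j) \<in> A \<times> A. j < i}" by auto
  also have "(\<Sum>(i, j)\<in>\<dots>. f i j) = (\<Sum>(i, j)\<in>{(i, j) \<in> A \<times> A. i < j}. f i j) + (\<Sum>(i, j)\<in>{(i, j) \<in> A \<times> A. j < i}. f i j)"
    by (rule sum.union_disjoint) (use assms(1) in \<open>auto intro: finite_subset[of _ "A \<times> A"]\<close>)
  also have "(\<Sum>(i, j)\<in>{(i, j) \<in> A \<times> A. j < i}. f i j) = (\<Sum>(i, j)\<in>{(i, j) \<in> A \<times> A. i < j}. f j i)"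
    by (rule sum.reindex_bij_witness[of _ prod.swap prod.swap]) auto
  also have "\<dots> = (\<Sum>(i, j)\<in>{(i, j) \<in> A \<times> A. i < j}. - f i j)"
    by (rule sum.cong) (use assms(2) in auto)
  finally show ?thesis by (simp add: sum_negf split_def)
qed

lemma kd_kd: "kd t (kd t x) = (\<lambda>F. 0)" for t :: "'n::{finite,linorder} \<Rightarrow> 'a::comm_ring_1"
proof
  fix F
  have "kd t (kd t x) F = (\<Sum>i\<in>-F. \<Sum>j\<in>-F - {i}. sg {i} F * t i * (sg {j} (insert i F) * t j * x (insert j (insert i F))))"
    unfolding kd_def sum_distrib_left by (rule sum.cong[OF refl], rule sum.cong) auto
  also have "\<dots> = 0"
  proof (rule sum_antisym_zero)
    fix i j assume ij: "i \<in> -F" "j \<in> -F" "i \<noteq> j"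
    have "sg {i} F * sg {j} (insert i F) = - (sg {j} F * sg {i} (insert j F) :: 'a)"
      using ij by (auto simp: sg_insert_right[of i F] sg_insert_right[of j F] sg_singletons)
    then have "(sg {i} F * sg {j} (insert i F)) * (t i * t j * x (insert j (insert i F))) 
       = - (sg {j} F * sg {i} (insert j F)) * (t i * t j * x (insert j (insert i F)))" by simp
    then show "sg {i} F * t i * (sg {j} (insert i F) * t j * x (insert j (insert i F))) =
          - (sg {j} F * t j * (sg {i} (insert j F) * t i * x (insert i (insert j F))))"
      by (simp add: insert_commute[of i j] mult_ac)
  qed simp
  finally show "kd t (kd t x) F = 0" .
qed

lemma sum_Pow_insert: 
  assumes "finite H" "i \<notin> H" 
  shows "(\<Sum>F\<in>Pow (insert i H). f F) = (\<Sum>F\<in>Pow H. f F) + (\<Sum>F\<in>Pow H. f (insert i F))"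
proof -
  have "inj_on (insert i) (Pow H)" using assms(2) by (auto simp: inj_on_def)
  moreover have "Pow H \<inter> insert i ` Pow H = {}" using assms(2) by auto
  ultimately show ?thesis unfolding Pow_insert using assms(1)
    by (subst sum.union_disjoint) (auto simp: sum.reindex)
qed

lemma leibniz: "kd t (km x y) H = km (kd t x) y H + km (kbar x) (kd t y) H"
  for x y :: "'n::{finite,linorder} set \<Rightarrow> 'a::comm_ring_1"
proof -
  \<comment> \<open>\<open>?B\<close> collects the terms in which the differential hits the left
    factor, \<open>?A\<close> those in which it hits the right one.\<close>
  let ?B = "\<lambda>F i. sg F (H - F) * (sg {i} F * t i * x (insert i F)) * y (H - F)"
  let ?A = "\<lambda>F i. sg F (H - F) * ((-1) ^ card F * x F) * (sg {i} (H - F) * t i * y (insert i (H - F)))"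
  have 1: "kd t (km x y) H = (\<Sum>i\<in>-H. \<Sum>F\<in>Pow H. ?A F i + ?B F i)"
    unfolding kd_def
  proof (rule sum.cong[OF refl])
    fix i assume i: "i \<in> - H"
    have "sg {i} H * t i * km x y (insert i H) = (\<Sum>F\<in>Pow H. sg {i} H * t i * (sg F (insert i H - F) * x F * y (insert i H - F)))
       + (\<Sum>F\<in>Pow H. sg {i} H * t i * (sg (insert i F) (insert i H - insert i F) * x (insert i F) * y (insert i H - insert i F)))"
      unfolding km_def using i by (subst sum_Pow_insert) (simp_all add: distrib_left sum_distrib_left)
    also have "(\<Sum>F\<in>Pow H. sg {i} H * t i * (sg F (insert i H - F) * x F * y (insert i H - F))) = (\<Sum>F\<in>Pow H. ?A F i)"
    proof (rule sum.cong[OF refl])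
      fix F assume F: "F \<in> Pow H"
      then have iF: "i \<notin> F" "i \<notin> H - F" "insert i H - F = insert i (H - F)" using i by auto
      have "sg {i} H * sg F (insert i (H - F)) = (sg {i} F * sg F {i}) * (sg {i} (H - F) * sg F (H - F) :: 'a)"
        using F iF sg_split[of F H "{i}", where 'a='a] by (simp add: sg_insert_right[of i "H - F"] mult_ac)
      also have "\<dots> = (-1) ^ card F * (sg {i} (H - F) * sg F (H - F))" by (simp only: sg_flip[OF iF(1)])
      finally have "(sg {i} H * sg F (insert i (H - F))) * (t i * x F * y (insert i (H - F))) 
         = ((-1) ^ card F * (sg {i} (H - F) * sg F (H - F))) * (t i * x F * y (insert i (H - F)))" by simp
      then show "sg {i} H * t i * (sg F (insert i H - F) * x F * y (insert i H - F)) = ?A F i"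
        unfolding iF(3) by (simp add: mult_ac)
    qed
    also have "(\<Sum>F\<in>Pow H. sg {i} H * t i * (sg (insert i F) (insert i H - insert i F) * x (insert i F) * y (insert i H - insert i F))) = (\<Sum>F\<in>Pow H. ?B F i)"
    proof (rule sum.cong[OF refl])
      fix F assume F: "F \<in> Pow H"
      then have iF: "i \<notin> F" "insert i H - insert i F = H - F" using i by auto
      have "sg {i} H * sg (insert i F) (H - F) = sg {i} F * (sg {i} (H - F) * (sg {i} (H - F) * sg F (H - F)) :: 'a)"
        using F iF sg_split[of F H "{i}", where 'a='a] by (simp add: sg_insert_left[of i F] mult_ac)
      also have "\<dots> = sg {i} F * sg F (H - F)" by (simp only: sg_sq')
      finally have "(sg {i} H * sg (insert i F) (H - F)) * (t i * x (insert i F) * y (H - F))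
          = (sg {i} F * sg F (H - F)) * (t i * x (insert i F) * y (H - F))" by simp
      then show "sg {i} H * t i * (sg (insert i F) (insert i H - insert i F) * x (insert i F) * y (insert i H - insert i F)) = ?B F i"
        unfolding iF(2) by (simp add: mult_ac)
    qed
    finally show "sg {i} H * t i * km x y (insert i H) = (\<Sum>F\<in>Pow H. ?A F i + ?B F i)" by (simp add: sum.distrib)
  qed
  have 2: "km (kd t x) y H = (\<Sum>F\<in>Pow H. \<Sum>i\<in>-H. ?B F i) + (\<Sum>F\<in>Pow H. \<Sum>i\<in>H - F. ?B F i)"
  proof -
    have "km (kd t x) y H = (\<Sum>F\<in>Pow H. \<Sum>i\<in>-F. ?B F i)"
      unfolding km_def kd_def by (simp add: sum_distrib_left sum_distrib_right)
    also have "\<dots> = (\<Sum>F\<in>Pow H. (\<Sum>i\<in>-H. ?B F i) + (\<Sum>i\<in>H - F. ?B F i))"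
    proof (rule sum.cong[OF refl])
      fix F assume "F \<in> Pow H"
      then have "-F = -H \<union> (H - F)" by auto
      then show "(\<Sum>i\<in>-F. ?B F i) = (\<Sum>i\<in>-H. ?B F i) + (\<Sum>i\<in>H - F. ?B F i)"
        by (simp only:) (rule sum.union_disjoint, auto)
    qed
    finally show ?thesis by (simp add: sum.distrib)
  qed
  have 3: "km (kbar x) (kd t y) H = (\<Sum>F\<in>Pow H. \<Sum>i\<in>-H. ?A F i) + (\<Sum>F\<in>Pow H. \<Sum>i\<in>F. ?A F i)"
  proof -
    have "km (kbar x) (kd t y) H = (\<Sum>F\<in>Pow H. \<Sum>i\<in>-(H - F). ?A F i)"
      unfolding km_def kd_def kbar_def by (simp add: sum_distrib_left)
    also have "\<dots> = (\<Sum>F\<in>Pow H. (\<Sum>i\<in>-H. ?A F i) + (\<Sum>i\<in>F. ?A F i))"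
    proof (rule sum.cong[OF refl])
      fix F assume "F \<in> Pow H"
      then have "-(H - F) = -H \<union> F" "-H \<inter> F = {}" by auto
      then show "(\<Sum>i\<in>-(H - F). ?A F i) = (\<Sum>i\<in>-H. ?A F i) + (\<Sum>i\<in>F. ?A F i)"
        by (simp only:) (rule sum.union_disjoint, auto)
    qed
    finally show ?thesis by (simp add: sum.distrib)
  qed
  \<comment> \<open>In these terms \<open>i\<close> lies in \<open>H\<close> and would occur in both
    factors of the product. They belong to the right-hand side only and cancel in pairs when
    \<open>i\<close> is moved from one factor to the other.\<close>
  have 4: "(\<Sum>F\<in>Pow H. \<Sum>i\<in>H - F. ?B F i) = - (\<Sum>F\<in>Pow H. \<Sum>i\<in>F. ?A F i)"
  proof -
    have "(\<Sum>F\<in>Pow H. \<Sum>i\<in>H - F. ?B F i) = (\<Sum>(F, i)\<in>(SIGMA F:Pow H. H - F). ?B F i)"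
      by (subst sum.Sigma) auto
    also have "\<dots> = (\<Sum>(F, i)\<in>(SIGMA F:Pow H. F). - ?A F i)"
    proof (rule sum.reindex_bij_witness[of _ "\<lambda>(F, i). (F - {i}, i)" "\<lambda>(F, i). (insert i F, i)"])
      fix p assume "p \<in> (SIGMA F:Pow H. H - F)"
      then obtain F i where p: "p = (F, i)" and F: "F \<subseteq> H" and i: "i \<in> H" "i \<notin> F" by auto
      let ?G = "H - insert i F"
      have HF: "H - F = insert i ?G" "i \<notin> ?G" using i by auto
      have "sg F (H - F) * sg {i} F = (sg {i} F * sg F {i}) * sg F ?G" using HF(2) unfolding HF(1) by (simp add: sg_insert_right[of i ?G] mult_ac)
      also have "\<dots> = (-1) ^ card F * sg F ?G" by (simp only: sg_flip[OF i(2)])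
      also have "\<dots> = (-1) ^ card F * (sg {i} ?G * (sg {i} ?G * sg F ?G))" by (simp only: sg_sq')
      also have "\<dots> = - (sg (insert i F) ?G * (-1) ^ card (insert i F) * sg {i} ?G)"
        using i(2) by (simp add: sg_insert_left[of i F] mult_ac)
      finally have s: "sg F (H - F) * sg {i} F = - (sg (insert i F) ?G * (-1) ^ card (insert i F) * sg {i} ?G :: 'a)" .
      have "?B F i = (sg F (H - F) * sg {i} F) * (t i * x (insert i F) * y (H - F))" by (simp add: mult_ac)
      also have "\<dots> = - ?A (insert i F) i" unfolding s using HF(1) by (simp add: mult_ac)
      finally show "(case (case p of (F, i) \<Rightarrow> (insert i F, i)) of (F, i) \<Rightarrow> - ?A F i) = (case p of (F, i) \<Rightarrow> ?B F i)"
        unfolding p by simp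
    qed auto
    also have "\<dots> = - (\<Sum>F\<in>Pow H. \<Sum>i\<in>F. ?A F i)"
      by (subst sum.Sigma) (auto simp: sum_negf split_def)
    finally show ?thesis .
  qed
  have "(\<Sum>i\<in>-H. \<Sum>F\<in>Pow H. ?A F i + ?B F i) = (\<Sum>F\<in>Pow H. \<Sum>i\<in>-H. ?A F i) + (\<Sum>F\<in>Pow H. \<Sum>i\<in>-H. ?B F i)"
    by (simp only: sum.distrib sum.swap[of _ "Pow H" "-H"])
  then show ?thesis unfolding 1 2 3 4 by simp
qed

text \<open>Both sides run over the ordered partitions of \<open>H\<close> into three parts, once as
  chains \<open>G \<subseteq> F \<subseteq> H\<close> and once as pairs of disjoint sets.\<close>

lemma km_assoc: "km (km x y) z = km x (km y z)"
  for x y z :: "'n::{finite,linorder} set \<Rightarrow> 'a::comm_ring_1"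
proof
  fix H
  have "km (km x y) z H = (\<Sum>F\<in>Pow H. \<Sum>G\<in>Pow F. sg F (H - F) * sg G (F - G) * x G * y (F - G) * z (H - F))"
    unfolding km_def by (simp add: sum_distrib_left sum_distrib_right mult_ac)
  also have "\<dots> = (\<Sum>(F, G)\<in>(SIGMA F:Pow H. Pow F). sg F (H - F) * sg G (F - G) * x G * y (F - G) * z (H - F))"
    by (subst sum.Sigma) auto
  also have "\<dots> = (\<Sum>(G, L)\<in>(SIGMA G:Pow H. Pow (H - G)). sg G (H - G) * sg L (H - G - L) * x G * y L * z (H - G - L))"
  proof (rule sum.reindex_bij_witness[of _ "\<lambda>(G, L). (G \<union> L, G)" "\<lambda>(F, G). (G, F - G)"])
    fix p assume "p \<in> (SIGMA F:Pow H. Pow F)"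
    then obtain F G where p: "p = (F, G)" and F: "F \<subseteq> H" "G \<subseteq> F" by auto
    have d: "H - G - (F - G) = H - F" "G \<union> (F - G) = F" "H - G = (F - G) \<union> (H - F)" using F by auto
    have s: "sg F (H - F) = sg G (H - F) * (sg (F - G) (H - F) :: 'a)" using sg_Un_left[of G "F - G" "H - F"] d by auto
    have s2: "sg G (H - G) = sg G (F - G) * (sg G (H - F) :: 'a)" unfolding d(3) using F by (intro sg_Un_right) auto
    have "sg G (H - G) * sg (F - G) (H - F) = sg F (H - F) * (sg G (F - G) :: 'a)" unfolding s s2 by (simp add: mult_ac)
    then show "(case (case p of (F, G) \<Rightarrow> (G, F - G)) of (G, L) \<Rightarrow> sg G (H - G) * sg L (H - G - L) * x G * y L * z (H - G - L)) =
        (case p of (F, G) \<Rightarrow> sg F (H - F) * sg G (F - G) * x G * y (F - G) * z (H - F))"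
      unfolding p by (simp add: d(1))
  qed auto
  also have "\<dots> = (\<Sum>G\<in>Pow H. \<Sum>L\<in>Pow (H - G). sg G (H - G) * sg L (H - G - L) * x G * y L * z (H - G - L))"
    by (subst sum.Sigma) auto
  also have "\<dots> = km x (km y z) H"
    unfolding km_def by (simp add: sum_distrib_left mult_ac)
  finally show "km (km x y) z H = km x (km y z) H" .
qed

lemma kd_add: "kd t (\<lambda>F. x F + y F) = (\<lambda>F. kd t x F + kd t y F)"
  by (auto simp: kd_def fun_eq_iff distrib_left sum.distrib)

lemma kd_smult: "kd t (\<lambda>F. c * x F) = (\<lambda>F. c * kd t x F)"
  by (auto simp: kd_def fun_eq_iff sum_distrib_left mult_ac)

lemma kd_zero: "kd t (\<lambda>F. 0) = (\<lambda>F. 0)" by (simp add: kd_def fun_eq_iff)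

lemma kd_diff: "kd t (\<lambda>F. x F - y F) = (\<lambda>F. kd t x F - kd t y F)"
  by (auto simp: kd_def fun_eq_iff right_diff_distrib sum_subtractf)

lemma kd_sum: "kd t (\<lambda>F. \<Sum>i\<in>S. x i F) = (\<lambda>F. \<Sum>i\<in>S. kd t (x i) F)"
  by (induction S rule: infinite_finite_induct) (auto simp: kd_zero kd_add)

lemma km_add_left: "km (\<lambda>F. x F + x' F) y = (\<lambda>F. km x y F + km x' y F)"
  by (auto simp: km_def fun_eq_iff distrib_left distrib_right sum.distrib)

lemma km_add_right: "km x (\<lambda>F. y F + y' F) = (\<lambda>F. km x y F + km x y' F)"
  by (auto simp: km_def fun_eq_iff distrib_left sum.distrib)

lemma km_smult_left: "km (\<lambda>F. c * x F) y = (\<lambda>F. c * km x y F)"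
  by (auto simp: km_def fun_eq_iff sum_distrib_left mult_ac)

lemma km_smult_right: "km x (\<lambda>F. c * y F) = (\<lambda>F. c * km x y F)"
  by (auto simp: km_def fun_eq_iff sum_distrib_left mult_ac)

lemma km_zero: "km (\<lambda>F. 0) y = (\<lambda>F. 0)" "km x (\<lambda>F. 0) = (\<lambda>F. 0)" by (simp_all add: km_def fun_eq_iff)

lemma km_diff_left: "km (\<lambda>F. x F - x' F) y = (\<lambda>F. km x y F - km x' y F)"
  using km_add_left[of x "\<lambda>F. -1 * x' F" y] km_smult_left[of "-1" x' y] by simp

lemma km_diff_right: "km x (\<lambda>F. y F - y' F) = (\<lambda>F. km x y F - km x y' F)"
  using km_add_right[of x y "\<lambda>F. -1 * y' F"] km_smult_right[of x "-1" y'] by simp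

lemma km_sum_left: "km (\<lambda>F. \<Sum>i\<in>S. x i F) y = (\<lambda>F. \<Sum>i\<in>S. km (x i) y F)"
  by (induction S rule: infinite_finite_induct) (auto simp: km_zero km_add_left)

lemma km_sum_right: "km x (\<lambda>F. \<Sum>i\<in>S. y i F) = (\<lambda>F. \<Sum>i\<in>S. km x (y i) F)"
  by (induction S rule: infinite_finite_induct) (auto simp: km_zero km_add_right)

lemma km_one: "km (\<lambda>F. if F = {} then c else 0) y = (\<lambda>F. c * y F)"
proof
  fix H
  have "km (\<lambda>F. if F = {} then c else 0) y H = (\<Sum>F\<in>{{}}. sg F (H - F) * c * y (H - F))"
    unfolding km_def by (rule sum.mono_neutral_cong_right) (auto split: if_splits)
  then show "km (\<lambda>F. if F = {} then c else 0) y H = c * y H" by (simp add: sg_empty)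
qed

lemma kbar_kbar: "kbar (kbar x) = x"
  by (auto simp: kbar_def fun_eq_iff mult.assoc[symmetric] power_add[symmetric] simp flip: mult_2)

lemma kbar_lin: "kbar (\<lambda>F. x F + y F) = (\<lambda>F. kbar x F + kbar y F)" "kbar (\<lambda>F. c * x F) = (\<lambda>F. c * kbar x F)"
  "kbar (\<lambda>F. 0) = (\<lambda>F. 0)" "kbar (\<lambda>F. x F - y F) = (\<lambda>F. kbar x F - kbar y F)"
  by (auto simp: kbar_def fun_eq_iff algebra_simps)

lemma kbar_sum: "kbar (\<lambda>F. \<Sum>i\<in>S. x i F) = (\<lambda>F. \<Sum>i\<in>S. kbar (x i) F)"
  by (auto simp: kbar_def fun_eq_iff sum_distrib_left)

lemma kd_kbar: "kd t (kbar x) = (\<lambda>F. - kbar (kd t x) F)"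
  by (auto simp: kbar_def kd_def fun_eq_iff sum_distrib_left sum_negf[symmetric] mult_ac intro!: sum.cong)

lemma kbar_km: "kbar (km x y) = km (kbar x) (kbar y)" for x y :: "'n::{finite,linorder} set \<Rightarrow> 'a::comm_ring_1"
proof
  fix H :: "'n set"
  have "(-1) ^ card H = (-1) ^ card F * ((-1) ^ card (H - F) :: 'a)" if "F \<in> Pow H" for F
    using that card_mono[OF finite, of F H] by (simp add: power_add[symmetric] card_Diff_subset)
  then show "kbar (km x y) H = km (kbar x) (kbar y) H"
    unfolding kbar_def km_def sum_distrib_left by (intro sum.cong) (auto simp: mult_ac)
qed

definition KM :: "nat \<Rightarrow> ('n set \<Rightarrow> 'a::zero) set" where "KM i = {x. \<forall>F. card F \<noteq> i \<longrightarrow> x F = 0}"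

lemma kd_KM: "x \<in> KM (Suc i) \<Longrightarrow> kd t x \<in> KM i" for x :: "'n::{finite,linorder} set \<Rightarrow> 'a::comm_ring_1"
  by (auto simp: KM_def kd_def intro!: sum.neutral)

lemma kd_KM0: "x \<in> KM 0 \<Longrightarrow> kd t x = (\<lambda>F. 0)" for x :: "'n::{finite,linorder} set \<Rightarrow> 'a::comm_ring_1"
  by (auto simp: KM_def kd_def fun_eq_iff intro!: sum.neutral)

lemma km_KM: "x \<in> KM i \<Longrightarrow> y \<in> KM j \<Longrightarrow> km x y \<in> KM (i + j)" for x :: "'n::{finite,linorder} set \<Rightarrow> 'a::comm_ring_1"
proof -
  assume x: "x \<in> KM i" and y: "y \<in> KM j"
  have "sg F (H - F) * x F * y (H - F) = 0" if "F \<in> Pow H" "card H \<noteq> i + j" for F H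
  proof (cases "card F = i")
    case True
    then have "card (H - F) \<noteq> j" using that card_mono[OF finite, of F H] by (auto simp: card_Diff_subset)
    then show ?thesis using y by (simp add: KM_def)
  qed (use x in \<open>simp add: KM_def\<close>)
  then show ?thesis by (auto simp: KM_def km_def intro!: sum.neutral)
qed

lemma kbar_KM: "x \<in> KM i \<Longrightarrow> kbar x = (\<lambda>F. (-1) ^ i * x F)"
  by (auto simp: KM_def kbar_def fun_eq_iff)

lemma kbar_mem_KM: "x \<in> KM i \<Longrightarrow> kbar x \<in> KM i"
  by (auto simp: KM_def kbar_def)

lemma KM_large: "x \<in> KM i \<Longrightarrow> i > CARD('n) \<Longrightarrow> x = (\<lambda>F. 0)" for x :: "'n::finite set \<Rightarrow> 'a::zero"
  unfolding KM_def by (auto simp: fun_eq_iff) (metis card_mono finite leD subset_UNIV)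

lemma km_commute: 
  fixes x y :: "'n::{finite,linorder} set \<Rightarrow> 'a::comm_ring_1"
  assumes x: "x \<in> KM i" and y: "y \<in> KM j" shows "km x y = (\<lambda>F. (-1) ^ (i * j) * km y x F)"
proof
  fix H
  have "km x y H = (\<Sum>F\<in>Pow H. sg (H - F) F * x (H - F) * y F)"
    unfolding km_def by (rule sum.reindex_bij_witness[of _ "\<lambda>F. H - F" "\<lambda>F. H - F"]) (auto simp: double_diff)
  also have "\<dots> = (\<Sum>F\<in>Pow H. (-1) ^ (i * j) * (sg F (H - F) * y F * x (H - F)))"
  proof (rule sum.cong[OF refl])
    fix F assume "F \<in> Pow H"
    have s: "sg (H - F) F = ((-1) ^ (card (H - F) * card F) * sg F (H - F) :: 'a)"
    proof -
      have "sg (H - F) F = (sg (H - F) F * sg F (H - F)) * (sg F (H - F) :: 'a)" by (simp add: sg_sq mult.assoc)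
      moreover have "(H - F) \<inter> F = {}" by auto
      ultimately show ?thesis using sg_flip_gen[of "H - F" F, where 'a='a] by simp
    qed
    show "sg (H - F) F * x (H - F) * y F = (-1) ^ (i * j) * (sg F (H - F) * y F * x (H - F))"
    proof (cases "card (H - F) = i \<and> card F = j")
      case True then show ?thesis unfolding s by (simp add: mult_ac)
    next
      case False
      then have "x (H - F) * y F = 0" using x y by (auto simp: KM_def)
      then show ?thesis by (simp add: mult.assoc mult.commute[of "y F"])
    qed
  qed
  finally show "km x y H = (-1) ^ (i * j) * km y x H" by (simp add: km_def sum_distrib_left)
qed

lemma kd_ideal: "is_ideal I \<Longrightarrow> (\<And>F. x F \<in> I) \<Longrightarrow> kd t x F \<in> I"
  unfolding kd_def by (auto intro!: idl.subspace_sum idl.subspace_scale)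

lemma km_ideal_left: "is_ideal I \<Longrightarrow> (\<And>F. x F \<in> I) \<Longrightarrow> km x y F \<in> I"
  unfolding km_def mult.commute[of _ "y _"] by (auto intro!: idl.subspace_sum idl.subspace_scale)

lemma km_ideal_right: "is_ideal I \<Longrightarrow> (\<And>F. y F \<in> I) \<Longrightarrow> km x y F \<in> I"
  unfolding km_def by (auto intro!: idl.subspace_sum idl.subspace_scale)

lemma kbar_ideal: "is_ideal I \<Longrightarrow> (\<And>F. x F \<in> I) \<Longrightarrow> kbar x F \<in> I"
  unfolding kbar_def by (auto intro!: idl.subspace_scale)

section \<open>Monomial ideals and the multigrading\<close>

abbreviation lk where "lk \<equiv> Poly_Mapping.lookup"
abbreviation ks where "ks \<equiv> Poly_Mapping.keys"
abbreviation one_at :: "'n \<Rightarrow> 'n \<Rightarrow>\<^sub>0 nat" where "one_at i \<equiv> Poly_Mapping.single i 1"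

definition upset :: "('n \<Rightarrow>\<^sub>0 nat) set \<Rightarrow> bool" where "upset E \<longleftrightarrow> (\<forall>m\<in>E. \<forall>d. m + d \<in> E)"

text \<open>A monomial ideal is encoded by the exponents of its monomials. Membership becomes a
  condition on each term, and inclusions, products and colons turn into statements about exponent
  sets.\<close>

definition Mid :: "('n \<Rightarrow>\<^sub>0 nat) set \<Rightarrow> ('n::finite, 'k::field) mpoly set" where
  "Mid E = {f. ks f \<subseteq> E}"

lemma Mid_ideal: assumes "upset E" shows "is_ideal (Mid E :: ('n::finite, 'k::field) mpoly set)"
  unfolding idl.subspace_def
proof (intro conjI ballI allI)
  fix f g :: "('n, 'k) mpoly" assume "f \<in> Mid E" "g \<in> Mid E"
  then show "f + g \<in> Mid E" using keys_add[of f g] by (auto simp: Mid_def)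
next
  fix c f :: "('n, 'k) mpoly" assume f: "f \<in> Mid E"
  have "ks (c * f) \<subseteq> {a + b | a b. a \<in> ks c \<and> b \<in> ks f}" by (rule keys_mult)
  also have "\<dots> \<subseteq> E" using f assms by (auto simp: Mid_def upset_def) (metis add.commute subsetD)
  finally show "c * f \<in> Mid E" by (simp add: Mid_def)
qed (simp add: Mid_def)

lemma single_Mid: "Poly_Mapping.single m c \<in> Mid E \<longleftrightarrow> c = 0 \<or> m \<in> E"
  by (auto simp: Mid_def)

text \<open>The exponent of the squarefree monomial with variables \<open>F\<close>, which is the
  multidegree of the exterior basis element of \<open>F\<close>.\<close>

definition ind :: "'n::finite set \<Rightarrow> 'n \<Rightarrow>\<^sub>0 nat" where "ind F = (\<Sum>i\<in>F. one_at i)"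

lemma lk_ind: "lk (ind F) i = (if i \<in> F then 1 else 0)"
proof -
  have "lk (ind F) i = (\<Sum>j\<in>F. lk (one_at j) i)" unfolding ind_def
    by (induction F rule: finite_induct[OF finite]) (auto simp: lookup_add)
  then show ?thesis by (simp add: lookup_single when_def sum.delta)
qed

lemma ind_insert: "i \<notin> F \<Longrightarrow> ind (insert i F) = one_at i + ind F"
  by (simp add: ind_def)

lemma ind_empty: "ind {} = 0" by (simp add: ind_def)

lemma ind_minus: assumes "F \<subseteq> ks a" shows "a - ind F + ind F = a"
proof (rule poly_mapping_eqI)
  fix i
  show "lk (a - ind F + ind F) i = lk a i"
    using assms by (auto simp: lookup_add lookup_minus lk_ind subset_iff in_keys_iff)
qed

lemma ind_plus_minus: "m + ind F - ind F = m" by simp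

lemma ind_keys: "F \<subseteq> ks (m + ind F)"
  by (auto simp: in_keys_iff lookup_add lk_ind)

lemma neg_pow_single: "(-1) ^ n * Poly_Mapping.single m c = (Poly_Mapping.single m ((-1) ^ n * c) :: ('n::finite, 'k::field) mpoly)"
  by (induction n) (auto simp: single_uminus mult.assoc)

lemma sg_single: "sg F G * Poly_Mapping.single m c = (Poly_Mapping.single m (sg F G * c) :: ('n::{finite,linorder}, 'k::field) mpoly)"
  unfolding sg_def by (rule neg_pow_single)

abbreviation kdv :: "('n::{finite,linorder} set \<Rightarrow> ('n, 'k::field) mpoly) \<Rightarrow> 'n set \<Rightarrow> ('n, 'k) mpoly" where
  "kdv \<equiv> kd mvar"

text \<open>Multigraded pieces: \<open>hm a c\<close> is the chain \<open>\<Sum> c F x\<^sup>a\<^sup>-\<^sup>F e\<^sub>F\<close>, \<open>sd\<close> is the Koszul differential in terms of the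
  coefficients, and \<open>cc a x\<close> are the coefficients of the piece of \<open>x\<close> in multidegree \<open>a\<close>.\<close>

definition hm :: "('n::finite \<Rightarrow>\<^sub>0 nat) \<Rightarrow> ('n set \<Rightarrow> 'k::field) \<Rightarrow> 'n set \<Rightarrow> ('n, 'k) mpoly" where
  "hm a c F = (if F \<subseteq> ks a then Poly_Mapping.single (a - ind F) (c F) else 0)"

definition sd :: "('n::{finite,linorder} \<Rightarrow>\<^sub>0 nat) \<Rightarrow> ('n set \<Rightarrow> 'k::field) \<Rightarrow> 'n set \<Rightarrow> 'k" where
  "sd a c F = (\<Sum>i\<in>ks a - F. sg {i} F * c (insert i F))"

lemma single_sum: "(\<Sum>i\<in>S. Poly_Mapping.single m (f i)) = Poly_Mapping.single m (\<Sum>i\<in>S. f i)"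
  by (induction S rule: infinite_finite_induct) (auto simp: single_add)

lemma kd_hm: "kdv (hm a c) = hm a (sd a c)" for a :: "'n::{finite,linorder} \<Rightarrow>\<^sub>0 nat"
proof
  fix F
  show "kdv (hm a c) F = hm a (sd a c) F"
  proof (cases "F \<subseteq> ks a")
    case True
    have "kdv (hm a c) F = (\<Sum>i\<in>ks a - F. sg {i} F * mvar i * hm a c (insert i F))"
      unfolding kd_def by (rule sum.mono_neutral_right) (auto simp: hm_def)
    also have "\<dots> = (\<Sum>i\<in>ks a - F. Poly_Mapping.single (a - ind F) (sg {i} F * c (insert i F)))"
    proof (rule sum.cong[OF refl])
      fix i assume i: "i \<in> ks a - F"
      then have s: "insert i F \<subseteq> ks a" using True by auto
      have "one_at i + (a - ind (insert i F)) + ind F = a"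
        using ind_minus[OF s] ind_insert[of i F] i by (simp add: ac_simps)
      then have e: "one_at i + (a - ind (insert i F)) = a - ind F" by (metis ind_plus_minus)
      have "mvar i * hm a c (insert i F) = Poly_Mapping.single (a - ind F) (c (insert i F))"
        using s e by (simp add: hm_def mvar_def monomial_def mult_single)
      then show "sg {i} F * mvar i * hm a c (insert i F) = Poly_Mapping.single (a - ind F) (sg {i} F * c (insert i F))"
        by (simp add: mult.assoc sg_single)
    qed
    finally show ?thesis using True by (simp add: hm_def sd_def single_sum)
  next
    case False
    then show ?thesis by (auto simp: kd_def hm_def intro!: sum.neutral)
  qed
qed

definition cc :: "('n::finite \<Rightarrow>\<^sub>0 nat) \<Rightarrow> ('n set \<Rightarrow> ('n, 'k::field) mpoly) \<Rightarrow> 'n set \<Rightarrow> 'k" where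
  "cc a x F = (if F \<subseteq> ks a then lk (x F) (a - ind F) else 0)"

definition degs :: "('n::finite set \<Rightarrow> ('n, 'k::field) mpoly) \<Rightarrow> ('n \<Rightarrow>\<^sub>0 nat) set" where
  "degs x = (\<Union>F. (\<lambda>m. m + ind F) ` ks (x F))"

lemma finite_degs: "finite (degs x)" by (auto simp: degs_def)

lemma lk_hm_cc: "lk (hm a (cc a x) F) m = (if m + ind F = a then lk (x F) m else 0)"
proof (cases "F \<subseteq> ks a")
  case True
  then have "a - ind F = m \<longleftrightarrow> m + ind F = a" using ind_minus[OF True] by auto
  then show ?thesis using True by (auto simp: hm_def cc_def lookup_single when_def)
next
  case False
  then have "m + ind F \<noteq> a" using ind_keys[of F m] by auto
  then show ?thesis using False by (simp add: hm_def)
qed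

lemma lk_sum: "lk (\<Sum>i\<in>S. f i) m = (\<Sum>i\<in>S. lk (f i) m)"
  by (induction S rule: infinite_finite_induct) (auto simp: lookup_add)

lemma decompose: "x F = (\<Sum>a\<in>degs x. hm a (cc a x) F)"
proof (rule poly_mapping_eqI)
  fix m
  have "lk (\<Sum>a\<in>degs x. hm a (cc a x) F) m = (\<Sum>a\<in>degs x. if a = m + ind F then lk (x F) m else 0)"
    by (simp add: lk_sum lk_hm_cc eq_commute)
  also have "\<dots> = (if m + ind F \<in> degs x then lk (x F) m else 0)" using finite_degs[of x] by (simp add: sum.delta)
  also have "\<dots> = lk (x F) m"
  proof (cases "m \<in> ks (x F)")
    case True
    then have "m + ind F \<in> degs x" by (auto simp: degs_def)
    then show ?thesis by simp
  qed (simp add: in_keys_iff)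
  finally show "lk (x F) m = lk (\<Sum>a\<in>degs x. hm a (cc a x) F) m" by simp
qed

lemma lk_mvar_mult: "lk (mvar i * p) m = (if i \<in> ks m then lk p (m - one_at i) else 0)" for p :: "('n::finite, 'k::field) mpoly"
proof (cases "i \<in> ks m")
  case True
  then have "one_at i + (m - one_at i) = m"
    by (intro poly_mapping_eqI) (auto simp: lookup_add lookup_minus lookup_single when_def in_keys_iff)
  then show ?thesis using True lookup_times_single[of "one_at i" 1 p "m - one_at i"] by (simp add: mvar_def monomial_def)
next
  case False
  have "m \<notin> ks (mvar i * p)"
  proof
    assume "m \<in> ks (mvar i * p)"
    then obtain m' where "m = one_at i + m'" using keys_times_single[of "one_at i" 1 p] by (auto simp: mvar_def monomial_def)
    then show False using False by (auto simp: in_keys_iff lookup_add)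
  qed
  then show ?thesis using False by (simp add: in_keys_iff)
qed

lemma lk_neg_pow: "lk ((-1) ^ n * p) m = (-1) ^ n * lk p m" for p :: "('n::finite, 'k::field) mpoly"
  by (induction n) (auto simp: lookup_uminus mult.assoc)

lemma lk_sg: "lk (sg F G * p) m = sg F G * lk p m" for p :: "('n::{finite,linorder}, 'k::field) mpoly"
  unfolding sg_def by (rule lk_neg_pow)

text \<open>Removing \<open>i\<close> from \<open>F\<close> is compensated by the factor
  \<open>mvar i\<close>, so multidegrees are preserved.\<close>

lemma cc_kd: "hm a (cc a (kdv x)) = kdv (hm a (cc a x))" for a :: "'n::{finite,linorder} \<Rightarrow>\<^sub>0 nat"
proof -
  have "cc a (kdv x) F = sd a (cc a x) F" if F: "F \<subseteq> ks a" for F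
  proof -
    have "cc a (kdv x) F = (\<Sum>i\<in>-F. sg {i} F * lk (mvar i * x (insert i F)) (a - ind F))"
      using F by (simp add: cc_def kd_def lk_sum mult.assoc lk_sg)
    also have "\<dots> = (\<Sum>i\<in>ks a - F. sg {i} F * lk (mvar i * x (insert i F)) (a - ind F))"
      by (rule sum.mono_neutral_right) (auto simp: lk_mvar_mult in_keys_iff lookup_minus)
    also have "\<dots> = sd a (cc a x) F" unfolding sd_def
    proof (rule sum.cong[OF refl])
      fix i assume i: "i \<in> ks a - F"
      have "a - ind F - one_at i = a - ind (insert i F)" using i by (simp add: ind_insert diff_diff_add add.commute)
      moreover have "i \<in> ks (a - ind F)" using i by (auto simp: in_keys_iff lookup_minus lk_ind)
      ultimately show "sg {i} F * lk (mvar i * x (insert i F)) (a - ind F) = sg {i} F * cc a x (insert i F)"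
        using i F by (simp add: lk_mvar_mult cc_def)
    qed
    finally show ?thesis .
  qed
  then have "hm a (cc a (kdv x)) = hm a (sd a (cc a x))" by (auto simp: hm_def fun_eq_iff)
  then show ?thesis by (simp add: kd_hm)
qed

text \<open>In multidegree \<open>a\<close> the Koszul complex is the augmented chain complex of the
  full simplex with vertices \<open>ks a\<close>; the cone with apex \<open>j\<close> contracts
  it.\<close>

lemma sd_exact:
  fixes a :: "'n::{finite,linorder} \<Rightarrow>\<^sub>0 nat"
  assumes j: "j \<in> ks a" and c: "\<And>F. F \<subseteq> ks a \<Longrightarrow> sd a c F = 0" and F: "F \<subseteq> ks a"
  shows "sd a (\<lambda>F. if j \<in> F then sg {j} (F - {j}) * c (F - {j}) else 0) F = (c F :: 'k::field)"
proof -
  let ?c = "\<lambda>F. if j \<in> F then sg {j} (F - {j}) * c (F - {j}) else 0"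
  show ?thesis
  proof (cases "j \<in> F")
    case False
    have "sd a ?c F = (\<Sum>i\<in>{j}. sg {i} F * ?c (insert i F))" unfolding sd_def
      by (rule sum.mono_neutral_right) (use False j in auto)
    then show ?thesis using False by (simp add: sg_sq')
  next
    case True
    let ?G = "F - {j}"
    have G: "F = insert j ?G" "j \<notin> ?G" using True by auto
    \<comment> \<open>The cycle condition at the face without \<open>j\<close> expresses
      \<open>c F\<close> by exactly the terms that the cone produces at \<open>F\<close>.\<close>
    have "0 = sd a c ?G" using c F by (simp add: subset_iff)
    also have "\<dots> = sg {j} ?G * c F + (\<Sum>i\<in>ks a - F. sg {i} ?G * c (insert i ?G))"
    proof -
      have "ks a - ?G = insert j (ks a - F)" using True j by auto
      then have "sd a c ?G = sg {j} ?G * c (insert j ?G) + (\<Sum>i\<in>ks a - F. sg {i} ?G * c (insert i ?G))"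
        unfolding sd_def using True by (simp add: sum.insert)
      then show ?thesis using G(1) by simp
    qed
    finally have e: "(\<Sum>i\<in>ks a - F. sg {i} ?G * c (insert i ?G)) = - (sg {j} ?G * c F)"
      by (simp add: eq_neg_iff_add_eq_0 add.commute)
    have "sd a ?c F = (\<Sum>i\<in>ks a - F. - sg {j} ?G * (sg {i} ?G * c (insert i ?G)))" unfolding sd_def
    proof (rule sum.cong[OF refl])
      fix i assume i: "i \<in> ks a - F"
      then have ij: "i \<noteq> j" "i \<notin> ?G" "insert i F - {j} = insert i ?G" using True by auto
      have "sg {i} F * sg {j} (insert i ?G) = (sg {i} {j} * sg {j} {i}) * (sg {i} ?G * sg {j} ?G :: 'k)"
      proof -
        have a: "sg {i} F = sg {i} {j} * (sg {i} ?G :: 'k)" by (subst G(1)) (rule sg_insert_right[OF G(2)])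
        have b: "sg {j} (insert i ?G) = sg {j} {i} * (sg {j} ?G :: 'k)" by (rule sg_insert_right[OF ij(2)])
        show ?thesis unfolding a b by (simp only: mult_ac)
      qed
      also have "\<dots> = - sg {j} ?G * sg {i} ?G" unfolding sg_anti[OF ij(1)] by simp
      finally have "(sg {i} F * sg {j} (insert i ?G)) * c (insert i ?G) = (- sg {j} ?G * sg {i} ?G) * c (insert i ?G)" by simp
      then show "sg {i} F * ?c (insert i F) = - sg {j} ?G * (sg {i} ?G * c (insert i ?G))"
        using True ij(3) by (simp add: mult.assoc)
    qed
    also have "\<dots> = - sg {j} ?G * (\<Sum>i\<in>ks a - F. sg {i} ?G * c (insert i ?G))" by (simp only: sum_distrib_left)
    also have "\<dots> = c F" unfolding e by (simp add: sg_sq')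
    finally show ?thesis .
  qed
qed

lemma hm_eq_iff: "hm a c = hm a c' \<longleftrightarrow> (\<forall>F\<subseteq>ks a. c F = c' F)"
  by (auto simp: hm_def fun_eq_iff inj_eq[OF inj_single])

lemma single_eq_0_iff: "Poly_Mapping.single m c = 0 \<longleftrightarrow> c = 0"
  by (metis lookup_single_eq lookup_zero single_zero)

lemma hm_zero_iff: "hm a c = (\<lambda>F. 0) \<longleftrightarrow> (\<forall>F\<subseteq>ks a. c F = 0)"
  by (auto simp: hm_def fun_eq_iff single_eq_0_iff)

lemma hm_exact:
  fixes a :: "'n::{finite,linorder} \<Rightarrow>\<^sub>0 nat"
  assumes "a \<noteq> 0" "kdv (hm a c) = (\<lambda>F. 0)" shows "\<exists>c'. hm a c = kdv (hm a c')"
proof -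
  obtain j where j: "j \<in> ks a" using assms(1) by fastforce
  have "sd a c F = 0" if "F \<subseteq> ks a" for F using assms(2) that unfolding kd_hm hm_zero_iff by blast
  from sd_exact[OF j this] show ?thesis 
    by (intro exI[of _ "\<lambda>F. if j \<in> F then sg {j} (F - {j}) * c (F - {j}) else 0"]) (simp add: kd_hm hm_eq_iff)
qed

text \<open>The equation is solved in each multidegree separately. Only \<open>a = 0\<close> offers
  no variable as an apex, and there the hypothesis on the constant term takes over.\<close>

lemma kd_exact:
  fixes x :: "'n::{finite,linorder} set \<Rightarrow> ('n, 'k::field) mpoly"
  assumes "kdv x = (\<lambda>F. 0)" "cst (x {}) = 0" shows "\<exists>y. x = kdv y"
proof -
  have "\<exists>c. hm a (cc a x) = kdv (hm a c)" for a
  proof (cases "a = 0")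
    case True
    have "hm a (cc a x) = (\<lambda>F. 0)" using assms(2) unfolding hm_zero_iff by (simp add: True cc_def ind_empty)
    moreover have "kdv (hm a (\<lambda>_. 0 :: 'k)) = (\<lambda>F. 0)"
    proof -
      have "hm a (\<lambda>_. 0) = (\<lambda>F. 0 :: ('n, 'k) mpoly)" by (simp add: hm_zero_iff)
      then show ?thesis by (simp only: kd_zero)
    qed
    ultimately have "hm a (cc a x) = kdv (hm a (\<lambda>_. 0))" by (simp only:)
    then show ?thesis by (rule exI[where x="\<lambda>_. 0"])
  next
    case False
    have "kdv (hm a (cc a x)) = (\<lambda>F. 0)" unfolding cc_kd[symmetric] assms(1) by (simp add: hm_zero_iff cc_def)
    then show ?thesis using hm_exact[OF False] by blast
  qed
  then obtain c where c: "\<And>a. hm a (cc a x) = kdv (hm a (c a))" by metis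
  have "x = (\<lambda>F. \<Sum>a\<in>degs x. kdv (hm a (c a)) F)" unfolding c[symmetric] using decompose[of x] by blast
  then have "x = kdv (\<lambda>F. \<Sum>a\<in>degs x. hm a (c a) F)" unfolding kd_sum .
  then show ?thesis by blast
qed

text \<open>Exactness by multidegrees ignores the homological degree; this projection cuts a
  bounding chain down to the right one.\<close>

definition trunc :: "nat \<Rightarrow> ('n set \<Rightarrow> 'a::zero) \<Rightarrow> 'n set \<Rightarrow> 'a" where
  "trunc i x F = (if card F = i then x F else 0)"

lemma trunc_KM: "trunc i x \<in> KM i" by (auto simp: trunc_def KM_def)

lemma trunc_id: "x \<in> KM i \<Longrightarrow> trunc i x = x" by (auto simp: trunc_def KM_def fun_eq_iff)

lemma trunc_kd: "kd t (trunc (Suc i) x) = trunc i (kd t x)" for x :: "'n::{finite,linorder} set \<Rightarrow> 'a::comm_ring_1"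
  by (auto simp: trunc_def kd_def fun_eq_iff intro!: sum.cong sum.neutral)

lemma kd_exact_KM:
  fixes x :: "'n::{finite,linorder} set \<Rightarrow> ('n, 'k::field) mpoly"
  assumes "x \<in> KM i" "kdv x = (\<lambda>F. 0)" "cst (x {}) = 0" shows "\<exists>y\<in>KM (Suc i). x = kdv y"
proof -
  obtain y where "x = kdv y" using kd_exact assms by blast
  then have "x = kdv (trunc (Suc i) y)" unfolding trunc_kd using trunc_id[OF assms(1)] by simp
  then show ?thesis using trunc_KM by blast
qed

lemma one_at_neq_0: "one_at i \<noteq> 0"
  by (metis lookup_single_eq lookup_zero zero_neq_one)

lemma cst_mvar: "cst (mvar i) = 0"
  using one_at_neq_0[of i] by (simp add: mvar_def monomial_def lookup_single when_def del: One_nat_def)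

lemma cst_kd: "cst (kdv x F) = 0"
  by (simp add: kd_def cst_sum cst_mult cst_mvar)

text \<open>Exactness in degree 0 in disguise: the coefficients that write \<open>p\<close> as a
  combination of the variables are packed into a Koszul chain.\<close>

lemma maximal_eq_kd: 
  fixes p :: "('n::{finite,linorder}, 'k::field) mpoly"
  assumes "cst p = 0" shows "\<exists>y\<in>KM 1. p = kdv y {}"
proof -
  let ?x = "\<lambda>F. if F = {} then p else 0"
  have "?x \<in> KM 0" by (auto simp: KM_def)
  moreover have "kdv ?x = (\<lambda>F. 0)" using \<open>?x \<in> KM 0\<close> by (rule kd_KM0)
  ultimately obtain y where "y \<in> KM (Suc 0)" "?x = kdv y" using kd_exact_KM[of ?x 0] assms by auto
  then show ?thesis by (intro bexI[of _ y]) (auto dest: fun_cong[of _ _ "{}"])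
qed

lemma hm_KM: "x \<in> KM i \<Longrightarrow> hm a (cc a x) \<in> KM i"
  by (auto simp: KM_def hm_def cc_def)

lemma hm_Mid: "(\<And>F. x F \<in> Mid E) \<Longrightarrow> hm a (cc a x) F \<in> Mid E"
proof -
  assume "\<And>F. x F \<in> Mid E"
  then have "a - ind F \<in> E" if "lk (x F) (a - ind F) \<noteq> 0" using that by (auto simp: Mid_def in_keys_iff subset_iff)
  then show ?thesis using single_Mid[of "a - ind F" "lk (x F) (a - ind F)" E] by (auto simp: hm_def cc_def Mid_def)
qed

section \<open>Golod's complex\<close>

text \<open>A letter counts one more than its homological degree, as in the bar construction. The
  shift is the exponent \<open>j + 1\<close> in the denominator of the Golod series.\<close>

definition wt :: "('l \<Rightarrow> nat) \<Rightarrow> 'l list \<Rightarrow> nat" where "wt dg w = (\<Sum>v\<leftarrow>w. Suc (dg v))"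

lemma wt_simps: "wt dg [] = 0" "wt dg (v # w) = Suc (dg v) + wt dg w" "wt dg (w @ w') = wt dg w + wt dg w'"
  by (auto simp: wt_def)

text \<open>The pairs label the basis, in degree \<open>n\<close>, of the exterior algebra tensored
  with the tensor algebra on shifted Koszul homology.\<close>

definition AX :: "'l set \<Rightarrow> ('l \<Rightarrow> nat) \<Rightarrow> nat \<Rightarrow> ('l list \<times> 'n set) set" where
  "AX L dg n = {(w, F). set w \<subseteq> L \<and> wt dg w + card F = n}"

definition sec :: "('l list \<times> 'n set \<Rightarrow> 'a) \<Rightarrow> 'l list \<Rightarrow> 'n set \<Rightarrow> 'a" where "sec x w = (\<lambda>F. x (w, F))"

text \<open>The letters are a basis \<open>z\<close> of Koszul homology in positive degrees, and \<open>g2 u v\<close> bounds the product of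
  two letters up to sign. The conditions are only required up to total degree \<open>N\<close>.\<close>

locale golod_complex =
  fixes I :: "('n::{finite,linorder}, 'k::field) mpoly set" and L :: "'l set" and dg :: "'l \<Rightarrow> nat"
    and z :: "'l \<Rightarrow> 'n set \<Rightarrow> ('n, 'k) mpoly" and g2 :: "'l \<Rightarrow> 'l \<Rightarrow> 'n set \<Rightarrow> ('n, 'k) mpoly" and N :: nat
  assumes ideal_I: "is_ideal I" and I_cst: "p \<in> I \<Longrightarrow> cst p = 0" and finL: "finite L"
    and z_KM: "v \<in> L \<Longrightarrow> z v \<in> KM (dg v)" and deg_pos: "v \<in> L \<Longrightarrow> dg v \<ge> 1" and z_cycle: "v \<in> L \<Longrightarrow> kdv (z v) F \<in> I"
    and z_min: "v \<in> L \<Longrightarrow> cst (z v F) = 0"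
    and z_span: "\<lbrakk>i \<ge> 1; x \<in> KM i; \<And>F. kdv x F \<in> I\<rbrakk> \<Longrightarrow> 
       \<exists>c. \<exists>y\<in>KM (Suc i). \<forall>F. x F - (\<Sum>v\<in>{v \<in> L. dg v = i}. mconst (c v) * z v F) - kdv y F \<in> I"
    and z_indep: "\<lbrakk>i \<ge> 1; y \<in> KM (Suc i); \<And>F. (\<Sum>v\<in>{v \<in> L. dg v = i}. mconst (c v) * z v F) - kdv y F \<in> I\<rbrakk> 
       \<Longrightarrow> \<forall>v\<in>{v \<in> L. dg v = i}. c v = 0"
    and g2_KM: "u \<in> L \<Longrightarrow> v \<in> L \<Longrightarrow> g2 u v \<in> KM (Suc (dg u + dg v))" and g2_min: "u \<in> L \<Longrightarrow> v \<in> L \<Longrightarrow> cst (g2 u v F) = 0"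
    and g2_eq: "u \<in> L \<Longrightarrow> v \<in> L \<Longrightarrow> wt dg [u, v] \<le> N \<Longrightarrow> kdv (g2 u v) F + km (kbar (z u)) (z v) F \<in> I"
    and g2_triple: "u \<in> L \<Longrightarrow> v \<in> L \<Longrightarrow> w \<in> L \<Longrightarrow> wt dg [u, v, w] \<le> N \<Longrightarrow> 
       km (kbar (g2 u v)) (z w) F + km (kbar (z u)) (g2 v w) F \<in> I"
    and g2_quad: "u \<in> L \<Longrightarrow> v \<in> L \<Longrightarrow> w \<in> L \<Longrightarrow> s \<in> L \<Longrightarrow> wt dg [u, v, w, s] \<le> N \<Longrightarrow> km (kbar (g2 u v)) (g2 w s) F \<in> I"
begin

lemmas I_0 = idl.subspace_0[OF ideal_I]
  and I_add = idl.subspace_add[OF ideal_I]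
  and I_mult = idl.subspace_scale[OF ideal_I]
  and I_diff = idl.subspace_diff[OF ideal_I]
  and I_sum = idl.subspace_sum[OF ideal_I]
  and I_neg = idl.subspace_neg[OF ideal_I]

text \<open>Words are shortened from the left, by one letter through \<open>z\<close> or by two
  through \<open>g2\<close>. Longer prefixes contribute nothing, which means that the higher Massey
  operations are taken to be zero; \<open>g2_triple\<close> and \<open>g2_quad\<close> are what a
  vanishing square of \<open>dX\<close> then demands.\<close>

definition dX :: "('l list \<times> 'n set \<Rightarrow> ('n, 'k) mpoly) \<Rightarrow> 'l list \<times> 'n set \<Rightarrow> ('n, 'k) mpoly" where
  "dX x = (\<lambda>(w, F). kdv (sec x w) F + (\<Sum>v\<in>L. km (kbar (sec x (v # w))) (z v) F)
     + (\<Sum>u\<in>L. \<Sum>v\<in>L. km (kbar (sec x (u # v # w))) (g2 u v) F))"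

abbreviation A :: "nat \<Rightarrow> ('l list \<times> 'n set) set" where "A \<equiv> AX L dg"

lemma dX_add: "dX (\<lambda>e. x e + y e) = (\<lambda>e. dX x e + dX y e)"
  by (auto simp: dX_def sec_def fun_eq_iff kd_add kbar_lin km_add_left sum.distrib)

lemma dX_smult: "dX (\<lambda>e. p * x e) = (\<lambda>e. p * dX x e)"
  by (auto simp: dX_def sec_def fun_eq_iff kd_smult kbar_lin km_smult_left sum_distrib_left distrib_left)

lemma dX_diff: "dX (\<lambda>e. x e - y e) = (\<lambda>e. dX x e - dX y e)"
  using dX_add[of x "\<lambda>e. (-1) * y e"] dX_smult[of "-1" y] by simp

lemma dX_zero: "dX (\<lambda>e. 0) = (\<lambda>e. 0)" using dX_smult[of 0 "\<lambda>e. 0"] by simp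

lemma dX_I: "(\<And>e. x e \<in> I) \<Longrightarrow> dX x e \<in> I"
  unfolding dX_def sec_def by (cases e) (auto intro!: I_add I_sum kd_ideal[OF ideal_I] km_ideal_left[OF ideal_I] kbar_ideal[OF ideal_I])

lemma dX_cst: "cst (dX x e) = 0"
proof -
  have "cst (km x (z v) F) = 0" if "v \<in> L" for x v F using z_min[OF that] by (simp add: km_def cst_sum cst_mult)
  moreover have "cst (km x (g2 u v) F) = 0" if "u \<in> L" "v \<in> L" for x u v F using g2_min[OF that] by (simp add: km_def cst_sum cst_mult)
  ultimately show ?thesis unfolding dX_def by (cases e) (simp add: cst_add cst_sum cst_kd)
qed

lemma sec_zero: "x \<in> XM A n \<Longrightarrow> \<not> (set w \<subseteq> L \<and> wt dg w \<le> n) \<Longrightarrow> sec x w = (\<lambda>F. 0)"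
  by (auto simp: XM_def AX_def sec_def fun_eq_iff)

lemma sec_KM: "x \<in> XM A n \<Longrightarrow> sec x w \<in> KM (n - wt dg w)"
proof -
  assume x: "x \<in> XM A n"
  have "x (w, F) = 0" if "card F \<noteq> n - wt dg w" for F
  proof -
    have "(w, F) \<notin> A n" using that by (auto simp: AX_def)
    then show ?thesis using x by (simp add: XM_def)
  qed
  then show ?thesis by (simp add: KM_def sec_def)
qed

lemma XM_I: "(\<And>w. set w \<subseteq> L \<Longrightarrow> wt dg w \<le> n \<Longrightarrow> sec x w \<in> KM (n - wt dg w)) \<Longrightarrow>
   (\<And>w. \<not> (set w \<subseteq> L \<and> wt dg w \<le> n) \<Longrightarrow> sec x w = (\<lambda>F. 0)) \<Longrightarrow> x \<in> XM A n"
proof -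
  assume a: "\<And>w. set w \<subseteq> L \<Longrightarrow> wt dg w \<le> n \<Longrightarrow> sec x w \<in> KM (n - wt dg w)"
    and b: "\<And>w. \<not> (set w \<subseteq> L \<and> wt dg w \<le> n) \<Longrightarrow> sec x w = (\<lambda>F. 0)"
  have "x (w, F) = 0" if "(w, F) \<notin> A n" for w F
  proof (cases "set w \<subseteq> L \<and> wt dg w \<le> n")
    case True
    then show ?thesis using a[of w] that by (auto simp: KM_def sec_def AX_def)
  qed (use b[of w] in \<open>auto simp: sec_def fun_eq_iff\<close>)
  then show ?thesis by (auto simp: XM_def)
qed

lemma KM_add: "x \<in> KM i \<Longrightarrow> y \<in> KM i \<Longrightarrow> (\<lambda>F. x F + y F) \<in> KM i" 
  and KM_sum: "(\<And>s. s \<in> S \<Longrightarrow> f s \<in> KM i) \<Longrightarrow> (\<lambda>F. \<Sum>s\<in>S. f s F) \<in> KM i"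
  and KM_zero: "(\<lambda>F. 0) \<in> KM i" for x y :: "'n set \<Rightarrow> ('n, 'k) mpoly" and f :: "'s \<Rightarrow> 'n set \<Rightarrow> ('n, 'k) mpoly"
  by (auto simp: KM_def)

lemma sec_dX: "sec (dX x) w = (\<lambda>F. kdv (sec x w) F + (\<Sum>v\<in>L. km (kbar (sec x (v # w))) (z v) F)
     + (\<Sum>u\<in>L. \<Sum>v\<in>L. km (kbar (sec x (u # v # w))) (g2 u v) F))"
  by (simp add: sec_def dX_def)

lemma dX_XM:
  assumes x: "x \<in> XM A (Suc n)" shows "dX x \<in> XM A n"
proof (rule XM_I)
  fix w assume w: "set w \<subseteq> L" "wt dg w \<le> n"
  have 1: "kdv (sec x w) \<in> KM (n - wt dg w)"
    using sec_KM[OF x, of w] w by (intro kd_KM) (simp add: Suc_diff_le)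
  have 2: "km (kbar (sec x (v # w))) (z v) \<in> KM (n - wt dg w)" if v: "v \<in> L" for v
  proof (cases "wt dg (v # w) \<le> Suc n")
    case True
    have "km (kbar (sec x (v # w))) (z v) \<in> KM ((Suc n - wt dg (v # w)) + dg v)"
      by (intro km_KM kbar_mem_KM sec_KM[OF x] z_KM v)
    moreover have "(Suc n - wt dg (v # w)) + dg v = n - wt dg w" using True by (simp add: wt_simps)
    ultimately show ?thesis by simp
  next
    case False then show ?thesis using sec_zero[OF x, of "v # w"] by (simp add: kbar_lin km_zero KM_zero)
  qed
  have 3: "km (kbar (sec x (u # v # w))) (g2 u v) \<in> KM (n - wt dg w)" if v: "u \<in> L" "v \<in> L" for u v
  proof (cases "wt dg (u # v # w) \<le> Suc n")
    case True
    have "km (kbar (sec x (u # v # w))) (g2 u v) \<in> KM ((Suc n - wt dg (u # v # w)) + Suc (dg u + dg v))"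
      by (intro km_KM kbar_mem_KM sec_KM[OF x] g2_KM v)
    moreover have "(Suc n - wt dg (u # v # w)) + Suc (dg u + dg v) = n - wt dg w" using True by (simp add: wt_simps)
    ultimately show ?thesis by simp
  next
    case False then show ?thesis using sec_zero[OF x, of "u # v # w"] by (simp add: kbar_lin km_zero KM_zero)
  qed
  show "sec (dX x) w \<in> KM (n - wt dg w)" unfolding sec_dX
    by (intro KM_add KM_sum 1 2 3)
next
  fix w assume w: "\<not> (set w \<subseteq> L \<and> wt dg w \<le> n)"
  have "sec x (v # w) = (\<lambda>F. 0)" if "v \<in> L" for v using w that by (intro sec_zero[OF x]) (auto simp: wt_simps)
  moreover have "sec x (u # v # w) = (\<lambda>F. 0)" if "v \<in> L" "u \<in> L" for u v using w that by (intro sec_zero[OF x]) (auto simp: wt_simps)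
  moreover have "kdv (sec x w) = (\<lambda>F. 0)"
  proof (cases "set w \<subseteq> L \<and> wt dg w = Suc n")
    case True
    then show ?thesis using sec_KM[OF x, of w] by (intro kd_KM0) simp
  next
    case False
    then have "sec x w = (\<lambda>F. 0)" using w by (intro sec_zero[OF x]) auto
    then show ?thesis by (simp add: kd_zero)
  qed
  ultimately show "sec (dX x) w = (\<lambda>F. 0)" unfolding sec_dX by (simp add: kbar_lin km_zero)
qed

lemma kd_km_bar: "kdv (km (kbar s) y) F = - km (kbar (kdv s)) y F + km s (kdv y) F"
proof -
  have "km (kdv (kbar s)) y = (\<lambda>F. - km (kbar (kdv s)) y F)"
    unfolding kd_kbar using km_smult_left[of "-1" "kbar (kdv s)" y] by simp
  then show ?thesis by (simp add: leibniz kbar_kbar)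
qed

text \<open>After expansion by the Leibniz rule and associativity, the terms containing a
  differentiated component of \<open>x\<close> cancel. The others are sorted by the length, one to
  four, of the prefix removed, and each group falls under one of the conditions on \<open>z\<close>
  and \<open>g2\<close>.\<close>

lemma dX_dX:
  assumes x: "x \<in> XM A n" and n: "n \<le> N" shows "dX (dX x) e \<in> I"
proof -
  obtain w F where e: "e = (w, F)" by (cases e)
  let ?s = "sec x"
  have kdD: "kdv (sec (dX x) w) F = 
     (\<Sum>v\<in>L. - km (kbar (kdv (?s (v # w)))) (z v) F + km (?s (v # w)) (kdv (z v)) F)
    + (\<Sum>u\<in>L. \<Sum>v\<in>L. - km (kbar (kdv (?s (u # v # w)))) (g2 u v) F + km (?s (u # v # w)) (kdv (g2 u v)) F)"
    unfolding sec_dX kd_add kd_sum kd_kd kd_km_bar by simp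
  have kb: "kbar (sec (dX x) w) = (\<lambda>F. kbar (kdv (?s w)) F + (\<Sum>v\<in>L. km (?s (v # w)) (kbar (z v)) F)
     + (\<Sum>u\<in>L. \<Sum>v\<in>L. km (?s (u # v # w)) (kbar (g2 u v)) F))" for w
    unfolding sec_dX kbar_lin kbar_sum kbar_km kbar_kbar ..
  have t1: "km (kbar (sec (dX x) (v # w))) (z v) F = km (kbar (kdv (?s (v # w)))) (z v) F
     + (\<Sum>u\<in>L. km (?s (u # v # w)) (km (kbar (z u)) (z v)) F)
     + (\<Sum>a\<in>L. \<Sum>b\<in>L. km (?s (a # b # v # w)) (km (kbar (g2 a b)) (z v)) F)" for v
    unfolding kb km_add_left km_sum_left km_assoc ..
  have t2: "km (kbar (sec (dX x) (u # v # w))) (g2 u v) F = km (kbar (kdv (?s (u # v # w)))) (g2 u v) F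
     + (\<Sum>a\<in>L. km (?s (a # u # v # w)) (km (kbar (z a)) (g2 u v)) F)
     + (\<Sum>a\<in>L. \<Sum>b\<in>L. km (?s (a # b # u # v # w)) (km (kbar (g2 a b)) (g2 u v)) F)" for u v
    unfolding kb km_add_left km_sum_left km_assoc ..
  let ?S1 = "\<Sum>v\<in>L. km (?s (v # w)) (kdv (z v)) F"
  let ?S2a = "\<Sum>u\<in>L. \<Sum>v\<in>L. km (?s (u # v # w)) (kdv (g2 u v)) F"
  let ?S2b = "\<Sum>u\<in>L. \<Sum>v\<in>L. km (?s (u # v # w)) (km (kbar (z u)) (z v)) F"
  let ?S3a = "\<Sum>a\<in>L. \<Sum>b\<in>L. \<Sum>v\<in>L. km (?s (a # b # v # w)) (km (kbar (g2 a b)) (z v)) F"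
  let ?S3b = "\<Sum>a\<in>L. \<Sum>b\<in>L. \<Sum>v\<in>L. km (?s (a # b # v # w)) (km (kbar (z a)) (g2 b v)) F"
  let ?S4 = "\<Sum>u\<in>L. \<Sum>v\<in>L. \<Sum>a\<in>L. \<Sum>b\<in>L. km (?s (a # b # u # v # w)) (km (kbar (g2 a b)) (g2 u v)) F"
  have sw2: "(\<Sum>v\<in>L. \<Sum>u\<in>L. km (?s (u # v # w)) (km (kbar (z u)) (z v)) F) = ?S2b" by (rule sum.swap)
  have sw3a: "(\<Sum>v\<in>L. \<Sum>a\<in>L. \<Sum>b\<in>L. km (?s (a # b # v # w)) (km (kbar (g2 a b)) (z v)) F) = ?S3a"
    by (subst sum.swap) (intro sum.cong refl sum.swap)
  have sw3b: "(\<Sum>u\<in>L. \<Sum>v\<in>L. \<Sum>a\<in>L. km (?s (a # u # v # w)) (km (kbar (z a)) (g2 u v)) F) = ?S3b"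
  proof -
    have "(\<Sum>u\<in>L. \<Sum>v\<in>L. \<Sum>a\<in>L. km (?s (a # u # v # w)) (km (kbar (z a)) (g2 u v)) F) =
      (\<Sum>u\<in>L. \<Sum>a\<in>L. \<Sum>v\<in>L. km (?s (a # u # v # w)) (km (kbar (z a)) (g2 u v)) F)"
      by (intro sum.cong refl sum.swap)
    also have "\<dots> = ?S3b" by (rule sum.swap)
    finally show ?thesis .
  qed
  have "dX (dX x) e = kdv (sec (dX x) w) F + (\<Sum>v\<in>L. km (kbar (sec (dX x) (v # w))) (z v) F)
     + (\<Sum>u\<in>L. \<Sum>v\<in>L. km (kbar (sec (dX x) (u # v # w))) (g2 u v) F)" unfolding e by (simp add: dX_def)
  also have "\<dots> = ?S1 + (?S2a + ?S2b) + (?S3a + ?S3b) + ?S4"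
    unfolding kdD t1 t2 sw2[symmetric] sw3a[symmetric] sw3b[symmetric] by (simp only: sum.distrib sum_negf) simp
  also have "\<dots> = ?S1 + (\<Sum>u\<in>L. \<Sum>v\<in>L. km (?s (u # v # w)) (\<lambda>F. kdv (g2 u v) F + km (kbar (z u)) (z v) F) F)
     + (\<Sum>a\<in>L. \<Sum>b\<in>L. \<Sum>v\<in>L. km (?s (a # b # v # w)) (\<lambda>F. km (kbar (g2 a b)) (z v) F + km (kbar (z a)) (g2 b v) F) F) + ?S4"
    by (simp only: km_add_right sum.distrib)
  also have "\<dots> \<in> I"
  proof -
    \<comment> \<open>A word on which \<open>x\<close> does not vanish has weight at most
      \<open>n \<le> N\<close>, so the conditions on \<open>g2\<close> are used only in the range
      where they are assumed.\<close>
    have small: "wt dg v \<le> N" if "sec x (v @ w) \<noteq> (\<lambda>F. 0)" for v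
      using sec_zero[OF x, of "v @ w"] that n by (auto simp: wt_simps)
    have *: "km (sec x (v @ w)) y F \<in> I" if "wt dg v \<le> N \<Longrightarrow> (\<And>F. y F \<in> I)" for v y
      using small[of v] that km_ideal_right[OF ideal_I, of y] by (cases "sec x (v @ w) = (\<lambda>F. 0)") (auto simp: km_zero I_0)
    have i1: "km (?s (v # w)) (kdv (z v)) F \<in> I" if "v \<in> L" for v
      using *[of "[v]"] z_cycle[OF that] by simp
    have i2: "km (?s (u # v # w)) (\<lambda>F. kdv (g2 u v) F + km (kbar (z u)) (z v) F) F \<in> I" if "u \<in> L" "v \<in> L" for u v
      using *[of "[u, v]"] g2_eq[OF that] by simp
    have i3: "km (?s (a # b # v # w)) (\<lambda>F. km (kbar (g2 a b)) (z v) F + km (kbar (z a)) (g2 b v) F) F \<in> I" 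
      if "a \<in> L" "b \<in> L" "v \<in> L" for a b v
      using *[of "[a, b, v]"] g2_triple[OF that] by simp
    have i4: "km (?s (a # b # u # v # w)) (km (kbar (g2 a b)) (g2 u v)) F \<in> I" if "a \<in> L" "b \<in> L" "u \<in> L" "v \<in> L" for a b u v
      using *[of "[a, b, u, v]"] g2_quad[OF that] by simp
    show ?thesis by (intro I_add I_sum i1 i2 i3 i4)
  qed
  finally show ?thesis .
qed

text \<open>Exactness is proved by splitting off the last letter of a word, which the differential does not touch
  unless the word has at most two letters.\<close>

definition glue :: "('n set \<Rightarrow> ('n, 'k) mpoly) \<Rightarrow> ('l \<Rightarrow> 'l list \<times> 'n set \<Rightarrow> ('n, 'k) mpoly) \<Rightarrow> 'l list \<times> 'n set \<Rightarrow> ('n, 'k) mpoly" where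
  "glue k H = (\<lambda>(w, F). if w = [] then k F else H (last w) (butlast w, F))"

lemma sec_glue: "sec (glue k H) [] = k" "sec (glue k H) (w @ [v]) = sec (H v) w"
  "sec (glue k H) [v] = sec (H v) []" "sec (glue k H) [u, v] = sec (H v) [u]"
  by (auto simp: sec_def glue_def)

lemma dX_snoc: "dX x (w @ [v], F) = dX (\<lambda>(w, F). x (w @ [v], F)) (w, F)"
  by (simp add: dX_def sec_def)

lemma dX_glue: "dX (glue k H) (w @ [v], F) = dX (H v) (w, F)"
proof -
  have "sec (glue k H) (a # w @ [v]) = sec (H v) (a # w)" for a
    using sec_glue(2)[of k H "a # w" v] by simp
  moreover have "sec (glue k H) (a # b # w @ [v]) = sec (H v) (a # b # w)" for a b
    using sec_glue(2)[of k H "a # b # w" v] by simp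
  ultimately show ?thesis by (simp add: dX_def sec_glue(2))
qed

lemma dX_glue_Nil: "dX (glue k H) ([], F) = kdv k F + (\<Sum>v\<in>L. km (kbar (sec (H v) [])) (z v) F) 
   + (\<Sum>u\<in>L. \<Sum>v\<in>L. km (kbar (sec (H v) [u])) (g2 u v) F)"
  by (simp add: dX_def sec_glue)

lemma glue_XM:
  assumes k: "k \<in> KM n" and H: "\<And>v. v \<in> L \<Longrightarrow> Suc (dg v) \<le> n \<Longrightarrow> H v \<in> XM A (n - Suc (dg v))"
    and H0: "\<And>v. \<not> (v \<in> L \<and> Suc (dg v) \<le> n) \<Longrightarrow> H v = (\<lambda>e. 0)"
  shows "glue k H \<in> XM A n"
proof (rule XM_I)
  fix w assume w: "set w \<subseteq> L" "wt dg w \<le> n"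
  show "sec (glue k H) w \<in> KM (n - wt dg w)"
  proof (cases w rule: rev_cases)
    case Nil then show ?thesis using k by (simp add: sec_glue wt_simps)
  next
    case (snoc w' v)
    then have v: "v \<in> L" "Suc (dg v) \<le> n" using w by (auto simp: wt_simps)
    have "sec (H v) w' \<in> KM (n - Suc (dg v) - wt dg w')" by (rule sec_KM[OF H[OF v]])
    then show ?thesis unfolding snoc sec_glue by (simp add: wt_simps diff_diff_add add.commute)
  qed
next
  fix w assume w: "\<not> (set w \<subseteq> L \<and> wt dg w \<le> n)"
  then obtain w' v where wv: "w = w' @ [v]" by (cases w rule: rev_cases) (auto simp: wt_simps)
  show "sec (glue k H) w = (\<lambda>F. 0)"
  proof (cases "v \<in> L \<and> Suc (dg v) \<le> n")
    case True
    then have "sec (H v) w' = (\<lambda>F. 0)" using w wv by (intro sec_zero[OF H]) (auto simp: wt_simps)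
    then show ?thesis by (simp add: wv sec_glue)
  next
    case False
    then show ?thesis by (simp add: wv sec_glue H0[OF False]) (simp add: sec_def)
  qed
qed

definition emb :: "('n set \<Rightarrow> ('n, 'k) mpoly) \<Rightarrow> 'l list \<times> 'n set \<Rightarrow> ('n, 'k) mpoly" where
  "emb k = (\<lambda>(w, F). if w = [] then k F else 0)"

lemma sec_emb: "sec (emb k) [] = k" "w \<noteq> [] \<Longrightarrow> sec (emb k) w = (\<lambda>F. 0)"
  by (auto simp: sec_def emb_def)

lemma emb_XM: "k \<in> KM n \<Longrightarrow> emb k \<in> XM A n"
  by (auto simp: XM_def AX_def emb_def KM_def wt_simps)

lemma dX_emb: "dX (emb k) (w, F) = (if w = [] then kdv k F else 0)"
  by (auto simp: dX_def sec_emb kbar_lin km_zero kd_zero)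

lemma dX_Nil_cong:
  assumes "\<And>v F. v \<in> L \<Longrightarrow> sec x [v] F - y v F \<in> I" "\<And>u v F. u \<in> L \<Longrightarrow> v \<in> L \<Longrightarrow> sec x [u, v] F \<in> I"
  shows "dX x ([], F) - (kdv (sec x []) F + (\<Sum>v\<in>L. km (kbar (y v)) (z v) F)) \<in> I"
proof -
  have 1: "km (kbar (sec x [v])) (z v) F - km (kbar (y v)) (z v) F \<in> I" if "v \<in> L" for v
  proof -
    have "km (kbar (\<lambda>F. sec x [v] F - y v F)) (z v) F \<in> I"
      by (intro km_ideal_left[OF ideal_I] kbar_ideal[OF ideal_I] assms that)
    then show ?thesis by (simp add: kbar_lin km_diff_left)
  qed
  have 2: "km (kbar (sec x [u, v])) (g2 u v) F \<in> I" if "u \<in> L" "v \<in> L" for u v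
    by (intro km_ideal_left[OF ideal_I] kbar_ideal[OF ideal_I] assms that)
  have "dX x ([], F) - (kdv (sec x []) F + (\<Sum>v\<in>L. km (kbar (y v)) (z v) F)) =
    (\<Sum>v\<in>L. km (kbar (sec x [v])) (z v) F - km (kbar (y v)) (z v) F) + (\<Sum>u\<in>L. \<Sum>v\<in>L. km (kbar (sec x [u, v])) (g2 u v) F)"
    by (simp add: dX_def sum_subtractf)
  also have "\<dots> \<in> I" by (intro I_add I_sum 1 2)
  finally show ?thesis .
qed

lemma I_cong: "p - q \<in> I \<Longrightarrow> p \<in> I \<longleftrightarrow> q \<in> I"
  using I_add[of "p - q" q] I_diff[of p "p - q"] by auto

lemma XM_add: "x \<in> XM A n \<Longrightarrow> y \<in> XM A n \<Longrightarrow> (\<lambda>e. x e + y e) \<in> XM A n"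
  and XM_diff: "x \<in> XM A n \<Longrightarrow> y \<in> XM A n \<Longrightarrow> (\<lambda>e. x e - y e) \<in> XM A n" for x y :: "'l list \<times> 'n set \<Rightarrow> ('n, 'k) mpoly"
  by (auto simp: XM_def)

text \<open>Modulo the ideal only the component at the empty word is left, and it is a Koszul cycle.
  By \<open>z_span\<close> it is a boundary plus a combination of the \<open>z v\<close>, and the
  latter is the differential of one-letter words with the constants \<open>c v\<close> as
  coefficients.\<close>

lemma dX_exact_last:
  assumes n: "n < N" "n \<ge> 1" and x: "x \<in> XM A n" and cyc: "\<And>e. dX x e \<in> I"
    and last: "\<And>w v F. x (w @ [v], F) \<in> I"
  shows "\<exists>y\<in>XM A (Suc n). \<forall>e. x e - dX y e \<in> I"
proof -
  have sI: "sec x [v] F - (\<lambda>v F. 0) v F \<in> I" "sec x [u, v] F \<in> I" for u v F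
    using last[of "[]" v F] last[of "[u]" v F] by (auto simp: sec_def)
  have "dX x ([], F) - (kdv (sec x []) F + (\<Sum>v\<in>L. km (kbar (\<lambda>F. 0)) (z v) F)) \<in> I" for F
    by (rule dX_Nil_cong) (rule sI)+
  then have "kdv (sec x []) F \<in> I" for F
    using I_cong[of "dX x ([], F)" "kdv (sec x []) F"] cyc by (simp add: kbar_lin km_zero)
  moreover have x0: "sec x [] \<in> KM n" using sec_KM[OF x, of "[]"] by (simp add: wt_simps)
  ultimately obtain c y where y: "y \<in> KM (Suc n)" 
      "\<And>F. sec x [] F - (\<Sum>v\<in>{v \<in> L. dg v = n}. mconst (c v) * z v F) - kdv y F \<in> I"
    using z_span[OF n(2)] by blast
  define H where "H v = (if v \<in> L \<and> dg v = n then emb (\<lambda>F. if F = {} then mconst (c v) else 0) else (\<lambda>e. 0))" for v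
  let ?y = "glue y H"
  have Hdeg: "H v \<in> XM A (Suc n - Suc (dg v))" if "v \<in> L" for v
  proof (cases "dg v = n")
    case True
    then show ?thesis using that unfolding H_def by (auto intro!: emb_XM simp: KM_def)
  qed (auto simp: H_def XM_def)
  have yX: "?y \<in> XM A (Suc n)"
    by (rule glue_XM[OF y(1) Hdeg]) (auto simp: H_def)
  have "x e - dX ?y e \<in> I" for e
  proof -
    obtain w F where e: "e = (w, F)" by (cases e)
    show ?thesis
    proof (cases w rule: rev_cases)
      case Nil
      have s0: "sec (H v) [] = (if v \<in> L \<and> dg v = n then (\<lambda>F. if F = {} then mconst (c v) else 0) else (\<lambda>F. 0))" 
        and s1: "sec (H v) [u] = (\<lambda>F. 0)" for u v
        by (auto simp: H_def sec_emb) (auto simp: sec_def)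
      have kb: "kbar (\<lambda>F. if F = {} then p else 0) = (\<lambda>F. if F = {} then p else 0)" for p :: "('n, 'k) mpoly"
        by (auto simp: kbar_def fun_eq_iff)
      have "dX ?y ([], F) = kdv y F + (\<Sum>v\<in>L. if dg v = n then mconst (c v) * z v F else 0)"
        unfolding dX_glue_Nil s0 s1 by (auto simp: kbar_lin km_zero kb km_one intro!: sum.cong)
      also have "\<dots> = kdv y F + (\<Sum>v\<in>{v \<in> L. dg v = n}. mconst (c v) * z v F)"
        using finL by (simp add: sum.If_cases Int_def)
      finally have "x e - dX ?y e = sec x [] F - (\<Sum>v\<in>{v \<in> L. dg v = n}. mconst (c v) * z v F) - kdv y F"
        unfolding e Nil by (simp add: sec_def algebra_simps)
      then show ?thesis using y(2)[of F] by simp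
    next
      case (snoc w' v)
      have "kdv (\<lambda>F. if F = {} then p else 0) = (\<lambda>F. 0)" for p :: "('n, 'k) mpoly" by (rule kd_KM0) (auto simp: KM_def)
      then have "dX (H v) (w', F) = 0" by (simp add: H_def dX_emb dX_zero)
      then show ?thesis unfolding e snoc dX_glue using last[of w' v F] by simp
    qed
  qed
  then show ?thesis using yX by blast
qed

text \<open>By \<open>last\<close> and by degree, the only nonempty words left modulo the ideal are
  letters \<open>v\<close> of weight \<open>n\<close>, with polynomial coefficients
  \<open>f v\<close>. The cycle condition makes the sum of the \<open>f v * z v\<close> a boundary,
  so the constant terms \<open>c v\<close> vanish by \<open>z_indep\<close>; then \<open>f v\<close>
  is the Koszul boundary of some \<open>k v\<close>, and subtracting the differential of these
  reduces to \<open>dX_exact_last\<close>.\<close>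

lemma dX_exact_mid:
  assumes n: "n < N" "n \<ge> 1" and x: "x \<in> XM A n" and cyc: "\<And>e. dX x e \<in> I"
    and last: "\<And>w v F. v \<in> L \<Longrightarrow> Suc (dg v) < n \<Longrightarrow> x (w @ [v], F) \<in> I"
  shows "\<exists>y\<in>XM A (Suc n). \<forall>e. x e - dX y e \<in> I"
proof -
  define f where "f v = (if v \<in> L \<and> Suc (dg v) = n then x ([v], {}) else 0)" for v
  have other: "x (w @ [v], F) - (if v \<in> L \<and> Suc (dg v) = n \<and> w = [] \<and> F = {} then f v else 0) \<in> I" for w v F
  proof (cases "v \<in> L \<and> Suc (dg v) < n")
    case True then show ?thesis using last by auto
  next
    case False
    show ?thesis
    proof (cases "(w @ [v], F) \<in> A n")
      case True
      then have "v \<in> L" "Suc (dg v) = n" "wt dg w = 0" "card F = 0" using False by (auto simp: AX_def wt_simps)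
      moreover have "w = []" using \<open>wt dg w = 0\<close> by (cases w) (auto simp: wt_simps)
      ultimately show ?thesis using I_0 by (auto simp: f_def)
    next
      case False
      then have "x (w @ [v], F) = 0" using x by (simp add: XM_def)
      moreover have "x ([v], {}) = 0" if "w = []" "F = {}" using calculation that by simp
      ultimately show ?thesis using I_0 by (auto simp: f_def)
    qed
  qed
  let ?b = "\<lambda>v F. if F = {} then f v else 0"
  have kb: "kbar (\<lambda>F. if F = {} then p else 0) = (\<lambda>F. if F = {} then p else 0)" for p :: "('n, 'k) mpoly"
    by (auto simp: kbar_def fun_eq_iff)
  have "dX x ([], F) - (kdv (sec x []) F + (\<Sum>v\<in>L. km (kbar (?b v)) (z v) F)) \<in> I" for F
  proof (rule dX_Nil_cong)
    show "sec x [v] F - ?b v F \<in> I" for v F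
      using other[of "[]" v F] by (auto simp: sec_def f_def split: if_splits)
    show "sec x [u, v] F \<in> I" for u v F using other[of "[u]" v F] by (simp add: sec_def)
  qed
  then have 1: "kdv (sec x []) F + (\<Sum>v\<in>L. f v * z v F) \<in> I" for F
    using I_cong cyc unfolding kb km_one by blast
  define c where "c v = cst (f v)" for v
  have "\<forall>v. \<exists>k. k \<in> KM 1 \<and> f v - mconst (c v) = kdv k {}"
    using maximal_eq_kd by (metis c_def cst_diff mconst_simps(5) diff_self)
  then obtain k where k: "\<And>v. k v \<in> KM 1" "\<And>v. f v - mconst (c v) = kdv (k v) {}" by metis
  have kk: "kdv (k v) = (\<lambda>F. if F = {} then f v - mconst (c v) else 0)" for v
  proof -
    have "kdv (k v) \<in> KM 0" using k(1)[of v] by (intro kd_KM) simp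
    then show ?thesis using k(2)[of v] by (auto simp: KM_def fun_eq_iff)
  qed
  \<comment> \<open>By the Leibniz rule, and since \<open>z v\<close> is a cycle, a multiple of
    \<open>z v\<close> by a polynomial without constant term is a boundary. Hence only the constants
    \<open>c v\<close> matter in homology.\<close>
  have fz: "(f v - mconst (c v)) * z v F - kdv (km (k v) (z v)) F \<in> I" if "v \<in> L" for v F
  proof -
    have "kdv (km (k v) (z v)) F = (f v - mconst (c v)) * z v F + km (kbar (k v)) (kdv (z v)) F"
      unfolding leibniz kk km_one ..
    moreover have "km (kbar (k v)) (kdv (z v)) F \<in> I" by (rule km_ideal_right[OF ideal_I z_cycle[OF that]])
    ultimately show ?thesis using I_neg by simp
  qed
  have c0: "c v = 0" if v: "v \<in> L" "Suc (dg v) = n" for v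
  proof -
    let ?L = "{v \<in> L. dg v = dg v}"
    obtain i where i: "n = Suc i" "i \<ge> 1" using v deg_pos by auto
    let ?L = "{v \<in> L. dg v = i}"
    let ?y = "\<lambda>F. - sec x [] F - (\<Sum>v\<in>?L. km (k v) (z v) F)"
    have "?y \<in> KM (Suc i)"
    proof -
      have "sec x [] \<in> KM (Suc i)" using sec_KM[OF x, of "[]"] i by (simp add: wt_simps)
      moreover have "km (k v) (z v) \<in> KM (Suc i)" if "v \<in> ?L" for v
        using km_KM[OF k(1) z_KM, of v v] that by simp
      ultimately show ?thesis by (auto simp: KM_def intro!: sum.neutral)
    qed
    moreover have "(\<Sum>v\<in>?L. mconst (c v) * z v F) - kdv ?y F \<in> I" for F
    proof -
      have "kdv (\<lambda>F. - sec x [] F) = (\<lambda>F. - kdv (sec x []) F)" using kd_smult[of mvar "-1" "sec x []"] by simp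
      then have kdy: "kdv ?y F = - kdv (sec x []) F - (\<Sum>v\<in>?L. kdv (km (k v) (z v)) F)" 
        unfolding kd_diff kd_sum by simp
      have fL: "(\<Sum>v\<in>L. f v * z v F) = (\<Sum>v\<in>?L. f v * z v F)"
        by (rule sum.mono_neutral_right) (use finL i in \<open>auto simp: f_def\<close>)
      have "(\<Sum>v\<in>?L. mconst (c v) * z v F) - kdv ?y F = 
          (kdv (sec x []) F + (\<Sum>v\<in>L. f v * z v F)) - (\<Sum>v\<in>?L. (f v - mconst (c v)) * z v F - kdv (km (k v) (z v)) F)"
        unfolding kdy fL by (simp add: sum_subtractf left_diff_distrib)
      also have "\<dots> \<in> I" by (intro I_diff 1 I_sum fz) auto
      finally show ?thesis .
    qed
    ultimately have "\<forall>v\<in>?L. c v = 0" by (rule z_indep[OF i(2)])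
    then show ?thesis using v i by simp
  qed
  define H where "H v = (if v \<in> L \<and> Suc (dg v) = n then emb (k v) else (\<lambda>e. 0))" for v
  let ?y = "glue (\<lambda>F. 0) H"
  have yX: "?y \<in> XM A (Suc n)"
  proof (rule glue_XM)
    fix v assume "v \<in> L"
    show "H v \<in> XM A (Suc n - Suc (dg v))"
    proof (cases "Suc (dg v) = n")
      case True then show ?thesis using emb_XM[OF k(1)[of v]] \<open>v \<in> L\<close> by (simp add: H_def)
    qed (auto simp: H_def XM_def)
  qed (auto simp: H_def KM_def)
  let ?x = "\<lambda>e. x e - dX ?y e"
  have xX: "?x \<in> XM A n" by (rule XM_diff[OF x dX_XM[OF yX]])
  have xc: "dX ?x e \<in> I" for e unfolding dX_diff using cyc dX_dX[OF yX] n by (intro I_diff) auto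
  have xl: "?x (w @ [v], F) \<in> I" for w v F
  proof -
    have "dX (H v) (w, F) = (if v \<in> L \<and> Suc (dg v) = n \<and> w = [] \<and> F = {} then f v else 0)"
      by (auto simp: H_def dX_emb dX_zero kk c0 mconst_simps)
    then show ?thesis using other[of w v F] unfolding dX_glue by simp
  qed
  obtain y' where y': "y' \<in> XM A (Suc n)" "\<forall>e. ?x e - dX y' e \<in> I"
    using dX_exact_last[OF n xX xc xl] by blast
  have "x e - dX (\<lambda>e. ?y e + y' e) e \<in> I" for e using y'(2)[rule_format, of e] by (simp add: dX_add diff_diff_add)
  then show ?thesis using XM_add[OF yX y'(1)] by blast
qed

text \<open>The coefficient of a last letter \<open>v\<close> is a cycle of degree
  \<open>n - Suc (dg v)\<close>; where this is positive, the induction bounds it. The bounds are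
  glued into one chain whose differential is subtracted, after which no last letter of weight below
  \<open>n\<close> survives modulo the ideal.\<close>

lemma dX_exact:
  assumes "n < N" "n \<ge> 1" "x \<in> XM A n" "\<And>e. dX x e \<in> I"
  shows "\<exists>y\<in>XM A (Suc n). \<forall>e. x e - dX y e \<in> I"
  using assms
proof (induction n arbitrary: x rule: less_induct)
  case (less n)
  have "\<forall>v. \<exists>y. v \<in> L \<and> Suc (dg v) < n \<longrightarrow> y \<in> XM A (Suc (n - Suc (dg v))) \<and> (\<forall>w F. x (w @ [v], F) - dX y (w, F) \<in> I)"
  proof (intro allI)
    fix v
    show "\<exists>y. v \<in> L \<and> Suc (dg v) < n \<longrightarrow> y \<in> XM A (Suc (n - Suc (dg v))) \<and> (\<forall>w F. x (w @ [v], F) - dX y (w, F) \<in> I)"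
    proof (cases "v \<in> L \<and> Suc (dg v) < n")
      case True
      let ?x = "\<lambda>(w, F). x (w @ [v], F)"
      have xX: "?x \<in> XM A (n - Suc (dg v))"
      proof -
        have "?x (w, F) = 0" if "(w, F) \<notin> A (n - Suc (dg v))" for w F
        proof -
          have "(w @ [v], F) \<notin> A n" using that True by (auto simp: AX_def wt_simps)
          then show ?thesis using less.prems(3) by (simp add: XM_def)
        qed
        then show ?thesis by (auto simp: XM_def)
      qed
      have xc: "dX ?x e \<in> I" for e using less.prems(4)[of "(fst e @ [v], snd e)"] unfolding dX_snoc by simp
      have "\<exists>y\<in>XM A (Suc (n - Suc (dg v))). \<forall>e. ?x e - dX y e \<in> I"
        by (rule less.IH[OF _ _ _ xX xc]) (use True less.prems in auto)
      then obtain y where y: "y \<in> XM A (Suc (n - Suc (dg v)))" "\<forall>e. ?x e - dX y e \<in> I" by blast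
      have "x (w @ [v], F) - dX y (w, F) \<in> I" for w F using y(2)[rule_format, of "(w, F)"] by simp
      then show ?thesis using y(1) by blast
    qed blast
  qed
  then obtain H0 where H0: "\<And>v. v \<in> L \<and> Suc (dg v) < n \<Longrightarrow> H0 v \<in> XM A (Suc (n - Suc (dg v)))"
    "\<And>v w F. v \<in> L \<and> Suc (dg v) < n \<Longrightarrow> x (w @ [v], F) - dX (H0 v) (w, F) \<in> I" by metis
  define H where "H v = (if v \<in> L \<and> Suc (dg v) < n then H0 v else (\<lambda>e. 0))" for v
  let ?y = "glue (\<lambda>F. 0) H"
  have yX: "?y \<in> XM A (Suc n)"
  proof (rule glue_XM)
    fix v assume v: "v \<in> L"
    show "H v \<in> XM A (Suc n - Suc (dg v))"
    proof (cases "Suc (dg v) < n")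
      case True 
      then have "Suc n - Suc (dg v) = Suc (n - Suc (dg v))" by simp
      then show ?thesis using H0(1) True v by (simp add: H_def)
    qed (auto simp: H_def XM_def)
  qed (auto simp: H_def KM_def)
  let ?x = "\<lambda>e. x e - dX ?y e"
  have xX: "?x \<in> XM A n" by (rule XM_diff[OF less.prems(3) dX_XM[OF yX]])
  have xc: "dX ?x e \<in> I" for e unfolding dX_diff using less.prems(1,4) dX_dX[OF yX] by (intro I_diff) auto
  have xl: "?x (w @ [v], F) \<in> I" if "v \<in> L" "Suc (dg v) < n" for w v F
    using H0(2)[of v w F] that unfolding dX_glue by (simp add: H_def)
  obtain y' where y': "y' \<in> XM A (Suc n)" "\<forall>e. ?x e - dX y' e \<in> I"
    using dX_exact_mid[OF less.prems(1,2) xX xc xl] by blast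
  have "x e - dX (\<lambda>e. ?y e + y' e) e \<in> I" for e using y'(2)[rule_format, of e] by (simp add: dX_add diff_diff_add)
  then show ?case using XM_add[OF yX y'(1)] by blast
qed

lemma A_0: "A 0 = {([], {})}"
proof -
  have "w = []" if "wt dg w = 0" for w using that by (cases w) (auto simp: wt_simps)
  then show ?thesis by (auto simp: AX_def wt_simps card_eq_0_iff)
qed

lemma dX_resolves: "cst p = 0 \<longleftrightarrow> (\<exists>y\<in>XM A 1. p - dX y ([], {}) \<in> I)"
proof
  assume "cst p = 0"
  then obtain k where k: "k \<in> KM 1" "p = kdv k {}" using maximal_eq_kd by blast
  then show "\<exists>y\<in>XM A 1. p - dX y ([], {}) \<in> I" using emb_XM[OF k(1)] I_0 by (intro bexI[of _ "emb k"]) (auto simp: dX_emb)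
next
  assume "\<exists>y\<in>XM A 1. p - dX y ([], {}) \<in> I"
  then show "cst p = 0" using I_cst dX_cst cst_diff by (metis right_minus_eq)
qed

end

section \<open>Betti numbers\<close>

lemma mpoly_ring_simps: "carrier (mpoly_ring :: ('n::finite, 'k::field) mpoly ring) = UNIV"
  "monoid.mult (mpoly_ring :: ('n, 'k) mpoly ring) = (*)" "add (mpoly_ring :: ('n, 'k) mpoly ring) = (+)"
  "\<one>\<^bsub>(mpoly_ring :: ('n, 'k) mpoly ring)\<^esub> = 1" "\<zero>\<^bsub>(mpoly_ring :: ('n, 'k) mpoly ring)\<^esub> = 0"
  by (auto simp: mpoly_ring_def ring_of_type_algebra_def)

lemma cring_mpoly: "cring (mpoly_ring :: ('n::finite, 'k::field) mpoly ring)"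
  unfolding mpoly_ring_def by (rule comm_ring_1_class.cring_from_type_algebra)

lemma a_inv_mpoly: "\<ominus>\<^bsub>mpoly_ring\<^esub> x = - x" for x :: "('n::finite, 'k::field) mpoly"
proof -
  interpret cring "mpoly_ring :: ('n, 'k) mpoly ring" by (rule cring_mpoly)
  show ?thesis by (rule minus_equality) (simp_all add: mpoly_ring_simps)
qed

lemma ideal_mpoly_iff: "ideal I mpoly_ring \<longleftrightarrow> is_ideal I" for I :: "('n::finite, 'k::field) mpoly set"
proof
  assume "ideal I mpoly_ring"
  then interpret ideal I mpoly_ring .
  show "is_ideal I" unfolding idl.subspace_def
    using additive_subgroup.zero_closed[OF is_additive_subgroup] additive_subgroup.a_closed[OF is_additive_subgroup] I_l_closed
    by (auto simp: mpoly_ring_simps)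
next
  assume I: "is_ideal I"
  interpret cring "mpoly_ring :: ('n, 'k) mpoly ring" by (rule cring_mpoly)
  have r: "a * x \<in> I" if "a \<in> I" for a x using idl.subspace_scale[OF I that, of x] by (simp add: mult.commute)
  show "ideal I mpoly_ring"
  proof (rule idealI)
    show "ring (mpoly_ring :: ('n, 'k) mpoly ring)" by unfold_locales
    show "subgroup I (add_monoid mpoly_ring)"
    proof (rule subgroup.intro)
      fix x assume "x \<in> I"
      then show "inv\<^bsub>add_monoid mpoly_ring\<^esub> x \<in> I"
        using idl.subspace_neg[OF I] a_inv_mpoly[of x] by (simp add: a_inv_def)
    qed (use I in \<open>auto simp: mpoly_ring_simps idl.subspace_add idl.subspace_0\<close>)
  qed (auto simp: mpoly_ring_simps r idl.subspace_scale[OF I])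
qed

lemma coset_mpoly: "I +>\<^bsub>mpoly_ring\<^esub> x = (\<lambda>h. h + x) ` I" for x :: "('n::finite, 'k::field) mpoly"
  by (auto simp: a_r_coset_def' mpoly_ring_simps)

lemma coset_eq_iff: 
  assumes I: "is_ideal I" shows "(\<lambda>h. h + x) ` I = (\<lambda>h. h + y) ` I \<longleftrightarrow> x - y \<in> I"
proof
  assume "(\<lambda>h. h + x) ` I = (\<lambda>h. h + y) ` I"
  moreover have "x \<in> (\<lambda>h. h + x) ` I" using idl.subspace_0[OF I] by (intro image_eqI[of _ _ 0]) auto
  ultimately obtain h where "h \<in> I" "x = h + y" by blast
  then show "x - y \<in> I" by simp
next
  assume d: "x - y \<in> I"
  show "(\<lambda>h. h + x) ` I = (\<lambda>h. h + y) ` I"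
  proof (intro equalityI subsetI)
    fix u assume "u \<in> (\<lambda>h. h + x) ` I"
    then obtain h where "h \<in> I" "u = h + x" by blast
    then show "u \<in> (\<lambda>h. h + y) ` I" using idl.subspace_add[OF I _ d] by (intro image_eqI[of _ _ "h + (x - y)"]) auto
  next
    fix u assume "u \<in> (\<lambda>h. h + y) ` I"
    then obtain h where "h \<in> I" "u = h + y" by blast
    then show "u \<in> (\<lambda>h. h + x) ` I" using idl.subspace_diff[OF I _ d] by (intro image_eqI[of _ _ "h - (x - y)"]) auto
  qed
qed

lemma coset_add: 
  assumes I: "is_ideal I" 
  shows "(\<Union>h\<in>(\<lambda>h. h + x) ` I. \<Union>k\<in>(\<lambda>h. h + y) ` I. {h + k}) = (\<lambda>h. h + (x + y)) ` I"
proof (intro equalityI subsetI)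
  fix u assume "u \<in> (\<Union>h\<in>(\<lambda>h. h + x) ` I. \<Union>k\<in>(\<lambda>h. h + y) ` I. {h + k})"
  then obtain h k where "h \<in> I" "k \<in> I" "u = (h + x) + (k + y)" by blast
  then show "u \<in> (\<lambda>h. h + (x + y)) ` I" using idl.subspace_add[OF I] by (intro image_eqI[of _ _ "h + k"]) (auto simp: algebra_simps)
next
  fix u assume "u \<in> (\<lambda>h. h + (x + y)) ` I"
  then obtain h where "h \<in> I" "u = (h + x) + (0 + y)" by (auto simp: algebra_simps)
  then show "u \<in> (\<Union>h\<in>(\<lambda>h. h + x) ` I. \<Union>k\<in>(\<lambda>h. h + y) ` I. {h + k})" using idl.subspace_0[OF I] by blast
qed

definition mmax :: "('n::finite, 'k::field) mpoly set" where "mmax = {p. cst p = 0}"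

lemma ideal_mmax: "is_ideal mmax"
  by (auto simp: idl.subspace_def mmax_def cst_add cst_mult)

lemma presented_id: "presented (mpoly_ring :: ('n::finite, 'k::field) mpoly ring) id {0}"
  by (intro presented.intro cring_mpoly) (auto simp: mpoly_ring_simps idl.subspace_def)

lemma presented_Quot: 
  fixes I :: "('n::finite, 'k::field) mpoly set"
  assumes I: "is_ideal I"
  shows "presented (mpoly_ring Quot I) (\<lambda>p. I +>\<^bsub>mpoly_ring\<^esub> p) I"
proof -
  interpret cring "mpoly_ring :: ('n, 'k) mpoly ring" by (rule cring_mpoly)
  interpret ideal I mpoly_ring using I by (simp add: ideal_mpoly_iff)
  have h: "(+>\<^bsub>mpoly_ring\<^esub>) I \<in> ring_hom mpoly_ring (mpoly_ring Quot I)" by (rule rcos_ring_hom)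
  show ?thesis
  proof (rule presented.intro)
    show "cring (mpoly_ring Quot I)" by (rule quotient_is_cring) (rule cring_mpoly)
    show "carrier (mpoly_ring Quot I) = range (\<lambda>p. I +>\<^bsub>mpoly_ring\<^esub> p)"
      by (auto simp: FactRing_def A_RCOSETS_def' mpoly_ring_simps)
  next
    fix x y :: "('n, 'k) mpoly"
    show "I +>\<^bsub>mpoly_ring\<^esub> (x + y) = (I +>\<^bsub>mpoly_ring\<^esub> x) \<oplus>\<^bsub>mpoly_ring Quot I\<^esub> (I +>\<^bsub>mpoly_ring\<^esub> y)"
      using ring_hom_add[OF h, of x y] by (simp add: mpoly_ring_simps)
    show "I +>\<^bsub>mpoly_ring\<^esub> (x * y) = (I +>\<^bsub>mpoly_ring\<^esub> x) \<otimes>\<^bsub>mpoly_ring Quot I\<^esub> (I +>\<^bsub>mpoly_ring\<^esub> y)"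
      using ring_hom_mult[OF h, of x y] by (simp add: mpoly_ring_simps)
    show "I +>\<^bsub>mpoly_ring\<^esub> x = I +>\<^bsub>mpoly_ring\<^esub> y \<longleftrightarrow> x - y \<in> I"
      by (simp add: coset_mpoly coset_eq_iff[OF I])
  qed (rule I)
qed

lemma presented_quotient_module:
  fixes I :: "('n::finite, 'k::field) mpoly set"
  assumes I: "is_ideal I"
  shows "presented_module mpoly_ring id {0} (quotient_module (regular_module mpoly_ring) I) (\<lambda>p. (\<lambda>h. h + p) ` I) I"
proof -
  have co: "I +>\<^bsub>regular_module mpoly_ring\<^esub> x = (\<lambda>h. h + x) ` I" for x :: "('n, 'k) mpoly"
    by (auto simp: a_r_coset_def' regular_module_def mpoly_ring_simps)
  show ?thesis
  proof (intro presented_module.intro presented_id presented_module_axioms.intro)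
    show "carrier (quotient_module (regular_module mpoly_ring) I) = range (\<lambda>p. (\<lambda>h. h + p) ` I)"
      by (auto simp: quotient_module_def A_RCOSETS_def' co) (auto simp: regular_module_def mpoly_ring_simps)
  next
    fix x y :: "('n, 'k) mpoly"
    show "(\<lambda>h. h + (x + y)) ` I = (\<lambda>h. h + x) ` I \<oplus>\<^bsub>quotient_module (regular_module mpoly_ring) I\<^esub> (\<lambda>h. h + y) ` I"
    proof -
      have sa: "set_add (regular_module mpoly_ring) S T = (\<Union>h\<in>S. \<Union>k\<in>T. {h + k})" for S T :: "('n, 'k) mpoly set"
        by (simp add: set_add_def' regular_module_def mpoly_ring_simps)
      have "add (quotient_module (regular_module mpoly_ring) I) = set_add (regular_module mpoly_ring)"
        by (simp add: quotient_module_def)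
      then show ?thesis by (simp only: sa coset_add[OF I])
    qed
  next
    fix r x :: "('n, 'k) mpoly"
    have "(\<lambda>h. h + r * u) ` I = (\<lambda>h. h + r * x) ` I" if "u \<in> (\<lambda>h. h + x) ` I" for u
    proof -
      have "r * (u - x) \<in> I" using that by (auto intro: idl.subspace_scale[OF I])
      then show ?thesis by (simp add: coset_eq_iff[OF I] right_diff_distrib)
    qed
    moreover have "(\<lambda>h. h + x) ` I \<noteq> {}" using idl.subspace_0[OF I] by auto
    ultimately have "(\<Union>u\<in>(\<lambda>h. h + x) ` I. (\<lambda>h. h + r * u) ` I) = (\<lambda>h. h + r * x) ` I" by simp
    then show "(\<lambda>h. h + r * x) ` I = id r \<odot>\<^bsub>quotient_module (regular_module mpoly_ring) I\<^esub> (\<lambda>h. h + x) ` I"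
      unfolding quotient_module_def module.simps co by (simp add: regular_module_def mpoly_ring_simps)
  next
    fix x y :: "('n, 'k) mpoly"
    show "(\<lambda>h. h + x) ` I = (\<lambda>h. h + y) ` I \<longleftrightarrow> x - y \<in> I" by (rule coset_eq_iff[OF I])
    show "(\<lambda>h. h + 0) ` I = \<zero>\<^bsub>quotient_module (regular_module mpoly_ring) I\<^esub>" by (simp add: quotient_module_def)
  qed (use I in \<open>auto simp: idl.subspace_0\<close>)
qed

lemma tensored_residue: "tensored (mpoly_ring :: ('n::finite, 'k::field) mpoly ring) id {0} residue_module"
  by (intro tensored.intro presented_id tensored_axioms.intro) (auto simp: residue_module_def)

text \<open>Since \<open>I \<subseteq> mmax\<close>, all members of a coset have the same constant
  term, so \<open>the_elem\<close> is applied to a singleton.\<close>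

lemma residue_quot_smult:
  fixes I :: "('n::finite, 'k::field) mpoly set"
  assumes I: "is_ideal I" and IM: "I \<subseteq> mmax"
  shows "(I +>\<^bsub>mpoly_ring\<^esub> p) \<odot>\<^bsub>module_over_quotient residue_module\<^esub> v = cst p * v"
proof -
  have "(\<lambda>r. cst r * v) ` (\<lambda>h. h + p) ` I = {cst p * v}"
    using IM idl.subspace_0[OF I] by (auto simp: image_image cst_add mmax_def subset_iff image_iff)
  then show ?thesis by (simp add: module_over_quotient_def residue_module_def coset_mpoly)
qed

lemma presented_residue_module:
  fixes I :: "('n::finite, 'k::field) mpoly set"
  assumes I: "is_ideal I" and IM: "I \<subseteq> mmax"
  shows "presented_module (mpoly_ring Quot I) (\<lambda>p. I +>\<^bsub>mpoly_ring\<^esub> p) I (module_over_quotient residue_module) cst mmax"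
proof (intro presented_module.intro presented_Quot I presented_module_axioms.intro)
  show "carrier (module_over_quotient residue_module) = range (cst :: ('n, 'k) mpoly \<Rightarrow> 'k)"
  proof -
    have "c \<in> range (cst :: ('n, 'k) mpoly \<Rightarrow> 'k)" for c
      by (rule range_eqI[of _ _ "mconst c"]) (simp add: mconst_simps)
    then show ?thesis by (auto simp: module_over_quotient_def residue_module_def)
  qed
next
  fix r x :: "('n, 'k) mpoly"
  show "cst (r * x) = (I +>\<^bsub>mpoly_ring\<^esub> r) \<odot>\<^bsub>module_over_quotient residue_module\<^esub> cst x"
    by (simp add: residue_quot_smult[OF I IM] cst_mult)
qed (use IM ideal_mmax in \<open>auto simp: module_over_quotient_def residue_module_def cst_add cst_diff mmax_def\<close>)

lemma tensored_residue_quot: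
  fixes I :: "('n::finite, 'k::field) mpoly set"
  assumes I: "is_ideal I" and IM: "I \<subseteq> mmax"
  shows "tensored (mpoly_ring Quot I) (\<lambda>p. I +>\<^bsub>mpoly_ring\<^esub> p) I (module_over_quotient residue_module)"
  by (intro tensored.intro presented_Quot I tensored_axioms.intro residue_quot_smult[OF I IM])
     (auto simp: module_over_quotient_def residue_module_def)

text \<open>A vector over \<open>k\<close> is lifted to constant polynomials, for which the
  composite of two differentials lies in \<open>I\<close>; passing back to constant terms kills
  \<open>I\<close>.\<close>

lemma bnd_cyc:
  fixes I :: "('n::finite, 'k::field) mpoly set"
  assumes res: "resolves I J b a q" and I: "is_ideal I" and IM: "I \<subseteq> mmax"
  shows "bnd b (\<lambda>n i j. cst (a n i j)) j \<subseteq> cyc b (\<lambda>n i j. cst (a n i j)) j"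
proof (cases j)
  case 0 then show ?thesis by (auto simp: bnd_def cyc_def mv_coords)
next
  case (Suc m)
  show ?thesis
  proof
    let ?ca = "\<lambda>n i j. cst (a n i j)"
    fix v assume "v \<in> bnd b ?ca j"
    then obtain w where w: "w \<in> coords (b (Suc j))" "v = mv (?ca j) (b j) (b (Suc j)) w" by (auto simp: bnd_def)
    let ?w = "\<lambda>l. mconst (w l) :: ('n, 'k) mpoly"
    let ?v = "mv (a (Suc m)) (b (Suc m)) (b (Suc (Suc m))) ?w"
    have w': "?w \<in> coords (b (Suc (Suc m)))" using w(1) Suc by (auto simp: coords_def mconst_simps)
    have "\<forall>i. ?v i - ?v i \<in> I" using idl.subspace_0[OF I] by simp
    then have "\<forall>i. mv (a m) (b m) (b (Suc m)) ?v i \<in> I"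
      using res w' mv_coords[of "a (Suc m)" "b (Suc m)"] unfolding resolves_def by blast
    then have "cst (mv (a m) (b m) (b (Suc m)) ?v i) = 0" for i using IM by (auto simp: mmax_def)
    then have "mv (?ca m) (b m) (b (Suc m)) (mv (?ca (Suc m)) (b (Suc m)) (b (Suc (Suc m))) w) = 0"
      by (simp add: cst_mv mconst_simps fun_eq_iff)
    then show "v \<in> cyc b ?ca j" using w Suc by (auto simp: cyc_def mv_coords)
  qed
qed

lemma qdim_betti_ex:
  fixes I :: "('n::finite, 'k::field) mpoly set"
  assumes "resolves I J b a q" and "is_ideal I" and "I \<subseteq> mmax"
  shows "\<exists>n. qdim fsc (bnd b (\<lambda>n i j. cst (a n i j)) j) (cyc b (\<lambda>n i j. cst (a n i j)) j) n"
  by (rule qdim_coords_ex[OF subspace_bnd subspace_cyc bnd_cyc[OF assms]]) (auto simp: cyc_def)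

section \<open>Betti numbers over the polynomial ring as Koszul homology\<close>

definition ZK :: "('n::{finite,linorder}, 'k::field) mpoly set \<Rightarrow> nat \<Rightarrow> ('n set \<Rightarrow> ('n, 'k) mpoly) set" where
  "ZK I i = {x \<in> KM i. \<forall>F. kdv x F \<in> I}"

definition BK :: "('n::{finite,linorder}, 'k::field) mpoly set \<Rightarrow> nat \<Rightarrow> ('n set \<Rightarrow> ('n, 'k) mpoly) set" where
  "BK I i = {x \<in> KM i. \<exists>y\<in>KM (Suc i). \<forall>F. x F - kdv y F \<in> I}"

lemma XM_KM: "XM (\<lambda>i. {F. card F = i}) i = KM i"
  by (auto simp: XM_def KM_def)

theorem qdim_quotient_betti:
  fixes I :: "('n::{finite,linorder}, 'k::field) mpoly set"
  assumes I: "is_ideal I" and j: "j \<ge> 1"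
  shows "qdim (lsc msc) (BK I j) (ZK I j) (quotient_betti I j)"
proof -
  have z: "is_ideal ({0} :: ('n, 'k) mpoly set)" "({0} :: ('n, 'k) mpoly set) \<subseteq> I" "({0} :: ('n, 'k) mpoly set) \<subseteq> mmax"
    using idl.subspace_0[OF I] by (auto simp: idl.subspace_def mmax_def)
  obtain b a q where res: "resolves {0} I b a q" and kd: "\<And>j n. qdim fsc (bnd b (\<lambda>n i j. cst (a n i j)) j) (cyc b (\<lambda>n i j. cst (a n i j)) j) n \<Longrightarrow>
      k_dim (restrict_scalars (\<lambda>c. id (mconst c)) (Tor mpoly_ring (quotient_module (regular_module mpoly_ring) I) residue_module j)) = n"
    using k_dim_Tor[OF presented_quotient_module[OF I] tensored_residue resolves_exists[OF z(1) I z(2)]] by blast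
  obtain n where n: "qdim fsc (bnd b (\<lambda>n i j. cst (a n i j)) j) (cyc b (\<lambda>n i j. cst (a n i j)) j) n"
    using qdim_betti_ex[OF res z(1,3)] by blast
  then have nb: "quotient_betti I j = n" using kd unfolding quotient_betti_def by simp
  obtain i where i: "j = Suc i" using j by (cases j) auto
  \<comment> \<open>The base ring is the polynomial ring, hence \<open>{0}\<close> as the first
    ideal; the given ideal \<open>I\<close> takes the role of \<open>J\<close>.\<close>
  interpret tor_data "{0}" I b a q "\<lambda>i. {F. card F = i}" kdv j "{}"
  proof (unfold_locales, goal_cases)
    case (5 x y) show ?case by (rule kd_add)
  next
    case (6 p x) show ?case by (rule kd_smult)
  next
    case (7 x i) then show ?case unfolding XM_KM by (rule kd_KM)
  next
    case (8 x e) then show ?case by (simp add: kd_def)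
  next
    case (9 i x e) then show ?case by (simp add: kd_kd)
  next
    case (10 i x)
    then have "x \<in> KM (Suc i)" "kdv x = (\<lambda>F. 0)" "cst (x {}) = 0" by (auto simp: XM_KM fun_eq_iff KM_def)
    then show ?case using kd_exact_KM[of x "Suc i"] unfolding XM_KM by auto
  next
    case 11 show ?case by auto
  next
    case (12 p) show ?case using maximal_eq_kd[of p] cst_kd unfolding XM_KM by auto
  qed (use z I res in auto)
  have "qdim fsc (bnd b (\<lambda>n i j. cst (a n i j)) j) (cyc b (\<lambda>n i j. cst (a n i j)) j) n \<longleftrightarrow> qdim (lsc msc) (UX j) (VX j) n"
    by (rule qdim_tor[OF i]) (rule kd_ideal[OF I])
  moreover have "VX j = ZK I j" unfolding VX_def ZK_def XM_KM ..
  \<comment> \<open>The Koszul complex is exact in all positive degrees, so its cycles over the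
    polynomial ring are boundaries.\<close>
  moreover have "UX j = BK I j"
  proof (intro equalityI subsetI)
    fix x assume "x \<in> UX j"
    then obtain y where y: "x \<in> KM j" "y \<in> KM j" "\<forall>e. kdv y e = 0" "\<forall>e. x e - y e \<in> I" by (auto simp: UX_def XM_KM)
    then have "\<exists>w\<in>KM (Suc j). y = kdv w" using j by (intro kd_exact_KM) (auto simp: KM_def fun_eq_iff)
    then show "x \<in> BK I j" using y by (auto simp: BK_def)
  next
    fix x assume "x \<in> BK I j"
    then obtain y where y: "x \<in> KM j" "y \<in> KM (Suc j)" "\<forall>F. x F - kdv y F \<in> I" by (auto simp: BK_def)
    then show "x \<in> UX j" unfolding UX_def XM_KM using kd_KM[OF y(2), of mvar]
      by (auto simp: kd_kd intro!: bexI[of _ "kdv y"])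
  qed
  ultimately show ?thesis using n nb by simp
qed

text \<open>Degree 0 lies outside the balancing argument. The functional \<open>p\<close> induced by
  the augmentation has the boundaries as its kernel and takes the value 1 at the constant terms of
  \<open>t\<close>, which leaves a line.\<close>

lemma residue_betti_0:
  fixes I :: "('n::finite, 'k::field) mpoly set"
  assumes I: "is_ideal I" and IM: "I \<subseteq> mmax" shows "residue_betti I 0 = 1"
proof -
  obtain b a q where res: "resolves I mmax b a q" and kd: "\<And>j n. qdim fsc (bnd b (\<lambda>n i j. cst (a n i j)) j) (cyc b (\<lambda>n i j. cst (a n i j)) j) n \<Longrightarrow>
      k_dim (restrict_scalars (\<lambda>c. I +>\<^bsub>mpoly_ring\<^esub> mconst c) (Tor (mpoly_ring Quot I) (module_over_quotient residue_module) (module_over_quotient residue_module) j)) = n"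
    using k_dim_Tor[OF presented_residue_module[OF I IM] tensored_residue_quot[OF I IM] resolves_exists[OF I ideal_mmax IM]] by blast
  let ?ca = "\<lambda>n i j. cst (a n i j)"
  define p where "p v = (\<Sum>l<b 0. v l * cst (q l))" for v :: "nat \<Rightarrow> 'k"
  obtain t where t: "t \<in> coords (b 0)" "(\<Sum>l<b 0. t l * q l) - 1 \<in> mmax" using res unfolding resolves_def by blast
  let ?t = "\<lambda>l. cst (t l)"
  have pt: "p ?t = 1" using t(2) by (simp add: mmax_def p_def cst_diff cst_sum cst_mult lookup_one)
  have pB: "v \<in> bnd b ?ca 0" if "v \<in> coords (b 0)" "p v = 0" for v
  proof -
    let ?v = "\<lambda>l. mconst (v l) :: ('n, 'k) mpoly"
    have v': "?v \<in> coords (b 0)" using that by (auto simp: coords_def mconst_simps)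
    moreover have "(\<Sum>l<b 0. ?v l * q l) \<in> mmax" using that(2) by (simp add: mmax_def p_def cst_sum cst_mult mconst_simps)
    moreover have "\<forall>v\<in>coords (b 0). (\<Sum>l<b 0. v l * q l) \<in> mmax \<longleftrightarrow> (\<exists>w\<in>coords (b 1). \<forall>i. v i - mv (a 0) (b 0) (b 1) w i \<in> I)"
      using res unfolding resolves_def by (elim conjE)
    ultimately obtain w where w: "w \<in> coords (b 1)" "\<forall>i. ?v i - mv (a 0) (b 0) (b 1) w i \<in> I" by (elim ballE[of _ _ ?v]) auto
    have "v i = mv (?ca 0) (b 0) (b 1) (\<lambda>l. cst (w l)) i" for i
    proof -
      have "cst (?v i - mv (a 0) (b 0) (b 1) w i) = 0" using w(2) IM by (auto simp: mmax_def)
      then show ?thesis by (simp add: cst_diff cst_mv mconst_simps)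
    qed
    moreover have "(\<lambda>l. cst (w l)) \<in> coords (b 1)" using w(1) by (auto simp: coords_def)
    ultimately show ?thesis by (auto simp: bnd_def image_iff fun_eq_iff)
  qed
  have Bp: "p v = 0" if vB: "v \<in> bnd b ?ca 0" for v
  proof -
    obtain w where w: "w \<in> coords (b 1)" "v = mv (?ca 0) (b 0) (b 1) w" using vB unfolding bnd_def One_nat_def by blast
    let ?w = "\<lambda>l. mconst (w l) :: ('n, 'k) mpoly"
    let ?v = "mv (a 0) (b 0) (b 1) ?w"
    have w': "?w \<in> coords (b 1)" using w(1) by (auto simp: coords_def mconst_simps)
    have "\<forall>i. ?v i - ?v i \<in> I" using idl.subspace_0[OF I] by simp
    then have "(\<Sum>l<b 0. ?v l * q l) \<in> mmax"
      using res w' mv_coords[of "a 0" "b 0"] unfolding resolves_def by blast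
    then show ?thesis by (simp add: mmax_def p_def cst_sum cst_mult cst_mv mconst_simps w(2))
  qed
  have s1: "(\<Sum>i<1::nat. f i) = f 0" for f :: "nat \<Rightarrow> nat \<Rightarrow> 'k" 
    by (simp only: One_nat_def sum.lessThan_Suc lessThan_0 sum.empty add_0)
  have "qdim fsc (bnd b ?ca 0) (cyc b ?ca 0) 1" unfolding qdim_def s1
  proof (intro exI[of _ "\<lambda>i. ?t"] conjI allI ballI impI)
    show "?t \<in> cyc b ?ca 0" using t(1) by (auto simp: cyc_def coords_def)
    fix v assume v: "v \<in> cyc b ?ca 0"
    show "\<exists>c. v - fsc (c (0::nat)) ?t \<in> bnd b ?ca 0"
    proof (intro exI[of _ "\<lambda>i. p v"] pB)
      show "v - fsc (p v) ?t \<in> coords (b 0)" using v t(1) by (auto simp: cyc_def coords_def lsc_def)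
      have "p (v - fsc (p v) ?t) = p v - p v * p ?t" 
        by (simp add: p_def lsc_def left_diff_distrib sum_subtractf sum_distrib_left mult.assoc)
      then show "p (v - fsc (p v) ?t) = 0" using pt by simp
    qed
  next
    fix c i assume "fsc (c (0::nat)) ?t \<in> bnd b ?ca 0" and i: "i < (1 :: nat)"
    then have "p (fsc (c (0::nat)) ?t) = 0" using Bp by simp
    moreover have "p (fsc (c (0::nat)) ?t) = c 0 * p ?t" by (simp add: p_def lsc_def sum_distrib_left mult.assoc)
    ultimately show "c i = (0 :: 'k)" using pt i by simp
  qed
  then show ?thesis using kd unfolding residue_betti_def by blast
qed

lemma finite_wt: assumes "finite L" shows "finite {w. set w \<subseteq> L \<and> wt dg w \<le> n}"
proof -
  have "length w \<le> wt dg w" for w by (induction w) (auto simp: wt_simps)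
  then have "{w. set w \<subseteq> L \<and> wt dg w \<le> n} \<subseteq> {w. set w \<subseteq> L \<and> length w \<le> n}" using le_trans by blast
  then show ?thesis using finite_lists_length_le[OF assms] finite_subset by blast
qed

lemma finite_AX: assumes "finite L" shows "finite (AX L dg n :: ('l list \<times> 'n::finite set) set)"
proof -
  have "AX L dg n \<subseteq> {w. set w \<subseteq> L \<and> wt dg w \<le> n} \<times> (UNIV :: 'n set set)" by (auto simp: AX_def)
  then show ?thesis by (rule finite_subset) (intro finite_SigmaI finite_wt assms finite)
qed

text \<open>Modulo the maximal ideal only constant terms survive, one for each basis
  element.\<close>

lemma qdim_free:
  fixes A :: "nat \<Rightarrow> 'a set"
  assumes fin: "finite (A m)"
  shows "qdim (lsc msc) {x \<in> XM A m. \<forall>e. x e \<in> (mmax :: ('n::finite, 'k::field) mpoly set)} (XM A m) (card (A m))"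
proof -
  obtain f where f: "bij_betw f {..<card (A m)} (A m)" using ex_bij_betw_nat_finite[OF fin] by (auto simp: atLeast0LessThan)
  let ?f = "\<lambda>i e. if e = f i then 1 else (0 :: ('n, 'k) mpoly)"
  have s: "(\<Sum>i<card (A m). lsc msc (c i) (?f i)) (f j) = mconst (c j)" if j: "j < card (A m)" for c j
  proof -
    have "(\<Sum>i<card (A m). lsc msc (c i) (?f i)) (f j) = (\<Sum>i<card (A m). if i = j then mconst (c i) else 0)"
      unfolding sum_fun_apply
    proof (rule sum.cong[OF refl])
      fix i assume "i \<in> {..<card (A m)}"
      then have "f j = f i \<longleftrightarrow> i = j" using inj_on_eq_iff[OF bij_betw_imp_inj_on[OF f], of j i] j by auto
      then show "lsc msc (c i) (?f i) (f j) = (if i = j then mconst (c i) else 0)" by (simp add: lsc_def msc_def)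
    qed
    then show ?thesis using j by simp
  qed
  have s0: "(\<Sum>i<card (A m). lsc msc (c i) (?f i)) e = 0" if "e \<notin> A m" for c e
    unfolding sum_fun_apply by (rule sum.neutral) (use that f in \<open>auto simp: lsc_def msc_def dest: bij_betwE\<close>)
  have ex: "\<exists>j<card (A m). e = f j" if "e \<in> A m" for e using f that by (auto simp: bij_betw_def)
  show ?thesis unfolding qdim_def
  proof (intro exI[of _ ?f] conjI allI ballI impI)
    fix i assume "i < card (A m)"
    then show "?f i \<in> XM A m" using f by (auto simp: XM_def dest: bij_betwE)
  next
    fix v :: "'a \<Rightarrow> ('n, 'k) mpoly" assume v: "v \<in> XM A m"
    let ?c = "\<lambda>i. cst (v (f i))"
    have "(v - (\<Sum>i<card (A m). lsc msc (?c i) (?f i))) e \<in> mmax" for e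
    proof (cases "e \<in> A m")
      case True
      then obtain j where "j < card (A m)" "e = f j" using ex by blast
      then show ?thesis using s[of j ?c] by (simp add: mmax_def cst_diff mconst_simps)
    next
      case False
      then show ?thesis using s0[OF False, of ?c] v by (simp add: mmax_def cst_diff XM_def)
    qed
    moreover have "v - (\<Sum>i<card (A m). lsc msc (?c i) (?f i)) \<in> XM A m"
      using v s0[of _ ?c] by (simp add: XM_def)
    ultimately show "\<exists>c. v - (\<Sum>i<card (A m). lsc msc (c i) (?f i)) \<in> {x \<in> XM A m. \<forall>e. x e \<in> mmax}"
      by (intro exI[of _ ?c]) simp
  next
    fix c i assume a: "(\<Sum>i<card (A m). lsc msc (c i) (?f i)) \<in> {x \<in> XM A m. \<forall>e. x e \<in> mmax}" and i: "i < card (A m)"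
    then have "(\<Sum>i<card (A m). lsc msc (c i) (?f i)) (f i) \<in> mmax" by blast
    then show "c i = (0 :: 'k)" unfolding s[OF i] by (simp add: mmax_def mconst_simps)
  qed
qed

section \<open>Betti numbers over the quotient ring from Golod's complex\<close>

context golod_complex
begin

lemma I_mmax: "I \<subseteq> mmax" using I_cst by (auto simp: mmax_def)

text \<open>The cycles modulo \<open>I\<close> together with the multiples of the maximal ideal. As
  the differential vanishes modulo the maximal ideal, Tor in degree \<open>m\<close> is all of
  \<open>XM A m\<close> modulo this space.\<close>

definition UG where "UG m = {x \<in> XM A m. \<exists>y\<in>XM A m. (\<forall>e. dX y e \<in> I) \<and> (\<forall>e. x e - y e \<in> mmax)}"

lemma qdim_residue_betti:
  assumes m: "m \<ge> 1" "m \<le> N"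
  shows "qdim (lsc msc) (UG m) (XM A m) (residue_betti I m)" and "Modules.module.subspace (lsc msc) (UG m)"
proof -
  obtain b a q where res: "resolves I mmax b a q" and kd: "\<And>j n. qdim fsc (bnd b (\<lambda>n i j. cst (a n i j)) j) (cyc b (\<lambda>n i j. cst (a n i j)) j) n \<Longrightarrow>
      k_dim (restrict_scalars (\<lambda>c. I +>\<^bsub>mpoly_ring\<^esub> mconst c) (Tor (mpoly_ring Quot I) (module_over_quotient residue_module) (module_over_quotient residue_module) j)) = n"
    using k_dim_Tor[OF presented_residue_module[OF ideal_I I_mmax] tensored_residue_quot[OF ideal_I I_mmax] 
        resolves_exists[OF ideal_I ideal_mmax I_mmax]] by blast
  obtain n where n: "qdim fsc (bnd b (\<lambda>n i j. cst (a n i j)) m) (cyc b (\<lambda>n i j. cst (a n i j)) m) n"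
    using qdim_betti_ex[OF res ideal_I I_mmax] by blast
  then have nb: "residue_betti I m = n" using kd unfolding residue_betti_def by blast
  obtain i where i: "m = Suc i" using m by (cases m) auto
  interpret t: tor_data I mmax b a q A dX m "([], {})"
  proof (unfold_locales, goal_cases)
    case (5 x y) show ?case by (rule dX_add)
  next
    case (6 p x) show ?case by (rule dX_smult)
  next
    case (7 x i) then show ?case by (rule dX_XM)
  next
    case (8 x e) then show ?case by (rule dX_I)
  next
    case (9 i x e) then show ?case using m by (intro dX_dX[of x "Suc (Suc i)"]) auto
  next
    case (10 i x) then show ?case using m by (intro dX_exact) auto
  next
    case 11 show ?case by (rule A_0)
  next
    case (12 p) show ?case by (rule dX_resolves)
  qed (use ideal_I ideal_mmax I_mmax res in auto)
  have dm: "dX x e \<in> mmax" for x e using dX_cst by (simp add: mmax_def)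
  have "qdim fsc (bnd b (\<lambda>n i j. cst (a n i j)) m) (cyc b (\<lambda>n i j. cst (a n i j)) m) n \<longleftrightarrow> qdim (lsc msc) (t.UX m) (t.VX m) n"
    by (rule t.qdim_tor[OF i]) (rule dm)
  moreover have "t.VX m = XM A m" unfolding t.VX_def using dm by auto
  moreover have U: "t.UX m = UG m" unfolding t.UX_def UG_def ..
  ultimately show "qdim (lsc msc) (UG m) (XM A m) (residue_betti I m)" using n nb by simp
  interpret x: vector_space "lsc msc :: 'k \<Rightarrow> ('l list \<times> 'n set \<Rightarrow> ('n, 'k) mpoly) \<Rightarrow> _" by (intro vector_space_lsc vector_space_msc)
  show "x.subspace (UG m)" unfolding x.subspace_def
  proof (intro conjI ballI allI)
    show "0 \<in> UG m" unfolding UG_def by (auto simp: XM_def dX_zero I_0 mmax_def intro!: bexI[of _ "\<lambda>e. 0"])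
  next
    fix x y assume "x \<in> UG m" "y \<in> UG m"
    then obtain u v where u: "x \<in> XM A m" "u \<in> XM A m" "\<forall>e. dX u e \<in> I" "\<forall>e. x e - u e \<in> mmax"
      and v: "y \<in> XM A m" "v \<in> XM A m" "\<forall>e. dX v e \<in> I" "\<forall>e. y e - v e \<in> mmax" by (auto simp: UG_def)
    have "\<forall>e. (x + y) e - (u e + v e) \<in> mmax" using u v by (simp add: mmax_def cst_add cst_diff)
    moreover have "\<forall>e. dX (\<lambda>e. u e + v e) e \<in> I" using u v by (simp add: dX_add I_add)
    moreover have "x + y \<in> XM A m" "(\<lambda>e. u e + v e) \<in> XM A m" using u v by (simp_all add: XM_def)
    ultimately show "x + y \<in> UG m" unfolding UG_def by blast
  next
    fix c x assume "x \<in> UG m"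
    then obtain u where u: "x \<in> XM A m" "u \<in> XM A m" "\<forall>e. dX u e \<in> I" "\<forall>e. x e - u e \<in> mmax" by (auto simp: UG_def)
    have "\<forall>e. lsc msc c x e - mconst c * u e \<in> mmax" using u by (simp add: mmax_def cst_diff lsc_def msc_def cst_mult)
    moreover have "\<forall>e. dX (\<lambda>e. mconst c * u e) e \<in> I" using u by (simp add: dX_smult I_mult)
    moreover have "lsc msc c x \<in> XM A m" "(\<lambda>e. mconst c * u e) \<in> XM A m" using u by (simp_all add: XM_def lsc_def msc_def)
    ultimately show "lsc msc c x \<in> UG m" unfolding UG_def by blast
  qed
qed

lemma mm_subspace: "Modules.module.subspace (lsc msc) {x \<in> XM A m. \<forall>e. x e \<in> (mmax :: ('n, 'k) mpoly set)}"
proof -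
  interpret x: vector_space "lsc msc :: 'k \<Rightarrow> ('l list \<times> 'n set \<Rightarrow> ('n, 'k) mpoly) \<Rightarrow> _" by (intro vector_space_lsc vector_space_msc)
  show ?thesis by (auto simp: x.subspace_def XM_def mmax_def cst_add cst_mult lsc_def msc_def)
qed

lemma mm_UG: "{x \<in> XM A m. \<forall>e. x e \<in> mmax} \<subseteq> UG m"
  by (auto simp: UG_def XM_def dX_zero I_0 intro!: bexI[of _ "\<lambda>e. 0"])

text \<open>Below \<open>N\<close> cycles are boundaries, and boundaries have no constant terms, so
  \<open>UG m\<close> shrinks to the multiples of the maximal ideal. The strict bound
  \<open>m < N\<close> leaves room for the chains of degree \<open>Suc m\<close> in the exactness
  argument.\<close>

lemma residue_betti_eq:
  assumes m: "m < N" shows "residue_betti I m = card (A m)"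
proof (cases m)
  case 0
  then show ?thesis using residue_betti_0[OF ideal_I I_mmax] by (simp add: A_0)
next
  case (Suc i)
  have "UG m = {x \<in> XM A m. \<forall>e. x e \<in> mmax}"
  proof
    show "UG m \<subseteq> {x \<in> XM A m. \<forall>e. x e \<in> mmax}"
    proof
      fix x assume "x \<in> UG m"
      then obtain y where y: "x \<in> XM A m" "y \<in> XM A m" "\<forall>e. dX y e \<in> I" "\<forall>e. x e - y e \<in> mmax" by (auto simp: UG_def)
      then obtain w where w: "\<forall>e. y e - dX w e \<in> I" using dX_exact[OF m, of y] Suc by auto
      have "cst (x e) = 0" for e
      proof -
        have "cst (x e) = cst (x e - y e) + cst (y e - dX w e) + cst (dX w e)" by (simp add: cst_diff)
        then show ?thesis using y(4)[rule_format, of e] I_cst[OF w[rule_format, of e]] dX_cst by (simp add: mmax_def)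
      qed
      then show "x \<in> {x \<in> XM A m. \<forall>e. x e \<in> mmax}" using y(1) by (simp add: mmax_def)
    qed
  qed (rule mm_UG)
  moreover have "qdim (lsc msc) (UG m) (XM A m) (residue_betti I m)" using m Suc by (intro qdim_residue_betti(1)) auto
  ultimately show ?thesis
    by (intro qdim_unique[OF vector_space_lsc[OF vector_space_msc] mm_subspace _ qdim_free[OF finite_AX[OF finL]]]) simp
qed

text \<open>The cycle \<open>y\<close> lies in \<open>UG m\<close> but is not a multiple of the
  maximal ideal. Here \<open>m = N\<close> is allowed, as exactness in degree \<open>m\<close> plays
  no part.\<close>

lemma residue_betti_less:
  assumes m: "1 \<le> m" "m \<le> N" and y: "y \<in> XM A m" "\<And>e. dX y e \<in> I" "cst (y e) \<noteq> 0"
  shows "residue_betti I m < card (A m)"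
proof (rule qdim_strict[OF vector_space_lsc[OF vector_space_msc] qdim_residue_betti(2)[OF m] mm_subspace mm_UG
       qdim_residue_betti(1)[OF m] qdim_free[OF finite_AX[OF finL]]])
  show "y \<in> UG m" using y unfolding UG_def by (auto intro!: bexI[of _ y] simp: mmax_def)
  show "y \<in> XM A m" by fact
  have "y e \<notin> mmax" using y(3) by (simp add: mmax_def)
  then show "y \<notin> {x \<in> XM A m. \<forall>e. x e \<in> mmax}" by blast
qed

end

section \<open>The Golod series\<close>

lemma fps_one_plus_X_power_nth: "((1 + fps_X) ^ N :: 'a::comm_ring_1 fps) $ i = of_nat (N choose i)"
proof (induction N arbitrary: i)
  case 0 then show ?case by (cases i) auto
next
  case (Suc N)
  have e: "((1 + fps_X) ^ Suc N :: 'a fps) = (1 + fps_X) ^ N + fps_X * (1 + fps_X) ^ N" by (simp only: power_Suc distrib_right mult_1_left)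
  show ?case unfolding e fps_add_nth fps_X_mult_nth Suc.IH by (cases i) (auto simp: add.commute)
qed

definition num_words :: "'l set \<Rightarrow> ('l \<Rightarrow> nat) \<Rightarrow> nat \<Rightarrow> nat" where "num_words L dg n = card {w. set w \<subseteq> L \<and> wt dg w = n}"

lemma finite_wt_eq: "finite L \<Longrightarrow> finite {w. set w \<subseteq> L \<and> wt dg w = n}"
  using finite_wt[of L dg n] by (rule finite_subset[rotated]) auto

lemma num_words_0: "num_words L dg 0 = 1"
proof -
  have "w = []" if "wt dg w = 0" for w :: "'a list" using that by (cases w) (auto simp: wt_simps)
  then have "{w. set w \<subseteq> L \<and> wt dg w = 0} = {[]}" by (auto simp: wt_simps)
  then show ?thesis by (simp add: num_words_def)
qed

text \<open>Splitting off a first letter of degree \<open>i\<close> lowers the weight by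
  \<open>Suc i\<close>, which leaves \<open>n - i\<close>.\<close>

lemma num_words_Suc:
  assumes L: "finite L"
  shows "num_words L dg (Suc n) = (\<Sum>i=0..n. card {v \<in> L. dg v = i} * num_words L dg (n - i))"
proof -
  let ?W = "\<lambda>n. {w. set w \<subseteq> L \<and> wt dg w = n}"
  let ?V = "{v \<in> L. dg v \<le> n}"
  have eq: "?W (Suc n) = (\<Union>v\<in>?V. (#) v ` ?W (n - dg v))"
  proof (intro equalityI subsetI)
    fix w assume w: "w \<in> ?W (Suc n)"
    then obtain v w' where vw: "w = v # w'" by (cases w) (auto simp: wt_simps)
    then have "v \<in> ?V" "w' \<in> ?W (n - dg v)" using w by (auto simp: wt_simps)
    then show "w \<in> (\<Union>v\<in>?V. (#) v ` ?W (n - dg v))" using vw by blast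
  qed (auto simp: wt_simps)
  have "num_words L dg (Suc n) = (\<Sum>v\<in>?V. card ((#) v ` ?W (n - dg v)))"
    unfolding num_words_def eq by (rule card_UN_disjoint) (use L finite_wt_eq[OF L] in auto)
  also have "\<dots> = (\<Sum>v\<in>?V. num_words L dg (n - dg v))"
    by (intro sum.cong refl) (simp add: card_image num_words_def)
  also have "\<dots> = (\<Sum>i=0..n. \<Sum>v\<in>{v \<in> ?V. dg v = i}. num_words L dg (n - dg v))"
    by (rule sum.group[symmetric]) (use L in auto)
  also have "\<dots> = (\<Sum>i=0..n. card {v \<in> L. dg v = i} * num_words L dg (n - i))"
  proof (rule sum.cong[OF refl])
    fix i assume "i \<in> {0..n}"
    then have "{v \<in> ?V. dg v = i} = {v \<in> L. dg v = i}" by auto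
    then show "(\<Sum>v\<in>{v \<in> ?V. dg v = i}. num_words L dg (n - dg v)) = card {v \<in> L. dg v = i} * num_words L dg (n - i)" by simp
  qed
  finally show ?thesis .
qed

lemma card_AX:
  assumes L: "finite L"
  shows "card (AX L dg n :: ('l list \<times> 'n::finite set) set) = (\<Sum>i=0..n. (CARD('n) choose i) * num_words L dg (n - i))"
proof -
  let ?W = "\<lambda>n. {w. set w \<subseteq> L \<and> wt dg w = n}"
  let ?V = "{F :: 'n set. card F \<le> n}"
  have eq: "(AX L dg n :: ('l list \<times> 'n set) set) = (\<Union>F\<in>?V. (\<lambda>w. (w, F)) ` ?W (n - card F))"
  proof (intro equalityI subsetI)
    fix e :: "'l list \<times> 'n set" assume e: "e \<in> AX L dg n"
    obtain w F where wF: "e = (w, F)" by (cases e)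
    have "F \<in> ?V" "w \<in> ?W (n - card F)" using e by (auto simp: AX_def wF)
    then show "e \<in> (\<Union>F\<in>?V. (\<lambda>w. (w, F)) ` ?W (n - card F))" unfolding wF by (intro UN_I[of F] imageI) auto
  qed (auto simp: AX_def)
  have "card (AX L dg n :: ('l list \<times> 'n set) set) = (\<Sum>F\<in>?V. card ((\<lambda>w. (w, F)) ` ?W (n - card F)))"
    unfolding eq by (rule card_UN_disjoint) (use finite_wt_eq[OF L] in auto)
  also have "\<dots> = (\<Sum>F\<in>?V. num_words L dg (n - card F))"
    by (intro sum.cong refl) (simp add: card_image inj_on_def num_words_def)
  also have "\<dots> = (\<Sum>i=0..n. \<Sum>F\<in>{F \<in> ?V. card F = i}. num_words L dg (n - card F))"
    by (rule sum.group[symmetric]) auto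
  also have "\<dots> = (\<Sum>i=0..n. (CARD('n) choose i) * num_words L dg (n - i))"
  proof (rule sum.cong[OF refl])
    fix i assume "i \<in> {0..n}"
    then have "{F \<in> ?V. card F = i} = {F. F \<subseteq> UNIV \<and> card F = i}" by auto
    then have "card {F \<in> ?V. card F = i} = CARD('n) choose i" using n_subsets[of "UNIV :: 'n set" i] by simp
    then show "(\<Sum>F\<in>{F \<in> ?V. card F = i}. num_words L dg (n - card F)) = (CARD('n) choose i) * num_words L dg (n - i)" by simp
  qed
  finally show ?thesis .
qed

text \<open>The generating series \<open>C\<close> of the words satisfies
  \<open>C = 1 + t * B * C\<close>, so it inverts the denominator, and the exterior algebra
  contributes the numerator. Golodness thus says that the Betti numbers are the ranks of Golod's
  complex.\<close>

theorem golod_iff_card: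
  fixes I :: "('n::finite, 'k::field) mpoly set"
  assumes L: "finite L" "\<And>v. v \<in> L \<Longrightarrow> dg v \<ge> 1" and b: "\<And>i. i \<ge> 1 \<Longrightarrow> card {v \<in> L. dg v = i} = quotient_betti I i"
  shows "golod I \<longleftrightarrow> (\<forall>j. residue_betti I j = card (AX L dg j :: ('l list \<times> 'n set) set))"
proof -
  define B :: "rat fps" where "B = Abs_fps (\<lambda>j. if j = 0 then 0 else of_nat (quotient_betti I j))"
  define C :: "rat fps" where "C = Abs_fps (\<lambda>j. of_nat (num_words L dg j))"
  let ?D = "1 - fps_X * B"
  have b0: "{v \<in> L. dg v = 0} = {}" using L(2) by force
  have Bb: "B $ i = of_nat (card {v \<in> L. dg v = i})" for i
  proof (cases "i = 0")
    case True then show ?thesis by (simp only: B_def b0 True) simp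
  qed (simp add: B_def b)
  have "C = 1 + fps_X * (B * C)"
  proof (rule fps_ext)
    fix n
    show "C $ n = (1 + fps_X * (B * C)) $ n"
    proof (cases n)
      case 0 then show ?thesis by (simp add: C_def num_words_0)
    next
      case (Suc n')
      have "C $ n = (\<Sum>i=0..n'. of_nat (card {v \<in> L. dg v = i}) * of_nat (num_words L dg (n' - i)))"
        by (simp add: C_def Suc num_words_Suc[OF L(1)])
      also have "\<dots> = (B * C) $ n'" by (simp add: fps_mult_nth Bb) (simp add: C_def)
      finally show ?thesis by (simp add: Suc)
    qed
  qed
  then have DC: "?D * C = 1" by (simp add: algebra_simps)
  then have D0: "?D \<noteq> 0" by auto
  have "(1 + fps_X) ^ CARD('n) / ?D = ((1 + fps_X) ^ CARD('n) * C) * ?D / ?D"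
    using DC by (simp add: mult.assoc mult.commute[of C])
  also have "\<dots> = (1 + fps_X) ^ CARD('n) * C" using D0 by (rule nonzero_mult_div_cancel_right)
  also have "\<dots> = Abs_fps (\<lambda>j. of_nat (card (AX L dg j :: ('l list \<times> 'n set) set)))"
    by (rule fps_ext) (simp add: fps_mult_nth fps_one_plus_X_power_nth card_AX[OF L(1)] C_def)
  finally have e: "(1 + fps_X) ^ CARD('n) / ?D = Abs_fps (\<lambda>j. of_nat (card (AX L dg j :: ('l list \<times> 'n set) set)))" .
  show ?thesis unfolding golod_def B_def[symmetric] e by (simp add: fps_eq_iff)
qed

section \<open>Exponents of monomial ideals\<close>

definition up_closure :: "('n \<Rightarrow>\<^sub>0 nat) set \<Rightarrow> ('n \<Rightarrow>\<^sub>0 nat) set" where "up_closure G = {g + d | g d. g \<in> G}"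
definition colon_exps :: "('n \<Rightarrow>\<^sub>0 nat) set \<Rightarrow> ('n \<Rightarrow>\<^sub>0 nat) set \<Rightarrow> ('n \<Rightarrow>\<^sub>0 nat) set" where "colon_exps E G = {m. \<forall>g\<in>G. m + g \<in> E}"
definition esum :: "('n \<Rightarrow>\<^sub>0 nat) set \<Rightarrow> ('n \<Rightarrow>\<^sub>0 nat) set \<Rightarrow> ('n \<Rightarrow>\<^sub>0 nat) set" where "esum E E' = {m + m' | m m'. m \<in> E \<and> m' \<in> E'}"

lemma upset_up_closure: "upset (up_closure G)"
  unfolding upset_def up_closure_def by (auto simp: add.assoc) blast

lemma up_closure_self: "g \<in> G \<Longrightarrow> g \<in> up_closure G"
  unfolding up_closure_def by (intro CollectI exI[of _ g] exI[of _ 0]) simp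

lemma upset_colon_exps: "upset E \<Longrightarrow> upset (colon_exps E G)"
proof -
  assume E: "upset E"
  have "m + d + g \<in> E" if "m + g \<in> E" for m d g
  proof -
    have "m + d + g = (m + g) + d" by (simp add: ac_simps)
    then show ?thesis using E that by (auto simp: upset_def)
  qed
  then show ?thesis unfolding upset_def colon_exps_def by blast
qed

lemma upset_esum: "upset E \<Longrightarrow> upset (esum E E')"
proof -
  assume "upset E"
  moreover have "m + m' + d = (m + d) + m'" for m m' d :: "'a \<Rightarrow>\<^sub>0 nat" by (simp add: ac_simps)
  ultimately show ?thesis unfolding upset_def esum_def by blast
qed

lemma mpoly_eq_sum: "f = (\<Sum>m\<in>ks f. Poly_Mapping.single m (lk f m))" for f :: "('n::finite, 'k::field) mpoly"
proof (rule poly_mapping_eqI)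
  fix m
  have "lk (\<Sum>m\<in>ks f. Poly_Mapping.single m (lk f m)) m = (\<Sum>m'\<in>ks f. if m' = m then lk f m else 0)"
    unfolding lk_sum by (rule sum.cong) (auto simp: lookup_single when_def)
  also have "\<dots> = lk f m" by (auto simp: sum.delta in_keys_iff)
  finally show "lk f m = lk (\<Sum>m\<in>ks f. Poly_Mapping.single m (lk f m)) m" by simp
qed

lemma Mid_subset_closed:
  assumes "0 \<in> S" "\<And>f g. f \<in> S \<Longrightarrow> g \<in> S \<Longrightarrow> f + g \<in> S" "\<And>m c. m \<in> E \<Longrightarrow> Poly_Mapping.single m c \<in> S"
  shows "Mid E \<subseteq> (S :: ('n::finite, 'k::field) mpoly set)"
proof
  fix f :: "('n, 'k) mpoly" assume f: "f \<in> Mid E"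
  have "(\<Sum>m\<in>T. Poly_Mapping.single m (lk f m)) \<in> S" if "T \<subseteq> ks f" for T
    using finite_subset[OF that finite_keys] that
  proof (induction T rule: finite_induct)
    case (insert x T) then show ?case using assms f by (auto simp: Mid_def)
  qed (use assms in auto)
  then show "f \<in> S" using mpoly_eq_sum[of f] by (metis subset_refl)
qed

lemma Mid_mono_iff: "(Mid E :: ('n::finite, 'k::field) mpoly set) \<subseteq> Mid E' \<longleftrightarrow> E \<subseteq> E'"
proof
  assume a: "(Mid E :: ('n, 'k) mpoly set) \<subseteq> Mid E'"
  show "E \<subseteq> E'"
  proof
    fix m assume "m \<in> E"
    then have "(Poly_Mapping.single m 1 :: ('n, 'k) mpoly) \<in> Mid E'" by (intro subsetD[OF a]) (simp add: single_Mid)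
    then show "m \<in> E'" by (simp add: Mid_def)
  qed
qed (auto simp: Mid_def)

lemma ideal_of_monomials: "ideal_of (monomial ` G) = (Mid (up_closure G) :: ('n::finite, 'k::field) mpoly set)"
proof -
  interpret cring "mpoly_ring :: ('n, 'k) mpoly ring" by (rule cring_mpoly)
  let ?J = "ideal_of (monomial ` G) :: ('n, 'k) mpoly set"
  have J: "is_ideal ?J" unfolding ideal_mpoly_iff[symmetric] ideal_of_def
    by (rule genideal_ideal) (simp add: mpoly_ring_simps)
  have GJ: "monomial g \<in> ?J" if "g \<in> G" for g
    using genideal_self[of "monomial ` G"] that by (auto simp: ideal_of_def mpoly_ring_simps)
  show ?thesis
  proof
    show "?J \<subseteq> Mid (up_closure G)" unfolding ideal_of_def
    proof (rule genideal_minimal)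
      show "ideal (Mid (up_closure G)) mpoly_ring" unfolding ideal_mpoly_iff by (rule Mid_ideal[OF upset_up_closure])
      show "monomial ` G \<subseteq> Mid (up_closure G)" by (auto simp: monomial_def single_Mid up_closure_self)
    qed
    show "Mid (up_closure G) \<subseteq> ?J"
    proof (rule Mid_subset_closed)
      fix m c assume "m \<in> up_closure G"
      then obtain g d where g: "g \<in> G" "m = g + d" by (auto simp: up_closure_def)
      have "(Poly_Mapping.single m c :: ('n, 'k) mpoly) = Poly_Mapping.single d c * monomial g"
        by (simp add: monomial_def mult_single g add.commute)
      then show "(Poly_Mapping.single m c :: ('n, 'k) mpoly) \<in> ?J" using idl.subspace_scale[OF J GJ[OF g(1)]] by simp
    qed (use J in \<open>auto simp: idl.subspace_0 idl.subspace_add\<close>)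
  qed
qed

text \<open>Multiplication by a monomial shifts exponents injectively. Nothing can cancel, and each
  term of \<open>f\<close> is tested on its own.\<close>

lemma colon_Mid:
  assumes E: "upset E"
  shows "colon_ideal mpoly_ring (Mid E) (Mid (up_closure G)) = (Mid (colon_exps E G) :: ('n::finite, 'k::field) mpoly set)"
proof (intro equalityI subsetI)
  fix f :: "('n, 'k) mpoly" assume f: "f \<in> colon_ideal mpoly_ring (Mid E) (Mid (up_closure G))"
  have "m + g \<in> E" if m: "m \<in> ks f" and g: "g \<in> G" for m g
  proof -
    have "f * monomial g \<in> Mid E" using f g by (auto simp: colon_ideal_def mpoly_ring_simps monomial_def single_Mid up_closure_self)
    moreover have "lk (f * monomial g) (g + m) = lk f m"
      using lookup_times_single[of g 1 f m] by (simp add: monomial_def mult.commute)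
    ultimately show ?thesis using m by (auto simp: Mid_def in_keys_iff subset_iff add.commute)
  qed
  then show "f \<in> Mid (colon_exps E G)" by (auto simp: Mid_def colon_exps_def)
next
  fix f :: "('n, 'k) mpoly" assume f: "f \<in> Mid (colon_exps E G)"
  have "f * g \<in> Mid E" if g: "g \<in> Mid (up_closure G)" for g
  proof -
    have "m + m' \<in> E" if mm: "m \<in> ks f" "m' \<in> ks g" for m m'
    proof -
      obtain h d where h: "h \<in> G" "m' = h + d" using g mm(2) by (auto simp: Mid_def up_closure_def)
      have "m + h \<in> E" using f mm(1) h(1) by (auto simp: Mid_def colon_exps_def)
      then have "m + h + d \<in> E" using E by (auto simp: upset_def)
      then show ?thesis by (simp add: h(2) add.assoc)
    qed
    then show ?thesis using keys_mult[of f g] by (auto simp: Mid_def)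
  qed
  then show "f \<in> colon_ideal mpoly_ring (Mid E) (Mid (up_closure G))" by (auto simp: colon_ideal_def mpoly_ring_simps)
qed

lemma Mid_set_add: "Mid E <+>\<^bsub>mpoly_ring\<^esub> Mid E' = (Mid (E \<union> E') :: ('n::finite, 'k::field) mpoly set)"
proof
  show "Mid E <+>\<^bsub>mpoly_ring\<^esub> Mid E' \<subseteq> (Mid (E \<union> E') :: ('n, 'k) mpoly set)"
  proof
    fix h :: "('n, 'k) mpoly" assume "h \<in> Mid E <+>\<^bsub>mpoly_ring\<^esub> Mid E'"
    then obtain f g where "f \<in> Mid E" "g \<in> Mid E'" "h = f + g" by (auto simp: set_add_def' mpoly_ring_simps)
    then show "h \<in> Mid (E \<union> E')" using keys_add[of f g] by (auto simp: Mid_def)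
  qed
  show "(Mid (E \<union> E') :: ('n, 'k) mpoly set) \<subseteq> Mid E <+>\<^bsub>mpoly_ring\<^esub> Mid E'"
  proof
    fix h :: "('n, 'k) mpoly" assume h: "h \<in> Mid (E \<union> E')"
    let ?f = "\<Sum>m\<in>ks h \<inter> E. Poly_Mapping.single m (lk h m)" and ?g = "\<Sum>m\<in>ks h - E. Poly_Mapping.single m (lk h m)"
    have k: "ks (\<Sum>m\<in>T. Poly_Mapping.single m (lk h m)) \<subseteq> T" for T
    proof -
      have "lk (\<Sum>m\<in>T. Poly_Mapping.single m (lk h m)) m' = 0" if "m' \<notin> T" for m'
        unfolding lk_sum by (rule sum.neutral) (use that in \<open>auto simp: lookup_single when_def\<close>)
      then show ?thesis by (auto simp: in_keys_iff)
    qed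
    have "?f \<in> Mid E" "?g \<in> Mid E'" using k[of "ks h \<inter> E"] k[of "ks h - E"] h unfolding Mid_def by auto
    moreover have "h = ?f + ?g"
    proof -
      have "h = (\<Sum>m\<in>(ks h \<inter> E) \<union> (ks h - E). Poly_Mapping.single m (lk h m))"
        using mpoly_eq_sum[of h] by (simp add: Int_Diff_Un)
      then show ?thesis by (subst (asm) sum.union_disjoint) auto
    qed
    ultimately show "h \<in> Mid E <+>\<^bsub>mpoly_ring\<^esub> Mid E'" unfolding set_add_def' mpoly_ring_simps by blast
  qed
qed

lemma Mid_prod: 
  assumes "upset E" shows "Mid E \<cdot>\<^bsub>mpoly_ring\<^esub> Mid E' = (Mid (esum E E') :: ('n::finite, 'k::field) mpoly set)"
proof
  have id: "is_ideal (Mid (esum E E') :: ('n, 'k) mpoly set)" by (rule Mid_ideal[OF upset_esum[OF assms]])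
  show "Mid E \<cdot>\<^bsub>mpoly_ring\<^esub> Mid E' \<subseteq> (Mid (esum E E') :: ('n, 'k) mpoly set)"
  proof
    fix h :: "('n, 'k) mpoly" assume "h \<in> Mid E \<cdot>\<^bsub>mpoly_ring\<^esub> Mid E'"
    then show "h \<in> Mid (esum E E')"
    proof (induction h rule: ideal_prod.induct)
      case (prod f g)
      then show ?case using keys_mult[of f g] by (auto simp: Mid_def esum_def mpoly_ring_simps) blast
    next
      case (sum f g) then show ?case using idl.subspace_add[OF id] by (simp add: mpoly_ring_simps)
    qed
  qed
  show "(Mid (esum E E') :: ('n, 'k) mpoly set) \<subseteq> Mid E \<cdot>\<^bsub>mpoly_ring\<^esub> Mid E'"
  proof (rule Mid_subset_closed)
    have "(0 :: ('n, 'k) mpoly) \<otimes>\<^bsub>mpoly_ring\<^esub> 0 \<in> Mid E \<cdot>\<^bsub>mpoly_ring\<^esub> Mid E'"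
      by (rule ideal_prod.prod) (auto simp: Mid_def)
    then show "(0 :: ('n, 'k) mpoly) \<in> Mid E \<cdot>\<^bsub>mpoly_ring\<^esub> Mid E'" by (simp add: mpoly_ring_simps)
  next
    fix f g :: "('n, 'k) mpoly" assume "f \<in> Mid E \<cdot>\<^bsub>mpoly_ring\<^esub> Mid E'" "g \<in> Mid E \<cdot>\<^bsub>mpoly_ring\<^esub> Mid E'"
    from ideal_prod.sum[OF this] show "f + g \<in> Mid E \<cdot>\<^bsub>mpoly_ring\<^esub> Mid E'" by (simp add: mpoly_ring_simps)
  next
    fix m c assume "m \<in> esum E E'"
    then obtain a b where ab: "a \<in> E" "b \<in> E'" "m = a + b" by (auto simp: esum_def)
    have "Poly_Mapping.single a c \<otimes>\<^bsub>mpoly_ring\<^esub> (monomial b :: ('n, 'k) mpoly) \<in> Mid E \<cdot>\<^bsub>mpoly_ring\<^esub> Mid E'"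
      by (rule ideal_prod.prod) (auto simp: single_Mid monomial_def ab)
    then show "(Poly_Mapping.single m c :: ('n, 'k) mpoly) \<in> Mid E \<cdot>\<^bsub>mpoly_ring\<^esub> Mid E'"
      by (simp add: mpoly_ring_simps monomial_def mult_single ab)
  qed
qed

lemma Mid_Int: "Mid E \<inter> Mid E' = Mid (E \<inter> E')" by (auto simp: Mid_def)

text \<open>The four inclusions, read on exponents of monomials.\<close>

definition comb1 where "comb1 E i j k l \<longleftrightarrow> (\<forall>f g. f + one_at i \<in> E \<longrightarrow> g + one_at j \<in> E \<longrightarrow> g + one_at k \<in> E \<longrightarrow> g + one_at l \<in> E \<longrightarrow> f + g \<in> E)"
definition comb2 where "comb2 E i j k l \<longleftrightarrow> (\<forall>f g. f + one_at i \<in> E \<longrightarrow> f + one_at j \<in> E \<longrightarrow> g + one_at k \<in> E \<longrightarrow> g + one_at l \<in> E \<longrightarrow> f + g \<in> E)"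
definition comb3 where "comb3 E i j k l \<longleftrightarrow> (\<forall>f g. f + one_at i \<in> E \<longrightarrow> g + one_at j \<in> E \<longrightarrow> g + one_at k \<in> E \<longrightarrow> f + g \<in> E \<or> 
   (\<exists>h. f + g = one_at l + h \<and> h + one_at i \<in> E \<and> h + one_at j \<in> E \<and> h + one_at k \<in> E))"
definition comb4 where "comb4 E i j k l \<longleftrightarrow> (\<forall>f g. f + one_at i \<in> E \<longrightarrow> g + one_at j \<in> E \<longrightarrow> f + g \<in> E \<or> 
   (\<exists>h. f + g = one_at k + h \<and> h + one_at i \<in> E \<and> h + one_at j \<in> E) \<or>
   (\<exists>h. f + g = one_at l + h \<and> h + one_at i \<in> E \<and> h + one_at j \<in> E) \<or>
   (\<exists>h. f + g = one_at k + one_at l + h \<and> h + (one_at i + one_at j) \<in> E \<and>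
      ((h + one_at l + one_at i \<in> E \<and> h + one_at k + one_at j \<in> E) \<or> (h + one_at l + one_at j \<in> E \<and> h + one_at k + one_at i \<in> E))))"

definition comb :: "('n \<Rightarrow>\<^sub>0 nat) set \<Rightarrow> bool" where
  "comb E \<longleftrightarrow> (\<forall>i j k l. distinct [i, j, k, l] \<longrightarrow> comb1 E i j k l \<and> comb2 E i j k l \<and> comb3 E i j k l \<and> comb4 E i j k l)"

lemma mem_esum_up: "upset E \<Longrightarrow> m \<in> esum (up_closure G) E \<longleftrightarrow> (\<exists>g\<in>G. \<exists>h\<in>E. m = g + h)"
proof
  assume E: "upset E" and "m \<in> esum (up_closure G) E"
  then obtain g d h where "g \<in> G" "h \<in> E" "m = g + (h + d)" by (auto simp: esum_def up_closure_def ac_simps)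
  then show "\<exists>g\<in>G. \<exists>h\<in>E. m = g + h" using E by (auto simp: upset_def)
next
  assume "\<exists>g\<in>G. \<exists>h\<in>E. m = g + h"
  then obtain g h where "g \<in> G" "h \<in> E" "m = (g + 0) + h" by auto
  then show "m \<in> esum (up_closure G) E" unfolding esum_def up_closure_def by blast
qed

lemma comb1_iff: "esum (colon_exps E {one_at i}) (colon_exps E {one_at j, one_at k, one_at l}) \<subseteq> E \<longleftrightarrow> comb1 E i j k l"
  by (auto simp: esum_def colon_exps_def comb1_def)

lemma comb2_iff: "esum (colon_exps E {one_at i, one_at j}) (colon_exps E {one_at k, one_at l}) \<subseteq> E \<longleftrightarrow> comb2 E i j k l"
  by (auto simp: esum_def colon_exps_def comb2_def)

lemma comb3_iff: assumes E: "upset E" 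
  shows "esum (colon_exps E {one_at i}) (colon_exps E {one_at j, one_at k}) \<subseteq> E \<union> esum (up_closure {one_at l}) (colon_exps E {one_at i, one_at j, one_at k}) \<longleftrightarrow> comb3 E i j k l"
proof -
  have "m \<in> esum (up_closure {one_at l}) (colon_exps E {one_at i, one_at j, one_at k}) \<longleftrightarrow> 
     (\<exists>h. m = one_at l + h \<and> h + one_at i \<in> E \<and> h + one_at j \<in> E \<and> h + one_at k \<in> E)" for m
    unfolding mem_esum_up[OF upset_colon_exps[OF E]] by (auto simp: colon_exps_def)
  then have "esum (colon_exps E {one_at i}) (colon_exps E {one_at j, one_at k}) \<subseteq> E \<union> esum (up_closure {one_at l}) (colon_exps E {one_at i, one_at j, one_at k}) \<longleftrightarrow> 
    (\<forall>m\<in>esum (colon_exps E {one_at i}) (colon_exps E {one_at j, one_at k}). m \<in> E \<or> (\<exists>h. m = one_at l + h \<and> h + one_at i \<in> E \<and> h + one_at j \<in> E \<and> h + one_at k \<in> E))"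
    by blast
  also have "\<dots> \<longleftrightarrow> (\<forall>f g. f + one_at i \<in> E \<longrightarrow> g + one_at j \<in> E \<longrightarrow> g + one_at k \<in> E \<longrightarrow> f + g \<in> E \<or> (\<exists>h. f + g = one_at l + h \<and> h + one_at i \<in> E \<and> h + one_at j \<in> E \<and> h + one_at k \<in> E))"
    unfolding esum_def colon_exps_def by blast
  finally show ?thesis unfolding comb3_def .
qed

lemma mem_esum_up1: "upset E \<Longrightarrow> m \<in> esum (up_closure {g}) E \<longleftrightarrow> (\<exists>h\<in>E. m = g + h)"
  using mem_esum_up[of E m "{g}"] by simp

lemma comb4_iff: assumes E: "upset E" 
  shows "esum (colon_exps E {one_at i}) (colon_exps E {one_at j}) \<subseteq> 
     E \<union> esum (up_closure {one_at k, one_at l}) (colon_exps E {one_at i, one_at j}) \<union>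
      (esum (up_closure {one_at k + one_at l}) (colon_exps E {one_at i + one_at j}) \<inter>
        ((esum (up_closure {one_at k}) (colon_exps E {one_at i}) \<inter> esum (up_closure {one_at l}) (colon_exps E {one_at j})) \<union>
         (esum (up_closure {one_at k}) (colon_exps E {one_at j}) \<inter> esum (up_closure {one_at l}) (colon_exps E {one_at i})))) \<longleftrightarrow> comb4 E i j k l"
   (is "?S \<subseteq> E \<union> ?A \<union> (?B \<inter> (?C1 \<inter> ?C2 \<union> ?C3 \<inter> ?C4)) \<longleftrightarrow> _")
proof -
  note up_col = upset_colon_exps[OF E]
  have A: "m \<in> ?A \<longleftrightarrow> (\<exists>h. m = one_at k + h \<and> h + one_at i \<in> E \<and> h + one_at j \<in> E) \<or> (\<exists>h. m = one_at l + h \<and> h + one_at i \<in> E \<and> h + one_at j \<in> E)" for m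
    unfolding mem_esum_up[OF up_col] by (auto simp: colon_exps_def)
  \<comment> \<open>For a multiple of the product of both variables, membership in each of the
    ideals being intersected is read off after cancelling one variable, so everything is expressed
    by the single exponent \<open>h\<close>.\<close>
  have C: "one_at k + one_at l + h \<in> esum (up_closure {one_at k}) (colon_exps E {one_at i}) \<longleftrightarrow> h + one_at l + one_at i \<in> E"
    "one_at k + one_at l + h \<in> esum (up_closure {one_at l}) (colon_exps E {one_at i}) \<longleftrightarrow> h + one_at k + one_at i \<in> E" for h i
  proof -
    have "one_at k + one_at l + h = one_at k + h' \<longleftrightarrow> h' = h + one_at l" for h'
      using add_left_cancel[of "one_at k" h' "h + one_at l"] by (auto simp only: ac_simps)
    then show "one_at k + one_at l + h \<in> esum (up_closure {one_at k}) (colon_exps E {one_at i}) \<longleftrightarrow> h + one_at l + one_at i \<in> E"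
      unfolding mem_esum_up1[OF up_col] by (simp add: colon_exps_def)
    have "one_at k + one_at l + h = one_at l + h' \<longleftrightarrow> h' = h + one_at k" for h'
      using add_left_cancel[of "one_at l" h' "h + one_at k"] by (auto simp only: ac_simps)
    then show "one_at k + one_at l + h \<in> esum (up_closure {one_at l}) (colon_exps E {one_at i}) \<longleftrightarrow> h + one_at k + one_at i \<in> E"
      unfolding mem_esum_up1[OF up_col] by (simp add: colon_exps_def)
  qed
  have B: "m \<in> ?B \<inter> (?C1 \<inter> ?C2 \<union> ?C3 \<inter> ?C4) \<longleftrightarrow> (\<exists>h. m = one_at k + one_at l + h \<and> h + (one_at i + one_at j) \<in> E \<and>
      ((h + one_at l + one_at i \<in> E \<and> h + one_at k + one_at j \<in> E) \<or> (h + one_at l + one_at j \<in> E \<and> h + one_at k + one_at i \<in> E)))" for m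
  proof -
    have "m \<in> ?B \<longleftrightarrow> (\<exists>h. m = one_at k + one_at l + h \<and> h + (one_at i + one_at j) \<in> E)"
      unfolding mem_esum_up1[OF up_col] by (auto simp: colon_exps_def)
    then show ?thesis using C by auto
  qed
  have "?S \<subseteq> E \<union> ?A \<union> (?B \<inter> (?C1 \<inter> ?C2 \<union> ?C3 \<inter> ?C4)) \<longleftrightarrow> (\<forall>m\<in>?S. m \<in> E \<or> m \<in> ?A \<or> m \<in> ?B \<inter> (?C1 \<inter> ?C2 \<union> ?C3 \<inter> ?C4))"
    by blast
  also have "\<dots> \<longleftrightarrow> (\<forall>f g. f + one_at i \<in> E \<longrightarrow> g + one_at j \<in> E \<longrightarrow> (f + g \<in> E \<or> f + g \<in> ?A \<or> f + g \<in> ?B \<inter> (?C1 \<inter> ?C2 \<union> ?C3 \<inter> ?C4)))"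
    unfolding esum_def colon_exps_def by blast
  also have "\<dots> \<longleftrightarrow> comb4 E i j k l" unfolding A B comb4_def by blast
  finally show ?thesis .
qed

lemma UNIV_4: "(UNIV :: 4 set) = {1, 2, 3, 4}"
proof -
  have "card {1, 2, 3, 4 :: 4} = 4" by simp
  then show ?thesis using card_subset_eq[of "UNIV :: 4 set" "{1, 2, 3, 4}"] by simp
qed

lemma permutes_4: 
  "(\<forall>\<sigma> :: 4 \<Rightarrow> 4. \<sigma> permutes UNIV \<longrightarrow> P (\<sigma> 1) (\<sigma> 2) (\<sigma> 3) (\<sigma> 4)) \<longleftrightarrow> (\<forall>i j k l. distinct [i, j, k, l] \<longrightarrow> P i j k l)"
proof (intro iffI allI impI)
  fix i j k l :: 4 assume a: "\<forall>\<sigma> :: 4 \<Rightarrow> 4. \<sigma> permutes UNIV \<longrightarrow> P (\<sigma> 1) (\<sigma> 2) (\<sigma> 3) (\<sigma> 4)" and d: "distinct [i, j, k, l]"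
  define \<sigma> :: "4 \<Rightarrow> 4" where "\<sigma> x = (if x = 1 then i else if x = 2 then j else if x = 3 then k else l)" for x
  have s: "\<sigma> 1 = i" "\<sigma> 2 = j" "\<sigma> 3 = k" "\<sigma> 4 = l" by (simp_all add: \<sigma>_def)
  have "inj \<sigma>"
  proof (rule injI)
    fix x y assume e: "\<sigma> x = \<sigma> y"
    have "x \<in> {1, 2, 3, 4}" "y \<in> {1, 2, 3, 4}" using UNIV_4 by auto
    then show "x = y" using e d s by auto
  qed
  then have "bij \<sigma>" using finite_UNIV_inj_surj[of \<sigma>] by (simp add: bij_def)
  then have "\<sigma> permutes UNIV" by (simp add: permutes_def bij_iff)
  then show "P i j k l" using a s by metis
next
  fix \<sigma> :: "4 \<Rightarrow> 4" assume a: "\<forall>i j k l. distinct [i, j, k, l] \<longrightarrow> P i j k l" and "\<sigma> permutes UNIV"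
  then have "inj \<sigma>" using permutes_inj by blast
  then have "distinct [\<sigma> 1, \<sigma> 2, \<sigma> 3, \<sigma> 4]" by (simp add: inj_eq)
  then show "P (\<sigma> 1) (\<sigma> 2) (\<sigma> 3) (\<sigma> 4)" using a by blast
qed

theorem inclusions_iff_comb:
  fixes E :: "(4 \<Rightarrow>\<^sub>0 nat) set"
  defines "S \<equiv> mpoly_ring :: (4, 'k::field) mpoly ring"
    and "x \<equiv> mvar :: 4 \<Rightarrow> (4, 'k) mpoly"
    and "I \<equiv> Mid E"
  assumes E: "upset E"
  shows "(\<forall>\<sigma> :: 4 \<Rightarrow> 4. \<sigma> permutes UNIV \<longrightarrow>
      (let x1 = x (\<sigma> 1); x2 = x (\<sigma> 2); x3 = x (\<sigma> 3); x4 = x (\<sigma> 4);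
           C = (\<lambda>G. colon_ideal S I (ideal_of G))
       in
         C {x1} \<cdot>\<^bsub>S\<^esub> C {x2, x3, x4} \<subseteq> I \<and>
         C {x1, x2} \<cdot>\<^bsub>S\<^esub> C {x3, x4} \<subseteq> I \<and>
         C {x1} \<cdot>\<^bsub>S\<^esub> C {x2, x3} \<subseteq> I <+>\<^bsub>S\<^esub> ideal_of {x4} \<cdot>\<^bsub>S\<^esub> C {x1, x2, x3} \<and>
         C {x1} \<cdot>\<^bsub>S\<^esub> C {x2} \<subseteq>
           I <+>\<^bsub>S\<^esub> ideal_of {x3, x4} \<cdot>\<^bsub>S\<^esub> C {x1, x2}
             <+>\<^bsub>S\<^esub> ((ideal_of {x3 \<otimes>\<^bsub>S\<^esub> x4} \<cdot>\<^bsub>S\<^esub> C {x1 \<otimes>\<^bsub>S\<^esub> x2}) \<inter>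
               ((ideal_of {x3} \<cdot>\<^bsub>S\<^esub> C {x1} \<inter> ideal_of {x4} \<cdot>\<^bsub>S\<^esub> C {x2}) <+>\<^bsub>S\<^esub>
                (ideal_of {x3} \<cdot>\<^bsub>S\<^esub> C {x2} \<inter> ideal_of {x4} \<cdot>\<^bsub>S\<^esub> C {x1}))))) \<longleftrightarrow> comb E"
proof -
  note up_col = upset_colon_exps[OF E]
  have io: "ideal_of {x i} = Mid (up_closure {one_at i})" "ideal_of {x i, x j} = Mid (up_closure {one_at i, one_at j})"
    "ideal_of {x i, x j, x k} = Mid (up_closure {one_at i, one_at j, one_at k})" "ideal_of {x i \<otimes>\<^bsub>S\<^esub> x j} = Mid (up_closure {one_at i + one_at j})" for i j k
    using ideal_of_monomials[of "{one_at i}", where 'k='k] ideal_of_monomials[of "{one_at i, one_at j}", where 'k='k] 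
      ideal_of_monomials[of "{one_at i, one_at j, one_at k}", where 'k='k] ideal_of_monomials[of "{one_at i + one_at j}", where 'k='k]
    by (simp_all add: x_def mvar_def S_def mpoly_ring_simps) (simp add: monomial_def mult_single)
  have C: "colon_ideal S I (Mid (up_closure G)) = Mid (colon_exps E G)" for G unfolding S_def I_def by (rule colon_Mid[OF E])
  show ?thesis unfolding Let_def io C
    unfolding I_def S_def Mid_prod[OF up_col] Mid_prod[OF upset_up_closure] Mid_set_add Mid_Int Mid_mono_iff
      comb1_iff comb2_iff comb3_iff[OF E] comb4_iff[OF E] comb_def
    by (rule permutes_4)
qed

section \<open>Products in Koszul homology\<close>

text \<open>The monomial with exponent \<open>m\<close> times the exterior basis element of
  \<open>F\<close>.\<close>

definition mc :: "('n::{finite,linorder} \<Rightarrow>\<^sub>0 nat) \<Rightarrow> 'n set \<Rightarrow> 'n set \<Rightarrow> ('n, 'k::field) mpoly" where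
  "mc m F = (\<lambda>G. if G = F then monomial m else 0)"

lemma mc_KM: "card F = i \<Longrightarrow> mc m F \<in> KM i" by (auto simp: mc_def KM_def)

lemma mvar_monomial: "mvar i * monomial m = (monomial (m + one_at i) :: ('n::finite, 'k::field) mpoly)"
  by (simp add: mvar_def monomial_def mult_single add.commute)

lemma kd_mc: "kdv (mc m F) G = (\<Sum>i\<in>F. sg {i} (F - {i}) * mc (m + one_at i) (F - {i}) G :: ('n::{finite,linorder}, 'k::field) mpoly)"
proof -
  have "kdv (mc m F) G = (\<Sum>i\<in>UNIV. if i \<in> F \<and> G = F - {i} then sg {i} G * monomial (m + one_at i) else 0 :: ('n, 'k) mpoly)"
    unfolding kd_def by (rule sum.mono_neutral_cong_left) (auto simp: mc_def mult.assoc mvar_monomial)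
  also have "\<dots> = (\<Sum>i\<in>F. sg {i} (F - {i}) * mc (m + one_at i) (F - {i}) G)"
    by (rule sum.mono_neutral_cong_right) (auto simp: mc_def)
  finally show ?thesis .
qed

lemma km_mc: "km (mc m F) (mc m' G) = (\<lambda>H. if F \<inter> G = {} then sg F G * mc (m + m') (F \<union> G) H else 0 :: ('n::{finite,linorder}, 'k::field) mpoly)"
proof
  fix H
  have "km (mc m F) (mc m' G) H = (\<Sum>F'\<in>Pow H. if F' = F then (if H - F = G then sg F G * monomial (m + m') else 0) else 0 :: ('n, 'k) mpoly)"
    unfolding km_def by (rule sum.cong) (auto simp: mc_def monomial_def mult_single mult.assoc)
  also have "\<dots> = (if F \<in> Pow H then (if H - F = G then sg F G * monomial (m + m') else 0) else 0)"
    by (simp add: sum.delta)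
  also have "\<dots> = (if F \<inter> G = {} then sg F G * mc (m + m') (F \<union> G) H else 0)"
    by (auto simp: mc_def)
  finally show "km (mc m F) (mc m' G) H = (if F \<inter> G = {} then sg F G * mc (m + m') (F \<union> G) H else 0 :: ('n, 'k) mpoly)" .
qed

lemma BK_ideal: "is_ideal I \<Longrightarrow> x \<in> KM i \<Longrightarrow> (\<And>F. x F \<in> I) \<Longrightarrow> x \<in> BK I i"
  unfolding BK_def by (intro CollectI conjI bexI[of _ "\<lambda>F. 0"]) (auto simp: KM_def kd_def)

lemma BK_kd: "is_ideal I \<Longrightarrow> y \<in> KM (Suc i) \<Longrightarrow> kdv y \<in> BK I i"
  unfolding BK_def by (intro CollectI conjI bexI[of _ y]) (auto simp: kd_KM idl.subspace_0)

lemma BK_lin: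
  assumes I: "is_ideal I" and "x \<in> BK I i" "x' \<in> BK I i" shows "(\<lambda>F. p * x F + q * x' F) \<in> BK I i"
proof -
  obtain y where y: "x \<in> KM i" "y \<in> KM (Suc i)" "\<forall>F. x F - kdv y F \<in> I" using assms(2) unfolding BK_def by blast
  obtain y' where y': "x' \<in> KM i" "y' \<in> KM (Suc i)" "\<forall>F. x' F - kdv y' F \<in> I" using assms(3) unfolding BK_def by blast
  have "(p * x F + q * x' F) - kdv (\<lambda>F. p * y F + q * y' F) F \<in> I" for F
  proof -
    have "(p * x F + q * x' F) - kdv (\<lambda>F. p * y F + q * y' F) F = p * (x F - kdv y F) + q * (x' F - kdv y' F)"
      by (simp add: kd_add kd_smult algebra_simps)
    then show ?thesis using I y(3) y'(3) by (simp add: idl.subspace_add idl.subspace_scale)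
  qed
  moreover have "(\<lambda>F. p * x F + q * x' F) \<in> KM i" "(\<lambda>F. p * y F + q * y' F) \<in> KM (Suc i)"
    using y y' by (auto simp: KM_def)
  ultimately show ?thesis unfolding BK_def by (intro CollectI conjI bexI[of _ "\<lambda>F. p * y F + q * y' F"]) auto
qed

lemma BK_zero: "is_ideal I \<Longrightarrow> (\<lambda>F. 0) \<in> BK I i"
  by (rule BK_ideal) (auto simp: KM_def idl.subspace_0)

lemma BK_smult: "is_ideal I \<Longrightarrow> x \<in> BK I i \<Longrightarrow> (\<lambda>F. p * x F) \<in> BK I i"
  using BK_lin[of I x i "\<lambda>F. 0" p 0] BK_zero[of I i] by simp

lemma BK_add: "is_ideal I \<Longrightarrow> x \<in> BK I i \<Longrightarrow> y \<in> BK I i \<Longrightarrow> (\<lambda>F. x F + y F) \<in> BK I i"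
  using BK_lin[of I x i y 1 1] by simp

lemma BK_diff: "is_ideal I \<Longrightarrow> x \<in> BK I i \<Longrightarrow> y \<in> BK I i \<Longrightarrow> (\<lambda>F. x F - y F) \<in> BK I i"
  using BK_lin[of I x i y 1 "-1"] by simp

lemma BK_sum: "is_ideal I \<Longrightarrow> (\<And>v. v \<in> S \<Longrightarrow> x v \<in> BK I i) \<Longrightarrow> (\<lambda>F. \<Sum>v\<in>S. x v F) \<in> BK I i"
  by (induction S rule: infinite_finite_induct) (auto simp: BK_zero intro: BK_add)

lemma BK_KM: "x \<in> BK I i \<Longrightarrow> x \<in> KM i" by (simp add: BK_def)

text \<open>If \<open>w\<close> bounds \<open>y\<close> modulo the ideal, then
  \<open>km (kbar x) w\<close> bounds \<open>km x y\<close>, because \<open>x\<close> is a cycle.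
  Products therefore descend to homology, and graded commutativity gives the other side.\<close>

lemma km_ZK_BK:
  assumes I: "is_ideal I" and x: "x \<in> ZK I a" and y: "y \<in> BK I b"
  shows "km x y \<in> BK I (a + b)" "km y x \<in> BK I (b + a)"
proof -
  obtain w where w: "w \<in> KM (Suc b)" "\<And>F. y F - kdv w F \<in> I" using y unfolding BK_def by blast
  have xk: "x \<in> KM a" "\<And>F. kdv x F \<in> I" and yk: "y \<in> KM b" using x y by (auto simp: ZK_def BK_def)
  have bx: "kbar x \<in> KM a" by (rule kbar_mem_KM[OF xk(1)])
  have e: "km x y H = kdv (km (kbar x) w) H + (km x (\<lambda>F. y F - kdv w F) H - km (kdv (kbar x)) w H)" for H
    unfolding leibniz kbar_kbar km_diff_right by simp
  have "km x y = (\<lambda>H. kdv (km (kbar x) w) H + (km x (\<lambda>F. y F - kdv w F) H - km (kdv (kbar x)) w H))"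
    using e by (rule ext)
  moreover have 1: "kdv (km (kbar x) w) \<in> BK I (a + b)"
    by (rule BK_kd[OF I]) (use km_KM[OF bx w(1)] in simp)
  moreover have "(\<lambda>H. km x (\<lambda>F. y F - kdv w F) H - km (kdv (kbar x)) w H) \<in> BK I (a + b)"
  proof (rule BK_ideal[OF I])
    have "(\<lambda>H. km x y H - kdv (km (kbar x) w) H) \<in> KM (a + b)"
      using km_KM[OF xk(1) yk] BK_KM[OF 1] by (auto simp: KM_def)
    then show "(\<lambda>H. km x (\<lambda>F. y F - kdv w F) H - km (kdv (kbar x)) w H) \<in> KM (a + b)" unfolding e by simp
    fix F
    have "kdv (kbar x) F \<in> I" for F unfolding kd_kbar using I xk(2) by (simp add: idl.subspace_neg kbar_ideal)
    then show "km x (\<lambda>F. y F - kdv w F) F - km (kdv (kbar x)) w F \<in> I"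
      using km_ideal_right[OF I, of "\<lambda>F. y F - kdv w F" x F] km_ideal_left[OF I, of "kdv (kbar x)" w F] w(2)
      by (simp add: idl.subspace_diff[OF I])
  qed
  ultimately show xy: "km x y \<in> BK I (a + b)" using BK_add[OF I] by simp
  have "km y x = (\<lambda>F. (-1) ^ (b * a) * km x y F)" by (rule km_commute[OF yk xk(1)])
  then show "km y x \<in> BK I (b + a)" using BK_smult[OF I xy] by (simp add: add.commute)
qed

text \<open>Cycles modulo the ideal each of whose boundary terms already lies in the ideal. In homological degrees one
  and two they span the homology.\<close>

definition SK :: "('n::{finite,linorder} \<Rightarrow>\<^sub>0 nat) set \<Rightarrow> nat \<Rightarrow> ('n set \<Rightarrow> ('n, 'k::field) mpoly) set" where
  "SK E a = {mc m F | m F. card F = a \<and> (\<forall>i\<in>F. m + one_at i \<in> E)}"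

lemma SK_ZK: assumes E: "upset E" and x: "x \<in> SK E a" shows "x \<in> ZK (Mid E) a"
proof -
  obtain m F where mF: "x = mc m F" "card F = a" "\<And>i. i \<in> F \<Longrightarrow> m + one_at i \<in> E" using x unfolding SK_def by blast
  have "kdv x G \<in> Mid E" for G unfolding mF(1) kd_mc
    by (intro idl.subspace_sum[OF Mid_ideal[OF E]] idl.subspace_scale[OF Mid_ideal[OF E]])
      (use mF(3) in \<open>auto simp: mc_def monomial_def single_Mid Mid_def\<close>)
  then show ?thesis using mF mc_KM[OF mF(2)] by (simp add: ZK_def)
qed

lemma hm_sum_mc: "hm a c G = (\<Sum>F\<in>Pow (ks a). mconst (c F) * mc (a - ind F) F G)"
proof -
  have "(\<Sum>F\<in>Pow (ks a). mconst (c F) * mc (a - ind F) F G) = (\<Sum>F\<in>Pow (ks a). if F = G then Poly_Mapping.single (a - ind G) (c G) else 0)"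
    by (rule sum.cong) (auto simp: mc_def monomial_def mconst_def mult_single)
  then show ?thesis by (simp add: hm_def sum.delta)
qed

text \<open>The boundary \<open>sd a c\<close> is coned off with apex \<open>j\<close>. The cone
  \<open>c'\<close> has the same boundary as \<open>c\<close>, so the difference is a cycle over the
  polynomial ring and hence a boundary. Each \<open>F\<close> in the support of \<open>c'\<close>
  consists of \<open>j\<close> and a face whose monomial lies in the ideal; for
  \<open>n \<le> 2\<close> the apex can be chosen such that all faces of \<open>F\<close> have this
  property. From degree three on, further faces appear on which the cycle condition gives no such
  control.\<close>

lemma hm_spanned:
  fixes a :: "'n::{finite,linorder} \<Rightarrow>\<^sub>0 nat" and c :: "'n set \<Rightarrow> 'k::field"
  assumes E: "upset E" and n: "n = 1 \<or> n = 2" and x: "hm a c \<in> ZK (Mid E) n"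
  shows "\<exists>c'. (\<forall>F. F \<subseteq> ks a \<longrightarrow> c' F \<noteq> 0 \<longrightarrow> mc (a - ind F) F \<in> (SK E n :: ('n set \<Rightarrow> ('n, 'k) mpoly) set)) \<and>
     (\<lambda>G. hm a c G - hm a c' G) \<in> BK (Mid E) n"
proof (cases "\<forall>G\<subseteq>ks a. sd a c G = 0")
  case True
  then have k0: "kdv (hm a c) = (\<lambda>F. 0)" unfolding kd_hm hm_zero_iff .
  have K: "hm a c \<in> KM n" using x by (simp add: ZK_def)
  have "cst (hm a c {}) = 0" using K n by (auto simp: KM_def)
  then obtain y where y: "y \<in> KM (Suc n)" "hm a c = kdv y" using kd_exact_KM[OF K k0] by blast
  have "hm a c \<in> BK (Mid E) n" unfolding y(2) by (rule BK_kd[OF Mid_ideal[OF E] y(1)])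
  moreover have "hm a (\<lambda>F. 0 :: 'k) G = 0" for G by (simp add: hm_def)
  ultimately show ?thesis by (intro exI[of _ "\<lambda>F. 0"]) simp
next
  case False
  then obtain G where G: "G \<subseteq> ks a" "sd a c G \<noteq> 0" by blast
  let ?d = "sd a c"
  have K: "hm a c \<in> KM n" and Z: "\<And>F. hm a ?d F \<in> Mid E" using x by (auto simp: ZK_def kd_hm)
  have dE: "a - ind F \<in> E" "card F = n - 1" if "F \<subseteq> ks a" "?d F \<noteq> 0" for F
  proof -
    show "a - ind F \<in> E" using Z[of F] that by (simp add: hm_def single_Mid)
    obtain n' where n': "n = Suc n'" using n by (cases n) auto
    have "hm a ?d \<in> KM n'" unfolding kd_hm[symmetric] using K n' by (auto intro: kd_KM)
    moreover have "hm a ?d F \<noteq> 0" using that by (simp add: hm_def single_eq_0_iff)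
    ultimately show "card F = n - 1" unfolding KM_def n' by auto
  qed
  \<comment> \<open>In degree one the only face is empty and every \<open>j\<close> in
    \<open>ks a\<close> works. In degree two the faces of \<open>{j, f}\<close> are
    \<open>{f}\<close> and \<open>{j}\<close>, and \<open>j\<close> itself is taken from the support
    of the boundary.\<close>
  have "\<exists>j\<in>ks a. \<forall>F\<subseteq>ks a. ?d F \<noteq> 0 \<longrightarrow> j \<notin> F \<longrightarrow> (\<forall>i\<in>insert j F. a - ind (insert j F - {i}) \<in> E)"
    using n
  proof
    assume n1: "n = 1"
    have "ks a - G \<noteq> {}"
    proof
      assume e: "ks a - G = {}"
      have "?d G = 0" unfolding sd_def e by simp
      then show False using G(2) by simp
    qed
    then obtain j where "j \<in> ks a - G" by (meson ex_in_conv)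
    then have j: "j \<in> ks a" by simp
    show ?thesis
    proof (intro bexI[OF _ j] allI impI ballI)
      fix F i assume F: "F \<subseteq> ks a" "?d F \<noteq> 0" and i: "i \<in> insert j F"
      have "F = {}" using dE(2)[OF F] n1 finite_subset[OF F(1)] by simp
      then show "a - ind (insert j F - {i}) \<in> E" using dE(1)[OF F] i by simp
    qed
  next
    assume n2: "n = 2"
    then obtain j where Gj: "G = {j}" using dE(2)[OF G] by (auto simp: card_1_singleton_iff)
    show ?thesis
    proof (intro bexI[of _ j] allI impI ballI)
      show "j \<in> ks a" using G Gj by simp
      fix F i assume F: "F \<subseteq> ks a" "?d F \<noteq> 0" "j \<notin> F" and i: "i \<in> insert j F"
      obtain f where f: "F = {f}" using dE(2)[OF F(1,2)] n2 by (auto simp: card_1_singleton_iff)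
      have "insert j F - {i} = G \<or> insert j F - {i} = F" using i f Gj F(3) by auto
      then show "a - ind (insert j F - {i}) \<in> E"
        by (rule disjE) (simp_all only: dE(1)[OF F(1,2)] dE(1)[OF G])
    qed
  qed
  then obtain j where j: "j \<in> ks a" "\<And>F i. F \<subseteq> ks a \<Longrightarrow> ?d F \<noteq> 0 \<Longrightarrow> j \<notin> F \<Longrightarrow> i \<in> insert j F \<Longrightarrow> a - ind (insert j F - {i}) \<in> E" by blast
  define c' where "c' F = (if j \<in> F then sg {j} (F - {j}) * ?d (F - {j}) else 0)" for F
  have dd: "sd a ?d F = 0" if "F \<subseteq> ks a" for F
  proof -
    have "hm a (sd a ?d) = (\<lambda>F. 0)" unfolding kd_hm[symmetric] kd_kd ..
    then show ?thesis using that unfolding hm_zero_iff by blast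
  qed
  have sdc': "sd a c' F = ?d F" if "F \<subseteq> ks a" for F unfolding c'_def by (rule sd_exact[OF j(1) dd that])
  have c'K: "hm a c' \<in> KM n"
  proof -
    have "hm a c' F = 0" if "card F \<noteq> n" for F
    proof (rule ccontr)
      assume "hm a c' F \<noteq> 0"
      then have F: "F \<subseteq> ks a" "j \<in> F" "?d (F - {j}) \<noteq> 0" by (auto simp: hm_def c'_def single_eq_0_iff split: if_splits)
      then have "card (F - {j}) = n - 1" using dE(2)[of "F - {j}"] by blast
      moreover have "card F > 0" using F(2) by (auto simp: card_gt_0_iff)
      ultimately show False using that n F(2) by (auto simp: card_Diff_singleton)
    qed
    then show ?thesis by (auto simp: KM_def)
  qed
  show ?thesis
  proof (intro exI[of _ c'] conjI allI impI)
    fix F assume F: "F \<subseteq> ks a" "c' F \<noteq> 0"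
    then have jF: "j \<in> F" "?d (F - {j}) \<noteq> 0" by (auto simp: c'_def split: if_splits)
    have "hm a c' F \<noteq> 0" using F by (simp add: hm_def single_eq_0_iff)
    then have cF: "card F = n" using c'K by (auto simp: KM_def)
    have "a - ind F + one_at i \<in> E" if i: "i \<in> F" for i
    proof -
      have "a - ind (F - {i}) \<in> E" using j(2)[of "F - {j}" i] F(1) jF i by (simp add: insert_absorb subset_iff)
      moreover have "a - ind (F - {i}) = a - ind F + one_at i"
      proof (rule poly_mapping_eqI)
        fix t show "lk (a - ind (F - {i})) t = lk (a - ind F + one_at i) t"
          using F(1) i by (cases "t = i") (auto simp: lookup_minus lookup_add lk_ind lookup_single in_keys_iff subset_iff)
      qed
      ultimately show ?thesis by simp
    qed
    then show "mc (a - ind F) F \<in> SK E n" using cF unfolding SK_def by blast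
  next
    let ?w = "\<lambda>G. hm a c G - hm a c' G"
    have wK: "?w \<in> KM n" using K c'K by (auto simp: KM_def)
    have "hm a ?d = hm a (sd a c')" unfolding hm_eq_iff using sdc' by simp
    then have "kdv ?w = (\<lambda>F. 0)" unfolding kd_diff kd_hm by (simp add: fun_eq_iff)
    moreover have "cst (?w {}) = 0" 
    proof -
      have "?w {} = 0" using wK n unfolding KM_def by auto
      then show ?thesis by simp
    qed
    ultimately obtain y where y: "y \<in> KM (Suc n)" "?w = kdv y" using kd_exact_KM[OF wK] by blast
    show "?w \<in> BK (Mid E) n" unfolding y(2) by (rule BK_kd[OF Mid_ideal[OF E] y(1)])
  qed
qed

lemma ZK_spanned:
  fixes x :: "'n::{finite,linorder} set \<Rightarrow> ('n, 'k::field) mpoly"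
  assumes E: "upset E" and n: "n = 1 \<or> n = 2" and x: "x \<in> ZK (Mid E) n"
  shows "\<exists>w\<in>Modules.module.span (lsc msc) (SK E n). (\<lambda>F. x F - w F) \<in> BK (Mid E) n"
proof -
  interpret v: vector_space "lsc msc :: 'k \<Rightarrow> ('n set \<Rightarrow> ('n, 'k) mpoly) \<Rightarrow> _" by (rule vector_space_lsc[OF vector_space_msc])
  note I = Mid_ideal[OF E]
  have "hm a (cc a x) \<in> ZK (Mid E) n" for a
    using x hm_KM[of x n a] hm_Mid[of "kdv x" E a] by (auto simp: ZK_def cc_kd)
  then have "\<exists>c'. (\<forall>F. F \<subseteq> ks a \<longrightarrow> c' F \<noteq> 0 \<longrightarrow> mc (a - ind F) F \<in> (SK E n :: ('n set \<Rightarrow> ('n, 'k) mpoly) set)) \<and>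
     (\<lambda>G. hm a (cc a x) G - hm a c' G) \<in> BK (Mid E) n" for a by (rule hm_spanned[OF E n])
  then have "\<exists>c'. \<forall>a. (\<forall>F. F \<subseteq> ks a \<longrightarrow> c' a F \<noteq> 0 \<longrightarrow> mc (a - ind F) F \<in> (SK E n :: ('n set \<Rightarrow> ('n, 'k) mpoly) set)) \<and>
     (\<lambda>G. hm a (cc a x) G - hm a (c' a) G) \<in> BK (Mid E) n" by (intro choice allI)
  then obtain c' where c': "\<And>a F. F \<subseteq> ks a \<Longrightarrow> c' a F \<noteq> 0 \<Longrightarrow> mc (a - ind F) F \<in> (SK E n :: ('n set \<Rightarrow> ('n, 'k) mpoly) set)"
    "\<And>a. (\<lambda>G. hm a (cc a x) G - hm a (c' a) G) \<in> BK (Mid E) n" by blast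
  have hms: "hm a (c' a) \<in> v.span (SK E n)" for a
  proof -
    have "hm a (c' a) = (\<Sum>F\<in>Pow (ks a). lsc msc (c' a F) (mc (a - ind F) F))"
      by (rule ext) (simp add: hm_sum_mc sum_fun_apply lsc_def msc_def)
    also have "\<dots> \<in> v.span (SK E n)"
    proof (rule v.span_sum)
      fix F assume F: "F \<in> Pow (ks a)"
      show "lsc msc (c' a F) (mc (a - ind F) F) \<in> v.span (SK E n)"
      proof (cases "c' a F = 0")
        case True then show ?thesis by (simp add: v.span_zero)
      next
        case False then show ?thesis using c'(1)[of F a] F by (auto intro: v.span_scale v.span_base)
      qed
    qed
    finally show ?thesis .
  qed
  define w where "w = (\<Sum>a\<in>degs x. hm a (c' a))"
  have "(\<lambda>F. x F - w F) = (\<lambda>F. \<Sum>a\<in>degs x. hm a (cc a x) F - hm a (c' a) F)"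
    unfolding w_def sum_fun_apply sum_subtractf decompose[of x, symmetric] ..
  also have "\<dots> \<in> BK (Mid E) n" by (rule BK_sum[OF I c'(2)])
  finally have "(\<lambda>F. x F - w F) \<in> BK (Mid E) n" .
  moreover have "w \<in> v.span (SK E n)" unfolding w_def by (rule v.span_sum) (rule hms)
  ultimately show ?thesis by blast
qed

text \<open>Products are bilinear and well defined on homology, so the monomial cycles that span it
  are enough.\<close>

lemma km_spanned:
  fixes x y :: "'n::{finite,linorder} set \<Rightarrow> ('n, 'k::field) mpoly"
  assumes E: "upset E" and n: "n = 1 \<or> n = 2" and x: "x \<in> ZK (Mid E) n" and y: "y \<in> ZK (Mid E) m"
    and S: "\<And>s. s \<in> SK E n \<Longrightarrow> km s y \<in> BK (Mid E) (n + m)"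
  shows "km x y \<in> BK (Mid E) (n + m)"
proof -
  interpret v: vector_space "lsc msc :: 'k \<Rightarrow> ('n set \<Rightarrow> ('n, 'k) mpoly) \<Rightarrow> _" by (rule vector_space_lsc[OF vector_space_msc])
  note I = Mid_ideal[OF E]
  obtain w where w: "w \<in> v.span (SK E n)" "(\<lambda>F. x F - w F) \<in> BK (Mid E) n" using ZK_spanned[OF E n x] by blast
  have "km w y \<in> BK (Mid E) (n + m)" using w(1)
  proof (induction w rule: v.span_induct_alt)
    case base
    have "km (0 :: 'n set \<Rightarrow> ('n, 'k) mpoly) y = (\<lambda>F. 0)" by (rule ext) (simp add: km_def)
    then show ?case using BK_zero[OF I] by (simp only:)
  next
    case (step c s w)
    have "lsc msc c s + w = (\<lambda>F. mconst c * s F + w F)" by (rule ext) (simp add: lsc_def msc_def)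
    then have "km (lsc msc c s + w) y = (\<lambda>F. mconst c * km s y F + km w y F)" by (simp add: km_add_left km_smult_left)
    then show ?case using BK_lin[OF I S[OF step(1)] step(2), of "mconst c" 1] by (simp only: mult_1_left)
  qed
  moreover have "km (\<lambda>F. x F - w F) y \<in> BK (Mid E) (n + m)" by (rule km_ZK_BK(2)[OF I y w(2)])
  ultimately have "(\<lambda>F. km (\<lambda>F. x F - w F) y F + km w y F) \<in> BK (Mid E) (n + m)" using BK_add[OF I] by blast
  then show ?thesis unfolding km_diff_left by simp
qed

text \<open>The boundary of a single monomial chain expresses one of its terms by the others.\<close>

lemma trade:
  fixes E :: "('n::{finite,linorder} \<Rightarrow>\<^sub>0 nat) set"
  assumes E: "upset E" and b: "b \<in> T" "card T = Suc n" 
    and o: "\<And>t. t \<in> T \<Longrightarrow> t \<noteq> b \<Longrightarrow> mc (m + one_at t) (T - {t}) \<in> (BK (Mid E) n :: ('n set \<Rightarrow> ('n, 'k::field) mpoly) set)"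
  shows "mc (m + one_at b) (T - {b}) \<in> (BK (Mid E) n :: ('n set \<Rightarrow> ('n, 'k) mpoly) set)"
proof -
  note I = Mid_ideal[OF E]
  let ?r = "\<lambda>F. \<Sum>i\<in>T - {b}. sg {i} (T - {i}) * mc (m + one_at i) (T - {i}) F :: ('n, 'k) mpoly"
  have "kdv (mc m T) F = sg {b} (T - {b}) * mc (m + one_at b) (T - {b}) F + ?r F" for F
    unfolding kd_mc using b by (simp add: sum.remove[of T b])
  then have "sg {b} (T - {b}) * (kdv (mc m T) F - ?r F) = sg {b} (T - {b}) * (sg {b} (T - {b}) * mc (m + one_at b) (T - {b}) F)" for F by simp
  then have e: "mc (m + one_at b) (T - {b}) = (\<lambda>F. sg {b} (T - {b}) * (kdv (mc m T) F - ?r F))"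
    unfolding sg_sq' by (intro ext) (rule sym)
  show ?thesis unfolding e
    by (intro BK_smult[OF I] BK_diff[OF I] BK_sum[OF I] BK_kd[OF I] mc_KM) (use b o in auto)
qed

lemma BK_mc: "upset E \<Longrightarrow> m \<in> E \<Longrightarrow> card F = n \<Longrightarrow> mc m F \<in> BK (Mid E) n"
  by (rule BK_ideal[OF Mid_ideal]) (auto simp: mc_KM, auto simp: mc_def monomial_def single_Mid Mid_def)

section \<open>From the inclusions to vanishing products\<close>

lemma UNIV_distinct: 
  assumes "CARD('n::finite) = 4" "distinct [i, j, k, l :: 'n]" shows "UNIV = {i, j, k, l}"
  using assms card_subset_eq[of "UNIV :: 'n set" "{i, j, k, l}"] by auto

lemma ex_distinct:
  assumes c: "CARD('n::finite) = 4" shows "distinct [i, j] \<Longrightarrow> \<exists>k l. distinct [i, j, k, l :: 'n]" "distinct [i, j, k] \<Longrightarrow> \<exists>l. distinct [i, j, k, l :: 'n]"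
proof -
  have 3: "\<exists>l. distinct [i, j, k, l]" if "distinct [i, j, k]" for i j k :: 'n
  proof -
    have "card {i, j, k} = 3" using that by simp
    then have "{i, j, k} \<noteq> UNIV" using c by auto
    then obtain l where "l \<notin> {i, j, k}" by blast
    then show ?thesis using that by (intro exI[of _ l]) auto
  qed
  show "\<exists>k l. distinct [i, j, k, l :: 'n]" if d: "distinct [i, j]"
  proof -
    have "card {i, j} = 2" using d by simp
    then have "{i, j} \<noteq> UNIV" using c by auto
    then obtain k where "k \<notin> {i, j}" by blast
    then have "distinct [i, j, k]" using d by auto
    then show ?thesis using 3 by blast
  qed
  show "distinct [i, j, k] \<Longrightarrow> \<exists>l. distinct [i, j, k, l :: 'n]" by (rule 3)
qed

text \<open>Each alternative of the fourth inclusion exchanges the product, through boundaries of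
  monomial chains on three variables, for chains with coefficients in the ideal. One exchange closes
  the edge \<open>{i, j}\<close> to a triangle, two exchanges close it to a four-cycle.\<close>

lemma comb_pair:
  fixes E :: "('n::{finite,linorder} \<Rightarrow>\<^sub>0 nat) set"
  assumes E: "upset E" and d: "distinct [i, j, k, l]" and c: "comb4 E i j k l" and fg: "f + one_at i \<in> E" "g + one_at j \<in> E"
  shows "mc (f + g) {i, j} \<in> (BK (Mid E) 2 :: ('n set \<Rightarrow> ('n, 'k::field) mpoly) set)"
proof -
  let ?B = "BK (Mid E) 2 :: ('n set \<Rightarrow> ('n, 'k) mpoly) set"
  note B = BK_mc[OF E]
  have t3: "mc (m + one_at b) {p, q} \<in> ?B" if "distinct [p, q, b]" "mc (m + one_at p) {q, b} \<in> ?B" "mc (m + one_at q) {p, b} \<in> ?B" for m p q b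
  proof -
    have "mc (m + one_at b) ({p, q, b} - {b}) \<in> ?B"
    proof (rule trade[OF E])
      fix t assume "t \<in> {p, q, b}" "t \<noteq> b"
      then show "mc (m + one_at t) ({p, q, b} - {t}) \<in> ?B" using that by (auto simp: insert_Diff_if)
    qed (use that in auto)
    moreover have "{p, q, b} - {b} = {p, q}" using that by auto
    ultimately show ?thesis by simp
  qed
  have t4: "mc (h + one_at k + one_at l) {p, q} \<in> ?B" 
    if "distinct [p, q, k, l]" "h + (one_at p + one_at q) \<in> E" "h + one_at l + one_at p \<in> E" "h + one_at k + one_at q \<in> E" for h p q
  proof -
    \<comment> \<open>The diagonal of the four-cycle is cleared first, by the chain on
      \<open>p\<close>, \<open>k\<close>, \<open>l\<close>; it is the one term that the chain on
      \<open>p\<close>, \<open>q\<close>, \<open>k\<close> leaves open.\<close>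
    have 1: "mc (h + one_at q + one_at l) {p, k} \<in> ?B"
      by (rule t3) (use that in \<open>auto intro!: B simp: ac_simps\<close>)
    have "mc (h + one_at l + one_at k) {p, q} \<in> ?B"
    proof (rule t3)
      show "mc (h + one_at l + one_at q) {p, k} \<in> ?B" using 1 by (simp add: ac_simps)
    qed (use that in \<open>auto intro!: B simp: ac_simps\<close>)
    then show ?thesis by (simp add: ac_simps)
  qed
  from c[unfolded comb4_def, rule_format, OF fg] consider "f + g \<in> E"
    | h where "f + g = one_at k + h" "h + one_at i \<in> E" "h + one_at j \<in> E" 
    | h where "f + g = one_at l + h" "h + one_at i \<in> E" "h + one_at j \<in> E" 
    | h where "f + g = one_at k + one_at l + h" "h + (one_at i + one_at j) \<in> E" "h + one_at l + one_at i \<in> E" "h + one_at k + one_at j \<in> E"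
    | h where "f + g = one_at k + one_at l + h" "h + (one_at i + one_at j) \<in> E" "h + one_at l + one_at j \<in> E" "h + one_at k + one_at i \<in> E"
    by blast
  then show ?thesis
  proof cases
    case 1 then show ?thesis using d by (intro B) auto
  next
    case (2 h)
    have "mc (h + one_at k) {i, j} \<in> ?B" by (rule t3) (use 2 d in \<open>auto intro!: B\<close>)
    then show ?thesis using 2 by (simp add: add.commute)
  next
    case (3 h)
    have "mc (h + one_at l) {i, j} \<in> ?B" by (rule t3) (use 3 d in \<open>auto intro!: B\<close>)
    then show ?thesis using 3 by (simp add: add.commute)
  next
    case (4 h)
    then show ?thesis using t4[of i j h] d by (simp add: ac_simps)
  next
    case (5 h)
    then have "mc (h + one_at k + one_at l) {j, i} \<in> ?B" using d by (intro t4) (auto simp: ac_simps)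
    then show ?thesis using 5 by (simp add: ac_simps insert_commute)
  qed
qed

definition products_vanish :: "('n::{finite,linorder}, 'k::field) mpoly set \<Rightarrow> bool" where
  "products_vanish I \<longleftrightarrow> (\<forall>a\<ge>1. \<forall>b\<ge>1. \<forall>x\<in>ZK I a. \<forall>y\<in>ZK I b. km x y \<in> BK I (a + b))"

lemma comb_D: 
  assumes "comb E" "distinct [i, j, k, l]" 
  shows "comb1 E i j k l" "comb2 E i j k l" "comb3 E i j k l" "comb4 E i j k l"
  using assms unfolding comb_def by blast+

lemma products_11:
  fixes E :: "('n::{finite,linorder} \<Rightarrow>\<^sub>0 nat) set" and x :: "'n set \<Rightarrow> ('n, 'k::field) mpoly"
  assumes E: "upset E" and c4: "CARD('n) = 4" and c: "comb E" and x: "x \<in> SK E 1" and y: "y \<in> SK E 1"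
  shows "km x y \<in> BK (Mid E) 2"
proof -
  note I = Mid_ideal[OF E]
  obtain f i where f: "x = mc f {i}" "f + one_at i \<in> E" using x unfolding SK_def by (auto simp: card_1_singleton_iff)
  obtain g j where g: "y = mc g {j}" "g + one_at j \<in> E" using y unfolding SK_def by (auto simp: card_1_singleton_iff)
  show ?thesis
  proof (cases "i = j")
    case True then show ?thesis unfolding f g km_mc using BK_zero[OF I] by simp
  next
    case False
    then obtain k l where d: "distinct [i, j, k, l]" using ex_distinct(1)[OF c4, of i j] by auto
    have "mc (f + g) {i, j} \<in> (BK (Mid E) 2 :: ('n set \<Rightarrow> ('n, 'k) mpoly) set)"
      by (rule comb_pair[OF E d comb_D(4)[OF c d] f(2) g(2)])
    then have "(\<lambda>H. sg {i} {j} * mc (f + g) {i, j} H) \<in> (BK (Mid E) 2 :: ('n set \<Rightarrow> ('n, 'k) mpoly) set)"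
      by (rule BK_smult[OF I])
    moreover have "{i} \<union> {j} = {i, j}" by auto
    ultimately show ?thesis unfolding f g km_mc using False by simp
  qed
qed

text \<open>The third inclusion provides a chain on all four variables one of whose boundary terms
  is the product, while the other three have their monomials in the ideal.\<close>

lemma products_12:
  fixes E :: "('n::{finite,linorder} \<Rightarrow>\<^sub>0 nat) set" and x :: "'n set \<Rightarrow> ('n, 'k::field) mpoly"
  assumes E: "upset E" and c4: "CARD('n) = 4" and c: "comb E" and x: "x \<in> SK E 1" and y: "y \<in> SK E 2"
  shows "km x y \<in> BK (Mid E) 3"
proof -
  note I = Mid_ideal[OF E]
  let ?B = "BK (Mid E) 3 :: ('n set \<Rightarrow> ('n, 'k) mpoly) set"
  obtain f i where f: "x = mc f {i}" "f + one_at i \<in> E" using x unfolding SK_def by (auto simp: card_1_singleton_iff)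
  obtain g G where "y = mc g G" "card G = 2" "\<forall>i\<in>G. g + one_at i \<in> E" using y unfolding SK_def by blast
  then obtain j k where g: "y = mc g {j, k}" "j \<noteq> k" "g + one_at j \<in> E" "g + one_at k \<in> E" by (auto simp: card_2_iff)
  show ?thesis
  proof (cases "i \<in> {j, k}")
    case True then show ?thesis unfolding f g km_mc using BK_zero[OF I] by simp
  next
    case False
    then obtain l where d: "distinct [i, j, k, l]" using g(2) ex_distinct(2)[OF c4, of i j k] by auto
    note U = UNIV_distinct[OF c4 d]
    have "mc (f + g) {i, j, k} \<in> ?B"
    proof (cases "f + g \<in> E")
      case True then show ?thesis using d by (intro BK_mc[OF E]) auto
    next
      case False
      then obtain h where h: "f + g = one_at l + h" "h + one_at i \<in> E" "h + one_at j \<in> E" "h + one_at k \<in> E"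
        using comb_D(3)[OF c d, unfolded comb3_def, rule_format, OF f(2) g(3) g(4)] by blast
      have "mc (h + one_at l) (UNIV - {l}) \<in> ?B"
      proof (rule trade[OF E])
        fix t :: 'n assume t: "t \<noteq> l"
        then have "t \<in> {i, j, k}" using U by auto
        then show "mc (h + one_at t) (UNIV - {t}) \<in> ?B" using h c4 by (intro BK_mc[OF E]) auto
      qed (use c4 in auto)
      moreover have "UNIV - {l} = {i, j, k}" unfolding U using d by auto
      ultimately show ?thesis using h(1) by (simp add: add.commute)
    qed
    then have "(\<lambda>H. sg {i} {j, k} * mc (f + g) {i, j, k} H) \<in> ?B" by (rule BK_smult[OF I])
    moreover have "{i} \<union> {j, k} = {i, j, k}" by auto
    ultimately show ?thesis unfolding f g km_mc using False by simp
  qed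
qed

lemma products_22:
  fixes E :: "('n::{finite,linorder} \<Rightarrow>\<^sub>0 nat) set" and x :: "'n set \<Rightarrow> ('n, 'k::field) mpoly"
  assumes E: "upset E" and c4: "CARD('n) = 4" and c: "comb E" and x: "x \<in> SK E 2" and y: "y \<in> SK E 2"
  shows "km x y \<in> BK (Mid E) 4"
proof -
  note I = Mid_ideal[OF E]
  let ?B = "BK (Mid E) 4 :: ('n set \<Rightarrow> ('n, 'k) mpoly) set"
  obtain f F where "x = mc f F" "card F = 2" "\<forall>i\<in>F. f + one_at i \<in> E" using x unfolding SK_def by blast
  then obtain i j where f: "x = mc f {i, j}" "i \<noteq> j" "f + one_at i \<in> E" "f + one_at j \<in> E" by (auto simp: card_2_iff)
  obtain g G where "y = mc g G" "card G = 2" "\<forall>i\<in>G. g + one_at i \<in> E" using y unfolding SK_def by blast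
  then obtain k l where g: "y = mc g {k, l}" "k \<noteq> l" "g + one_at k \<in> E" "g + one_at l \<in> E" by (auto simp: card_2_iff)
  show ?thesis
  proof (cases "{i, j} \<inter> {k, l} = {}")
    case False then show ?thesis unfolding f g km_mc if_not_P[OF False] using BK_zero[OF I] by simp
  next
    case True
    then have d: "distinct [i, j, k, l]" using f g by auto
    have "f + g \<in> E" using comb_D(2)[OF c d, unfolded comb2_def] f g by blast
    then have "mc (f + g) ({i, j} \<union> {k, l}) \<in> ?B" using d by (intro BK_mc[OF E]) auto
    then have "(\<lambda>H. sg {i, j} {k, l} * mc (f + g) ({i, j} \<union> {k, l}) H) \<in> ?B" by (rule BK_smult[OF I])
    then show ?thesis unfolding f g km_mc using True by simp
  qed
qed

text \<open>Homology in degree three is not known to be spanned by monomial cycles, so the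
  coefficients of \<open>y\<close> are examined directly. Only exponents \<open>m\<close> at the
  complement of \<open>i\<close> enter the product. If \<open>i\<close> occurs in \<open>m\<close>,
  then \<open>f + m\<close> contains \<open>f + one_at i\<close>. Otherwise nothing cancels
  \<open>m + one_at j\<close> in the boundary of \<open>y\<close> at the complement of
  \<open>{i, j}\<close>, so it lies in \<open>E\<close> for every other \<open>j\<close>, and the
  first inclusion applies.\<close>

lemma products_13:
  fixes E :: "('n::{finite,linorder} \<Rightarrow>\<^sub>0 nat) set" and x :: "'n set \<Rightarrow> ('n, 'k::field) mpoly"
  assumes E: "upset E" and c4: "CARD('n) = 4" and c: "comb E" and x: "x \<in> SK E 1" and y: "y \<in> ZK (Mid E) 3"
  shows "km x y \<in> BK (Mid E) 4"
proof -
  note I = Mid_ideal[OF E]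
  obtain f i where f: "x = mc f {i}" "f + one_at i \<in> E" using x unfolding SK_def by (auto simp: card_1_singleton_iff)
  have yK: "y \<in> KM 3" and yZ: "\<And>F. kdv y F \<in> Mid E" using y by (auto simp: ZK_def)
  have xK: "x \<in> KM 1" unfolding f by (rule mc_KM) simp
  have fm: "f + m \<in> E" if m: "m \<in> ks (y (- {i}))" for m
  proof (cases "i \<in> ks m")
    case True
    then have "f + m = (f + one_at i) + (m - one_at i)"
      using ind_minus[of "{i}" m] by (simp add: ind_insert ind_empty ac_simps)
    then show ?thesis using E f(2) by (auto simp: upset_def)
  next
    case False
    have mE: "m + one_at j \<in> E" if j: "j \<noteq> i" for j
    proof -
      let ?F = "- {i, j}"
      have "kdv y ?F = (\<Sum>t\<in>{i, j}. sg {t} ?F * mvar t * y (insert t ?F))" unfolding kd_def by simp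
      also have "\<dots> = sg {i} ?F * (mvar i * y (insert i ?F)) + sg {j} ?F * (mvar j * y (insert j ?F))" using j by (simp add: mult.assoc)
      also have "insert j ?F = - {i}" using j by auto
      finally have e: "kdv y ?F = sg {i} ?F * (mvar i * y (insert i ?F)) + sg {j} ?F * (mvar j * y (- {i}))" .
      have "i \<notin> ks (m + one_at j)" using False j by (simp add: in_keys_iff lookup_add lookup_single)
      moreover have "j \<in> ks (m + one_at j)" by (simp add: in_keys_iff lookup_add)
      ultimately have "lk (kdv y ?F) (m + one_at j) = sg {j} ?F * lk (y (- {i})) m"
        unfolding e by (simp add: lookup_add lk_sg lk_mvar_mult)
      also have "\<dots> \<noteq> 0" using m by (auto simp: sg_def in_keys_iff)
      finally show ?thesis using yZ[of ?F] by (auto simp: Mid_def in_keys_iff subset_iff)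
    qed
    have "{i} \<noteq> UNIV"
    proof
      assume "{i} = UNIV"
      then have "card {i} = 4" using c4 by metis
      then show False by simp
    qed
    then obtain j where "j \<notin> {i}" by blast
    then have "i \<noteq> j" by simp
    then obtain k l where d: "distinct [i, j, k, l]" using ex_distinct(1)[OF c4, of i j] by auto
    show ?thesis using comb_D(1)[OF c d, unfolded comb1_def, rule_format, OF f(2) mE mE mE] d by auto
  qed
  have "km x y H \<in> Mid E" for H
  proof (cases "H = UNIV")
    case True
    have "km x y H = (\<Sum>F\<in>{{i}}. sg F (- F) * x F * y (- F))"
      unfolding km_def True by (rule sum.mono_neutral_cong_right) (auto simp: f mc_def Compl_eq_Diff_UNIV)
    also have "\<dots> = sg {i} (- {i}) * (monomial f * y (- {i}))" by (simp add: f mc_def mult.assoc)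
    also have "\<dots> \<in> Mid E"
    proof (rule idl.subspace_scale[OF I])
      show "monomial f * y (- {i}) \<in> Mid E" using fm keys_mult[of "monomial f :: ('n, 'k) mpoly" "y (- {i})"]
        by (auto simp: Mid_def monomial_def split: if_splits)
    qed
    finally show ?thesis .
  next
    case False
    then have "card H < 4" using c4 psubset_card_mono[of UNIV H] by auto
    then have "km x y H = 0" using km_KM[OF xK yK] by (auto simp: KM_def)
    then show ?thesis using idl.subspace_0[OF I] by simp
  qed
  then show ?thesis using km_KM[OF xK yK] by (intro BK_ideal[OF I]) auto
qed

theorem products_vanish_of_comb:
  fixes E :: "('n::{finite,linorder} \<Rightarrow>\<^sub>0 nat) set"
  assumes E: "upset E" and c4: "CARD('n) = 4" and c: "comb E"
  shows "products_vanish (Mid E :: ('n, 'k::field) mpoly set)"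
proof -
  let ?I = "Mid E :: ('n, 'k) mpoly set"
  note I = Mid_ideal[OF E]
  have swap: "km x y \<in> BK ?I (a + b)" if x: "x \<in> ZK ?I a" and y: "y \<in> ZK ?I b" and yx: "km y x \<in> BK ?I (b + a)" for x y a b
  proof -
    have "km x y = (\<lambda>F. (-1) ^ (a * b) * km y x F)" by (rule km_commute) (use x y in \<open>auto simp: ZK_def\<close>)
    then show ?thesis using BK_smult[OF I yx] by (simp add: add.commute)
  qed
  have 1: "km x y \<in> BK ?I (1 + b)" if x: "x \<in> ZK ?I 1" and y: "y \<in> ZK ?I b" and b: "b \<in> {1, 2, 3}" for x y b
  proof (rule km_spanned[OF E _ x y])
    fix s :: "'n set \<Rightarrow> ('n, 'k) mpoly" assume s: "s \<in> SK E 1"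
    show "km s y \<in> BK ?I (1 + b)"
    proof (cases "b = 3")
      case True then show ?thesis using products_13[OF E c4 c s] y by simp
    next
      case False
      then have b': "b = 1 \<or> b = 2" using b by auto
      have "km y s \<in> BK ?I (b + 1)"
      proof (rule km_spanned[OF E b' y SK_ZK[OF E s]])
        fix t :: "'n set \<Rightarrow> ('n, 'k) mpoly" assume t: "t \<in> SK E b"
        have "km s t \<in> BK ?I (1 + b)" using b' products_11[OF E c4 c s] products_12[OF E c4 c s] t by (auto simp: numeral_2_eq_2 numeral_3_eq_3)
        from swap[OF SK_ZK[OF E t] SK_ZK[OF E s] this] show "km t s \<in> BK ?I (b + 1)" .
      qed
      from swap[OF SK_ZK[OF E s] y this] show ?thesis .
    qed
  qed simp
  have 2: "km x y \<in> BK ?I (2 + 2)" if x: "x \<in> ZK ?I 2" and y: "y \<in> ZK ?I 2" for x y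
  proof (rule km_spanned[OF E _ x y])
    fix s :: "'n set \<Rightarrow> ('n, 'k) mpoly" assume s: "s \<in> SK E 2"
    have "km y s \<in> BK ?I (2 + 2)"
    proof (rule km_spanned[OF E _ y SK_ZK[OF E s]])
      fix t :: "'n set \<Rightarrow> ('n, 'k) mpoly" assume t: "t \<in> SK E 2"
      show "km t s \<in> BK ?I (2 + 2)" using products_22[OF E c4 c t s] by simp
    qed simp
    from swap[OF SK_ZK[OF E s] y this] show "km s y \<in> BK ?I (2 + 2)" .
  qed simp
  show ?thesis unfolding products_vanish_def
  proof (intro allI impI ballI)
    fix a b :: nat and x y assume ab: "1 \<le> a" "1 \<le> b" and x: "x \<in> ZK ?I a" and y: "y \<in> ZK ?I b"
    consider "a + b > 4" | "a = 1" "b \<in> {1, 2, 3}" | "b = 1" "a \<in> {1, 2, 3}" | "a = 2" "b = 2" using ab by fastforce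
    then show "km x y \<in> BK ?I (a + b)"
    proof cases
      case 1
      have "km x y \<in> KM (a + b)" by (rule km_KM) (use x y in \<open>auto simp: ZK_def\<close>)
      then have "km x y = (\<lambda>F. 0)" using KM_large 1 c4 by metis
      then show ?thesis using BK_zero[OF I] by simp
    next
      case 2 then show ?thesis using 1 x y by auto
    next
      case 3 then show ?thesis using swap[OF x y] 1[of y x a] x y by auto
    next
      case 4 then show ?thesis using 2 x y by auto
    qed
  qed
qed

section \<open>From vanishing products to the inclusions\<close>

lemma SK_I: "card F = a \<Longrightarrow> (\<And>i. i \<in> F \<Longrightarrow> m + one_at i \<in> E) \<Longrightarrow> mc m F \<in> SK E a"
  unfolding SK_def by blast

lemma product_mc:
  fixes E :: "('n::{finite,linorder} \<Rightarrow>\<^sub>0 nat) set"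
  assumes E: "upset E" and P: "products_vanish (Mid E :: ('n, 'k::field) mpoly set)" 
    and F: "\<And>i. i \<in> F \<Longrightarrow> f + one_at i \<in> E" and G: "\<And>i. i \<in> G \<Longrightarrow> g + one_at i \<in> E" and d: "F \<inter> G = {}" "F \<noteq> {}" "G \<noteq> {}"
  shows "mc (f + g) (F \<union> G) \<in> (BK (Mid E) (card (F \<union> G)) :: ('n set \<Rightarrow> ('n, 'k) mpoly) set)"
proof -
  note I = Mid_ideal[OF E]
  have "mc f F \<in> (ZK (Mid E) (card F) :: ('n set \<Rightarrow> ('n, 'k) mpoly) set)" "mc g G \<in> (ZK (Mid E) (card G) :: ('n set \<Rightarrow> ('n, 'k) mpoly) set)"
    using F G by (auto intro!: SK_ZK[OF E] SK_I)
  then have "km (mc f F) (mc g G) \<in> (BK (Mid E) (card F + card G) :: ('n set \<Rightarrow> ('n, 'k) mpoly) set)"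
    using P d(2,3) unfolding products_vanish_def by (metis One_nat_def Suc_leI card_gt_0_iff finite_code)
  then have "(\<lambda>H. sg F G * km (mc f F) (mc g G) H) \<in> (BK (Mid E) (card F + card G) :: ('n set \<Rightarrow> ('n, 'k) mpoly) set)"
    by (rule BK_smult[OF I])
  moreover have "(\<lambda>H. sg F G * km (mc f F) (mc g G) H) = (mc (f + g) (F \<union> G) :: 'n set \<Rightarrow> ('n, 'k) mpoly)"
    unfolding km_mc if_P[OF d(1)] sg_sq' ..
  moreover have "card F + card G = card (F \<union> G)" using d(1) by (simp add: card_Un_disjoint)
  ultimately show ?thesis by simp
qed

text \<open>Above the top degree there are no nonzero chains, so being a boundary modulo the ideal
  means lying in it.\<close>

lemma BK_mc_UNIV:
  fixes E :: "('n::{finite,linorder} \<Rightarrow>\<^sub>0 nat) set"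
  assumes "mc m UNIV \<in> (BK (Mid E) (CARD('n)) :: ('n set \<Rightarrow> ('n, 'k::field) mpoly) set)" shows "m \<in> E"
proof -
  obtain y :: "'n set \<Rightarrow> ('n, 'k) mpoly" where y: "y \<in> KM (Suc (CARD('n)))" "\<And>F. mc m UNIV F - kdv y F \<in> Mid E" using assms unfolding BK_def by blast
  have "y = (\<lambda>F. 0)" by (rule KM_large[OF y(1)]) simp
  then have "monomial m \<in> (Mid E :: ('n, 'k) mpoly set)" using y(2)[of UNIV] by (simp add: mc_def kd_def)
  then show ?thesis by (simp add: monomial_def single_Mid)
qed

text \<open>Boundaries in degree three come from \<open>y UNIV\<close> alone. The term that accounts
  for \<open>m\<close> at the complement of \<open>l\<close> also shows up at the complement of
  every other variable, and there it must lie in the ideal.\<close>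

lemma comb3_of_BK:
  fixes E :: "('n::{finite,linorder} \<Rightarrow>\<^sub>0 nat) set"
  assumes c4: "CARD('n) = 4" and d: "distinct [i, j, k, l]" and b: "mc m {i, j, k} \<in> (BK (Mid E) 3 :: ('n set \<Rightarrow> ('n, 'k::field) mpoly) set)" and m: "m \<notin> E"
  shows "\<exists>h. m = one_at l + h \<and> h + one_at i \<in> E \<and> h + one_at j \<in> E \<and> h + one_at k \<in> E"
proof -
  obtain y :: "'n set \<Rightarrow> ('n, 'k) mpoly" where y: "\<And>F. mc m {i, j, k} F - kdv y F \<in> Mid E" using b unfolding BK_def by blast
  have kd1: "kdv y (- {t}) = sg {t} (- {t}) * (mvar t * y UNIV)" for t
  proof -
    have "insert t (- {t}) = UNIV" by auto
    then show ?thesis by (simp add: kd_def mult.assoc)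
  qed
  have ijk: "{i, j, k} = - {l}" using UNIV_distinct[OF c4 d] d by auto
  have "lk (kdv y (- {l})) m \<noteq> 0"
  proof
    assume "lk (kdv y (- {l})) m = 0"
    then have "lk (mc m {i, j, k} (- {l}) - kdv y (- {l})) m = 1" unfolding ijk by (simp add: mc_def monomial_def lookup_minus)
    then show False using y[of "- {l}"] m by (auto simp: Mid_def in_keys_iff subset_iff)
  qed
  then have l: "l \<in> ks m" "lk (y UNIV) (m - one_at l) \<noteq> 0" unfolding kd1 by (auto simp: lk_sg lk_mvar_mult split: if_splits)
  define h where "h = m - one_at l"
  have mh: "m = one_at l + h" using ind_minus[of "{l}" m] l(1) unfolding h_def by (simp add: ind_insert ind_empty add.commute)
  have "h + one_at t \<in> E" if t: "t \<noteq> l" for t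
  proof -
    have "lk (kdv y (- {t})) (h + one_at t) = sg {t} (- {t}) * lk (y UNIV) h"
      unfolding kd1 by (simp add: lk_sg lk_mvar_mult in_keys_iff lookup_add)
    then have "lk (kdv y (- {t})) (h + one_at t) \<noteq> 0" using l(2) unfolding h_def by (auto simp: sg_def)
    moreover have "mc m {i, j, k} (- {t}) = (0 :: ('n, 'k) mpoly)" using t unfolding ijk by (auto simp: mc_def)
    ultimately have "lk (mc m {i, j, k} (- {t}) - kdv y (- {t})) (h + one_at t) \<noteq> 0" by (simp add: lookup_minus)
    then show ?thesis using y[of "- {t}"] by (auto simp: Mid_def in_keys_iff subset_iff)
  qed
  then show ?thesis using mh d by (intro exI[of _ h]) auto
qed

text \<open>In multidegree \<open>a\<close> the coefficients \<open>u\<close> of the boundary at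
  two-element sets are a flow on the complete graph with vertices \<open>ks a\<close>. It uses the
  edge \<open>{i, j}\<close>, as \<open>m\<close> is not in \<open>E\<close>, and every other edge
  in use has its monomial in \<open>E\<close>. Conservation at \<open>i\<close> and at
  \<open>j\<close> continues the flow to further vertices, which yields a triangle or a four-cycle;
  these are the alternatives to be shown.\<close>

lemma comb4_of_BK:
  fixes E :: "('n::{finite,linorder} \<Rightarrow>\<^sub>0 nat) set"
  assumes c4: "CARD('n) = 4" and d: "distinct [i, j, k, l]" and b: "mc m {i, j} \<in> (BK (Mid E) 2 :: ('n set \<Rightarrow> ('n, 'k::field) mpoly) set)" and m: "m \<notin> E"
  shows "(\<exists>h. m = one_at k + h \<and> h + one_at i \<in> E \<and> h + one_at j \<in> E) \<or>
   (\<exists>h. m = one_at l + h \<and> h + one_at i \<in> E \<and> h + one_at j \<in> E) \<or>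
   (\<exists>h. m = one_at k + one_at l + h \<and> h + (one_at i + one_at j) \<in> E \<and>
      ((h + one_at l + one_at i \<in> E \<and> h + one_at k + one_at j \<in> E) \<or> (h + one_at l + one_at j \<in> E \<and> h + one_at k + one_at i \<in> E)))"
proof -
  obtain y :: "'n set \<Rightarrow> ('n, 'k) mpoly" where y: "\<And>F. mc m {i, j} F - kdv y F \<in> Mid E" using b unfolding BK_def by blast
  define a where "a = m + one_at i + one_at j"
  define u where "u = cc a (kdv y)"
  have su: "sd a u F = 0" if "F \<subseteq> ks a" for F
  proof -
    have "hm a (sd a u) = (\<lambda>F. 0)" unfolding u_def kd_hm[symmetric] cc_kd kd_kd ..
    then show ?thesis using that unfolding hm_zero_iff by blast
  qed
  have lka: "lk a t = lk m t + (if t = i \<or> t = j then 1 else 0)" for t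
    using d by (auto simp: a_def lookup_add lookup_single)
  have aij: "a - ind {i, j} = m" using d by (auto simp: a_def ind_insert ind_empty add.assoc)
  have uij: "u {i, j} \<noteq> 0"
  proof
    assume "u {i, j} = 0"
    moreover have "{i, j} \<subseteq> ks a" by (auto simp: in_keys_iff lka)
    ultimately have "lk (kdv y {i, j}) m = 0" by (simp add: u_def cc_def aij)
    then have "lk (mc m {i, j} {i, j} - kdv y {i, j}) m = 1" by (simp add: mc_def monomial_def lookup_minus)
    then show False using y[of "{i, j}"] m by (auto simp: Mid_def in_keys_iff subset_iff)
  qed
  have uE: "F \<subseteq> ks a" "a - ind F \<in> E" if "F \<noteq> {i, j}" "u F \<noteq> 0" for F
  proof -
    show "F \<subseteq> ks a" using that by (auto simp: u_def cc_def split: if_splits)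
    have "lk (mc m {i, j} F - kdv y F) (a - ind F) \<noteq> 0" using that by (auto simp: mc_def u_def cc_def lookup_minus split: if_splits)
    then show "a - ind F \<in> E" using y[of F] by (auto simp: Mid_def in_keys_iff subset_iff)
  qed
  \<comment> \<open>Conservation at the vertex \<open>p\<close>: a single nonzero term in
    \<open>sd a u {p}\<close> could not cancel.\<close>
  have flow: "\<exists>r. r \<noteq> p \<and> r \<noteq> q \<and> r \<in> ks a \<and> u {p, r} \<noteq> 0" if "u {p, q} \<noteq> 0" "p \<in> ks a" "q \<in> ks a" "p \<noteq> q" for p q
  proof (rule ccontr)
    assume no: "\<not> ?thesis"
    have "sd a u {p} = (\<Sum>r\<in>{q}. sg {r} {p} * u (insert r {p}))"
      unfolding sd_def using no that by (intro sum.mono_neutral_right) (auto simp: insert_commute)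
    also have "\<dots> \<noteq> 0" using that by (auto simp: sg_def insert_commute)
    finally show False using su[of "{p}"] that(2) by simp
  qed
  have ijk: "i \<in> ks a" "j \<in> ks a" by (auto simp: in_keys_iff lka)
  note U = UNIV_distinct[OF c4 d]
  obtain q where q: "q \<noteq> i" "q \<noteq> j" "q \<in> ks a" "u {i, q} \<noteq> 0" using flow[OF uij ijk] d by auto
  obtain q' where q': "q' \<noteq> i" "q' \<noteq> j" "q' \<in> ks a" "u {j, q'} \<noteq> 0" using flow[of j i] uij ijk d by (auto simp: insert_commute)
  have sub: "m = one_at r + (m - one_at r)" if "r \<in> ks a" "r \<noteq> i" "r \<noteq> j" for r
    using ind_minus[of "{r}" m] that by (simp add: ind_insert ind_empty add.commute in_keys_iff lka)
  have sb: "a - ind F = v" if "a = v + ind F" for F v using that by simp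
  have one: "\<exists>h. m = one_at r + h \<and> h + one_at i \<in> E \<and> h + one_at j \<in> E" if r: "r \<noteq> i" "r \<noteq> j" "r \<in> ks a" "u {i, r} \<noteq> 0" "u {j, r} \<noteq> 0" for r
  proof -
    define h where "h = m - one_at r"
    have mh: "m = one_at r + h" using sub[OF r(3,1,2)] unfolding h_def .
    have ae: "a = (h + one_at j) + ind {i, r}" "a = (h + one_at i) + ind {j, r}" using r by (simp_all add: a_def mh ind_insert ind_empty ac_simps)
    note sb[OF ae(1)] sb[OF ae(2)]
    moreover have "{i, r} \<noteq> {i, j}" "{j, r} \<noteq> {i, j}" using r d by (auto simp: doubleton_eq_iff)
    ultimately show ?thesis using uE(2)[OF _ r(4)] uE(2)[OF _ r(5)] mh by auto
  qed
  have two: "\<exists>h. m = one_at r + one_at s + h \<and> h + (one_at i + one_at j) \<in> E \<and> h + one_at s + one_at j \<in> E \<and> h + one_at r + one_at i \<in> E" 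
    if r: "r \<noteq> i" "r \<noteq> j" "r \<in> ks a" "u {i, r} \<noteq> 0" "u {j, r} = 0" and s: "s \<noteq> i" "s \<noteq> j" "s \<in> ks a" "u {j, s} \<noteq> 0" for r s
  proof -
    have rs: "r \<noteq> s" using r s by auto
    \<comment> \<open>The flow that reaches \<open>r\<close> from \<open>i\<close> must leave it
      again; the edge to \<open>j\<close> carries nothing, so it continues to \<open>s\<close> and
      closes the four-cycle.\<close>
    obtain t where t: "t \<noteq> r" "t \<noteq> i" "u {r, t} \<noteq> 0" using flow[of r i] r ijk by (auto simp: insert_commute)
    have "t \<noteq> j" using t(3) r(5) by (auto simp: insert_commute)
    moreover have "UNIV = {i, j, r, s}" using UNIV_distinct[OF c4, of i j r s] r s rs d by auto
    ultimately have ts: "t = s" using t by auto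
    define h where "h = m - ind {r, s}"
    have "{r, s} \<subseteq> ks m" using r s by (auto simp: in_keys_iff lka)
    from ind_minus[OF this] have mh: "m = one_at r + one_at s + h" using rs unfolding h_def by (simp add: ind_insert ind_empty add.commute)
    have ae: "a = (h + one_at s + one_at j) + ind {i, r}" "a = (h + one_at r + one_at i) + ind {j, s}" "a = (h + (one_at i + one_at j)) + ind {r, s}"
      using r s rs by (simp_all add: a_def mh ind_insert ind_empty ac_simps)
    note sb[OF ae(1)] sb[OF ae(2)] sb[OF ae(3)]
    moreover have "{i, r} \<noteq> {i, j}" "{j, s} \<noteq> {i, j}" "{r, s} \<noteq> {i, j}" using r s d by (auto simp: doubleton_eq_iff)
    ultimately show ?thesis using uE(2)[OF _ r(4)] uE(2)[OF _ s(4)] uE(2)[OF _ t(3)] mh ts by auto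
  qed
  have qs: "q \<in> {k, l}" "q' \<in> {k, l}" using q q' U by auto
  show ?thesis
  proof (cases "u {j, q} \<noteq> 0")
    case True
    have "\<exists>h. m = one_at q + h \<and> h + one_at i \<in> E \<and> h + one_at j \<in> E" by (rule one[OF q True])
    then show ?thesis using qs by auto
  next
    case False
    then have z: "u {j, q} = 0" by simp
    obtain h where h: "m = one_at q + one_at q' + h" "h + (one_at i + one_at j) \<in> E" "h + one_at q' + one_at j \<in> E" "h + one_at q + one_at i \<in> E"
      using two[OF q z q'] by blast
    have "q \<noteq> q'" using q' z by auto
    then consider "q = k" "q' = l" | "q = l" "q' = k" using qs by auto
    then show ?thesis
    proof cases
      case 1 then show ?thesis using h by (intro disjI2 exI[of _ h]) auto
    next
      case 2 then show ?thesis using h by (intro disjI2 exI[of _ h]) (auto simp: ac_simps)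
    qed
  qed
qed

theorem comb_of_products_vanish:
  fixes E :: "('n::{finite,linorder} \<Rightarrow>\<^sub>0 nat) set"
  assumes E: "upset E" and c4: "CARD('n) = 4" and P: "products_vanish (Mid E :: ('n, 'k::field) mpoly set)"
  shows "comb E"
  unfolding comb_def
proof (intro allI impI)
  fix i j k l :: 'n assume d: "distinct [i, j, k, l]"
  note U = UNIV_distinct[OF c4 d]
  note pm = product_mc[OF E P]
  have 1: "comb1 E i j k l" unfolding comb1_def
  proof (intro allI impI)
    fix f g assume a: "f + one_at i \<in> E" "g + one_at j \<in> E" "g + one_at k \<in> E" "g + one_at l \<in> E"
    have u: "{i} \<union> {j, k, l} = UNIV" using U by auto
    have "mc (f + g) ({i} \<union> {j, k, l}) \<in> (BK (Mid E) (card ({i} \<union> {j, k, l})) :: ('n set \<Rightarrow> ('n, 'k) mpoly) set)"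
      by (rule pm) (use a d in auto)
    then show "f + g \<in> E" unfolding u by (rule BK_mc_UNIV)
  qed
  have 2: "comb2 E i j k l" unfolding comb2_def
  proof (intro allI impI)
    fix f g assume a: "f + one_at i \<in> E" "f + one_at j \<in> E" "g + one_at k \<in> E" "g + one_at l \<in> E"
    have u: "{i, j} \<union> {k, l} = UNIV" using U by auto
    have "mc (f + g) ({i, j} \<union> {k, l}) \<in> (BK (Mid E) (card ({i, j} \<union> {k, l})) :: ('n set \<Rightarrow> ('n, 'k) mpoly) set)"
      by (rule pm) (use a d in auto)
    then show "f + g \<in> E" unfolding u by (rule BK_mc_UNIV)
  qed
  have 3: "comb3 E i j k l" unfolding comb3_def
  proof (intro allI impI)
    fix f g assume a: "f + one_at i \<in> E" "g + one_at j \<in> E" "g + one_at k \<in> E"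
    have "mc (f + g) ({i} \<union> {j, k}) \<in> (BK (Mid E) (card ({i} \<union> {j, k})) :: ('n set \<Rightarrow> ('n, 'k) mpoly) set)"
      by (rule pm) (use a d in auto)
    moreover have "{i} \<union> {j, k} = {i, j, k}" "card {i, j, k} = 3" using d by auto
    ultimately have "mc (f + g) {i, j, k} \<in> (BK (Mid E) 3 :: ('n set \<Rightarrow> ('n, 'k) mpoly) set)" by (simp only:)
    then show "f + g \<in> E \<or> (\<exists>h. f + g = one_at l + h \<and> h + one_at i \<in> E \<and> h + one_at j \<in> E \<and> h + one_at k \<in> E)"
      using comb3_of_BK[OF c4 d] by blast
  qed
  have 4: "comb4 E i j k l" unfolding comb4_def
  proof (intro allI impI)
    fix f g assume a: "f + one_at i \<in> E" "g + one_at j \<in> E"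
    have "mc (f + g) ({i} \<union> {j}) \<in> (BK (Mid E) (card ({i} \<union> {j})) :: ('n set \<Rightarrow> ('n, 'k) mpoly) set)"
      by (rule pm) (use a d in auto)
    moreover have "{i} \<union> {j} = {i, j}" "card {i, j} = 2" using d by auto
    ultimately have "mc (f + g) {i, j} \<in> (BK (Mid E) 2 :: ('n set \<Rightarrow> ('n, 'k) mpoly) set)" by (simp only:)
    from comb4_of_BK[OF c4 d this] show "f + g \<in> E \<or>
      (\<exists>h. f + g = one_at k + h \<and> h + one_at i \<in> E \<and> h + one_at j \<in> E) \<or>
      (\<exists>h. f + g = one_at l + h \<and> h + one_at i \<in> E \<and> h + one_at j \<in> E) \<or>
      (\<exists>h. f + g = one_at k + one_at l + h \<and> h + (one_at i + one_at j) \<in> E \<and>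
      ((h + one_at l + one_at i \<in> E \<and> h + one_at k + one_at j \<in> E) \<or> (h + one_at l + one_at j \<in> E \<and> h + one_at k + one_at i \<in> E)))"
      by blast
  qed
  show "comb1 E i j k l \<and> comb2 E i j k l \<and> comb3 E i j k l \<and> comb4 E i j k l" using 1 2 3 4 by blast
qed

section \<open>Triple products\<close>

definition homog :: "('n::{finite,linorder} \<Rightarrow>\<^sub>0 nat) \<Rightarrow> ('n set \<Rightarrow> ('n, 'k::field) mpoly) \<Rightarrow> bool" where
  "homog a x \<longleftrightarrow> (\<forall>F. \<forall>m\<in>ks (x F). m + ind F = a)"

lemma ind_Un: "F \<inter> G = {} \<Longrightarrow> ind (F \<union> G) = ind F + ind G"
  unfolding ind_def by (rule sum.union_disjoint) auto

lemma homog_mc: "m + ind F = a \<Longrightarrow> homog a (mc m F)"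
  unfolding homog_def mc_def monomial_def by auto

lemma homog_zero: "homog a (\<lambda>F. 0)" by (simp add: homog_def)

lemma homog_smult: "homog a x \<Longrightarrow> homog a (\<lambda>F. mconst c * x F)"
proof -
  assume x: "homog a x"
  have "m \<in> ks (x F)" if "m \<in> ks (mconst c * x F)" for m F
  proof -
    have "lk (mconst c * x F) m = c * lk (x F) m"
      unfolding mconst_def using lookup_times_single[of 0 c "x F" m] by (simp add: mult.commute)
    then show ?thesis using that by (auto simp: in_keys_iff)
  qed
  then show ?thesis using x unfolding homog_def by blast
qed

lemma sg_mconst: "sg F G = (mconst (sg F G) :: ('n::{finite,linorder}, 'k::field) mpoly)"
proof -
  have "sg F G * (Poly_Mapping.single 0 1 :: ('n, 'k) mpoly) = Poly_Mapping.single 0 (sg F G * 1)" by (rule sg_single)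
  then show ?thesis by (simp add: mconst_def)
qed

lemma homog_km:
  fixes x y :: "'n::{finite,linorder} set \<Rightarrow> ('n, 'k::field) mpoly"
  assumes x: "homog a x" and y: "homog b y" shows "homog (a + b) (km x y)"
  unfolding homog_def
proof (intro allI ballI)
  fix H m assume m: "m \<in> ks (km x y H)"
  then have "lk (km x y H) m \<noteq> 0" by (simp add: in_keys_iff)
  then have "(\<Sum>F\<in>Pow H. lk (sg F (H - F) * x F * y (H - F)) m) \<noteq> 0" unfolding km_def lk_sum .
  then obtain F where F: "F \<in> Pow H" "lk (sg F (H - F) * x F * y (H - F)) m \<noteq> 0" by (meson sum.not_neutral_contains_not_neutral)
  then have "m \<in> ks (x F * y (H - F))" by (auto simp: mult.assoc lk_sg in_keys_iff)
  then obtain p q where pq: "p \<in> ks (x F)" "q \<in> ks (y (H - F))" "m = p + q" using keys_mult[of "x F" "y (H - F)"] by blast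
  have "H = F \<union> (H - F)" using F(1) by auto
  then have "ind H = ind F + ind (H - F)" using ind_Un[of F "H - F"] by auto
  moreover have "p + ind F = a" "q + ind (H - F) = b" using x y pq unfolding homog_def by blast+
  ultimately show "m + ind H = a + b" by (auto simp: pq ac_simps)
qed

lemma hm_cc_homog: "homog a (hm a (cc a x))"
  unfolding homog_def by (auto simp: in_keys_iff lk_hm_cc split: if_splits)

lemma hm_cc_id: assumes "homog a x" shows "hm a (cc a x) = x"
proof (intro ext poly_mapping_eqI)
  fix F m show "lk (hm a (cc a x) F) m = lk (x F) m"
    using assms[unfolded homog_def, rule_format, of m F] by (auto simp: lk_hm_cc in_keys_iff)
qed

lemma hm_cc_diff: "hm a (cc a (\<lambda>F. x F - y F)) = (\<lambda>F. hm a (cc a x) F - hm a (cc a y) F)"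
  by (intro ext poly_mapping_eqI) (auto simp: lk_hm_cc lookup_minus)

text \<open>Admissible choices of a bounding chain for the product of two monomial cycles. Normalising the
  chain whenever the two generators share a further variable makes the triple products cancel.\<close>

definition bounds :: "('n::{finite,linorder} \<Rightarrow>\<^sub>0 nat) set \<Rightarrow> ('n \<Rightarrow>\<^sub>0 nat) \<Rightarrow> 'n \<Rightarrow> ('n \<Rightarrow>\<^sub>0 nat) \<Rightarrow> 'n \<Rightarrow> ('n set \<Rightarrow> ('n, 'k::field) mpoly) \<Rightarrow> bool" where
  "bounds E f i g j y \<longleftrightarrow> y \<in> KM 3 \<and> homog (f + one_at i + (g + one_at j)) y \<and> (\<forall>F. kdv y F - km (mc f {i}) (mc g {j}) F \<in> Mid E) \<and>
    (if i \<noteq> j \<and> (\<exists>d. d \<notin> {i, j} \<and> d \<in> ks f \<and> d \<in> ks g)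
     then \<exists>d. d \<notin> {i, j} \<and> d \<in> ks f \<and> d \<in> ks g \<and> y = (\<lambda>F. mconst (sg {d} {i, j} * sg {i} {j}) * mc (f + g - one_at d) {i, j, d} F)
     else i = j \<or> f + g \<in> E \<longrightarrow> y = (\<lambda>F. 0))"

lemma minus_one_at: "d \<in> ks (f :: 'n::finite \<Rightarrow>\<^sub>0 nat) \<Longrightarrow> f - one_at d + one_at d = f"
  using ind_minus[of "{d}" f] by (simp add: ind_insert ind_empty)

lemma upset_add: "upset E \<Longrightarrow> m \<in> E \<Longrightarrow> m + d \<in> E" "upset E \<Longrightarrow> m \<in> E \<Longrightarrow> d + m \<in> E"
  by (auto simp: upset_def add.commute)

lemma mc_Mid: "m \<in> E \<Longrightarrow> mc m F G \<in> Mid E" by (auto simp: mc_def monomial_def single_Mid Mid_def)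

text \<open>When a further variable \<open>d\<close> divides both generators, one monomial chain on
  \<open>i\<close>, \<open>j\<close>, \<open>d\<close> suffices: its other boundary terms are
  multiples of \<open>f + one_at i\<close> or of \<open>g + one_at j\<close>. When the product is
  zero or has its monomial in the ideal, the zero chain serves, and otherwise the part of any
  bounding chain in the multidegree of the product.\<close>

lemma bounds_exists:
  fixes E :: "('n::{finite,linorder} \<Rightarrow>\<^sub>0 nat) set"
  assumes E: "upset E" and c4: "CARD('n) = 4" and c: "comb E" and f: "f + one_at i \<in> E" and g: "g + one_at j \<in> E"
  shows "\<exists>y :: 'n set \<Rightarrow> ('n, 'k::field) mpoly. bounds E f i g j y"
proof -
  note I = Mid_ideal[OF E]
  let ?a = "f + one_at i + (g + one_at j)"
  consider d where "i \<noteq> j" "d \<notin> {i, j}" "d \<in> ks f" "d \<in> ks g" 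
    | "\<not> (i \<noteq> j \<and> (\<exists>d. d \<notin> {i, j} \<and> d \<in> ks f \<and> d \<in> ks g))" "i = j \<or> f + g \<in> E" 
    | "\<not> (i \<noteq> j \<and> (\<exists>d. d \<notin> {i, j} \<and> d \<in> ks f \<and> d \<in> ks g))" "i \<noteq> j" "f + g \<notin> E" by blast
  then show ?thesis
  proof cases
    case (1 d)
    define h where "h = f + g - one_at d"
    have "d \<in> ks (f + g)" using 1 by (simp add: in_keys_iff lookup_add)
    then have hd: "h + one_at d = f + g" unfolding h_def by (rule minus_one_at)
    have "h + one_at i + one_at d = (g - one_at d) + (f + one_at i) + one_at d"
      using hd minus_one_at[OF 1(4)] by (metis (no_types, opaque_lifting) add.assoc add.commute)
    then have "h + one_at i = (g - one_at d) + (f + one_at i)" by simp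
    then have hi: "h + one_at i \<in> E" using upset_add(2)[OF E f] by simp
    have "h + one_at j + one_at d = (f - one_at d) + (g + one_at j) + one_at d"
      using hd minus_one_at[OF 1(3)] by (metis (no_types, opaque_lifting) add.assoc add.commute)
    then have "h + one_at j = (f - one_at d) + (g + one_at j)" by simp
    then have hj: "h + one_at j \<in> E" using upset_add(2)[OF E g] by simp
    \<comment> \<open>The first factor cancels the sign of the face \<open>{i, j}\<close> in the
      boundary, the second installs the sign of the product.\<close>
    define s :: 'k where "s = sg {d} {i, j} * sg {i} {j}"
    define y :: "'n set \<Rightarrow> ('n, 'k) mpoly" where "y = (\<lambda>F. mconst s * mc h {i, j, d} F)"
    have "mc h {i, j, d} \<in> (KM 3 :: ('n set \<Rightarrow> ('n, 'k) mpoly) set)" using 1 by (intro mc_KM) auto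
    then have "y \<in> KM 3" by (auto simp: KM_def y_def)
    moreover have "homog ?a y" unfolding y_def
    proof (intro homog_smult homog_mc)
      have "i \<notin> {j, d}" "j \<notin> {d}" using 1 by auto
      then have "ind {i, j, d} = one_at i + (one_at j + one_at d)" by (simp add: ind_insert ind_empty)
      then have "h + ind {i, j, d} = (h + one_at d) + (one_at i + one_at j)" by (simp add: ac_simps)
      then show "h + ind {i, j, d} = ?a" unfolding hd by (simp add: ac_simps)
    qed
    moreover have "kdv y F - km (mc f {i}) (mc g {j}) F \<in> Mid E" for F
    proof -
      have r: "{i, j, d} - {d} = {i, j}" "{i, j, d} - {i} = {j, d}" "{i, j, d} - {j} = {i, d}" using 1 by auto
      have "kdv (mc h {i, j, d}) F = sg {d} {i, j} * mc (h + one_at d) {i, j} F + 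
         (sg {i} {j, d} * mc (h + one_at i) {j, d} F + sg {j} {i, d} * mc (h + one_at j) {i, d} F :: ('n, 'k) mpoly)" (is "_ = _ + ?r")
      proof -
        have "i \<notin> {j, d}" "j \<notin> {d}" using 1 by auto
        then have "(\<Sum>t\<in>{i, j, d}. G t) = G d + (G i + G j)" for G :: "'n \<Rightarrow> ('n, 'k) mpoly" by (simp add: ac_simps)
        then show ?thesis unfolding kd_mc by (simp only: r)
      qed
      moreover have "kdv y F = mconst s * kdv (mc h {i, j, d}) F" unfolding y_def kd_smult ..
      moreover have "km (mc f {i}) (mc g {j}) F = mconst s * (sg {d} {i, j} * mc (h + one_at d) {i, j} F)"
      proof -
        have "mconst s = (sg {d} {i, j} * sg {i} {j} :: ('n, 'k) mpoly)"
          unfolding s_def sg_mconst by (simp add: mconst_def mult_single)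
        moreover have "{i} \<union> {j} = {i, j}" by auto
        ultimately have "mconst s * (sg {d} {i, j} * mc (h + one_at d) {i, j} F) = sg {d} {i, j} * (sg {d} {i, j} * (sg {i} {j} * mc (f + g) {i, j} F))" 
          unfolding hd by (simp add: ac_simps)
        also have "\<dots> = sg {i} {j} * mc (f + g) {i, j} F" by (rule sg_sq')
        also have "\<dots> = km (mc f {i}) (mc g {j}) F" unfolding km_mc using 1 \<open>{i} \<union> {j} = {i, j}\<close> by simp
        finally show ?thesis ..
      qed
      ultimately have "kdv y F - km (mc f {i}) (mc g {j}) F = mconst s * ?r" by (simp add: algebra_simps)
      moreover have "?r \<in> Mid E" by (intro idl.subspace_add[OF I] idl.subspace_scale[OF I] mc_Mid hi hj)
      ultimately show ?thesis using idl.subspace_scale[OF I] by simp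
    qed
    moreover have "\<exists>d. d \<notin> {i, j} \<and> d \<in> ks f \<and> d \<in> ks g \<and> y = (\<lambda>F. mconst (sg {d} {i, j} * sg {i} {j}) * mc (f + g - one_at d) {i, j, d} F)"
      by (rule exI[of _ d]) (use 1 in \<open>auto simp: y_def s_def h_def\<close>)
    moreover have "i \<noteq> j \<and> (\<exists>d. d \<notin> {i, j} \<and> d \<in> ks f \<and> d \<in> ks g)" using 1 by blast
    ultimately have "bounds E f i g j y" unfolding bounds_def by simp
    then show ?thesis by (rule exI[of _ y])
  next
    case 2
    have "km (mc f {i}) (mc g {j}) F \<in> (Mid E :: ('n, 'k) mpoly set)" for F
      unfolding km_mc using 2(2) idl.subspace_0[OF I] by (auto intro!: idl.subspace_scale[OF I] mc_Mid)
    then have "bounds E f i g j (\<lambda>F. 0 :: ('n, 'k) mpoly)" unfolding bounds_def if_not_P[OF 2(1)]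
      using idl.subspace_neg[OF I] by (auto simp: KM_def homog_zero kd_def)
    then show ?thesis by (rule exI[of _ "\<lambda>F. 0"])
  next
    case 3
    let ?p = "km (mc f {i}) (mc g {j}) :: 'n set \<Rightarrow> ('n, 'k) mpoly"
    have "?p \<in> BK (Mid E) 2" by (rule products_11[OF E c4 c]) (use f g in \<open>auto intro!: SK_I\<close>)
    then obtain y0 where y0: "y0 \<in> KM (Suc 2)" "\<forall>F. ?p F - kdv y0 F \<in> Mid E" unfolding BK_def by blast
    define y where "y = hm ?a (cc ?a y0)"
    have hp: "homog ?a ?p" by (intro homog_km homog_mc) (auto simp: ind_insert ind_empty)
    have "(\<lambda>F. kdv y F - ?p F) = hm ?a (cc ?a (\<lambda>F. kdv y0 F - ?p F))"
      unfolding hm_cc_diff hm_cc_id[OF hp] cc_kd y_def ..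
    moreover have "hm ?a (cc ?a (\<lambda>F. kdv y0 F - ?p F)) F \<in> Mid E" for F
    proof (rule hm_Mid)
      fix F show "kdv y0 F - ?p F \<in> Mid E" using idl.subspace_neg[OF I y0(2)[rule_format, of F]] by simp
    qed
    ultimately have "kdv y F - ?p F \<in> Mid E" for F by (metis (no_types, lifting))
    moreover have "y \<in> KM 3" unfolding y_def using hm_KM[OF y0(1)] by (simp add: eval_nat_numeral)
    moreover have "homog ?a y" unfolding y_def by (rule hm_cc_homog)
    ultimately have "bounds E f i g j y" unfolding bounds_def if_not_P[OF 3(1)] using 3 by simp
    then show ?thesis by (rule exI[of _ y])
  qed
qed

text \<open>If \<open>d\<close> divided neither \<open>U\<close> nor \<open>V\<close>, these would be pure powers of \<open>a\<close> and \<open>b\<close>, and the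
  inclusion for \<open>[I : a][I : b]\<close> would put \<open>m\<close> into \<open>E\<close>.\<close>

lemma shared_variable:
  fixes E :: "('n::{finite,linorder} \<Rightarrow>\<^sub>0 nat) set"
  assumes E: "upset E" and c: "comb E" and d: "distinct [a, b, c, d]" and U: "U \<in> E" "ks U \<subseteq> {a, d}" "a \<in> ks U" and V: "V \<in> E" "ks V \<subseteq> {b, d}" "b \<in> ks V"
    and W: "c \<in> ks W" and m: "m \<notin> E" "m + ind UNIV = U + V + W" and UN: "UNIV = {a, b, c, d}"
  shows "d \<in> ks U \<or> d \<in> ks V"
proof (rule ccontr)
  assume no: "\<not> ?thesis"
  let ?f = "U - one_at a" and ?g = "V - one_at b"
  have f: "?f + one_at a = U" and g: "?g + one_at b = V" using minus_one_at[OF U(3)] minus_one_at[OF V(3)] by auto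
  have lkm: "lk m t + 1 = lk U t + lk V t + lk W t" for t
    using arg_cong[OF m(2), of "\<lambda>p. lk p t"] by (simp add: lookup_add lk_ind)
  have cd: "lk U c = 0" "lk V c = 0" "lk U d = 0" "lk V d = 0" using no U V d by (auto simp: in_keys_iff)
  have z: "lk (?f + ?g) c = 0" "lk (?f + ?g) d = 0" using cd by (simp_all add: lookup_add lookup_minus)
  have no': "?f + ?g \<noteq> one_at c + h" "?f + ?g \<noteq> one_at d + h" "?f + ?g \<noteq> one_at c + one_at d + h" for h
  proof -
    show "?f + ?g \<noteq> one_at c + h"
    proof
      assume e: "?f + ?g = one_at c + h" show False using z(1)[unfolded e] by (simp add: lookup_add)
    qed
    show "?f + ?g \<noteq> one_at d + h"
    proof
      assume e: "?f + ?g = one_at d + h" show False using z(2)[unfolded e] by (simp add: lookup_add)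
    qed
    show "?f + ?g \<noteq> one_at c + one_at d + h"
    proof
      assume e: "?f + ?g = one_at c + one_at d + h" show False using z(1)[unfolded e] by (simp add: lookup_add)
    qed
  qed
  have "?f + ?g \<in> E"
    using comb_D(4)[OF c d, unfolded comb4_def, rule_format, of ?f ?g] U V no' unfolding f g by blast
  moreover have "m = (?f + ?g) + (W - ind {c, d})"
  proof (rule poly_mapping_eqI)
    fix t
    have "t \<in> {a, b, c, d}" using UN by auto
    then show "lk m t = lk ((?f + ?g) + (W - ind {c, d})) t"
      using lkm[of t] cd U V W d by (auto simp: lookup_add lookup_minus lk_ind lookup_single in_keys_iff subset_iff)
  qed
  ultimately show False using m(1) upset_add(1)[OF E] by metis
qed

text \<open>In the critical multidegree only \<open>a\<close>, \<open>b\<close>, \<open>d\<close>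
  occur, so a chain of degree three is a scalar \<open>la\<close> times one monomial chain. A face
  whose monomial lies outside \<open>E\<close> determines \<open>la\<close>; where no such face is
  available, the normal form prescribed by \<open>bounds\<close> fixes the chain. Either way the
  result is independent of the choice made.\<close>

lemma bounds_unique:
  fixes E :: "('n::{finite,linorder} \<Rightarrow>\<^sub>0 nat) set" and y :: "'n set \<Rightarrow> ('n, 'k::field) mpoly"
  assumes E: "upset E" and d: "distinct [a, b, c, d]" and UN: "UNIV = {a, b, c, d}" 
    and U: "f + one_at i \<in> E" "ks (f + one_at i) \<subseteq> {a, d}" "a \<in> ks (f + one_at i)" and V: "g + one_at j \<in> E" "ks (g + one_at j) \<subseteq> {b, d}" "b \<in> ks (g + one_at j)"
    and W: "c \<in> ks W" "ks W \<subseteq> {c, d}" and m: "m \<notin> E" "m + ind UNIV = f + one_at i + (g + one_at j) + W" 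
    and sh: "d \<in> ks (f + one_at i) \<or> d \<in> ks (g + one_at j)" "d \<in> ks (f + one_at i) \<or> d \<in> ks W" "d \<in> ks (g + one_at j) \<or> d \<in> ks W"
    and y: "bounds E f i g j y"
  shows "y = (\<lambda>F. if i = a \<and> j = b then mconst (sg {d} {a, b} * sg {a} {b}) * mc (f + one_at i + (g + one_at j) - ind {a, b, d}) {a, b, d} F else 0)"
proof -
  let ?U = "f + one_at i" and ?V = "g + one_at j"
  let ?T = "{a, b, d}"
  define n0 where "n0 = ?U + ?V - ind ?T"
  have yK: "y \<in> KM 3" and yh: "homog (?U + ?V) y" and yI: "\<And>F. kdv y F - km (mc f {i}) (mc g {j}) F \<in> Mid E" using y unfolding bounds_def by auto
  have TS: "?T \<subseteq> ks (?U + ?V)" using U(3) V(3) sh(1) by (auto simp: in_keys_iff lookup_add)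
  have ST: "ks (?U + ?V) \<subseteq> ?T" using keys_add[of ?U ?V] U(2) V(2) by blast
  have n0: "n0 + ind ?T = ?U + ?V" unfolding n0_def by (rule ind_minus[OF TS])
  define la where "la = lk (y ?T) n0"
  have yF: "y F = mconst la * mc n0 ?T F" for F
  proof (cases "F = ?T")
    case True
    have "lk (y ?T) p = (if p = n0 then la else 0)" for p
    proof (cases "p \<in> ks (y ?T)")
      case True
      then have "p + ind ?T = ?U + ?V" using yh unfolding homog_def by blast
      then have "p = n0" using n0 by (metis add_right_cancel)
      then show ?thesis by (simp add: la_def)
    next
      case False then show ?thesis by (auto simp: la_def in_keys_iff)
    qed
    then have "y ?T = Poly_Mapping.single n0 la" by (intro poly_mapping_eqI) (auto simp: lookup_single when_def)
    then show ?thesis unfolding True by (simp add: mc_def mconst_def monomial_def mult_single)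
  next
    case False
    have "y F = 0"
    proof (rule ccontr)
      assume nz: "y F \<noteq> 0"
      then have cF: "card F = 3" using yK by (auto simp: KM_def)
      obtain p where "p \<in> ks (y F)" using nz by (meson ex_in_conv keys_eq_empty)
      then have "p + ind F = ?U + ?V" using yh unfolding homog_def by blast
      then have "F \<subseteq> ?T" using ind_keys[of F p] ST by auto
      moreover have "card ?T = 3" using d by simp
      ultimately have "F = ?T" using cF card_subset_eq[of ?T F] by simp
      then show False using False by simp
    qed
    then show ?thesis using False by (simp add: mc_def)
  qed
  have ye: "y = (\<lambda>F. mconst la * mc n0 ?T F)" by (rule ext) (rule yF)
  have ia: "i = a \<or> i = d" and jb: "j = b \<or> j = d" using U(2) V(2) by (auto simp: in_keys_iff lookup_add subset_iff)
  \<comment> \<open>Modulo the ideal the boundary equals the product, and at an exponent outside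
    \<open>E\<close> this is an equality of scalars.\<close>
  have face: "la * sg {t} (?T - {t}) = (if {i, j} = ?T - {t} then sg {i} {j} else 0)" 
    if t: "t \<in> ?T" and nE: "n0 + one_at t \<notin> E" for t
  proof -
    let ?F = "?T - {t}"
    have "kdv y ?F = mconst la * (\<Sum>s\<in>?T. sg {s} (?T - {s}) * mc (n0 + one_at s) (?T - {s}) ?F)"
      unfolding ye kd_smult kd_mc ..
    also have "(\<Sum>s\<in>?T. sg {s} (?T - {s}) * mc (n0 + one_at s) (?T - {s}) ?F) = (\<Sum>s\<in>{t}. sg {s} (?T - {s}) * mc (n0 + one_at s) (?T - {s}) ?F :: ('n, 'k) mpoly)"
      by (rule sum.mono_neutral_right) (use t in \<open>auto simp: mc_def\<close>)
    finally have 1: "lk (kdv y ?F) (n0 + one_at t) = la * sg {t} ?F"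
      by (simp add: mc_def sg_mconst mconst_def monomial_def mult_single)
    have 2: "lk (km (mc f {i}) (mc g {j}) ?F) (n0 + one_at t) = (if {i, j} = ?F then sg {i} {j} else 0 :: 'k)"
    proof (cases "{i, j} = ?F")
      case True
      have "card ?F = 2" using t d by (auto simp: card_Diff_singleton)
      then have "card {i, j} = 2" using True by simp
      then have ij: "i \<noteq> j" by (cases "i = j") auto
      have "?T = insert t ?F" using t by auto
      then have "ind ?T = one_at t + ind ?F" using ind_insert[of t ?F] by auto
      moreover have "ind ?F = one_at i + one_at j" unfolding True[symmetric] using ij by (simp add: ind_insert ind_empty)
      ultimately have "(n0 + one_at t) + (one_at i + one_at j) = (f + g) + (one_at i + one_at j)" using n0 by (simp add: ac_simps)
      then have e: "n0 + one_at t = f + g" using add_right_imp_eq by blast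
      have "{i} \<union> {j} = ?F" using True by auto
      then show ?thesis unfolding e km_mc using True ij by (simp add: mc_def sg_mconst mconst_def monomial_def mult_single)
    next
      case False
      then have "{i} \<union> {j} \<noteq> ?F" by auto
      then show ?thesis unfolding km_mc using False by (simp add: mc_def)
    qed
    have "lk (kdv y ?F - km (mc f {i}) (mc g {j}) ?F) (n0 + one_at t) = 0"
      using yI[of ?F] nE by (auto simp: Mid_def in_keys_iff subset_iff)
    then show ?thesis unfolding lookup_minus 1 2 by simp
  qed
  have lkm: "lk m t + 1 = lk ?U t + lk ?V t + lk W t" for t
    using arg_cong[OF m(2), of "\<lambda>p. lk p t"] by (simp add: lookup_add lk_ind)
  \<comment> \<open>If \<open>d\<close> divides \<open>W\<close>, then \<open>m\<close> is
    \<open>n0 + one_at d\<close> plus the rest of \<open>W\<close>, so membership of the former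
    would put \<open>m\<close> into \<open>E\<close>.\<close>
  have nd: "n0 + one_at d \<notin> E" if "d \<in> ks W"
  proof
    assume a: "n0 + one_at d \<in> E"
    have "ind UNIV = ind ?T + one_at c" unfolding UN using d by (simp add: ind_insert ind_empty ac_simps)
    moreover have "W = (W - ind {c, d}) + (one_at c + one_at d)" using ind_minus[of "{c, d}" W] that W(1) d by (simp add: ind_insert ind_empty)
    ultimately have "m + (ind ?T + one_at c) = n0 + ind ?T + ((W - ind {c, d}) + (one_at c + one_at d))" using m(2) n0 by metis
    then have "m + (ind ?T + one_at c) = (n0 + one_at d + (W - ind {c, d})) + (ind ?T + one_at c)" by (simp add: ac_simps)
    then have "m = n0 + one_at d + (W - ind {c, d})" using add_right_imp_eq by blast
    then show False using m(1) upset_add(1)[OF E a] by simp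
  qed
  have ksf: "ks f \<subseteq> {a, d}" "ks g \<subseteq> {b, d}" using U(2) V(2) by (auto simp: in_keys_iff lookup_add subset_iff)
  have nfg: "n0 + ind ?T = f + g + (one_at i + one_at j)" unfolding n0 by (simp add: ac_simps)
  have sgn: "sg F G \<noteq> (0 :: 'k)" for F G :: "'n set" by (simp add: sg_def)
  show ?thesis
  proof (cases "i = a \<and> j = b")
    case True
    then have ij: "i = a" "j = b" by auto
    have "ind ?T = one_at d + (one_at i + one_at j)" using d ij by (simp add: ind_insert ind_empty ac_simps)
    then have "(n0 + one_at d) + (one_at i + one_at j) = (f + g) + (one_at i + one_at j)" using nfg by (simp add: ac_simps)
    then have nfg': "n0 + one_at d = f + g" using add_right_imp_eq by blast
    have "y = (\<lambda>F. mconst (sg {d} {a, b} * sg {a} {b}) * mc n0 ?T F)"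
    proof (cases "d \<in> ks f \<and> d \<in> ks g")
      case True
      then have A: "i \<noteq> j \<and> (\<exists>d. d \<notin> {i, j} \<and> d \<in> ks f \<and> d \<in> ks g)" using ij d by auto
      obtain d' where d': "d' \<notin> {i, j}" "d' \<in> ks f" "d' \<in> ks g" "y = (\<lambda>F. mconst (sg {d'} {i, j} * sg {i} {j}) * mc (f + g - one_at d') {i, j, d'} F)"
        using y unfolding bounds_def if_P[OF A] by blast
      have dd: "d' = d" using d'(1,2) ksf ij by auto
      have "f + g - one_at d = n0" using nfg' by (metis add_diff_cancel_right')
      then show ?thesis using d'(4) unfolding dd ij by simp
    next
      case False
      then have "d \<in> ks W" using sh ij d by (auto simp: in_keys_iff lookup_add lookup_single)
      have "?T - {d} = {a, b}" using d by auto
      then have "la * sg {d} {a, b} = sg {a} {b}" using face[of d] nd[OF \<open>d \<in> ks W\<close>] ij by simp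
      then have "sg {d} {a, b} * sg {a} {b} = sg {d} {a, b} * (sg {d} {a, b} * la)" by (simp add: mult.commute)
      then have "la = sg {d} {a, b} * sg {a} {b}" by (simp only: sg_sq')
      then show ?thesis using ye by simp
    qed
    then show ?thesis using True unfolding n0_def by simp
  next
    case False
    have notA: "\<not> (i \<noteq> j \<and> (\<exists>d. d \<notin> {i, j} \<and> d \<in> ks f \<and> d \<in> ks g))" using False ia jb ksf d by auto
    have "y = (\<lambda>F. 0)"
    proof (cases "i = j \<or> f + g \<in> E")
      case True then show ?thesis using y unfolding bounds_def if_not_P[OF notA] by blast
    next
      \<comment> \<open>This case is contradictory. The face opposite \<open>t\<close> makes
        \<open>la\<close> nonzero, so the face opposite \<open>d\<close> must have its monomial in
        \<open>E\<close>, and \<open>d\<close> does not divide \<open>W\<close>. Then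
        \<open>d\<close> divides both \<open>?U\<close> and \<open>?V\<close>, which makes
        \<open>f + g\<close> a multiple of one of them.\<close>
      case nE: False
      then have ij: "i = d \<and> j = b \<or> i = a \<and> j = d" using ia jb False by auto
      define t where "t = (if i = d then a else b)"
      have t: "t \<in> ?T" "?T - {t} = {i, j}" using ij d by (auto simp: t_def)
      have Tt: "ind ?T = one_at t + (one_at i + one_at j)" using ij d by (auto simp: t_def ind_insert ind_empty ac_simps)
      then have "(n0 + one_at t) + (one_at i + one_at j) = (f + g) + (one_at i + one_at j)" using nfg by (simp add: ac_simps)
      then have nt: "n0 + one_at t = f + g" using add_right_imp_eq by blast
      have "la \<noteq> 0" using face[OF t(1)] nE sgn[of "{i}" "{j}"] unfolding nt t(2) by auto
      moreover have "{i, j} \<noteq> ?T - {d}" using ij d by auto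
      ultimately have "n0 + one_at d \<in> E" using face[of d] sgn by auto
      then have dW: "d \<notin> ks W" using nd by blast
      have "f + g \<in> E"
      proof (cases "i = d")
        case True
        then have "d \<in> ks g" using sh(3) dW ij d by (auto simp: in_keys_iff lookup_add lookup_single)
        then have "f + g = ?U + (g - one_at d)" using minus_one_at[of d g] True by (simp add: ac_simps)
        then show ?thesis using upset_add(1)[OF E U(1)] by simp
      next
        case False
        then have "d \<in> ks f" and "j = d" using sh(2) dW ij d by (auto simp: in_keys_iff lookup_add lookup_single)
        have "f + g = (f - one_at d + one_at d) + g" using minus_one_at[OF \<open>d \<in> ks f\<close>] by simp
        also have "\<dots> = (f - one_at d) + ?V" unfolding \<open>j = d\<close> add.assoc add.commute[of g] ..
        finally have "f + g = (f - one_at d) + ?V" .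
        then show ?thesis using upset_add(2)[OF E V(1)] by simp
      qed
      then show ?thesis using nE by simp
    qed
    then show ?thesis unfolding if_not_P[OF False] .
  qed
qed

text \<open>Suppose that \<open>m\<close> outside \<open>E\<close> survives. None of
  \<open>?U\<close>, \<open>?V\<close>, \<open>?W\<close> divides it, although \<open>m\<close>
  times all four variables is their product; hence each has a variable \<open>a\<close>,
  \<open>b\<close>, \<open>c\<close> of its own, missing in the other two. Any two of them share
  between them the fourth variable \<open>d\<close>, so both chains are known by
  \<open>bounds_unique\<close>, and the two terms either vanish or have opposite signs.\<close>

theorem triple_products_vanish:
  fixes E :: "('n::{finite,linorder} \<Rightarrow>\<^sub>0 nat) set" and y y' :: "'n set \<Rightarrow> ('n, 'k::field) mpoly"
  assumes E: "upset E" and c4: "CARD('n) = 4" and cE: "comb E" 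
    and U: "f + one_at i \<in> E" and V: "g + one_at j \<in> E" and W: "h + one_at k \<in> E"
    and y: "bounds E f i g j y" and y': "bounds E g j h k y'"
  shows "km y (mc h {k}) F + km (mc f {i}) y' F \<in> Mid E"
proof -
  note I = Mid_ideal[OF E]
  let ?U = "f + one_at i" and ?V = "g + one_at j" and ?W = "h + one_at k"
  let ?x = "\<lambda>F. km y (mc h {k}) F + km (mc f {i}) y' F"
  have K: "y \<in> KM 3" "y' \<in> KM 3" and H: "homog (?U + ?V) y" "homog (?V + ?W) y'" using y y' unfolding bounds_def by auto
  have M: "mc f {i} \<in> KM 1" "mc h {k} \<in> KM 1" by (auto intro: mc_KM)
  have "\<forall>F. card F \<noteq> 4 \<longrightarrow> ?x F = 0" using km_KM[OF K(1) M(2)] km_KM[OF M(1) K(2)] by (simp add: KM_def)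
  moreover have "F = UNIV" if "card F = 4" using that c4 card_subset_eq[of UNIV F] by auto
  moreover have "?x UNIV \<in> Mid E" unfolding Mid_def
  proof (intro CollectI subsetI, rule ccontr)
    fix m assume m: "m \<in> ks (?x UNIV)" and mE: "m \<notin> E"
    have hh: "homog (?U + ?V + ?W) (km y (mc h {k}))" "homog (?U + (?V + ?W)) (km (mc f {i}) y')"
      using H by (auto intro!: homog_km homog_mc simp: ind_insert ind_empty)
    have "m \<in> ks (km y (mc h {k}) UNIV) \<or> m \<in> ks (km (mc f {i}) y' UNIV)"
      using m keys_add[of "km y (mc h {k}) UNIV" "km (mc f {i}) y' UNIV"] by blast
    then have mU: "m + ind UNIV = ?U + ?V + ?W"
    proof
      assume "m \<in> ks (km y (mc h {k}) UNIV)"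
      then show ?thesis by (rule hh(1)[unfolded homog_def, rule_format])
    next
      assume "m \<in> ks (km (mc f {i}) y' UNIV)"
      then show ?thesis unfolding add.assoc[of ?U] by (rule hh(2)[unfolded homog_def, rule_format])
    qed
    have lkm: "lk m t + 1 = lk ?U t + lk ?V t + lk ?W t" for t
      using arg_cong[OF mU, of "\<lambda>p. lk p t"] by (simp add: lookup_add lk_ind)
    \<comment> \<open>If \<open>P\<close> and \<open>Q\<close> together involved every variable,
      dividing their product by all the variables would leave \<open>m\<close> as a multiple of
      \<open>R\<close>.\<close>
    have gap: "\<exists>t. lk P t + lk Q t = 0" if R: "R \<in> E" and s: "\<And>t. lk m t + 1 = lk P t + lk Q t + lk R t" for P Q R
    proof (rule ccontr)
      assume no: "\<not> ?thesis"
      have "m = R + (P + Q - ind UNIV)"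
      proof (rule poly_mapping_eqI)
        fix t show "lk m t = lk (R + (P + Q - ind UNIV)) t" using s[of t] no[simplified, rule_format, of t] by (simp add: lookup_add lookup_minus lk_ind) linarith
      qed
      then show False using mE upset_add(1)[OF E R] by metis
    qed
    have kt: "t \<in> ks P" if "lk m t + 1 = lk P t + lk Q t + lk R t" "lk Q t + lk R t = 0" for P Q R :: "'n \<Rightarrow>\<^sub>0 nat" and t
      using that by (simp add: in_keys_iff)
    have lkm': "lk m t + 1 = lk ?V t + lk ?W t + lk ?U t" "lk m t + 1 = lk ?U t + lk ?W t + lk ?V t" 
      "lk m t + 1 = lk ?V t + lk ?U t + lk ?W t" "lk m t + 1 = lk ?W t + lk ?U t + lk ?V t" for t using lkm[of t] by simp_all
    from gap[OF U lkm'(1)] obtain a where a0: "lk ?V a + lk ?W a = 0" ..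
    from gap[OF V lkm'(2)] obtain b where b0: "lk ?U b + lk ?W b = 0" ..
    from gap[OF W lkm] obtain c where c0: "lk ?U c + lk ?V c = 0" ..
    have a: "lk ?V a = 0" "lk ?W a = 0" "a \<in> ks ?U" using a0 kt[OF lkm a0] by simp_all
    have b: "lk ?U b = 0" "lk ?W b = 0" "b \<in> ks ?V" using b0 kt[OF lkm'(3) b0] by simp_all
    have c: "lk ?U c = 0" "lk ?V c = 0" "c \<in> ks ?W" using c0 kt[OF lkm'(4) c0] by simp_all
    have "distinct [a, b, c]" using a b c by (auto simp: in_keys_iff)
    then obtain d where d: "distinct [a, b, c, d]" using ex_distinct(2)[OF c4] by blast
    note UN = UNIV_distinct[OF c4 d]
    have ksU: "ks ?U \<subseteq> {a, d}" "ks ?V \<subseteq> {b, d}" "ks ?W \<subseteq> {c, d}"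
    proof -
      have t: "t \<in> {a, b, c, d}" for t using UN by auto
      have "t \<in> {a, d}" if "t \<in> ks ?U" for t using t[of t] that b(1) c(1) unfolding in_keys_iff by (metis insertE singletonD insertI1 insertI2)
      moreover have "t \<in> {b, d}" if "t \<in> ks ?V" for t using t[of t] that a(1) c(2) unfolding in_keys_iff by (metis insertE singletonD insertI1 insertI2)
      moreover have "t \<in> {c, d}" if "t \<in> ks ?W" for t using t[of t] that a(2) b(2) unfolding in_keys_iff by (metis insertE singletonD insertI1 insertI2)
      ultimately show "ks ?U \<subseteq> {a, d}" "ks ?V \<subseteq> {b, d}" "ks ?W \<subseteq> {c, d}" by blast+
    qed
    have d': "distinct [b, c, a, d]" "distinct [a, c, b, d]" and UN': "UNIV = {b, c, a, d}" "UNIV = {a, c, b, d}" using d UN by auto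
    have mU': "m + ind UNIV = ?V + ?W + ?U" "m + ind UNIV = ?U + ?W + ?V" using mU by (simp_all add: ac_simps)
    have sh: "d \<in> ks ?U \<or> d \<in> ks ?V" "d \<in> ks ?U \<or> d \<in> ks ?W" "d \<in> ks ?V \<or> d \<in> ks ?W"
    proof -
      show "d \<in> ks ?U \<or> d \<in> ks ?V" by (rule shared_variable[OF E cE d U ksU(1) a(3) V ksU(2) b(3) c(3) mE mU UN])
      show "d \<in> ks ?U \<or> d \<in> ks ?W" by (rule shared_variable[OF E cE d'(2) U ksU(1) a(3) W ksU(3) c(3) b(3) mE mU'(2) UN'(2)])
      show "d \<in> ks ?V \<or> d \<in> ks ?W" by (rule shared_variable[OF E cE d'(1) V ksU(2) b(3) W ksU(3) c(3) a(3) mE mU'(1) UN'(1)])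
    qed
    have sh': "d \<in> ks ?V \<or> d \<in> ks ?U" "d \<in> ks ?W \<or> d \<in> ks ?U" using sh by auto
    note y1 = bounds_unique[OF E d UN U ksU(1) a(3) V ksU(2) b(3) c(3) ksU(3) mE mU sh y]
    note y2 = bounds_unique[OF E d'(1) UN'(1) V ksU(2) b(3) W ksU(3) c(3) a(3) ksU(1) mE mU'(1) sh(3) sh' y']
    have ia: "i = a \<or> i = d" and kc: "k = c \<or> k = d" using ksU by (auto simp: in_keys_iff lookup_add subset_iff)
    have "?x UNIV = 0"
    proof (cases "i = a \<and> j = b \<and> k = c")
      case True
      then have ijk: "i = a" "j = b" "k = c" by auto
      let ?n1 = "?U + ?V - ind {a, b, d}" and ?n2 = "?V + ?W - ind {b, c, d}"
      have n1: "?n1 + ind {a, b, d} = ?U + ?V" by (rule ind_minus) (use a b sh in \<open>auto simp: in_keys_iff lookup_add\<close>)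
      have n2: "?n2 + ind {b, c, d} = ?V + ?W" by (rule ind_minus) (use b c sh in \<open>auto simp: in_keys_iff lookup_add\<close>)
      have "?n1 + h + (ind {a, b, d} + one_at c) = f + ?n2 + (ind {b, c, d} + one_at a)"
      proof -
        have "?n1 + h + (ind {a, b, d} + one_at c) = (?n1 + ind {a, b, d}) + (h + one_at c)" by (simp only: ac_simps)
        also have "\<dots> = (f + one_at a) + ((g + one_at b) + (h + one_at c))" unfolding n1 unfolding ijk by (simp only: ac_simps)
        also have "(g + one_at b) + (h + one_at c) = ?n2 + ind {b, c, d}" unfolding n2 unfolding ijk ..
        finally show ?thesis by (simp only: ac_simps)
      qed
      moreover have "ind {a, b, d} + one_at c = ind UNIV" "ind {b, c, d} + one_at a = ind UNIV"
        unfolding UN using d by (simp_all add: ind_insert ind_empty ac_simps)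
      ultimately have nn: "?n1 + h = f + ?n2" by simp
      have sets: "{a, b, d} \<inter> {c} = {}" "{a} \<inter> {b, c, d} = {}" "{a, b, d} \<union> {c} = UNIV" "{a} \<union> {b, c, d} = UNIV" using d UN by auto
      define m0 :: "('n, 'k) mpoly" where "m0 = mc (f + ?n2) UNIV UNIV"
      have "y = (\<lambda>F. mconst (sg {d} {a, b} * sg {a} {b}) * mc ?n1 {a, b, d} F)" using y1 ijk by simp
      then have 1: "km y (mc h {k}) UNIV = mconst (sg {d} {a, b} * sg {a} {b}) * (sg {a, b, d} {c} * m0)"
        unfolding m0_def nn[symmetric] using ijk sets by (simp add: km_smult_left km_mc)
      have "y' = (\<lambda>F. mconst (sg {d} {b, c} * sg {b} {c}) * mc ?n2 {b, c, d} F)" using y2 ijk by simp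
      then have 2: "km (mc f {i}) y' UNIV = mconst (sg {d} {b, c} * sg {b} {c}) * (sg {a} {b, c, d} * m0)"
        unfolding m0_def using ijk sets by (simp add: km_smult_right km_mc)
      have m3: "mconst (sg A B * sg A' B') = (sg A B * sg A' B' :: ('n, 'k) mpoly)" for A B A' B' :: "'n set"
        unfolding sg_mconst by (simp add: mconst_def mult_single)
      have S: "sg {d} {a, b} = (sg {d} {a} * sg {d} {b} :: ('n, 'k) mpoly)" "sg {a, b, d} {c} = (sg {a} {c} * (sg {b} {c} * sg {d} {c}) :: ('n, 'k) mpoly)"
        "sg {d} {b, c} = (sg {d} {b} * sg {d} {c} :: ('n, 'k) mpoly)" "sg {a} {b, c, d} = (sg {a} {b} * (sg {a} {c} * sg {a} {d}) :: ('n, 'k) mpoly)"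
        using d by (simp_all add: sg_insert_right[of a "{b}"] sg_insert_left[of a "{b, d}"] sg_insert_left[of b "{d}"]
          sg_insert_right[of b "{c}"] sg_insert_right[of b "{c, d}"] sg_insert_right[of c "{d}"])
      \<comment> \<open>All other sign factors agree in the two terms; the cancellation rests on
        this one.\<close>
      have "sg {d} {a} = (- sg {a} {d} :: ('n, 'k) mpoly)" using d unfolding sg_singletons by auto
      then show ?thesis unfolding 1 2 m3 S by (simp add: algebra_simps)
    next
      case False
      \<comment> \<open>Either the chain is zero, or it is supported on a set containing
        \<open>d\<close>, and the other factor also involves \<open>d\<close>.\<close>
      have 1: "km y (mc h {k}) UNIV = 0"
      proof (cases "i = a \<and> j = b")
        case True
        then have "k = d" using False kc by auto
        then show ?thesis unfolding y1 using True by (simp add: km_smult_left km_mc)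
      next
        case False
        have "y = (\<lambda>F. 0)" unfolding y1 if_not_P[OF False] ..
        then show ?thesis by (simp add: km_def)
      qed
      have 2: "km (mc f {i}) y' UNIV = 0"
      proof (cases "j = b \<and> k = c")
        case True
        then have "i = d" using False ia by auto
        then show ?thesis unfolding y2 using True by (simp add: km_smult_right km_mc)
      next
        case False
        have "y' = (\<lambda>F. 0)" unfolding y2 if_not_P[OF False] ..
        then show ?thesis by (simp add: km_def)
      qed
      show ?thesis unfolding 1 2 by simp
    qed
    then show False using m by simp
  qed
  ultimately show ?thesis using idl.subspace_0[OF I] by (cases "card F = 4") auto
qed

section \<open>The criterion\<close>

lemma lk_mult_one_at:
  fixes p q :: "('n::finite, 'k::field) mpoly"
  assumes "cst p = 0" "cst q = 0" shows "lk (p * q) (one_at t) = 0"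
proof (rule ccontr)
  assume "lk (p * q) (one_at t) \<noteq> 0"
  then have "one_at t \<in> ks (p * q)" by (simp add: in_keys_iff)
  then obtain a b where ab: "a \<in> ks p" "b \<in> ks q" "one_at t = a + b" using keys_mult[of p q] by blast
  have "a \<noteq> 0" "b \<noteq> 0" using ab(1,2) assms by (auto simp: in_keys_iff)
  have nz: "lk c t \<noteq> 0" if c: "c \<noteq> 0" "c + c' = one_at t" for c c' :: "'n \<Rightarrow>\<^sub>0 nat"
  proof -
    obtain i where i: "lk c i \<noteq> 0" using c(1) by (metis lookup_zero poly_mapping_eqI)
    have "lk c i + lk c' i = lk (one_at t) i" using c(2) by (metis lookup_add)
    then have "i = t" using i by (auto simp: lookup_single when_def split: if_splits)
    then show ?thesis using i by simp
  qed
  have "lk a t \<noteq> 0" by (rule nz[OF \<open>a \<noteq> 0\<close> ab(3)[symmetric]])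
  moreover have "lk b t \<noteq> 0" by (rule nz[OF \<open>b \<noteq> 0\<close>, of a]) (simp only: ab(3) add.commute)
  moreover have "lk a t + lk b t = 1" using arg_cong[OF ab(3), of "\<lambda>p. lk p t"] by (simp add: lookup_add)
  ultimately show False by linarith
qed

text \<open>A constant term of \<open>y F\<close> shows up in the boundary at \<open>F - {t}\<close>
  as a multiple of the variable \<open>t\<close>, and nothing else contributes to that monomial. In
  this way the containment of the ideal in the square of the maximal ideal makes the cycles and
  bounding chains minimal.\<close>

lemma cst_of_linear_terms:
  fixes y :: "'n::{finite,linorder} set \<Rightarrow> ('n, 'k::field) mpoly"
  assumes y: "y \<in> KM i" "i \<ge> 1" and l: "\<And>G t. lk (kdv y G) (one_at t) = 0"
  shows "cst (y F) = 0"
proof (cases "F = {}")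
  case True then show ?thesis using y by (auto simp: KM_def)
next
  case False
  then obtain t where t: "t \<in> F" by blast
  let ?G = "F - {t}"
  have "lk (kdv y ?G) (one_at t) = (\<Sum>s\<in>-?G. lk (sg {s} ?G * (mvar s * y (insert s ?G))) (one_at t))"
    unfolding kd_def lk_sum by (simp add: mult.assoc)
  also have "\<dots> = (\<Sum>s\<in>{t}. lk (sg {s} ?G * (mvar s * y (insert s ?G))) (one_at t))"
    by (rule sum.mono_neutral_right) (auto simp: lk_sg lk_mvar_mult)
  also have "\<dots> = sg {t} ?G * cst (y F)" using t by (simp add: lk_sg lk_mvar_mult insert_absorb)
  finally have "sg {t} ?G * cst (y F) = 0" unfolding l by (rule sym)
  then show ?thesis by (auto simp: sg_def)
qed

text \<open>Letters are cycles representing a basis of homology in each positive degree.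
  \<open>E0\<close> and \<open>E1\<close> are the form in which containment in the square of the
  maximal ideal enters.\<close>

locale homology_basis =
  fixes E :: "('n::{finite,linorder} \<Rightarrow>\<^sub>0 nat) set" and I :: "('n, 'k::field) mpoly set"
    and L :: "'l set" and dg :: "'l \<Rightarrow> nat" and z :: "'l \<Rightarrow> 'n set \<Rightarrow> ('n, 'k) mpoly"
  assumes E: "upset E" and I_def: "I = Mid E" and E0: "0 \<notin> E" and E1: "one_at j \<notin> E" and c4: "CARD('n) = 4"
    and finL: "finite L" and deg_pos: "v \<in> L \<Longrightarrow> dg v \<ge> 1" and z_ZK: "v \<in> L \<Longrightarrow> z v \<in> ZK I (dg v)"
    and z_span: "\<lbrakk>i \<ge> 1; x \<in> ZK I i\<rbrakk> \<Longrightarrow> \<exists>c. (\<lambda>F. x F - (\<Sum>v\<in>{v \<in> L. dg v = i}. mconst (c v) * z v F)) \<in> BK I i"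
    and z_indep: "\<lbrakk>i \<ge> 1; (\<lambda>F. \<Sum>v\<in>{v \<in> L. dg v = i}. mconst (c v) * z v F) \<in> BK I i\<rbrakk> \<Longrightarrow> \<forall>v\<in>{v \<in> L. dg v = i}. c v = 0"
begin

lemma ideal_I: "is_ideal I" unfolding I_def by (rule Mid_ideal[OF E])

lemma I_cst: "p \<in> I \<Longrightarrow> cst p = 0"
  unfolding I_def Mid_def using E0 by (auto simp: in_keys_iff subset_iff)

lemma I_linear: "p \<in> I \<Longrightarrow> lk p (one_at t) = 0"
  unfolding I_def Mid_def using E1 by (auto simp: in_keys_iff subset_iff)

lemma z_KM: "v \<in> L \<Longrightarrow> z v \<in> KM (dg v)" and z_cycle: "v \<in> L \<Longrightarrow> kdv (z v) F \<in> I"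
  using z_ZK by (auto simp: ZK_def)

lemma z_min: "v \<in> L \<Longrightarrow> cst (z v F) = 0"
  by (rule cst_of_linear_terms[OF z_KM deg_pos I_linear[OF z_cycle]])

lemma g2_min:
  assumes u: "u \<in> L" and v: "v \<in> L" and y: "y \<in> KM (Suc n)" "\<And>F. kdv y F + km (kbar (z u)) (z v) F \<in> I" shows "cst (y F) = 0"
proof (rule cst_of_linear_terms[OF y(1)])
  fix G t
  have "lk (km (kbar (z u)) (z v) G) (one_at t) = 0" unfolding km_def lk_sum
  proof (rule sum.neutral, intro ballI)
    fix F assume "F \<in> Pow G"
    have "cst (kbar (z u) F) = 0" using z_min[OF u, of F] by (simp add: kbar_def lk_neg_pow)
    then have "lk (kbar (z u) F * z v (G - F)) (one_at t) = 0" by (intro lk_mult_one_at z_min[OF v])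
    then show "lk (sg F (G - F) * kbar (z u) F * z v (G - F)) (one_at t) = 0" by (simp add: mult.assoc lk_sg)
  qed
  then show "lk (kdv y G) (one_at t) = 0" using I_linear[OF y(2)[of G], of t] by (simp add: lookup_add)
qed simp

text \<open>Degrees take care of most conditions: a triple product with a letter of degree above
  one, and every product of two bounding chains, lives above degree four and vanishes. Minimality
  follows from the absence of linear terms in the ideal.\<close>

lemma golod_complexI:
  assumes g2: "\<And>u v. u \<in> L \<Longrightarrow> v \<in> L \<Longrightarrow> g2 u v \<in> KM (Suc (dg u + dg v))"
    and g2_eq: "\<And>u v F. u \<in> L \<Longrightarrow> v \<in> L \<Longrightarrow> wt dg [u, v] \<le> N \<Longrightarrow> kdv (g2 u v) F + km (kbar (z u)) (z v) F \<in> I"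
    and g2_0: "\<And>u v F. u \<in> L \<Longrightarrow> v \<in> L \<Longrightarrow> \<not> wt dg [u, v] \<le> N \<Longrightarrow> cst (g2 u v F) = 0"
    and g2_triple: "\<And>u v w F. u \<in> L \<Longrightarrow> v \<in> L \<Longrightarrow> w \<in> L \<Longrightarrow> dg u = 1 \<Longrightarrow> dg v = 1 \<Longrightarrow> dg w = 1 \<Longrightarrow> wt dg [u, v, w] \<le> N \<Longrightarrow> 
       km (kbar (g2 u v)) (z w) F + km (kbar (z u)) (g2 v w) F \<in> I"
  shows "golod_complex I L dg z g2 N"
proof
  show "is_ideal I" "finite L" by (rule ideal_I, rule finL)
  show "p \<in> I \<Longrightarrow> cst p = 0" for p by (rule I_cst)
  show "v \<in> L \<Longrightarrow> z v \<in> KM (dg v)" "v \<in> L \<Longrightarrow> dg v \<ge> 1" "v \<in> L \<Longrightarrow> kdv (z v) F \<in> I" "v \<in> L \<Longrightarrow> cst (z v F) = 0" for v F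
    by (rule z_KM deg_pos z_cycle z_min; assumption)+
  show "\<exists>c. \<exists>y\<in>KM (Suc i). \<forall>F. x F - (\<Sum>v\<in>{v \<in> L. dg v = i}. mconst (c v) * z v F) - kdv y F \<in> I"
    if "i \<ge> 1" "x \<in> KM i" "\<And>F. kdv x F \<in> I" for i x
  proof -
    have "x \<in> ZK I i" using that by (simp add: ZK_def)
    from z_span[OF that(1) this] obtain c where "(\<lambda>F. x F - (\<Sum>v\<in>{v \<in> L. dg v = i}. mconst (c v) * z v F)) \<in> BK I i" ..
    then have "\<exists>y\<in>KM (Suc i). \<forall>F. x F - (\<Sum>v\<in>{v \<in> L. dg v = i}. mconst (c v) * z v F) - kdv y F \<in> I" by (simp add: BK_def)
    then show ?thesis by (rule exI[of _ c])
  qed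
  show "\<forall>v\<in>{v \<in> L. dg v = i}. c v = 0"
    if "i \<ge> 1" "y \<in> KM (Suc i)" "\<And>F. (\<Sum>v\<in>{v \<in> L. dg v = i}. mconst (c v) * z v F) - kdv y F \<in> I" for i y c
  proof (rule z_indep[OF that(1)])
    have "(\<Sum>v\<in>{v \<in> L. dg v = i}. mconst (c v) * z v F) = 0" if "card F \<noteq> i" for F
      by (rule sum.neutral) (use that z_KM in \<open>auto simp: KM_def\<close>)
    then show "(\<lambda>F. \<Sum>v\<in>{v \<in> L. dg v = i}. mconst (c v) * z v F) \<in> BK I i"
      unfolding BK_def using that by (intro CollectI conjI bexI[of _ y]) (auto simp: KM_def)
  qed
  fix u v assume uv: "u \<in> L" "v \<in> L"
  show "g2 u v \<in> KM (Suc (dg u + dg v))" by (rule g2[OF uv])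
  show "cst (g2 u v F) = 0" for F
  proof (cases "wt dg [u, v] \<le> N")
    case True show ?thesis by (rule g2_min[OF uv g2[OF uv] g2_eq[OF uv True]])
  next
    case False show ?thesis by (rule g2_0[OF uv False])
  qed
  show "wt dg [u, v] \<le> N \<Longrightarrow> kdv (g2 u v) F + km (kbar (z u)) (z v) F \<in> I" for F by (rule g2_eq[OF uv])
  fix w assume w: "w \<in> L"
  show "km (kbar (g2 u v)) (z w) F + km (kbar (z u)) (g2 v w) F \<in> I" if N: "wt dg [u, v, w] \<le> N" for F
  proof (cases "dg u = 1 \<and> dg v = 1 \<and> dg w = 1")
    case True then show ?thesis using g2_triple[OF uv w _ _ _ N] by blast
  next
    case False
    have big: "Suc (dg u + dg v) + dg w > 4" "dg u + Suc (dg v + dg w) > 4" using False deg_pos[OF uv(1)] deg_pos[OF uv(2)] deg_pos[OF w] by auto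
    have 1: "km (kbar (g2 u v)) (z w) \<in> KM (Suc (dg u + dg v) + dg w)" by (rule km_KM[OF kbar_mem_KM[OF g2[OF uv]] z_KM[OF w]])
    have 2: "km (kbar (z u)) (g2 v w) \<in> KM (dg u + Suc (dg v + dg w))" by (rule km_KM[OF kbar_mem_KM[OF z_KM[OF uv(1)]] g2[OF uv(2) w]])
    show ?thesis using KM_large[OF 1] KM_large[OF 2] big c4 idl.subspace_0[OF ideal_I] by simp
  qed
  fix s assume s: "s \<in> L"
  show "km (kbar (g2 u v)) (g2 w s) F \<in> I" for F
  proof -
    have 1: "km (kbar (g2 u v)) (g2 w s) \<in> KM (Suc (dg u + dg v) + Suc (dg w + dg s))" by (rule km_KM[OF kbar_mem_KM[OF g2[OF uv]] g2[OF w s]])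
    have "Suc (dg u + dg v) + Suc (dg w + dg s) > 4" using deg_pos[OF uv(1)] deg_pos[OF uv(2)] deg_pos[OF w] by auto
    then show ?thesis using KM_large[OF 1] c4 idl.subspace_0[OF ideal_I] by simp
  qed
qed

lemma product_bounds:
  assumes "u \<in> L" "v \<in> L" and B: "km (z u) (z v) \<in> BK I (dg u + dg v)"
  shows "\<exists>y. y \<in> KM (Suc (dg u + dg v)) \<and> (\<forall>F. kdv y F + km (kbar (z u)) (z v) F \<in> I)"
proof -
  have "km (kbar (z u)) (z v) = (\<lambda>F. (-1) ^ dg u * km (z u) (z v) F)" unfolding kbar_KM[OF z_KM[OF assms(1)]] km_smult_left ..
  then have "km (kbar (z u)) (z v) \<in> BK I (dg u + dg v)" using BK_smult[OF ideal_I B] by simp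
  then obtain y where y: "y \<in> KM (Suc (dg u + dg v))" "\<forall>F. km (kbar (z u)) (z v) F - kdv y F \<in> I" unfolding BK_def by blast
  have e: "kdv (\<lambda>F. - 1 * y F) F = - kdv y F" for F using kd_smult[of mvar "-1" y] by (simp add: fun_eq_iff)
  show ?thesis
  proof (intro exI[of _ "\<lambda>F. - 1 * y F"] conjI allI)
    show "(\<lambda>F. - 1 * y F) \<in> KM (Suc (dg u + dg v))" using y(1) by (simp add: KM_def)
    fix F show "kdv (\<lambda>F. - 1 * y F) F + km (kbar (z u)) (z v) F \<in> I" unfolding e using y(2) by simp
  qed
qed

text \<open>Two letters of degree one get a bounding chain from \<open>bounds\<close>, all other
  pairs an arbitrary one. The bound \<open>Suc j\<close> for the complex puts degree
  \<open>j\<close> into the exact range.\<close>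

theorem residue_betti_of_comb:
  assumes c: "comb E" and z1: "\<And>v. v \<in> L \<Longrightarrow> dg v = 1 \<Longrightarrow> z v \<in> SK E 1"
  shows "residue_betti I j = card (AX L dg j :: ('l list \<times> 'n set) set)"
proof -
  have "\<exists>p. z v = mc (fst p) {snd p} \<and> fst p + one_at (snd p) \<in> E" if v: "v \<in> L" "dg v = 1" for v
  proof -
    obtain m F where m: "z v = mc m F" "card F = 1" "\<forall>i\<in>F. m + one_at i \<in> E" using z1[OF v] unfolding SK_def by blast
    then obtain i where "F = {i}" by (auto simp: card_1_singleton_iff)
    then show ?thesis using m by (intro exI[of _ "(m, i)"]) auto
  qed
  then have "\<exists>p. \<forall>v. v \<in> L \<longrightarrow> dg v = 1 \<longrightarrow> z v = mc (fst (p v)) {snd (p v)} \<and> fst (p v) + one_at (snd (p v)) \<in> E"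
    by (intro choice) blast
  then obtain p where p: "\<And>v. v \<in> L \<Longrightarrow> dg v = 1 \<Longrightarrow> z v = mc (fst (p v)) {snd (p v)}" "\<And>v. v \<in> L \<Longrightarrow> dg v = 1 \<Longrightarrow> fst (p v) + one_at (snd (p v)) \<in> E" by blast
  define g2 :: "'l \<Rightarrow> 'l \<Rightarrow> 'n set \<Rightarrow> ('n, 'k) mpoly" where 
    "g2 u v = (if dg u = 1 \<and> dg v = 1 then SOME y. bounds E (fst (p u)) (snd (p u)) (fst (p v)) (snd (p v)) y
       else SOME y. y \<in> KM (Suc (dg u + dg v)) \<and> (\<forall>F. kdv y F + km (kbar (z u)) (z v) F \<in> I))" for u v
  have b: "bounds E (fst (p u)) (snd (p u)) (fst (p v)) (snd (p v)) (g2 u v)" if "u \<in> L" "v \<in> L" "dg u = 1" "dg v = 1" for u v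
    unfolding g2_def if_P[OF conjI[OF that(3,4)]] by (rule someI_ex[OF bounds_exists[OF E c4 c p(2)[OF that(1,3)] p(2)[OF that(2,4)]]])
  have b': "g2 u v \<in> KM (Suc (dg u + dg v)) \<and> (\<forall>F. kdv (g2 u v) F + km (kbar (z u)) (z v) F \<in> I)" if uv: "u \<in> L" "v \<in> L" and n: "\<not> (dg u = 1 \<and> dg v = 1)" for u v
  proof -
    have "km (z u) (z v) \<in> BK I (dg u + dg v)"
      using products_vanish_of_comb[OF E c4 c] z_ZK[OF uv(1)] z_ZK[OF uv(2)] deg_pos[OF uv(1)] deg_pos[OF uv(2)] unfolding products_vanish_def I_def by blast
    from someI_ex[OF product_bounds[OF uv this]] show ?thesis unfolding g2_def if_not_P[OF n] .
  qed
  have kb1: "kbar (z u) = (\<lambda>F. - 1 * z u F)" if "u \<in> L" "dg u = 1" for u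
    using kbar_KM[OF z_KM[OF that(1)]] that(2) by simp
  interpret g: golod_complex I L dg z g2 "Suc j"
  proof (rule golod_complexI)
    fix u v assume uv: "u \<in> L" "v \<in> L"
    show g2K: "g2 u v \<in> KM (Suc (dg u + dg v))"
      using b[OF uv] b'[OF uv] unfolding bounds_def by (cases "dg u = 1 \<and> dg v = 1") (auto simp: numeral_3_eq_3)
    show g2_eq: "kdv (g2 u v) F + km (kbar (z u)) (z v) F \<in> I" for F
    proof (cases "dg u = 1 \<and> dg v = 1")
      case True
      then have "kdv (g2 u v) F - km (z u) (z v) F \<in> I" using b[OF uv] unfolding bounds_def I_def p(1)[OF uv(1) conjunct1[OF True]] p(1)[OF uv(2) conjunct2[OF True]] by blast
      then show ?thesis unfolding kb1[OF uv(1) conjunct1[OF True]] km_smult_left by simp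
    next
      case False then show ?thesis using b'[OF uv] by blast
    qed
    show "cst (g2 u v F) = 0" for F by (rule g2_min[OF uv g2K g2_eq])
    fix w F assume w: "w \<in> L" and d: "dg u = 1" "dg v = 1" "dg w = 1"
    have "g2 u v \<in> KM 3" using b[OF uv d(1,2)] unfolding bounds_def by blast
    from kbar_KM[OF this] have "kbar (g2 u v) = (\<lambda>F. - 1 * g2 u v F)" by simp
    \<comment> \<open>Both \<open>z u\<close>, of degree one, and \<open>g2 u v\<close>, of degree
      three, change sign under \<open>kbar\<close>, so the sum required here is the negative of the
      one known to vanish.\<close>
    then have e: "km (kbar (g2 u v)) (z w) F + km (kbar (z u)) (g2 v w) F = - (km (g2 u v) (z w) F + km (z u) (g2 v w) F)"
      unfolding kb1[OF uv(1) d(1)] by (simp only: km_smult_left) simp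
    have "km (g2 u v) (z w) F + km (z u) (g2 v w) F \<in> I"
      unfolding I_def p(1)[OF uv(1) d(1)] p(1)[OF w d(3)]
      by (rule triple_products_vanish[OF E c4 c p(2)[OF uv(1) d(1)] p(2)[OF uv(2) d(2)] p(2)[OF w d(3)] b[OF uv d(1,2)] b[OF uv(2) w d(2,3)]])
    then show "km (kbar (g2 u v)) (z w) F + km (kbar (z u)) (g2 v w) F \<in> I" unfolding e by (rule idl.subspace_neg[OF ideal_I])
  qed
  show ?thesis by (rule g.residue_betti_eq) simp
qed

text \<open>The relation that writes \<open>km x (z v)\<close> as the combination of the
  \<open>z u\<close> plus the boundary of \<open>ka\<close>, modulo the ideal, is itself a cycle of
  Golod's complex: its terms are read as coefficients at the words \<open>[v]\<close>,
  \<open>[u]\<close> and the empty word. If the product is nonzero in homology, some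
  \<open>c u0\<close> is a unit coefficient in it.\<close>

theorem products_vanish_of_residue_betti:
  assumes r: "\<And>j. residue_betti I j = card (AX L dg j :: ('l list \<times> 'n set) set)"
  shows "products_vanish I"
proof (rule ccontr)
  define Q where "Q s \<longleftrightarrow> (\<exists>a b. a \<ge> 1 \<and> b \<ge> 1 \<and> a + b = s \<and> (\<exists>x\<in>ZK I a. \<exists>y\<in>ZK I b. km x y \<notin> BK I s))" for s
  assume "\<not> products_vanish I"
  then have "\<exists>s. Q s" unfolding products_vanish_def Q_def by blast
  define s where "s = (LEAST s. Q s)"
  have Qs: "Q s" unfolding s_def using \<open>\<exists>s. Q s\<close> by (rule LeastI_ex)
  have small: "km x y \<in> BK I (a + b)" if "a \<ge> 1" "b \<ge> 1" "a + b < s" "x \<in> ZK I a" "y \<in> ZK I b" for a b x y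
    using not_less_Least[OF that(3)[unfolded s_def]] that unfolding Q_def by blast
  obtain a b x y where ab: "a \<ge> 1" "b \<ge> 1" "a + b = s" and x: "x \<in> ZK I a" and y: "y \<in> ZK I b" and xy: "km x y \<notin> BK I s" using Qs unfolding Q_def by blast
  have xK: "x \<in> KM a" and xI: "\<And>F. kdv x F \<in> I" using x by (auto simp: ZK_def)
  have yK: "y \<in> KM b" using y by (auto simp: ZK_def)
  have s4: "s \<le> 4"
  proof (rule ccontr)
    assume "\<not> s \<le> 4"
    then have "km x y = (\<lambda>F. 0)" using KM_large[OF km_KM[OF xK yK]] ab(3) c4 by simp
    then show False using xy BK_zero[OF ideal_I] by simp
  qed
  obtain c where c: "(\<lambda>F. y F - (\<Sum>v\<in>{v \<in> L. dg v = b}. mconst (c v) * z v F)) \<in> BK I b" using z_span[OF ab(2) y] by blast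
  \<comment> \<open>Only the second factor is replaced by a basis element: it becomes a letter,
    while \<open>x\<close> stays a coefficient.\<close>
  have "\<exists>v\<in>{v \<in> L. dg v = b}. km x (z v) \<notin> BK I s"
  proof (rule ccontr)
    assume "\<not> ?thesis"
    then have a: "km x (z v) \<in> BK I s" if "v \<in> {v \<in> L. dg v = b}" for v using that by blast
    have "(\<lambda>F. \<Sum>v\<in>{v \<in> L. dg v = b}. mconst (c v) * km x (z v) F) \<in> BK I s" by (intro BK_sum[OF ideal_I] BK_smult[OF ideal_I] a)
    from BK_add[OF ideal_I km_ZK_BK(1)[OF ideal_I x c, unfolded ab(3)] this] show False
      using xy unfolding km_diff_right km_sum_right km_smult_right by simp
  qed
  then obtain v where v: "v \<in> L" "dg v = b" and xv: "km x (z v) \<notin> BK I s" by blast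
  have zvK: "z v \<in> KM b" using z_KM[OF v(1)] v(2) by simp
  have xvZ: "km x (z v) \<in> ZK I s"
  proof -
    have "kdv (km x (z v)) F \<in> I" for F unfolding leibniz
      by (intro idl.subspace_add[OF ideal_I] km_ideal_left[OF ideal_I] km_ideal_right[OF ideal_I] xI z_cycle[OF v(1)])
    then show ?thesis using km_KM[OF xK zvK] ab(3) by (simp add: ZK_def)
  qed
  define T where "T = {u \<in> L. dg u = s}"
  have "s \<ge> 1" using ab by simp
  from z_span[OF this xvZ] obtain c where cB: "(\<lambda>F. km x (z v) F - (\<Sum>u\<in>T. mconst (c u) * z u F)) \<in> BK I s" unfolding T_def by blast
  obtain u0 where u0: "u0 \<in> T" "c u0 \<noteq> 0"
  proof (rule ccontr)
    assume a: "\<not> thesis"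
    have "(\<Sum>u\<in>T. mconst (c u) * z u F) = 0" for F by (rule sum.neutral) (use a that mconst_simps(4) in force)
    then show False using cB xv by simp
  qed
  obtain ka where ka: "ka \<in> KM (Suc s)" "\<And>F. km x (z v) F - (\<Sum>u\<in>T. mconst (c u) * z u F) - kdv ka F \<in> I" using cB unfolding BK_def by blast
  \<comment> \<open>Weight at most \<open>Suc s\<close> means that the degrees add up to less than
    \<open>s\<close>, where products vanish by the choice of \<open>s\<close>. Beyond that the zero
    chain keeps the complex minimal.\<close>
  define g2 :: "'l \<Rightarrow> 'l \<Rightarrow> 'n set \<Rightarrow> ('n, 'k) mpoly" where 
    "g2 u v = (if wt dg [u, v] \<le> Suc s then SOME y. y \<in> KM (Suc (dg u + dg v)) \<and> (\<forall>F. kdv y F + km (kbar (z u)) (z v) F \<in> I) else (\<lambda>F. 0))" for u v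
  have b: "g2 u v \<in> KM (Suc (dg u + dg v)) \<and> (\<forall>F. kdv (g2 u v) F + km (kbar (z u)) (z v) F \<in> I)" if uv: "u \<in> L" "v \<in> L" and n: "wt dg [u, v] \<le> Suc s" for u v
  proof -
    have "km (z u) (z v) \<in> BK I (dg u + dg v)"
      by (rule small) (use n deg_pos[OF uv(1)] deg_pos[OF uv(2)] z_ZK[OF uv(1)] z_ZK[OF uv(2)] in \<open>auto simp: wt_simps\<close>)
    from someI_ex[OF product_bounds[OF uv this]] show ?thesis unfolding g2_def if_P[OF n] .
  qed
  have g0: "g2 u v = (\<lambda>F. 0)" if "\<not> wt dg [u, v] \<le> Suc s" for u v unfolding g2_def if_not_P[OF that] ..
  interpret g: golod_complex I L dg z g2 "Suc s"
  proof (rule golod_complexI)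
    fix u v assume uv: "u \<in> L" "v \<in> L"
    show "g2 u v \<in> KM (Suc (dg u + dg v))"
    proof (cases "wt dg [u, v] \<le> Suc s")
      case False then show ?thesis unfolding g0[OF False] by (simp add: KM_def)
    qed (use b[OF uv] in blast)
    show "kdv (g2 u v) F + km (kbar (z u)) (z v) F \<in> I" if "wt dg [u, v] \<le> Suc s" for F using b[OF uv that] by blast
    show "cst (g2 u v F) = 0" if "\<not> wt dg [u, v] \<le> Suc s" for F unfolding g0[OF that] by simp
    \<comment> \<open>Three letters of degree one have weight six, and \<open>Suc s \<le> 5\<close>,
      so such a triple does not occur.\<close>
    fix w F assume "dg u = 1" "dg v = 1" "dg w = 1" "wt dg [u, v, w] \<le> Suc s"
    then show "km (kbar (g2 u v)) (z w) F + km (kbar (z u)) (g2 v w) F \<in> I" using s4 by (simp add: wt_simps)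
  qed
  \<comment> \<open>The \<open>kbar\<close> at \<open>[v]\<close> is undone by the one in
    \<open>dX\<close>, so the product appears with a plus sign against the negative terms from
    \<open>c\<close> and \<open>ka\<close>.\<close>
  define xi :: "'l list \<times> 'n set \<Rightarrow> ('n, 'k) mpoly" where
    "xi e = (if fst e = [] then - ka (snd e) else if fst e = [v] then kbar x (snd e)
       else if tl (fst e) = [] \<and> hd (fst e) \<in> T then (if snd e = {} then - mconst (c (hd (fst e))) else 0) else 0)" for e
  have vT: "v \<notin> T" using v ab by (auto simp: T_def)
  have s0: "sec xi [] = (\<lambda>F. - 1 * ka F)" "sec xi [v] = kbar x" by (simp_all add: sec_def xi_def fun_eq_iff)
  have s1: "sec xi [u] = (\<lambda>F. if F = {} then - mconst (c u) else 0)" if "u \<in> T" for u using that vT by (auto simp: sec_def xi_def fun_eq_iff)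
  have s2: "sec xi [u] = (\<lambda>F. 0)" if "u \<notin> T" "u \<noteq> v" for u using that by (auto simp: sec_def xi_def fun_eq_iff)
  have s3: "sec xi (u # w # ws) = (\<lambda>F. 0)" for u w ws by (auto simp: sec_def xi_def fun_eq_iff)
  have XM: "xi \<in> XM (AX L dg) (Suc s)"
  proof -
    have "xi (w, F) = 0" if n: "(w, F) \<notin> AX L dg (Suc s)" for w F
    proof -
      consider "w = []" | "w = [v]" | u where "w = [u]" "u \<noteq> v" | u u' ws where "w = u # u' # ws" by (metis neq_Nil_conv)
      then show ?thesis
      proof cases
        case 1
        then have "card F \<noteq> Suc s" using n by (simp add: AX_def wt_simps)
        then show ?thesis using ka(1) 1 by (simp add: xi_def KM_def)
      next
        case 2
        then have "card F \<noteq> a" using n v ab by (auto simp: AX_def wt_simps)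
        then show ?thesis using kbar_mem_KM[OF xK] 2 by (simp add: xi_def KM_def)
      next
        case (3 u)
        then show ?thesis using n by (auto simp: AX_def wt_simps xi_def T_def)
      next
        case 4 then show ?thesis by (simp add: xi_def)
      qed
    qed
    then show ?thesis unfolding XM_def by auto
  qed
  have cyc: "g.dX xi (w, F) \<in> I" for w F
  proof -
    have dz: "(\<Sum>u\<in>L. \<Sum>u'\<in>L. km (kbar (sec xi (u # u' # w))) (g2 u u') F) = 0"
      unfolding s3 by (simp add: kbar_lin km_zero)
    consider "w = []" | u ws where "w = u # ws" by (cases w)
    then show ?thesis
    proof cases
      case 1
      have TL: "T \<subseteq> L" by (auto simp: T_def)
      have "(\<Sum>u\<in>L. km (kbar (sec xi [u])) (z u) F) = (\<Sum>u\<in>insert v T. km (kbar (sec xi [u])) (z u) F)"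
        by (rule sum.mono_neutral_right) (use finL TL v s2 in \<open>auto simp: kbar_lin km_zero\<close>)
      also have "\<dots> = km (kbar (kbar x)) (z v) F + (\<Sum>u\<in>T. km (kbar (sec xi [u])) (z u) F)"
        using vT finite_subset[OF TL finL] by (simp add: s0)
      also have "(\<Sum>u\<in>T. km (kbar (sec xi [u])) (z u) F) = (\<Sum>u\<in>T. - (mconst (c u) * z u F))"
      proof (rule sum.cong[OF refl])
        fix u assume u: "u \<in> T"
        have "kbar (sec xi [u]) = (\<lambda>F. if F = {} then - mconst (c u) else 0)" unfolding s1[OF u] kbar_def by (rule ext) simp
        then show "km (kbar (sec xi [u])) (z u) F = - (mconst (c u) * z u F)" by (simp add: km_one)
      qed
      finally have e: "(\<Sum>u\<in>L. km (kbar (sec xi [u])) (z u) F) = km x (z v) F - (\<Sum>u\<in>T. mconst (c u) * z u F)"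
        by (simp add: kbar_kbar sum_negf)
      have "g.dX xi (w, F) = km x (z v) F - (\<Sum>u\<in>T. mconst (c u) * z u F) - kdv ka F"
        unfolding g.dX_def prod.case dz unfolding 1 s0 kd_smult e by simp
      then show ?thesis using ka(2) by simp
    next
      case (2 u ws)
      have "(\<Sum>u'\<in>L. km (kbar (sec xi (u' # w))) (z u') F) = 0" unfolding 2 s3 by (simp add: kbar_lin km_zero)
      then have e: "g.dX xi (w, F) = kdv (sec xi w) F" unfolding g.dX_def prod.case dz by simp
      consider "ws \<noteq> []" | "w = [v]" | "ws = []" "u \<in> T" "u \<noteq> v" | "ws = []" "u \<notin> T" "u \<noteq> v" using 2 by blast
      then show ?thesis
      proof cases
        case 1
        then obtain u' ws' where "w = u # u' # ws'" using 2 by (cases ws) auto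
        then show ?thesis unfolding e by (simp add: s3 kd_def idl.subspace_0[OF ideal_I])
      next
        case 2
        have "- kbar (kdv x) F \<in> I" using idl.subspace_neg[OF ideal_I kbar_ideal[OF ideal_I xI]] .
        then show ?thesis unfolding e unfolding \<open>w = [v]\<close> s0 kd_kbar .
      next
        case 3
        then show ?thesis unfolding e using 2 idl.subspace_0[OF ideal_I] by (simp add: s1 kd_def)
      next
        case 4
        then show ?thesis unfolding e using 2 idl.subspace_0[OF ideal_I] by (simp add: s2 kd_def)
      qed
    qed
  qed
  have "xi ([u0], {}) = - mconst (c u0)" using u0(1) vT by (auto simp: xi_def)
  then have "cst (xi ([u0], {})) = - c u0" by (simp add: mconst_def)
  then have nz: "cst (xi ([u0], {})) \<noteq> 0" using u0(2) by simp
  have "residue_betti I (Suc s) < card (AX L dg (Suc s) :: ('l list \<times> 'n set) set)"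
  proof (rule g.residue_betti_less[OF _ _ XM _ nz])
    fix e show "g.dX xi e \<in> I" using cyc by (cases e) auto
  qed auto
  then show False using r by simp
qed

end

lemma BK_subspace:
  fixes I :: "('n::{finite,linorder}, 'k::field) mpoly set"
  assumes "is_ideal I" shows "module.subspace (lsc msc) (BK I i)"
proof -
  interpret v: vector_space "lsc msc :: 'k \<Rightarrow> ('n set \<Rightarrow> ('n, 'k) mpoly) \<Rightarrow> _" by (rule vector_space_lsc[OF vector_space_msc])
  show ?thesis unfolding v.subspace_def
  proof (intro conjI ballI allI)
    show "0 \<in> BK I i" using BK_zero[OF assms] by (simp only: zero_fun_def)
    fix x assume x: "x \<in> BK I i"
    show "x + y \<in> BK I i" if "y \<in> BK I i" for y using BK_add[OF assms x that] by (simp only: plus_fun_def)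
    show "lsc msc c x \<in> BK I i" for c using BK_smult[OF assms x, of "mconst c"] by (simp only: lsc_def msc_def)
  qed
qed

lemma quotient_betti_large:
  fixes I :: "('n::{finite,linorder}, 'k::field) mpoly set"
  assumes I: "is_ideal I" and j: "j > CARD('n)" shows "quotient_betti I j = 0"
proof -
  have "ZK I j \<subseteq> BK I j"
  proof
    fix x assume "x \<in> ZK I j"
    then have "x = (\<lambda>F. 0)" using j by (intro KM_large) (auto simp: ZK_def)
    then show "x \<in> BK I j" using BK_zero[OF I] by simp
  qed
  then have "qdim (lsc msc) (BK I j) (ZK I j) 0" unfolding qdim_def by auto
  moreover have "qdim (lsc msc) (BK I j) (ZK I j) (quotient_betti I j)" using j by (intro qdim_quotient_betti[OF I]) auto
  ultimately show ?thesis using qdim_unique[OF vector_space_lsc[OF vector_space_msc] BK_subspace[OF I]] by blast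
qed

text \<open>In degree one the basis is selected among the monomial cycles, which
  \<open>bounds\<close> presupposes; in the other degrees any basis is taken. A letter is a pair of
  degree and index, and \<open>L\<close> is finite because homology vanishes above degree
  four.\<close>

lemma homology_basis_exists:
  fixes E :: "('n::{finite,linorder} \<Rightarrow>\<^sub>0 nat) set"
  defines "I \<equiv> Mid E :: ('n, 'k::field) mpoly set"
  assumes E: "upset E" and E0: "0 \<notin> E" and E1: "\<And>j. one_at j \<notin> E" and c4: "CARD('n) = 4"
  shows "\<exists>L z. homology_basis E I (L :: (nat \<times> nat) set) fst z \<and> (\<forall>v\<in>L. fst v = 1 \<longrightarrow> z v \<in> SK E 1) \<and>
     (\<forall>i\<ge>1. card {v \<in> L. fst v = i} = quotient_betti I i)"
proof -
  have I: "is_ideal I" unfolding I_def by (rule Mid_ideal[OF E])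
  note vs = vector_space_lsc[OF vector_space_msc]
  let ?b = "quotient_betti I"
  let ?S = "\<lambda>i. if i = 1 then SK E 1 else ZK I i"
  have SZ: "?S i \<subseteq> ZK I i" for i using SK_ZK[OF E] by (auto simp: I_def)
  have "\<forall>i. \<exists>f. 1 \<le> i \<longrightarrow> (\<forall>l<?b i. f l \<in> ?S i) \<and> (\<forall>v\<in>ZK I i. \<exists>c. v - (\<Sum>l<?b i. lsc msc (c l) (f l)) \<in> BK I i) \<and>
     (\<forall>c. (\<Sum>l<?b i. lsc msc (c l) (f l)) \<in> BK I i \<longrightarrow> (\<forall>l<?b i. c l = 0))"
  proof
    fix i
    show "\<exists>f. 1 \<le> i \<longrightarrow> (\<forall>l<?b i. f l \<in> ?S i) \<and> (\<forall>v\<in>ZK I i. \<exists>c. v - (\<Sum>l<?b i. lsc msc (c l) (f l)) \<in> BK I i) \<and>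
     (\<forall>c. (\<Sum>l<?b i. lsc msc (c l) (f l)) \<in> BK I i \<longrightarrow> (\<forall>l<?b i. c l = 0))"
    proof (cases "1 \<le> i")
      case True
      note q = qdim_quotient_betti[OF I True]
      show ?thesis
      proof (cases "i = 1")
        case i1: True
        have sp: "\<exists>w\<in>Modules.module.span (lsc msc) (SK E 1). v - w \<in> BK I 1" if v: "v \<in> ZK I 1" for v
        proof -
          obtain w where w: "w \<in> Modules.module.span (lsc msc) (SK E 1)" "(\<lambda>F. v F - w F) \<in> BK I 1" using ZK_spanned[OF E _ v[unfolded I_def]] unfolding I_def by blast
          have "v - w = (\<lambda>F. v F - w F)" by (rule ext) simp
          then show ?thesis using w by (intro bexI[of _ w]) simp_all
        qed
        have "SK E 1 \<subseteq> ZK I 1" using SZ[of 1] by simp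
        from qdim_basis_from_spanning[OF vs BK_subspace[OF I] q[unfolded i1] this sp] show ?thesis unfolding i1 by simp
      next
        case False then show ?thesis using q unfolding qdim_def by simp
      qed
    qed simp
  qed
  from choice[OF this] obtain f where f: "\<And>i l. 1 \<le> i \<Longrightarrow> l < ?b i \<Longrightarrow> f i l \<in> ?S i"
    "\<And>i v. 1 \<le> i \<Longrightarrow> v \<in> ZK I i \<Longrightarrow> \<exists>c. v - (\<Sum>l<?b i. lsc msc (c l) (f i l)) \<in> BK I i"
    "\<And>i c. 1 \<le> i \<Longrightarrow> (\<Sum>l<?b i. lsc msc (c l) (f i l)) \<in> BK I i \<Longrightarrow> \<forall>l<?b i. c l = 0" by blast
  define L where "L = Sigma {1..4} (\<lambda>i. {..<?b i})"
  define z where "z v = f (fst v) (snd v)" for v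
  have Li: "{v \<in> L. fst v = i} = Pair i ` {..<?b i}" if "1 \<le> i" for i
    using that quotient_betti_large[OF I, of i] c4 by (cases "i \<le> 4") (auto simp: L_def)
  have inj: "inj_on (Pair i) S" for i :: nat and S :: "nat set" by (auto simp: inj_on_def)
  have sumL: "(\<lambda>F. \<Sum>v\<in>{v \<in> L. fst v = i}. mconst (c v) * z v F) = (\<Sum>l<?b i. lsc msc (c (i, l)) (f i l))" if "1 \<le> i" for i c
    by (rule ext) (simp add: Li[OF that] sum.reindex[OF inj] z_def sum_fun_apply lsc_def msc_def)
  have "homology_basis E I L fst z"
  proof
    show "upset E" "I = Mid E" "0 \<notin> E" "CARD('n) = 4" by (rule E, simp add: I_def, rule E0, rule c4)
    show "one_at j \<notin> E" for j by (rule E1)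
    show "finite L" by (simp add: L_def)
    show "1 \<le> fst v" if "v \<in> L" for v using that by (auto simp: L_def)
    show "z v \<in> ZK I (fst v)" if "v \<in> L" for v
      using f(1)[of "fst v" "snd v"] SZ[of "fst v"] that by (auto simp: L_def z_def simp del: One_nat_def)
    show "\<exists>c. (\<lambda>F. x F - (\<Sum>v\<in>{v \<in> L. fst v = i}. mconst (c v) * z v F)) \<in> BK I i" if i: "1 \<le> i" and x: "x \<in> ZK I i" for i x
    proof -
      obtain c where c: "x - (\<Sum>l<?b i. lsc msc (c l) (f i l)) \<in> BK I i" using f(2)[OF i x] ..
      have "x - (\<Sum>l<?b i. lsc msc (c l) (f i l)) = (\<lambda>F. x F - (\<Sum>v\<in>{v \<in> L. fst v = i}. mconst (c (snd v)) * z v F))"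
        using sumL[OF i, of "\<lambda>v. c (snd v)"] by (simp add: fun_eq_iff)
      then show ?thesis using c by (intro exI[of _ "\<lambda>v. c (snd v)"]) simp
    qed
    show "\<forall>v\<in>{v \<in> L. fst v = i}. c v = 0" if i: "1 \<le> i" and c: "(\<lambda>F. \<Sum>v\<in>{v \<in> L. fst v = i}. mconst (c v) * z v F) \<in> BK I i" for i c
      using f(3)[OF i c[unfolded sumL[OF i]]] unfolding Li[OF i] by auto
  qed
  moreover have "z v \<in> SK E 1" if "v \<in> L" "fst v = 1" for v
    using f(1)[of "fst v" "snd v"] that by (auto simp: L_def z_def simp del: One_nat_def)
  moreover have "card {v \<in> L. fst v = i} = ?b i" if "i \<ge> 1" for i
    unfolding Li[OF that] by (simp add: card_image[OF inj])
  ultimately show ?thesis by (intro exI[of _ L] exI[of _ z]) blast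
qed

theorem golod_iff_comb:
  fixes E :: "('n::{finite,linorder} \<Rightarrow>\<^sub>0 nat) set"
  assumes E: "upset E" and E0: "0 \<notin> E" and E1: "\<And>j. one_at j \<notin> E" and c4: "CARD('n) = 4"
  shows "golod (Mid E :: ('n, 'k::field) mpoly set) \<longleftrightarrow> comb E"
proof -
  let ?I = "Mid E :: ('n, 'k) mpoly set"
  obtain L :: "(nat \<times> nat) set" and z where Lz: "homology_basis E ?I L fst z" "\<forall>v\<in>L. fst v = 1 \<longrightarrow> z v \<in> SK E 1"
     "\<forall>i\<ge>1. card {v \<in> L. fst v = i} = quotient_betti ?I i" using homology_basis_exists[OF E E0 E1 c4, where 'k='k] by blast
  interpret homology_basis E ?I L fst z by (rule Lz(1))
  have "golod ?I \<longleftrightarrow> (\<forall>j. residue_betti ?I j = card (AX L fst j :: ((nat \<times> nat) list \<times> 'n set) set))"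
    by (rule golod_iff_card[OF finL deg_pos]) (use Lz(3) in auto)
  also have "\<dots> \<longleftrightarrow> comb E"
  proof
    assume "\<forall>j. residue_betti ?I j = card (AX L fst j :: ((nat \<times> nat) list \<times> 'n set) set)"
    then have "products_vanish ?I" by (intro products_vanish_of_residue_betti) blast
    then show "comb E" by (rule comb_of_products_vanish[OF E c4])
  next
    assume "comb E"
    then show "\<forall>j. residue_betti ?I j = card (AX L fst j :: ((nat \<times> nat) list \<times> 'n set) set)"
      using residue_betti_of_comb Lz(2) by blast
  qed
  finally show ?thesis .
qed

lemma order_at_least_two:
  assumes "m \<in> esum (up_closure (one_at ` S)) (up_closure (one_at ` S))" shows "m \<noteq> 0" "m \<noteq> one_at t"
proof -
  obtain i d j d' where "m = (one_at i + d) + (one_at j + d')" using assms by (auto simp: esum_def up_closure_def)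
  then have m: "m = one_at i + one_at j + (d + d')" by (simp add: ac_simps)
  then have l: "lk m i \<ge> 1" "lk m j \<ge> 1" "i = j \<Longrightarrow> lk m i \<ge> 2" by (auto simp: lookup_add lookup_single)
  show "m \<noteq> 0" using l(1) by auto
  show "m \<noteq> one_at t"
  proof
    assume "m = one_at t"
    then have "i = t" "j = t" "lk m t = 1" using l(1,2) by (auto simp: lookup_single when_def split: if_splits)
    then show False using l(3) by simp
  qed
qed

theorem theorem1p5:
  fixes I :: "(4, 'k::field) mpoly set"
  defines "S \<equiv> mpoly_ring :: (4, 'k) mpoly ring"
    and "x \<equiv> mvar :: 4 \<Rightarrow> (4, 'k) mpoly"
  assumes "monomial_ideal I"
    and "I \<subseteq> ideal_of {x 1, x 2, x 3, x 4} \<cdot>\<^bsub>S\<^esub> ideal_of {x 1, x 2, x 3, x 4}"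
  shows "golod I \<longleftrightarrow>
    (\<forall>\<sigma> :: 4 \<Rightarrow> 4. \<sigma> permutes UNIV \<longrightarrow>
      (let x1 = x (\<sigma> 1); x2 = x (\<sigma> 2); x3 = x (\<sigma> 3); x4 = x (\<sigma> 4);
           C = (\<lambda>G. colon_ideal S I (ideal_of G))
       in
         C {x1} \<cdot>\<^bsub>S\<^esub> C {x2, x3, x4} \<subseteq> I \<and>
         C {x1, x2} \<cdot>\<^bsub>S\<^esub> C {x3, x4} \<subseteq> I \<and>
         C {x1} \<cdot>\<^bsub>S\<^esub> C {x2, x3} \<subseteq> I <+>\<^bsub>S\<^esub> ideal_of {x4} \<cdot>\<^bsub>S\<^esub> C {x1, x2, x3} \<and>
         C {x1} \<cdot>\<^bsub>S\<^esub> C {x2} \<subseteq>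
           I <+>\<^bsub>S\<^esub> ideal_of {x3, x4} \<cdot>\<^bsub>S\<^esub> C {x1, x2}
             <+>\<^bsub>S\<^esub> ((ideal_of {x3 \<otimes>\<^bsub>S\<^esub> x4} \<cdot>\<^bsub>S\<^esub> C {x1 \<otimes>\<^bsub>S\<^esub> x2}) \<inter>
               ((ideal_of {x3} \<cdot>\<^bsub>S\<^esub> C {x1} \<inter> ideal_of {x4} \<cdot>\<^bsub>S\<^esub> C {x2}) <+>\<^bsub>S\<^esub>
                (ideal_of {x3} \<cdot>\<^bsub>S\<^esub> C {x2} \<inter> ideal_of {x4} \<cdot>\<^bsub>S\<^esub> C {x1})))))"
proof -
  obtain G where "I = ideal_of (monomial ` G)" using assms(3) unfolding monomial_ideal_def by blast
  then have I: "I = Mid (up_closure G)" by (simp add: ideal_of_monomials)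
  define T :: "(4 \<Rightarrow>\<^sub>0 nat) set" where "T = one_at ` {1, 2, 3, 4}"
  have "ideal_of {x 1, x 2, x 3, x 4} = (Mid (up_closure T) :: (4, 'k) mpoly set)"
    using ideal_of_monomials[of T, where 'k='k] by (simp add: T_def x_def mvar_def)
  then have "(Mid (up_closure G) :: (4, 'k) mpoly set) \<subseteq> Mid (esum (up_closure T) (up_closure T))"
    using assms(4) unfolding I S_def by (simp add: Mid_prod[OF upset_up_closure])
  then have sub: "up_closure G \<subseteq> esum (up_closure T) (up_closure T)" unfolding Mid_mono_iff .
  have "0 \<notin> up_closure G" "one_at j \<notin> up_closure G" for j
    using sub order_at_least_two[of _ "{1, 2, 3, 4 :: 4}", folded T_def] by blast+
  then have "golod I \<longleftrightarrow> comb (up_closure G)" unfolding I by (intro golod_iff_comb upset_up_closure) simp_all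
  then show ?thesis unfolding I S_def x_def inclusions_iff_comb[OF upset_up_closure] .
qed

end
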